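(* Let $\gamma=\{\chi,\chi^s\}$ for a character $\chi:H\to\overline{\mathbf F}_p^\times$, and let $\pi_\gamma=\mathrm{Im}\big(H_0(X,\mathcal V_\gamma)\to H_0(X,\mathcal I_\gamma)\big)$. The representation $H_0(X,\mathcal I_\gamma)$ is an essential extension of $\pi_\gamma$ in the category of smooth $\overline{\mathbf F}_p$-representations of $G$ (that is, every non-zero $G$-invariant subspace of $H_0(X,\mathcal I_\gamma)$ intersects $\pi_\gamma$ non-trivially). In particular, $$\pi_\gamma\cong\mathrm{soc}(H_0(X,\mathcal I_\gamma)),$$ where $\mathrm{soc}(H_0(X,\mathcal I_\gamma))$ is the subspace of $H_0(X,\mathcal I_\gamma)$ generated by all the irreducible subrepresentations.
   Context: GROUPS. All representations are on $\overline{\mathbf F}_p$-vector spaces. $F$ is a non-Archimedean local field, $\mathfrak o_F$ its ring of integers, $\mathfrak p_F$ its maximal ideal, $\varpi_F$ a fixed uniformiser, the residue field is $\mathbf F_q$, $q=p^n$, $p$ prime; an embedding $\mathbf F_q\subset\overline{\mathbf F}_p$ is fixed. $G=\mathrm{GL}_2(F)$, $K=\mathrm{GL}_2(\mathfrak o_F)$, $\Gamma=\mathrm{GL}_2(\mathbf F_q)$; $B,H,U\subset\Gamma$ are the upper triangular, diagonal, and unipotent upper triangular matrices. $K_1$ is the kernel of reduction $K\to\Gamma$; $I$ and $I_1$ are the preimages of $B$ and $U$ in $K$. Put $\Pi=\begin{pmatrix}0&1\\ \varpi_F&0\end{pmatrix}$, $s=\begin{pmatrix}0&1\\1&0\end{pmatrix}$.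 For a character $\chi:H\to\overline{\mathbf F}_p^\times$, $\chi^s(h)=\chi(s^{-1}hs)$. Characters of $H$ are viewed as characters of $I$ via $I/I_1\cong H$, and representations of $\Gamma$ as representations of $K$ via $K/K_1\cong\Gamma$. $\mathrm{Rep}_{\mathcal K}$ is the category of smooth representations of $\mathcal K$. IRREDUCIBLES OF $\Gamma$. $J_0(\chi)=\{s\}$ if $\chi=\chi^s$ and $J_0(\chi)=\emptyset$ otherwise; for $J\subseteq J_0(\chi)$, $\overline J=J_0(\chi)\setminus J$. Every irreducible representation of $\Gamma$ has one-dimensional $U$-invariants. If $\chi\neq\chi^s$, $\rho_{\chi,\emptyset}$ is the unique irreducible representation of $\Gamma$ on whose $U$-invariants $B$ acts by $\chi$. If $\chi=\chi^s$, write $\chi=\chi'\circ\det$; then $\rho_{\chi,\{s\}}=\chi'\circ\det$ and $\rho_{\chi,\emptyset}=\mathrm{St}\otimes\chi'\circ\det$ with $\mathrm{St}$ the $q$-dimensional Steinberg representation. A tilde denotes extension of a representation of $K$ (or $I$) to $F^\times K$ (or $F^\times I$) with $\varpi_F$ acting trivially. COEFFICIENT SYSTEMS. $X$ is the Bruhat–Tits tree of $G$ (vertices: homothety classes of $\mathfrak o_F$-lattices in $F^2=\langle v_1,v_2\rangle$); $\sigma_0=[\mathfrak o_Fv_1+\mathfrak o_Fv_2]$, $\sigma_1=\{\sigma_0,[\mathfrak o_Fv_1+\mathfrak p_Fv_2]\}$; their $G$-stabilisers are $\mathfrak K(\sigma_0)=F^\times K$ and $\mathfrak K(\sigma_1)=\langle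 I,\Pi\rangle$, with intersection $F^\times I$. A $G$-equivariant coefficient system $\mathcal V$ consists of vector spaces $V_\sigma$ for each simplex, linear maps $r^{\sigma'}_\sigma:V_{\sigma'}\to V_\sigma$ for $\sigma\subseteq\sigma'$ with $r^\sigma_\sigma=\mathrm{id}$, and linear maps $g_\sigma:V_\sigma\to V_{g\sigma}$ ($g\in G$) with $1_\sigma=\mathrm{id}$, $g_{h\sigma}h_\sigma=(gh)_\sigma$, compatible with the $r$'s, such that the stabiliser of each $\sigma$ acts smoothly on $V_\sigma$. $H_0(X,\mathcal V)$ is the cokernel of $\partial: C_1\to C_0$, where $C_0$ is the space of finitely supported functions $\omega$ on vertices with $\omega(\sigma)\in V_\sigma$, $C_1$ the space of finitely supported functions on oriented edges with $\omega((\sigma,\sigma'))\in V_{\{\sigma,\sigma'\}}$, $\omega((\sigma',\sigma))=-\omega((\sigma,\sigma'))$, and $\partial(\omega)(\sigma)=\sum_{\sigma'}r^{\{\sigma,\sigma'\}}_\sigma(\omega((\sigma,\sigma')))$ over neighbours $\sigma'$ of $\sigma$; it is a smooth $G$-representation, functorial in $\mathcal V$. A diagram is a triple $D=(D_0,D_1,r)$ with $D_i$ a smooth representation of $\mathfrak K(\sigma_i)$ and $r:D_1\to D_0$ an $F^\times I$-equivariant map; morphisms are pairs $(\psi_0,\psi_1)$ of equivariant maps commuting with the $r$'s. The functor $\mathcal C$ sends $D$ to the coefficient system with $\mathcal F_{g\sigma_i}=\{f\in\text{c-Ind}_{\mathfrak K(\sigma_i)}^GD_i:\mathrm{supp} f\subseteq\mathfrak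 K(\sigma_i)g^{-1}\}$, $G$ acting by right translation, restriction maps sending $f\in\mathcal F_{g\sigma_1}$ to the element of $\mathcal F_{g\sigma_0}$ with value $r(f(g^{-1}))$ at $g^{-1}$; on morphisms it is $f\mapsto\psi_i\circ f$. $\mathcal V_\gamma$. For $\gamma=\{\chi,\chi^s\}$ choose $J\subseteq J_0(\chi)$ and nonzero $v_{\chi,J}\in\rho_{\chi,J}^{I_1}$, $v_{\chi^s,\overline J}\in\rho_{\chi^s,\overline J}^{I_1}$. $D_\gamma=(D_0,D_0^{I_1},\text{inclusion})$ with $D_0=\tilde\rho_{\chi,J}\oplus\tilde\rho_{\chi^s,\overline J}$, where the $F^\times I$-action on $D_0^{I_1}$ is extended to $\mathfrak K(\sigma_1)$ by $\Pi^{-1}v_{\chi,J}=v_{\chi^s,\overline J}$, $\Pi^{-1}v_{\chi^s,\overline J}=v_{\chi,J}$. $\mathcal V_\gamma=\mathcal C(D_\gamma)$ (independent of the choices up to isomorphism). THE REPRESENTATIONS $R_{\mathbf r}$. For $0\le d\le p-1$ let $V_d$ be the space of homogeneous polynomials of degree $d$ in $X,Y$ over $\overline{\mathbf F}_p$ with $\Gamma$-action $\begin{pmatrix}a&b\\c&e\end{pmatrix}X^{d-i}Y^i=(aX+cY)^{d-i}(bX+eY)^i$, with standard basis $m_i=\binom diX^{d-i}Y^i$, $0\le i\le d$, and let $f$ be the operator $fm_i=(i+1)m_{i+1}$, $fm_d=0$, acting on tensor products by $f(v\otimes w)=fv\otimes w+v\otimes fw$. For $0\le r\le p-1$ let $v_i$,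 $w_j$ be the standard bases of $V_{p-1-r}$, $V_{p-1}$ and $E_i=\sum_{k+l=i}v_k\otimes w_l$. If $r<p-1$ set $a_0=0$, $a_1=(p-r-2)!$, $a_{i+1}=a_i+\frac{(-1)^i(r+1)\cdots(r+i)}{(p-r-2)\cdots(p-r-i-1)}(a_1-a_0)$, $Z=\sum_{i=0}^{p-r-1}a_i\,v_i\otimes w_{p-r-1-i}$, and let $R_r\subset V_{p-1-r}\otimes V_{p-1}$ be the ($\Gamma$-stable) span of $E_0,\dots,E_{2p-r-2},Z,\frac{f}{1!}Z,\dots,\frac{f^r}{r!}Z$; $R_{p-1}=V_{p-1}$ (with $E_i=m_i$). For $\mathbf r=(r_0,\dots,r_{n-1})$, $0\le r_i\le p-1$, $R_{\mathbf r}=R_{r_0}\otimes R_{r_1}^{\mathrm{Fr}}\otimes\cdots\otimes R_{r_{n-1}}^{\mathrm{Fr}^{n-1}}$, where $\mathrm{Fr}$ raises matrix entries to the $p$-th power. For $\varepsilon\in\{0,1\}^n$, $b_\varepsilon=\bigotimes_iE_{(1-\epsilon_i)(p-1-r_i)}\in R_{\mathbf r}^U$. $\Sigma_{\mathbf r}$ is the set of $\varepsilon\in\{0,1\}^n$ with $\epsilon_i=0$ whenever $r_i=p-1$; $\delta_{\mathbf r}\in\Sigma_{\mathbf r}$ has $\delta_i=1$ iff $r_i\ne p-1$; $\Sigma'_{\mathbf r}=\Sigma_{\mathbf r}\setminus\{\mathbf 0,\delta_{\mathbf r}\}$. The $b_\varepsilon$, $\varepsilon\in\Sigma_{\mathbf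 r}$, form a basis of $R_{\mathbf r}^U$, and $b_{\delta_{\mathbf r}}=b_{\mathbf 1}$. Let $\mathbf{p-1}=(p-1,\dots,p-1)$. $\mathcal I_\gamma$. Let $\mathrm{Inj}\,\rho$ (resp. $\mathrm{inj}\,\rho$) denote an injective envelope of $\rho$ in $\mathrm{Rep}_K$ (resp. $\mathrm{Rep}_\Gamma$). Let $Y_{\gamma,0}=\widetilde{\mathrm{Inj}}\,\rho_{\chi,J}\oplus\widetilde{\mathrm{Inj}}\,\rho_{\chi^s,\overline J}$. Then $Y_{\gamma,0}^{K_1}\cong\mathrm{inj}\,\rho_{\chi,J}\oplus\mathrm{inj}\,\rho_{\chi^s,\overline J}$. Let $1\le a,r\le q-1$ be defined by $\chi(\mathrm{diag}(1,\lambda))=\lambda^a$, $\chi(\mathrm{diag}(\lambda,\lambda^{-1}))=\lambda^r$. If $\chi=\chi^s$, then $Y_{\gamma,0}^{K_1}\cong R_{\mathbf 0}\otimes\det^a$; fix such an isomorphism and let $\mathcal B_\gamma$ be the basis of $Y_{\gamma,0}^{I_1}$ consisting of $b_{\mathbf 0}$, $b_{\mathbf 0}+b_{\mathbf 1}$ (paired with each other) and $b_\varepsilon$, $\varepsilon\in\Sigma'_{\mathbf 0}$ ($b_\varepsilon$ paired with $b_{\mathbf 1-\varepsilon}$). If $\chi\ne\chi^s$, let $\mathbf r=(r_0,\dots,r_{n-1})$ be the base-$p$ digits of $r=\sum r_ip^i$; then $\mathrm{inj}\,\rho_{\chi,\emptyset}\cong R_{\mathbf r}\otimes\det^{a+r}$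 and $\mathrm{inj}\,\rho_{\chi^s,\emptyset}\cong R_{\mathbf{p-1}-\mathbf r}\otimes\det^a$; fix such isomorphisms, write $b_\varepsilon$ (resp. $\bar b_\varepsilon$) for the vectors in the first (resp. second), and let $\mathcal B_\gamma$ be the basis of $Y_{\gamma,0}^{I_1}$ given by the $b_\varepsilon$, $\varepsilon\in\Sigma_{\mathbf r}$, and $\bar b_\varepsilon$, $\varepsilon\in\Sigma_{\mathbf{p-1}-\mathbf r}$, paired as $\{b_{\mathbf 0},\bar b_{\mathbf 0}\}$, $\{b_{\mathbf 1},\bar b_{\mathbf 1}\}$, $\{b_\varepsilon,b_{\mathbf 1-\varepsilon}\}$ for $\varepsilon\in\Sigma'_{\mathbf r}$, $\{\bar b_\varepsilon,\bar b_{\mathbf 1-\varepsilon}\}$ for $\varepsilon\in\Sigma'_{\mathbf{p-1}-\mathbf r}$. In each pair, if $I$ acts on one vector by $\psi$, it acts on the other by $\psi^s$. Choose an $F^\times I$-stable decomposition $Y_{\gamma,0}=\bigoplus_{b\in\mathcal B_\gamma}\mathcal W(b)$ with $b\in\mathcal W(b)$ and $\mathcal W(b)|_I$ an injective envelope of $\langle b\rangle$ in $\mathrm{Rep}_I$; for each pair $\{b,b'\}$ choose a linear isomorphism $\phi:\mathcal W(b)\to\mathcal W(b')$ with $\phi(b)=b'$ and $\phi(\Pi g\Pi^{-1}v)=g\phi(v)$ for $g\in I$, and let $\Pi^{-1}$ act on $\mathcal W(b)\oplus\mathcal W(b')$ by $v+w\mapsto\phi^{-1}(w)+\phi(v)$.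 This extends the $F^\times I$-action on $Y_{\gamma,0}$ to a $\mathfrak K(\sigma_1)$-action; call the result $Y_{\gamma,1}$. $Y_\gamma=(Y_{\gamma,0},Y_{\gamma,1},\mathrm{id})$ and $\mathcal I_\gamma=\mathcal C(Y_\gamma)$. Such choices exist and are fixed; the claim holds for any such choices. THE MAP. There is an injective morphism of diagrams $D_\gamma\to Y_\gamma$ given by a $K$-equivariant injection sending $v_{\chi,\{s\}}\mapsto b_{\mathbf 0}$, $v_{\chi,\emptyset}\mapsto b_{\mathbf 0}+b_{\mathbf 1}$ if $\chi=\chi^s$, and $v_{\chi,\emptyset}\mapsto b_{\mathbf 0}$, $v_{\chi^s,\emptyset}\mapsto\bar b_{\mathbf 0}$ if $\chi\ne\chi^s$ (the $v$'s suitably scaled). Applying $\mathcal C$ and $H_0$ gives the map $H_0(X,\mathcal V_\gamma)\to H_0(X,\mathcal I_\gamma)$ whose image is $\pi_\gamma$. *)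

theory Defs
  imports
    "HOL-Analysis.Determinants"
    "HOL-Algebra.Module"
    "HOL-Algebra.Coset"
    "HOL-Algebra.AbelCoset"
    "HOL-Algebra.Generated_Groups"
    "HOL-Algebra.Algebraic_Closure_Type"
begin

section \<open>Matrices and the group GL2 of a field\<close>

definition mat2 :: "'a::zero \<Rightarrow> 'a \<Rightarrow> 'a \<Rightarrow> 'a \<Rightarrow> 'a^2^2" where
  "mat2 a b c d = vector [vector [a, b], vector [c, d]]"

definition GL2 :: "('a::field^2^2) monoid" where
  "GL2 = \<lparr>carrier = {g. invertible g}, monoid.mult = (**), one = mat 1\<rparr>"

definition borel2 :: "('a::field^2^2) set" where
  "borel2 = {g \<in> carrier GL2. g$2$1 = 0}"

definition torus2 :: "('a::field^2^2) set" where
  "torus2 = {g \<in> carrier GL2. g$1$2 = 0 \<and> g$2$1 = 0}"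

definition unip2 :: "('a::field^2^2) set" where
  "unip2 = {g. g$1$1 = 1 \<and> g$2$1 = 0 \<and> g$2$2 = 1}"

definition smat :: "'a::field^2^2" where
  "smat = mat2 0 1 1 0"


section \<open>Linear representations\<close>

text \<open>A representation is a module record (over the field of scalars, regarded as the ring
  \<^const>\<open>ring_of_type_algebra\<close>) together with an action. Only the additive and scalar structure
  of the record matters; the inherited fields for multiplication and unit are irrelevant.
  The acting group is always given separately, as a set of invertible matrices.\<close>

record ('k, 'v, 'g) rep = "('k, 'v) module" +
  act :: "'g \<Rightarrow> 'v \<Rightarrow> 'v"

definition linear_maps ::
  "('k::field, 'v, 'm) module_scheme \<Rightarrow> ('k, 'w, 'n) module_scheme \<Rightarrow> ('v \<Rightarrow> 'w) set" where
  "linear_maps V W = {f \<in> carrier V \<rightarrow> carrier W.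
     (\<forall>x\<in>carrier V. \<forall>y\<in>carrier V. f (x \<oplus>\<^bsub>V\<^esub> y) = f x \<oplus>\<^bsub>W\<^esub> f y) \<and>
     (\<forall>c. \<forall>x\<in>carrier V. f (c \<odot>\<^bsub>V\<^esub> x) = c \<odot>\<^bsub>W\<^esub> f x)}"

definition representation :: "('a::field^2^2) set \<Rightarrow> ('k::field, 'v, 'a^2^2) rep \<Rightarrow> bool" where
  "representation S V \<longleftrightarrow>
     Module.module (ring_of_type_algebra :: 'k ring) V \<and>
     (\<forall>g\<in>S. act V g \<in> linear_maps V V) \<and>
     (\<forall>v\<in>carrier V. act V (mat 1) v = v) \<and>
     (\<forall>g\<in>S. \<forall>h\<in>S. \<forall>v\<in>carrier V. act V (g ** h) v = act V g (act V h v))"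

definition rep_hom ::
  "'g set \<Rightarrow> ('k::field, 'v, 'g) rep \<Rightarrow> ('k, 'w, 'g) rep \<Rightarrow> ('v \<Rightarrow> 'w) set" where
  "rep_hom S V W = {f \<in> linear_maps V W. \<forall>g\<in>S. \<forall>v\<in>carrier V. f (act V g v) = act W g (f v)}"

definition rep_iso_map ::
  "'g set \<Rightarrow> ('k::field, 'v, 'g) rep \<Rightarrow> ('k, 'w, 'g) rep \<Rightarrow> ('v \<Rightarrow> 'w) \<Rightarrow> bool" where
  "rep_iso_map S V W f \<longleftrightarrow> f \<in> rep_hom S V W \<and> bij_betw f (carrier V) (carrier W)"

definition rep_isomorphic ::
  "'g set \<Rightarrow> ('k::field, 'v, 'g) rep \<Rightarrow> ('k, 'w, 'g) rep \<Rightarrow> bool" where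
  "rep_isomorphic S V W \<longleftrightarrow> (\<exists>f. rep_iso_map S V W f)"

definition lin_subspace :: "('k::field, 'v, 'm) module_scheme \<Rightarrow> 'v set \<Rightarrow> bool" where
  "lin_subspace V N \<longleftrightarrow> submodule N (ring_of_type_algebra :: 'k ring) V"

definition lin_span :: "('k::field, 'v, 'm) module_scheme \<Rightarrow> 'v set \<Rightarrow> 'v set" where
  "lin_span V T = \<Inter>{N. lin_subspace V N \<and> T \<subseteq> N}"

definition subrep :: "'g set \<Rightarrow> ('k::field, 'v, 'g) rep \<Rightarrow> 'v set \<Rightarrow> bool" where
  "subrep S V N \<longleftrightarrow> lin_subspace V N \<and> (\<forall>g\<in>S. \<forall>v\<in>N. act V g v \<in> N)"

abbreviation restrict_to :: "('k, 'v, 'g) rep \<Rightarrow> 'v set \<Rightarrow> ('k, 'v, 'g) rep" where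
  "restrict_to V N \<equiv> V\<lparr>carrier := N\<rparr>"

definition irreducible_rep :: "('a::field^2^2) set \<Rightarrow> ('k::field, 'v, 'a^2^2) rep \<Rightarrow> bool" where
  "irreducible_rep S V \<longleftrightarrow> representation S V \<and> carrier V \<noteq> {\<zero>\<^bsub>V\<^esub>} \<and>
     (\<forall>N. subrep S V N \<longrightarrow> N = {\<zero>\<^bsub>V\<^esub>} \<or> N = carrier V)"

definition socle :: "('a::field^2^2) set \<Rightarrow> ('k::field, 'v, 'a^2^2) rep \<Rightarrow> 'v set" where
  "socle S V = lin_span V (\<Union>{N. subrep S V N \<and> irreducible_rep S (restrict_to V N)})"

definition essential_subrep :: "'g set \<Rightarrow> ('k::field, 'v, 'g) rep \<Rightarrow> 'v set \<Rightarrow> bool" where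
  "essential_subrep S V N \<longleftrightarrow> subrep S V N \<and>
     (\<forall>W. subrep S V W \<and> W \<noteq> {\<zero>\<^bsub>V\<^esub>} \<longrightarrow> W \<inter> N \<noteq> {\<zero>\<^bsub>V\<^esub>})"

definition invariants :: "'g set \<Rightarrow> ('k, 'v, 'g) rep \<Rightarrow> 'v set" where
  "invariants S V = {v \<in> carrier V. \<forall>g\<in>S. act V g v = v}"

definition with_act :: "('k, 'v, 'g) rep \<Rightarrow> ('h \<Rightarrow> 'v \<Rightarrow> 'v) \<Rightarrow> ('k, 'v, 'h) rep" where
  "with_act V a = module.extend (module.truncate V) (rep.fields a)"

definition twist_det :: "('a::field \<Rightarrow> 'k) \<Rightarrow> ('k, 'v, 'a^2^2) rep \<Rightarrow> ('k, 'v, 'a^2^2) rep" where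
  "twist_det \<eta> V = with_act V (\<lambda>g v. \<eta> (det g) \<odot>\<^bsub>V\<^esub> act V g v)"

definition trivial_rep :: "('k::field, 'k, 'g) rep" where
  "trivial_rep = \<lparr>carrier = UNIV, monoid.mult = undefined, one = undefined,
     zero = 0, add = (+), module.smult = (*), act = (\<lambda>_ v. v)\<rparr>"

definition dsum_rep :: "('k, 'v, 'g) rep \<Rightarrow> ('k, 'w, 'g) rep \<Rightarrow> ('k, 'v \<times> 'w, 'g) rep" where
  "dsum_rep V W = \<lparr>carrier = carrier V \<times> carrier W, monoid.mult = undefined, one = undefined,
     zero = (\<zero>\<^bsub>V\<^esub>, \<zero>\<^bsub>W\<^esub>),
     add = (\<lambda>(v, w) (v', w'). (v \<oplus>\<^bsub>V\<^esub> v', w \<oplus>\<^bsub>W\<^esub> w')),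
     module.smult = (\<lambda>c (v, w). (c \<odot>\<^bsub>V\<^esub> v, c \<odot>\<^bsub>W\<^esub> w)),
     act = (\<lambda>g (v, w). (act V g v, act W g w))\<rparr>"

text \<open>Quotient by a subspace; the elements are the cosets of the subspace.\<close>

definition quot_rep :: "('k, 'v, 'g) rep \<Rightarrow> 'v set \<Rightarrow> ('k, 'v set, 'g) rep" where
  "quot_rep V N = \<lparr>carrier = a_rcosets\<^bsub>V\<^esub> N, monoid.mult = undefined, one = undefined,
     zero = N,
     add = (\<lambda>A B. A <+>\<^bsub>V\<^esub> B),
     module.smult = (\<lambda>c A. \<Union>v\<in>A. N +>\<^bsub>V\<^esub> (c \<odot>\<^bsub>V\<^esub> v)),
     act = (\<lambda>g A. \<Union>v\<in>A. N +>\<^bsub>V\<^esub> (act V g v))\<rparr>"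

text \<open>Compact induction from an open subgroup \<^term>\<open>S\<close> of GL2, with GL2 acting by right translation.
  As \<^term>\<open>S\<close> is open, compact support modulo \<^term>\<open>S\<close> means support in finitely many
  cosets \<^term>\<open>S #>\<^bsub>GL2\<^esub> x\<close>, and local constancy is automatic when the inducing representation is
  smooth. Functions are extended by zero to all matrices. For a finite field this is
  ordinary induction.\<close>

definition c_ind :: "('a::field^2^2) set \<Rightarrow> ('k, 'v, 'a^2^2) rep \<Rightarrow> ('k, 'a^2^2 \<Rightarrow> 'v, 'a^2^2) rep" where
  "c_ind S V = \<lparr>
     carrier = {f. (\<forall>x. x \<notin> carrier GL2 \<longrightarrow> f x = \<zero>\<^bsub>V\<^esub>) \<and>
                   (\<forall>x\<in>carrier GL2. f x \<in> carrier V) \<and>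
                   (\<forall>k\<in>S. \<forall>x\<in>carrier GL2. f (k ** x) = act V k (f x)) \<and>
                   finite {S #>\<^bsub>GL2\<^esub> x | x. x \<in> carrier GL2 \<and> f x \<noteq> \<zero>\<^bsub>V\<^esub>}},
     monoid.mult = undefined, one = undefined,
     zero = (\<lambda>_. \<zero>\<^bsub>V\<^esub>),
     add = (\<lambda>f h x. f x \<oplus>\<^bsub>V\<^esub> h x),
     module.smult = (\<lambda>c f x. c \<odot>\<^bsub>V\<^esub> f x),
     act = (\<lambda>g f x. f (x ** g))\<rparr>"


section \<open>Irreducible representations of GL2 of the residue field\<close>

text \<open>The finite field with \<^term>\<open>q\<close> elements is the type \<^typ>\<open>'q\<close>, and the fixed algebraic closure of the
  prime field is \<^typ>\<open>'q alg_closure\<close>, with the fixed embedding \<^const>\<open>to_ac\<close>.\<close>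

definition torus_char :: "('q::finite_field^2^2 \<Rightarrow> 'q alg_closure) \<Rightarrow> bool" where
  "torus_char chi \<longleftrightarrow> (\<forall>h\<in>torus2. chi h \<noteq> 0) \<and>
     (\<forall>h\<in>torus2. \<forall>h'\<in>torus2. chi (h ** h') = chi h * chi h')"

definition char_s :: "('q::finite_field^2^2 \<Rightarrow> 'k) \<Rightarrow> 'q^2^2 \<Rightarrow> 'k" where
  "char_s chi = (\<lambda>h. chi (matrix_inv smat ** h ** smat))"

definition J0 :: "('q::finite_field^2^2 \<Rightarrow> 'k) \<Rightarrow> ('q^2^2) set" where
  "J0 chi = (if \<forall>h\<in>torus2. chi h = char_s chi h then {smat} else {})"

definition steinberg ::
  "('q::finite_field alg_closure, ('q^2^2 \<Rightarrow> 'q alg_closure) set, 'q^2^2) rep" where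
  "steinberg = quot_rep (c_ind borel2 trivial_rep)
     (range (\<lambda>c g. if g \<in> carrier GL2 then c else 0))"

text \<open>\<^term>\<open>is_rho chi J \<rho>\<close> says that \<^term>\<open>\<rho>\<close> is (a model of) the irreducible representation attached to
  \<^term>\<open>chi\<close> and \<^term>\<open>J \<subseteq> J0 chi\<close>.\<close>

definition is_rho :: "('q::finite_field^2^2 \<Rightarrow> 'q alg_closure) \<Rightarrow> ('q^2^2) set \<Rightarrow>
    ('q alg_closure, 'v, 'q^2^2) rep \<Rightarrow> bool" where
  "is_rho chi J \<rho> \<longleftrightarrow> representation (carrier GL2) \<rho> \<and>
     (if J0 chi = {} then
        irreducible_rep (carrier GL2) \<rho> \<and>
        (\<forall>b\<in>borel2. \<forall>v\<in>invariants unip2 \<rho>. act \<rho> b v = chi (mat2 (b$1$1) 0 0 (b$2$2)) \<odot>\<^bsub>\<rho>\<^esub> v)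
      else
        \<exists>\<eta>. (\<forall>x. x \<noteq> 0 \<longrightarrow> \<eta> x \<noteq> 0) \<and> (\<forall>x y. x \<noteq> 0 \<and> y \<noteq> 0 \<longrightarrow> \<eta> (x * y) = \<eta> x * \<eta> y) \<and>
            (\<forall>h\<in>torus2. chi h = \<eta> (det h)) \<and>
            (if J = {smat} then rep_isomorphic (carrier GL2) \<rho> (twist_det \<eta> trivial_rep)
             else rep_isomorphic (carrier GL2) \<rho> (twist_det \<eta> steinberg)))"


section \<open>The representations \<^term>\<open>R\<close>\<close>

text \<open>Elements of a tensor product of \<^term>\<open>n\<close> spaces
  $V_{p-1-r_i} \otimes V_{p-1}$ are given by their coordinates with respect to the
  tensor products of the standard bases $m_0, \dots, m_d$ of the factors; such a basis vector is
  indexed by a list of \<^term>\<open>n\<close> pairs.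
  \<^term>\<open>sym_coeff d g j i\<close> is the coefficient of $m_j$ in $g m_i$ for
  $m_i = \binom{d}{i} X^{d-i} Y^i$; the coefficient of $X^{d-j} Y^j$ in
  $(aX+cY)^{d-i} (bX+eY)^i$ is read off from the dehomogenised polynomial (put $X = 1$).\<close>

definition sym_coeff :: "nat \<Rightarrow> 'k::field^2^2 \<Rightarrow> nat \<Rightarrow> nat \<Rightarrow> 'k" where
  "sym_coeff d g j i =
     of_nat (d choose i) * poly.coeff ([:g$1$1, g$2$1:] ^ (d - i) * [:g$1$2, g$2$2:] ^ i) j
       / of_nat (d choose j)"

definition frob_mat :: "nat \<Rightarrow> 'q::finite_field^2^2 \<Rightarrow> 'q alg_closure^2^2" where
  "frob_mat i g = (\<chi> a b. to_ac (g$a$b) ^ (CHAR('q) ^ i))"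

definition tensor_index :: "nat \<Rightarrow> nat list \<Rightarrow> (nat \<times> nat) list set" where
  "tensor_index p rs = {xs. length xs = length rs \<and>
     (\<forall>i<length rs. fst (xs!i) \<le> p - 1 - rs!i \<and> snd (xs!i) \<le> p - 1)}"

definition tensor_rep ::
  "nat list \<Rightarrow> ('q::finite_field alg_closure, (nat \<times> nat) list \<Rightarrow> 'q alg_closure, 'q^2^2) rep" where
  "tensor_rep rs = (let p = CHAR('q) in \<lparr>
     carrier = {c. \<forall>xs. xs \<notin> tensor_index p rs \<longrightarrow> c xs = 0},
     monoid.mult = undefined, one = undefined,
     zero = (\<lambda>_. 0),
     add = (\<lambda>c d xs. c xs + d xs),
     module.smult = (\<lambda>t c xs. t * c xs),
     act = (\<lambda>g c xs. if xs \<in> tensor_index p rs then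
        (\<Sum>ys\<in>tensor_index p rs.
          (\<Prod>i<length rs.
             sym_coeff (p - 1 - rs!i) (frob_mat i g) (fst (xs!i)) (fst (ys!i)) *
             sym_coeff (p - 1) (frob_mat i g) (snd (xs!i)) (snd (ys!i))) * c ys) else 0)\<rparr>)"

definition pure_tensor :: "(nat \<times> nat \<Rightarrow> 'k::field) list \<Rightarrow> (nat \<times> nat) list \<Rightarrow> 'k" where
  "pure_tensor us = (\<lambda>xs. if length xs = length us then \<Prod>i<length us. (us!i) (xs!i) else 0)"

definition E_vec :: "nat \<Rightarrow> nat \<Rightarrow> nat \<Rightarrow> nat \<times> nat \<Rightarrow> 'k::field" where
  "E_vec p r i = (\<lambda>(k, l). if k \<le> p - 1 - r \<and> l \<le> p - 1 \<and> k + l = i then 1 else 0)"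

text \<open>In the range of indices that is used, none of the subtractions below is truncated and none of
  the denominators vanishes.\<close>

fun a_coeff :: "nat \<Rightarrow> nat \<Rightarrow> nat \<Rightarrow> 'k::field" where
  "a_coeff p r 0 = 0"
| "a_coeff p r (Suc 0) = of_nat (fact (p - r - 2))"
| "a_coeff p r (Suc (Suc m)) =
     a_coeff p r (Suc m) + (-1) ^ Suc m * (\<Prod>t=1..Suc m. of_nat (r + t))
       / (\<Prod>t=1..Suc m. of_nat (p - r - 1 - t)) * (a_coeff p r (Suc 0) - a_coeff p r 0)"

definition Z_vec :: "nat \<Rightarrow> nat \<Rightarrow> nat \<times> nat \<Rightarrow> 'k::field" where
  "Z_vec p r = (\<lambda>(k, l). if k + l = p - r - 1 then a_coeff p r k else 0)"

definition f_op :: "nat \<Rightarrow> nat \<Rightarrow> (nat \<times> nat \<Rightarrow> 'k::field) \<Rightarrow> nat \<times> nat \<Rightarrow> 'k" where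
  "f_op p r c = (\<lambda>(k, l). if k \<le> p - 1 - r \<and> l \<le> p - 1
      then of_nat k * c (k - 1, l) + of_nat l * c (k, l - 1) else 0)"

definition R_gens :: "nat \<Rightarrow> nat \<Rightarrow> (nat \<times> nat \<Rightarrow> 'k::field) set" where
  "R_gens p r = E_vec p r ` {..2 * p - r - 2} \<union>
     (if r < p - 1
      then (\<lambda>j x. (f_op p r ^^ j) (Z_vec p r) x / of_nat (fact j)) ` {..r} else {})"

text \<open>The tensor product of the spans of the \<^const>\<open>R_gens\<close> is spanned by the pure tensors of
  generators. For \<^term>\<open>r = p - 1\<close> the factor $V_0 \otimes V_{p-1}$ is identified with
  $V_{p-1}$, and \<^term>\<open>E_vec p r i\<close> with $m_i$.\<close>

definition R_rep ::
  "nat list \<Rightarrow> ('q::finite_field alg_closure, (nat \<times> nat) list \<Rightarrow> 'q alg_closure, 'q^2^2) rep" where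
  "R_rep rs = restrict_to (tensor_rep rs) (lin_span (tensor_rep rs :: ('q alg_closure, _, 'q^2^2) rep)
     {pure_tensor us | us. length us = length rs \<and> (\<forall>i<length rs. us!i \<in> R_gens (CHAR('q)) (rs!i))})"

definition b_vec :: "nat \<Rightarrow> nat list \<Rightarrow> nat list \<Rightarrow> (nat \<times> nat) list \<Rightarrow> 'k::field" where
  "b_vec p rs \<epsilon> = pure_tensor (map2 (\<lambda>r e. E_vec p r ((1 - e) * (p - 1 - r))) rs \<epsilon>)"

definition Sigma_set :: "nat \<Rightarrow> nat list \<Rightarrow> nat list set" where
  "Sigma_set p rs = {\<epsilon>. length \<epsilon> = length rs \<and> set \<epsilon> \<subseteq> {0, 1} \<and>
     (\<forall>i<length rs. rs!i = p - 1 \<longrightarrow> \<epsilon>!i = 0)}"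

definition delta :: "nat \<Rightarrow> nat list \<Rightarrow> nat list" where
  "delta p rs = map (\<lambda>r. if r \<noteq> p - 1 then 1 else 0) rs"

definition Sigma_set' :: "nat \<Rightarrow> nat list \<Rightarrow> nat list set" where
  "Sigma_set' p rs = Sigma_set p rs - {replicate (length rs) 0, delta p rs}"

definition compl_eps :: "nat list \<Rightarrow> nat list" where
  "compl_eps \<epsilon> = map (\<lambda>e. 1 - e) \<epsilon>"

definition digits :: "nat \<Rightarrow> nat \<Rightarrow> nat \<Rightarrow> nat list" where
  "digits p n r = map (\<lambda>i. r div p ^ i mod p) [0..<n]"


section \<open>Local fields and subgroups of GL2\<close>

record ('f, 'q) local_field_data =
  val :: "'f \<Rightarrow> int"
  res :: "'f \<Rightarrow> 'q"
  unif :: 'f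

definition valuation_ring :: "('f::field, 'q) local_field_data \<Rightarrow> 'f set" where
  "valuation_ring F = {x. x = 0 \<or> 0 \<le> val F x}"

text \<open>A non-Archimedean local field: complete for a normalised discrete valuation, with finite residue
  field. The valuation of 0 is a junk value, hence the case distinctions. The map
  \<^const>\<open>res\<close> identifies the residue field with the type \<^typ>\<open>'q\<close>.\<close>

definition local_field :: "('f::field, 'q::finite_field) local_field_data \<Rightarrow> bool" where
  "local_field F \<longleftrightarrow>
     (\<forall>x y. x \<noteq> 0 \<and> y \<noteq> 0 \<longrightarrow> val F (x * y) = val F x + val F y) \<and>
     (\<forall>x y. x \<noteq> 0 \<and> y \<noteq> 0 \<and> x + y \<noteq> 0 \<longrightarrow> min (val F x) (val F y) \<le> val F (x + y)) \<and>
     unif F \<noteq> 0 \<and> val F (unif F) = 1 \<and>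
     (\<forall>a :: nat \<Rightarrow> 'f.
        (\<forall>N. \<exists>M. \<forall>i\<ge>M. \<forall>j\<ge>M. a i = a j \<or> N \<le> val F (a i - a j)) \<longrightarrow>
        (\<exists>L. \<forall>N. \<exists>M. \<forall>i\<ge>M. a i = L \<or> N \<le> val F (a i - L))) \<and>
     res F 1 = 1 \<and>
     (\<forall>x\<in>valuation_ring F. \<forall>y\<in>valuation_ring F.
        res F (x + y) = res F x + res F y \<and> res F (x * y) = res F x * res F y) \<and>
     res F ` valuation_ring F = UNIV \<and>
     (\<forall>x\<in>valuation_ring F. res F x = 0 \<longleftrightarrow> x = 0 \<or> 1 \<le> val F x)"

context
  fixes F :: "('f::field, 'q::finite_field) local_field_data"
begin

definition max_compact :: "('f^2^2) set" where
  "max_compact = {g. (\<forall>i j. g$i$j \<in> valuation_ring F) \<and> det g \<noteq> 0 \<and> val F (det g) = 0}"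

definition reduction :: "'f^2^2 \<Rightarrow> 'q^2^2" where
  "reduction g = (\<chi> i j. res F (g$i$j))"

definition K1 :: "('f^2^2) set" where
  "K1 = {g \<in> max_compact. reduction g = mat 1}"

definition iwahori :: "('f^2^2) set" where
  "iwahori = {g \<in> max_compact. reduction g \<in> borel2}"

definition iwahori1 :: "('f^2^2) set" where
  "iwahori1 = {g \<in> max_compact. reduction g \<in> unip2}"

definition Pi_mat :: "'f^2^2" where
  "Pi_mat = mat2 0 1 (unif F) 0"

definition ZK :: "('f^2^2) set" where
  "ZK = {mat c ** k | c k. c \<noteq> 0 \<and> k \<in> max_compact}"

definition ZI :: "('f^2^2) set" where
  "ZI = {mat c ** k | c k. c \<noteq> 0 \<and> k \<in> iwahori}"

definition stab_edge :: "('f^2^2) set" where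
  "stab_edge = generate GL2 (insert Pi_mat iwahori)"

text \<open>The principal congruence subgroups form a neighbourhood basis of 1 in GL2.\<close>

definition congruence :: "nat \<Rightarrow> ('f^2^2) set" where
  "congruence m = {g \<in> max_compact.
     \<forall>i j. (g - mat 1)$i$j = 0 \<or> int m \<le> val F ((g - mat 1)$i$j)}"

definition smooth_rep :: "('f^2^2) set \<Rightarrow> ('k::field, 'v, 'f^2^2) rep \<Rightarrow> bool" where
  "smooth_rep S V \<longleftrightarrow> representation S V \<and>
     (\<forall>v\<in>carrier V. \<exists>m. \<forall>g \<in> S \<inter> congruence m. act V g v = v)"

definition essential_extension ::
  "('f^2^2) set \<Rightarrow> ('k::field, 'v, 'f^2^2) rep \<Rightarrow> 'v set \<Rightarrow> bool" where
  "essential_extension S V N \<longleftrightarrow> smooth_rep S V \<and> essential_subrep S V N"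

text \<open>Inflation along the reduction map, and extension from \<^const>\<open>max_compact\<close> to \<^const>\<open>ZK\<close> with
  the uniformiser acting trivially.\<close>

definition inflate :: "('k, 'v, 'q^2^2) rep \<Rightarrow> ('k, 'v, 'f^2^2) rep" where
  "inflate \<rho> = with_act \<rho> (\<lambda>g. act \<rho> (reduction g))"

definition K_part :: "'f^2^2 \<Rightarrow> 'f^2^2" where
  "K_part g = (THE k. k \<in> max_compact \<and> (\<exists>j::int. g = mat (unif F powi j) ** k))"

definition tilde :: "('k, 'v, 'f^2^2) rep \<Rightarrow> ('k, 'v, 'f^2^2) rep" where
  "tilde V = with_act V (\<lambda>g. act V (K_part g))"

text \<open>Injectivity in the category of smooth representations of a compact open subgroup \<^term>\<open>S\<close>. HOL has
  no quantification over types, so the test objects are all smooth representations whose underlying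
  set lies in a fixed type, that of functions from matrices to scalars. This loses
  nothing: up to isomorphism that type contains the generators $k[S/N]$ of the category,
  \<^term>\<open>N\<close> open and normal in \<^term>\<open>S\<close>, and by Baer's criterion these suffice as test objects.\<close>

definition injective_rep ::
  "('f^2^2) set \<Rightarrow> ('q alg_closure, 'v, 'f^2^2) rep \<Rightarrow> bool" where
  "injective_rep S V \<longleftrightarrow> smooth_rep S V \<and>
     (\<forall>(A :: ('q alg_closure, 'f^2^2 \<Rightarrow> 'q alg_closure, 'f^2^2) rep)
       (B :: ('q alg_closure, 'f^2^2 \<Rightarrow> 'q alg_closure, 'f^2^2) rep) i f.
        smooth_rep S A \<and> smooth_rep S B \<and> i \<in> rep_hom S A B \<and> inj_on i (carrier A) \<and>
        f \<in> rep_hom S A V \<longrightarrow>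
        (\<exists>h \<in> rep_hom S B V. \<forall>a\<in>carrier A. h (i a) = f a))"

definition injective_envelope ::
  "('f^2^2) set \<Rightarrow> ('q alg_closure, 'u, 'f^2^2) rep \<Rightarrow> ('q alg_closure, 'v, 'f^2^2) rep \<Rightarrow>
     ('u \<Rightarrow> 'v) \<Rightarrow> bool" where
  "injective_envelope S \<rho> V j \<longleftrightarrow> smooth_rep S \<rho> \<and> injective_rep S V \<and>
     j \<in> rep_hom S \<rho> V \<and> inj_on j (carrier \<rho>) \<and> essential_subrep S V (j ` carrier \<rho>)"

end


section \<open>The tree\<close>

text \<open>Vertices are homothety classes of lattices, and a simplex is the set of its
  vertices.\<close>

type_synonym 'f vertex = "('f^2) set set"
type_synonym 'f simplex = "('f^2) set set set"

definition vertex_act :: "'f::field^2^2 \<Rightarrow> 'f vertex \<Rightarrow> 'f vertex" where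
  "vertex_act g \<sigma> = (\<lambda>L. (\<lambda>x. g *v x) ` L) ` \<sigma>"

definition simplex_act :: "'f::field^2^2 \<Rightarrow> 'f simplex \<Rightarrow> 'f simplex" where
  "simplex_act g \<tau> = vertex_act g ` \<tau>"

definition homothety_class :: "('f::field^2) set \<Rightarrow> 'f vertex" where
  "homothety_class L = {(\<lambda>x. c *s x) ` L | c. c \<noteq> 0}"

context
  fixes F :: "('f::field, 'q::finite_field) local_field_data"
begin

definition lattice0 :: "('f^2) set" where
  "lattice0 = {x. \<forall>i. x$i \<in> valuation_ring F}"

definition lattice1 :: "('f^2) set" where
  "lattice1 = {x. x$1 \<in> valuation_ring F \<and> (x$2 = 0 \<or> 1 \<le> val F (x$2))}"

text \<open>A lattice is the span over the valuation ring of the columns of an invertible matrix.\<close>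

definition is_lattice :: "('f^2) set \<Rightarrow> bool" where
  "is_lattice L \<longleftrightarrow> (\<exists>g\<in>carrier GL2. L = (\<lambda>x. g *v x) ` lattice0)"

definition vertices :: "'f vertex set" where
  "vertices = {homothety_class L | L. is_lattice L}"

definition oriented_edges :: "('f vertex \<times> 'f vertex) set" where
  "oriented_edges = {(\<sigma>, \<sigma>'). \<sigma> \<in> vertices \<and> \<sigma>' \<in> vertices \<and>
     (\<exists>L\<in>\<sigma>. \<exists>L'\<in>\<sigma>'. (\<lambda>x. unif F *s x) ` L \<subset> L' \<and> L' \<subset> L)}"

definition sigma0 :: "'f simplex" where
  "sigma0 = {homothety_class lattice0}"

definition sigma1 :: "'f simplex" where
  "sigma1 = {homothety_class lattice0, homothety_class lattice1}"

end


section \<open>Diagrams, coefficient systems and homology\<close>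

record ('k, 'v, 'g) diagram =
  diag0 :: "('k, 'v, 'g) rep"
  diag1 :: "('k, 'v, 'g) rep"
  diag_r :: "'v \<Rightarrow> 'v"

text \<open>\<^term>\<open>cs_res \<V> \<sigma> \<tau>\<close> is the restriction map from the space at \<^term>\<open>\<tau>\<close> to the space at its
  face \<^term>\<open>\<sigma>\<close>.\<close>

record ('k, 's, 'v, 'g) coeff_system =
  cs_space :: "'s \<Rightarrow> ('k, 'v) module"
  cs_res :: "'s \<Rightarrow> 's \<Rightarrow> 'v \<Rightarrow> 'v"
  cs_act :: "'g \<Rightarrow> 's \<Rightarrow> 'v \<Rightarrow> 'v"

context
  fixes F :: "('f::field, 'q::finite_field) local_field_data"
begin

text \<open>The space at a simplex \<^term>\<open>\<tau>\<close> in the orbit of \<^term>\<open>\<sigma>\<close>, where \<^term>\<open>S\<close> is the stabiliser of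
  \<^term>\<open>\<sigma>\<close>: the functions in the compact induction supported in the coset $S g^{-1}$, for any
  \<^term>\<open>g\<close> with \<^term>\<open>simplex_act g \<sigma> = \<tau>\<close>.\<close>

definition orbit_space :: "('f^2^2) set \<Rightarrow> ('k, 'v, 'f^2^2) rep \<Rightarrow> 'f simplex \<Rightarrow> 'f simplex \<Rightarrow>
    ('k, 'f^2^2 \<Rightarrow> 'v) module" where
  "orbit_space S V \<sigma> \<tau> = module.truncate (restrict_to (c_ind S V)
     {f \<in> carrier (c_ind S V). \<forall>g\<in>carrier GL2. simplex_act g \<sigma> = \<tau> \<longrightarrow>
        {x. f x \<noteq> \<zero>\<^bsub>V\<^esub>} \<subseteq> S #>\<^bsub>GL2\<^esub> matrix_inv g})"

definition diagram_space ::
  "('k, 'v, 'f^2^2) diagram \<Rightarrow> 'f simplex \<Rightarrow> ('k, 'f^2^2 \<Rightarrow> 'v) module" where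
  "diagram_space D \<tau> = (if is_singleton \<tau>
     then orbit_space (ZK F) (diag0 D) (sigma0 F) \<tau>
     else orbit_space (stab_edge F) (diag1 D) (sigma1 F) \<tau>)"

definition coeff_of_diagram ::
  "('k, 'v, 'f^2^2) diagram \<Rightarrow> ('k, 'f simplex, 'f^2^2 \<Rightarrow> 'v, 'f^2^2) coeff_system" where
  "coeff_of_diagram D = \<lparr>
     cs_space = diagram_space D,
     cs_res = (\<lambda>\<sigma> \<tau> f. if \<sigma> = \<tau> then f else
       (THE f'. f' \<in> carrier (diagram_space D \<sigma>) \<and>
          (\<forall>g\<in>carrier GL2. simplex_act g (sigma0 F) = \<sigma> \<and> simplex_act g (sigma1 F) = \<tau> \<longrightarrow>
             f' (matrix_inv g) = diag_r D (f (matrix_inv g))))),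
     cs_act = (\<lambda>g \<tau> f x. f (x ** g))\<rparr>"

definition coeff_map :: "('v \<Rightarrow> 'w) \<Rightarrow> ('v \<Rightarrow> 'w) \<Rightarrow> 'f simplex \<Rightarrow> ('f^2^2 \<Rightarrow> 'v) \<Rightarrow> 'f^2^2 \<Rightarrow> 'w" where
  "coeff_map \<psi>0 \<psi>1 \<tau> f = (if is_singleton \<tau> then \<psi>0 \<circ> f else \<psi>1 \<circ> f)"

definition chains0 ::
  "('k, 'f simplex, 'v, 'f^2^2) coeff_system \<Rightarrow> ('k, 'f vertex \<Rightarrow> 'v, 'f^2^2) rep" where
  "chains0 \<V> = \<lparr>
     carrier = {\<omega> \<in> extensional (vertices F).
        (\<forall>\<sigma>\<in>vertices F. \<omega> \<sigma> \<in> carrier (cs_space \<V> {\<sigma>})) \<and>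
        finite {\<sigma> \<in> vertices F. \<omega> \<sigma> \<noteq> \<zero>\<^bsub>cs_space \<V> {\<sigma>}\<^esub>}},
     monoid.mult = undefined, one = undefined,
     zero = (\<lambda>\<sigma>\<in>vertices F. \<zero>\<^bsub>cs_space \<V> {\<sigma>}\<^esub>),
     add = (\<lambda>\<omega> \<omega>'. \<lambda>\<sigma>\<in>vertices F. \<omega> \<sigma> \<oplus>\<^bsub>cs_space \<V> {\<sigma>}\<^esub> \<omega>' \<sigma>),
     module.smult = (\<lambda>c \<omega>. \<lambda>\<sigma>\<in>vertices F. c \<odot>\<^bsub>cs_space \<V> {\<sigma>}\<^esub> \<omega> \<sigma>),
     act = (\<lambda>g \<omega>. \<lambda>\<sigma>\<in>vertices F.
        cs_act \<V> g {vertex_act (matrix_inv g) \<sigma>} (\<omega> (vertex_act (matrix_inv g) \<sigma>)))\<rparr>"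

definition chains1 ::
  "('k, 'f simplex, 'v, 'f^2^2) coeff_system \<Rightarrow> ('f vertex \<times> 'f vertex \<Rightarrow> 'v) set" where
  "chains1 \<V> = {\<omega> \<in> extensional (oriented_edges F).
     (\<forall>(\<sigma>, \<sigma>')\<in>oriented_edges F. \<omega> (\<sigma>, \<sigma>') \<in> carrier (cs_space \<V> {\<sigma>, \<sigma>'}) \<and>
        \<omega> (\<sigma>', \<sigma>) = \<ominus>\<^bsub>cs_space \<V> {\<sigma>, \<sigma>'}\<^esub> \<omega> (\<sigma>, \<sigma>')) \<and>
     finite {(\<sigma>, \<sigma>') \<in> oriented_edges F. \<omega> (\<sigma>, \<sigma>') \<noteq> \<zero>\<^bsub>cs_space \<V> {\<sigma>, \<sigma>'}\<^esub>}}"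

definition boundary :: "('k, 'f simplex, 'v, 'f^2^2) coeff_system \<Rightarrow>
    ('f vertex \<times> 'f vertex \<Rightarrow> 'v) \<Rightarrow> 'f vertex \<Rightarrow> 'v" where
  "boundary \<V> \<omega> = (\<lambda>\<sigma>\<in>vertices F.
     \<Oplus>\<^bsub>cs_space \<V> {\<sigma>}\<^esub> \<sigma>' \<in> {\<sigma>'. (\<sigma>, \<sigma>') \<in> oriented_edges F}.
       cs_res \<V> {\<sigma>} {\<sigma>, \<sigma>'} (\<omega> (\<sigma>, \<sigma>')))"

definition H0 ::
  "('k, 'f simplex, 'v, 'f^2^2) coeff_system \<Rightarrow> ('k, ('f vertex \<Rightarrow> 'v) set, 'f^2^2) rep" where
  "H0 \<V> = quot_rep (chains0 \<V>) (boundary \<V> ` chains1 \<V>)"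

definition H0_map :: "('k, 'f simplex, 'w, 'f^2^2) coeff_system \<Rightarrow> ('f simplex \<Rightarrow> 'v \<Rightarrow> 'w) \<Rightarrow>
    ('f vertex \<Rightarrow> 'v) set \<Rightarrow> ('f vertex \<Rightarrow> 'w) set" where
  "H0_map \<W> \<Phi> A = (\<Union>\<omega>\<in>A. (boundary \<W> ` chains1 \<W>) +>\<^bsub>chains0 \<W>\<^esub> (\<lambda>\<sigma>\<in>vertices F. \<Phi> {\<sigma>} (\<omega> \<sigma>)))"


section \<open>The diagrams attached to a character\<close>

definition is_D_gamma ::
  "('q alg_closure, 'u, 'q^2^2) rep \<Rightarrow> ('q alg_closure, 'v, 'q^2^2) rep \<Rightarrow> 'u \<Rightarrow> 'v \<Rightarrow>
     ('q alg_closure, 'u \<times> 'v, 'f^2^2) diagram \<Rightarrow> bool" where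
  "is_D_gamma \<rho>1 \<rho>2 v1 v2 D \<longleftrightarrow>
     diag0 D = dsum_rep (tilde F (inflate F \<rho>1)) (tilde F (inflate F \<rho>2)) \<and>
     module.truncate (diag1 D) =
       module.truncate (restrict_to (diag0 D) (invariants (iwahori1 F) (diag0 D))) \<and>
     smooth_rep F (stab_edge F) (diag1 D) \<and>
     (\<forall>g\<in>ZI F. \<forall>v\<in>carrier (diag1 D). act (diag1 D) g v = act (diag0 D) g v) \<and>
     act (diag1 D) (matrix_inv (Pi_mat F)) (v1, \<zero>\<^bsub>\<rho>2\<^esub>) = (\<zero>\<^bsub>\<rho>1\<^esub>, v2) \<and>
     act (diag1 D) (matrix_inv (Pi_mat F)) (\<zero>\<^bsub>\<rho>1\<^esub>, v2) = (v1, \<zero>\<^bsub>\<rho>2\<^esub>) \<and>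
     diag_r D = id"

text \<open>The basis of the invariants under \<^const>\<open>iwahori1\<close> of
  \<^term>\<open>Y0 = dsum_rep (tilde F E1) (tilde F E2)\<close>, recorded
  through the set \<^term>\<open>P\<close> of its pairs, with the prescribed images \<^term>\<open>w1\<close>, \<^term>\<open>w2\<close> of the
  chosen vectors \<^term>\<open>v1\<close>, \<^term>\<open>v2\<close> of the representations attached to \<^term>\<open>chi\<close>, \<^term>\<open>J\<close> and to
  \<^term>\<open>char_s chi\<close>, \<^term>\<open>J0 chi - J\<close>. The pair of \<^term>\<open>b \<epsilon>\<close> and \<^term>\<open>b (compl_eps \<epsilon>)\<close> may be listed
  in both orders.\<close>

definition gamma_basis ::
  "nat \<Rightarrow> ('q^2^2 \<Rightarrow> 'q alg_closure) \<Rightarrow> ('q^2^2) set \<Rightarrow>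
     ('q alg_closure, 'v, 'f^2^2) rep \<Rightarrow> ('q alg_closure, 'w, 'f^2^2) rep \<Rightarrow>
     (('v \<times> 'w) \<times> ('v \<times> 'w)) set \<Rightarrow> 'v \<times> 'w \<Rightarrow> 'v \<times> 'w \<Rightarrow> bool" where
  "gamma_basis n chi J E1 E2 P w1 w2 \<longleftrightarrow> (\<exists>a r.
     a \<in> {1..CARD('q) - 1} \<and> r \<in> {1..CARD('q) - 1} \<and>
     (\<forall>x. x \<noteq> 0 \<longrightarrow> chi (mat2 1 0 0 x) = to_ac x ^ a \<and> chi (mat2 x 0 0 (inverse x)) = to_ac x ^ r) \<and>
     (let p = CHAR('q); Y0 = dsum_rep (tilde F E1) (tilde F E2) in
      if J0 chi \<noteq> {} then
        (let rs = replicate n 0; zeros = replicate n 0; ones = replicate n 1;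
             R = twist_det (\<lambda>x. to_ac x ^ a) (R_rep rs) in
         \<exists>\<theta>. rep_iso_map (max_compact F) (inflate F R)
               (restrict_to Y0 (invariants (K1 F) Y0)) \<theta> \<and>
             (let b = (\<lambda>\<epsilon>. \<theta> (b_vec p rs \<epsilon>));
                  b01 = \<theta> (b_vec p rs zeros \<oplus>\<^bsub>R\<^esub> b_vec p rs ones) in
              P = {(b zeros, b01)} \<union> {(b \<epsilon>, b (compl_eps \<epsilon>)) | \<epsilon>. \<epsilon> \<in> Sigma_set' p rs} \<and>
              (w1, w2) = (if J = {smat} then (b zeros, b01) else (b01, b zeros))))
      else
        (let rs = digits p n r; rs' = map (\<lambda>d. p - 1 - d) rs;
             zeros = replicate n 0; ones = replicate n 1;
             R = twist_det (\<lambda>x. to_ac x ^ (a + r)) (R_rep rs);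
             R' = twist_det (\<lambda>x. to_ac x ^ a) (R_rep rs') in
         \<exists>\<theta> \<theta>'. rep_iso_map (max_compact F) (inflate F R)
                  (restrict_to E1 (invariants (K1 F) E1)) \<theta> \<and>
                rep_iso_map (max_compact F) (inflate F R')
                  (restrict_to E2 (invariants (K1 F) E2)) \<theta>' \<and>
             (let b = (\<lambda>\<epsilon>. (\<theta> (b_vec p rs \<epsilon>), \<zero>\<^bsub>E2\<^esub>));
                  b' = (\<lambda>\<epsilon>. (\<zero>\<^bsub>E1\<^esub>, \<theta>' (b_vec p rs' \<epsilon>))) in
              P = {(b zeros, b' zeros), (b ones, b' ones)} \<union>
                  {(b \<epsilon>, b (compl_eps \<epsilon>)) | \<epsilon>. \<epsilon> \<in> Sigma_set' p rs} \<union>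
                  {(b' \<epsilon>, b' (compl_eps \<epsilon>)) | \<epsilon>. \<epsilon> \<in> Sigma_set' p rs'} \<and>
              (w1, w2) = (b zeros, b' zeros)))))"

text \<open>In the last clause the condition on \<^term>\<open>\<phi>\<close> is symmetric: it holds for \<^term>\<open>\<phi>\<close> and a pair if and
  only if it holds for the inverse of \<^term>\<open>\<phi>\<close> and the reversed pair, as the square of \<^const>\<open>Pi_mat\<close>
  is central.\<close>

definition is_Y_gamma ::
  "('q alg_closure, 'v, 'f^2^2) rep \<Rightarrow> ('q alg_closure, 'w, 'f^2^2) rep \<Rightarrow>
     (('v \<times> 'w) \<times> ('v \<times> 'w)) set \<Rightarrow> ('q alg_closure, 'v \<times> 'w, 'f^2^2) diagram \<Rightarrow> bool" where
  "is_Y_gamma E1 E2 P Y \<longleftrightarrow>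
     diag0 Y = dsum_rep (tilde F E1) (tilde F E2) \<and>
     module.truncate (diag1 Y) = module.truncate (diag0 Y) \<and>
     smooth_rep F (stab_edge F) (diag1 Y) \<and>
     (\<forall>g\<in>ZI F. \<forall>v\<in>carrier (diag0 Y). act (diag1 Y) g v = act (diag0 Y) g v) \<and>
     diag_r Y = id \<and>
     (\<exists>W.
       (\<forall>b\<in>Field P. subrep (ZI F) (diag0 Y) (W b) \<and> b \<in> W b \<and>
          injective_envelope F (iwahori F) (restrict_to (diag0 Y) (lin_span (diag0 Y) {b}))
            (restrict_to (diag0 Y) (W b)) id) \<and>
       (\<forall>y\<in>carrier (diag0 Y). \<exists>!u. u \<in> (\<Pi>\<^sub>E b\<in>Field P. W b) \<and> y = (\<Oplus>\<^bsub>diag0 Y\<^esub> b\<in>Field P. u b)) \<and>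
       (\<forall>(b, b')\<in>P. \<exists>\<phi>.
          \<phi> \<in> linear_maps (restrict_to (diag0 Y) (W b)) (restrict_to (diag0 Y) (W b')) \<and>
          bij_betw \<phi> (W b) (W b') \<and> \<phi> b = b' \<and>
          (\<forall>g\<in>iwahori F. \<forall>v\<in>W b.
             \<phi> (act (diag0 Y) (Pi_mat F ** g ** matrix_inv (Pi_mat F)) v) = act (diag0 Y) g (\<phi> v)) \<and>
          (\<forall>v\<in>W b. \<forall>w\<in>W b'. act (diag1 Y) (matrix_inv (Pi_mat F)) (v \<oplus>\<^bsub>diag0 Y\<^esub> w) =
             inv_into (W b) \<phi> w \<oplus>\<^bsub>diag0 Y\<^esub> \<phi> v)))"

end

end

theory Submission
  imports Defs
begin

text \<open>Since the restriction maps of \<open>\<I>\<^sub>\<gamma>\<close> are isomorphisms and the tree is contractible, the map from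
  \<open>Y\<^sub>0\<close> to \<open>H\<^sub>0(X, \<I>\<^sub>\<gamma>)\<close> that sends a vector to the class of the chain supported at the base vertex is
  bijective. So a non-zero subrepresentation \<open>W\<close> of \<open>H\<^sub>0\<close> gives a non-zero subspace of \<open>Y\<^sub>0\<close> that is stable
  under \<open>K\<close> and \<open>\<Pi>\<close>. As \<open>Y\<^sub>0\<close> is an injective envelope, this subspace meets the image of
  \<open>\<rho>1 \<oplus> \<rho>2\<close>; the two summands are irreducible and not isomorphic, so it contains one of them,
  in particular one of the \<open>U\<close>-invariant vectors \<open>w1\<close>, \<open>w2\<close>. As \<open>\<Pi>\<close> exchanges these, it contains both, hence
  both summands. Therefore \<open>W\<close> contains \<open>\<pi>\<^sub>\<gamma>\<close>, which is thus the smallest non-zero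
  subrepresentation; in particular it is the socle.\<close>

subsection \<open>Vector spaces and representations\<close>

text \<open>The contraction of the tree is a computation with valuations of determinants. A vertex
  away from the base has a neighbour that is closer, so every class can be moved to the base; and it
  has at most one neighbour that is not farther, which excludes cycles. The diagram \<open>D\<close>
  prescribes \<Pi> only on the two chosen vectors. That \<open>\<psi>\<close> is a morphism of
  diagrams therefore rests on the \<open>U\<close>-invariants of \<open>\<rho>1\<close> and
  \<open>\<rho>2\<close> being lines. For Steinberg twists this is seen on the projective line and
  also yields irreducibility. For \<open>chi \<noteq> char_s chi\<close> the definition of
  \<open>\<rho>\<close> gives irreducibility and the character on the invariants, but not their
  dimension. There the Hecke operator of \<open>U s U\<close> vanishes on invariants, so an
  invariant vector generates everything under the lower unipotent group; since a finite p-group has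
  non-zero coinvariants in characteristic p, a second invariant vector, corrected by a multiple of
  the first, generates a proper subspace and so vanishes. The torus distinguishes
  \<open>\<rho>1\<close> from \<open>\<rho>2\<close> in this case; otherwise one is a character and
  the other a Steinberg twist.\<close>

lemma ring_of_type_algebra_simps [simp]:
  "carrier (ring_of_type_algebra :: 'k::field ring) = UNIV"
  "a \<oplus>\<^bsub>ring_of_type_algebra\<^esub> b = (a::'k) + b"
  "a \<otimes>\<^bsub>ring_of_type_algebra\<^esub> b = (a::'k) * b"
  "\<zero>\<^bsub>ring_of_type_algebra\<^esub> = (0::'k)"
  "\<one>\<^bsub>ring_of_type_algebra\<^esub> = (1::'k)"
  by (simp_all add: ring_of_type_algebra_def)

text \<open>Scalars range over the whole type \<open>'k\<close>, so no law below carries a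
  membership condition on them; the scheme type lets the same laws serve \<open>module\<close>
  records and \<open>rep\<close> records.\<close>

locale kspace =
  fixes V :: "('k::field, 'v, 'm) module_scheme" (structure)
  assumes module_V: "Module.module (ring_of_type_algebra :: 'k ring) V"

sublocale kspace \<subseteq> abelian_group V
  using module_V by (simp add: Module.module_def)

context kspace
begin

lemma smult_closed [simp, intro]: "x \<in> carrier V \<Longrightarrow> c \<odot> x \<in> carrier V"
  using module.smult_closed[OF module_V, of c x] by simp

lemma smult_add_left: "x \<in> carrier V \<Longrightarrow> (a + b) \<odot> x = a \<odot> x \<oplus> b \<odot> x"
  using module.smult_l_distr[OF module_V, of a b x] by simp

lemma smult_add: "x \<in> carrier V \<Longrightarrow> y \<in> carrier V \<Longrightarrow> a \<odot> (x \<oplus> y) = a \<odot> x \<oplus> a \<odot> y"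
  using module.smult_r_distr[OF module_V, of a x y] by simp

lemma smult_mult: "x \<in> carrier V \<Longrightarrow> (a * b) \<odot> x = a \<odot> (b \<odot> x)"
  using module.smult_assoc1[OF module_V, of a b x] by simp

lemma one_smult [simp]: "x \<in> carrier V \<Longrightarrow> 1 \<odot> x = x"
  using module.smult_one[OF module_V, of x] by simp

lemma zero_smult [simp]: "x \<in> carrier V \<Longrightarrow> 0 \<odot> x = \<zero>"
  using module.smult_l_null[OF module_V, of x] by simp

lemma smult_zero [simp]: "c \<odot> \<zero> = \<zero>"
  using module.smult_r_null[OF module_V, of c] by simp

lemma minus_smult: "x \<in> carrier V \<Longrightarrow> (- c) \<odot> x = \<ominus> (c \<odot> x)"
  by (metis add.inv_unique' add.right_inverse one_smult smult_add_left smult_closed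
      minus_equality add.left_inverse zero_smult)

lemma minus_eq_smult: "x \<in> carrier V \<Longrightarrow> \<ominus> x = (- 1) \<odot> x"
  by (simp add: minus_smult)

lemma smult_a_inv: "x \<in> carrier V \<Longrightarrow> c \<odot> (\<ominus> x) = \<ominus> (c \<odot> x)"
  by (simp add: minus_eq_smult flip: smult_mult)

lemma smult_eq_zeroD: "x \<in> carrier V \<Longrightarrow> c \<odot> x = \<zero> \<Longrightarrow> c = 0 \<or> x = \<zero>"
  by (metis left_inverse one_smult smult_mult smult_zero)

lemma diff_eq_zero_iff [simp]:
  "x \<in> carrier V \<Longrightarrow> y \<in> carrier V \<Longrightarrow> x \<ominus> y = \<zero> \<longleftrightarrow> x = y"
  by (metis a_minus_def add.inv_closed add.inv_equality add.inv_inv r_neg)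

lemma lin_subspace_iff:
  "lin_subspace V N \<longleftrightarrow> N \<subseteq> carrier V \<and> \<zero> \<in> N \<and> (\<forall>x\<in>N. \<forall>y\<in>N. x \<oplus> y \<in> N) \<and>
     (\<forall>c. \<forall>x\<in>N. c \<odot> x \<in> N)" (is "?L \<longleftrightarrow> ?R")
proof
  assume ?L
  then have s: "submodule N (ring_of_type_algebra :: 'k ring) V"
    by (simp add: lin_subspace_def)
  show ?R
    using module.submoduleE[OF module_V s] submodule.axioms(1)[OF s] subgroup.one_closed
    by fastforce
next
  assume R: ?R
  then have "submodule N (ring_of_type_algebra :: 'k ring) V"
    by (intro module.submoduleI[OF module_V]) (auto simp: minus_eq_smult subset_iff)
  then show ?L
    by (simp add: lin_subspace_def)
qed

lemma lin_subspaceD: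
  assumes "lin_subspace V N"
  shows "x \<in> N \<Longrightarrow> x \<in> carrier V" "\<zero> \<in> N" "x \<in> N \<Longrightarrow> y \<in> N \<Longrightarrow> x \<oplus> y \<in> N"
    "x \<in> N \<Longrightarrow> c \<odot> x \<in> N" "x \<in> N \<Longrightarrow> \<ominus> x \<in> N" "x \<in> N \<Longrightarrow> y \<in> N \<Longrightarrow> x \<ominus> y \<in> N"
  using assms by (auto simp: lin_subspace_iff minus_eq_smult minus_eq subset_iff)

lemma lin_subspace_carrier: "lin_subspace V (carrier V)"
  and lin_subspace_zero: "lin_subspace V {\<zero>}"
  by (auto simp: lin_subspace_iff)

lemma lin_subspace_span: "T \<subseteq> carrier V \<Longrightarrow> lin_subspace V (lin_span V T)"
  unfolding lin_span_def using lin_subspace_carrier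
  by (subst lin_subspace_iff) (blast dest: lin_subspaceD)

lemma finsum_in_subspace:
  assumes "lin_subspace V N" "\<And>x. x \<in> A \<Longrightarrow> f x \<in> N"
  shows "finsum V f A \<in> N"
  using assms(2)
proof (induction A rule: infinite_finite_induct)
  case (insert x A)
  then show ?case
    using lin_subspaceD[OF assms(1)] by (subst finsum_insert) auto
qed (use lin_subspaceD[OF assms(1)] in auto)

end

lemma lin_span_mono: "T \<subseteq> lin_span V T"
  by (auto simp: lin_span_def)

lemma lin_span_least: "lin_subspace V N \<Longrightarrow> T \<subseteq> N \<Longrightarrow> lin_span V T \<subseteq> N"
  by (auto simp: lin_span_def)

text \<open>The law \<open>0 \<odot> x = \<zero>\<close> stands in for the existence of negatives:
  with it and distributivity, \<open>(- 1) \<odot> x\<close> is an inverse of \<open>x\<close>. So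
  the spaces built below are checked without exhibiting inverses.\<close>

lemma kspaceI:
  fixes V :: "('k::field, 'v, 'm) module_scheme" (structure)
  assumes "\<zero> \<in> carrier V"
    and "\<And>x y. x \<in> carrier V \<Longrightarrow> y \<in> carrier V \<Longrightarrow> x \<oplus> y \<in> carrier V"
    and "\<And>x y z. x \<in> carrier V \<Longrightarrow> y \<in> carrier V \<Longrightarrow> z \<in> carrier V \<Longrightarrow> (x \<oplus> y) \<oplus> z = x \<oplus> (y \<oplus> z)"
    and "\<And>x y. x \<in> carrier V \<Longrightarrow> y \<in> carrier V \<Longrightarrow> x \<oplus> y = y \<oplus> x"
    and "\<And>x. x \<in> carrier V \<Longrightarrow> \<zero> \<oplus> x = x"
    and "\<And>c x. x \<in> carrier V \<Longrightarrow> c \<odot> x \<in> carrier V"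
    and "\<And>a b x. x \<in> carrier V \<Longrightarrow> (a + b) \<odot> x = a \<odot> x \<oplus> b \<odot> x"
    and "\<And>a x y. x \<in> carrier V \<Longrightarrow> y \<in> carrier V \<Longrightarrow> a \<odot> (x \<oplus> y) = a \<odot> x \<oplus> a \<odot> y"
    and "\<And>a b x. x \<in> carrier V \<Longrightarrow> (a * b) \<odot> x = a \<odot> (b \<odot> x)"
    and "\<And>x. x \<in> carrier V \<Longrightarrow> 1 \<odot> x = x"
    and "\<And>x. x \<in> carrier V \<Longrightarrow> 0 \<odot> x = \<zero>"
  shows "kspace V"
proof -
  have "\<exists>y\<in>carrier V. y \<oplus> x = \<zero>" if x: "x \<in> carrier V" for x
  proof
    show "(- 1) \<odot> x \<oplus> x = \<zero>"
      using assms(7)[OF x, of "- 1" 1] assms(10,11)[OF x] by simp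
  qed (use assms(6) x in blast)
  then have "abelian_group V"
    using assms by (intro abelian_groupI) auto
  moreover have "cring (ring_of_type_algebra :: 'k ring)"
    by (rule cring_from_type_algebra)
  ultimately have "Module.module (ring_of_type_algebra :: 'k ring) V"
    using assms by (intro moduleI) simp_all
  then show ?thesis
    by (rule kspace.intro)
qed

lemma kspace_subspace:
  fixes V :: "('k::field, 'v, 'g) rep"
  assumes "kspace V" "lin_subspace V N"
  shows "kspace (restrict_to V N)"
proof -
  interpret V: kspace V by fact
  note * = V.lin_subspaceD[OF assms(2)]
  show ?thesis
    using * by (intro kspaceI)
      (auto simp: V.add.m_assoc V.smult_add_left V.smult_add V.smult_mult intro: V.add.m_comm)
qed

section \<open>Linear maps\<close>

lemma linear_mapsD:
  assumes "f \<in> linear_maps V W"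
  shows "x \<in> carrier V \<Longrightarrow> f x \<in> carrier W"
    "x \<in> carrier V \<Longrightarrow> y \<in> carrier V \<Longrightarrow> f (x \<oplus>\<^bsub>V\<^esub> y) = f x \<oplus>\<^bsub>W\<^esub> f y"
    "x \<in> carrier V \<Longrightarrow> f (c \<odot>\<^bsub>V\<^esub> x) = c \<odot>\<^bsub>W\<^esub> f x"
  using assms by (auto simp: linear_maps_def)

locale linear_map = V: kspace V + W: kspace W
  for V :: "('k::field, 'v, 'm) module_scheme" and W :: "('k, 'w, 'n) module_scheme" +
  fixes f :: "'v \<Rightarrow> 'w"
  assumes lin: "f \<in> linear_maps V W"
begin

lemma closed [simp, intro]: "x \<in> carrier V \<Longrightarrow> f x \<in> carrier W"
  and add: "x \<in> carrier V \<Longrightarrow> y \<in> carrier V \<Longrightarrow> f (x \<oplus>\<^bsub>V\<^esub> y) = f x \<oplus>\<^bsub>W\<^esub> f y"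
  and smult: "x \<in> carrier V \<Longrightarrow> f (c \<odot>\<^bsub>V\<^esub> x) = c \<odot>\<^bsub>W\<^esub> f x"
  using linear_mapsD[OF lin] by auto

lemma zero [simp]: "f \<zero>\<^bsub>V\<^esub> = \<zero>\<^bsub>W\<^esub>"
  by (metis V.zero_closed V.zero_smult W.zero_smult closed smult)

lemma a_inv: "x \<in> carrier V \<Longrightarrow> f (\<ominus>\<^bsub>V\<^esub> x) = \<ominus>\<^bsub>W\<^esub> f x"
  by (simp add: V.minus_eq_smult W.minus_eq_smult smult)

lemma minus: "x \<in> carrier V \<Longrightarrow> y \<in> carrier V \<Longrightarrow> f (x \<ominus>\<^bsub>V\<^esub> y) = f x \<ominus>\<^bsub>W\<^esub> f y"
  by (simp add: V.minus_eq W.minus_eq add a_inv)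

lemma finsum:
  "g \<in> A \<rightarrow> carrier V \<Longrightarrow> f (finsum V g A) = finsum W (\<lambda>x. f (g x)) A"
proof (induction A rule: infinite_finite_induct)
  case (insert x A)
  then show ?case
    by (subst V.finsum_insert, simp_all, subst W.finsum_insert) (auto simp: add Pi_iff)
qed auto

lemma subspace_image: "lin_subspace V N \<Longrightarrow> lin_subspace W (f ` N)"
  unfolding V.lin_subspace_iff W.lin_subspace_iff
  by (auto simp: image_iff subset_iff add[symmetric] smult[symmetric])
    (metis zero)+

lemma subspace_vimage: "lin_subspace W N \<Longrightarrow> lin_subspace V {x \<in> carrier V. f x \<in> N}"
  unfolding V.lin_subspace_iff W.lin_subspace_iff
  by (auto simp: add smult)

end

section \<open>Representations, subrepresentations and equivariant maps\<close>

lemma kspace_of_representation: "representation S V \<Longrightarrow> kspace V"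
  by (simp add: representation_def kspace_def)

locale grep =
  fixes S :: "('a::field^2^2) set" and V :: "('k::field, 'v, 'a^2^2) rep" (structure)
  assumes rep: "representation S V"

sublocale grep \<subseteq> kspace V
  using rep by (rule kspace_of_representation)

context grep
begin

lemma act_linear: "g \<in> S \<Longrightarrow> act V g \<in> linear_maps V V"
  and act_one [simp]: "v \<in> carrier V \<Longrightarrow> act V (mat 1) v = v"
  and act_mult: "g \<in> S \<Longrightarrow> h \<in> S \<Longrightarrow> v \<in> carrier V \<Longrightarrow> act V (g ** h) v = act V g (act V h v)"
  using rep by (auto simp: representation_def)

lemma act_linear_map: "g \<in> S \<Longrightarrow> linear_map V V (act V g)"
  using act_linear kspace_axioms by (simp add: linear_map_def linear_map_axioms_def)

lemma act_closed [simp, intro]: "g \<in> S \<Longrightarrow> v \<in> carrier V \<Longrightarrow> act V g v \<in> carrier V"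
  and act_add: "g \<in> S \<Longrightarrow> v \<in> carrier V \<Longrightarrow> w \<in> carrier V \<Longrightarrow>
    act V g (v \<oplus> w) = act V g v \<oplus> act V g w"
  and act_smult: "g \<in> S \<Longrightarrow> v \<in> carrier V \<Longrightarrow> act V g (c \<odot> v) = c \<odot> act V g v"
  using linear_mapsD[OF act_linear] by auto

lemma act_zero [simp]: "g \<in> S \<Longrightarrow> act V g \<zero> = \<zero>"
  by (rule linear_map.zero[OF act_linear_map])

lemma act_minus: "g \<in> S \<Longrightarrow> v \<in> carrier V \<Longrightarrow> w \<in> carrier V \<Longrightarrow>
    act V g (v \<ominus> w) = act V g v \<ominus> act V g w"
  by (rule linear_map.minus[OF act_linear_map])

lemma subrep_iff:
  "subrep S V N \<longleftrightarrow> N \<subseteq> carrier V \<and> \<zero> \<in> N \<and> (\<forall>x\<in>N. \<forall>y\<in>N. x \<oplus> y \<in> N) \<and>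
     (\<forall>c. \<forall>x\<in>N. c \<odot> x \<in> N) \<and> (\<forall>g\<in>S. \<forall>v\<in>N. act V g v \<in> N)"
  by (simp add: subrep_def lin_subspace_iff)

lemma restrict_representation: "subrep S V N \<Longrightarrow> representation S (restrict_to V N)"
proof -
  assume N: "subrep S V N"
  then have "kspace (restrict_to V N)"
    by (intro kspace_subspace kspace_axioms) (simp add: subrep_def)
  note kspace.module_V[OF this]
  with N show ?thesis
    by (auto simp: representation_def subrep_iff linear_maps_def act_add act_smult act_mult subset_iff)
qed

lemma irreducible_restrictD:
  assumes "irreducible_rep S (restrict_to V N)" "subrep S V N" "subrep S V W" "W \<subseteq> N" "W \<noteq> {\<zero>}"
  shows "W = N"
proof -
  interpret N: grep S "restrict_to V N"
    using restrict_representation[OF assms(2)] by unfold_locales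
  have "subrep S (restrict_to V N) W"
    using assms(3,4) by (simp add: N.subrep_iff subrep_iff)
  with assms(1,5) show ?thesis
    by (auto simp: irreducible_rep_def)
qed

lemma irreducible_restrictI:
  assumes "subrep S V N" "N \<noteq> {\<zero>}"
    and "\<And>W. subrep S V W \<Longrightarrow> W \<subseteq> N \<Longrightarrow> W \<noteq> {\<zero>} \<Longrightarrow> W = N"
  shows "irreducible_rep S (restrict_to V N)"
proof -
  have r: "representation S (restrict_to V N)"
    using assms(1) by (rule restrict_representation)
  interpret N: grep S "restrict_to V N"
    using r by unfold_locales
  have "W = {\<zero>} \<or> W = N" if "subrep S (restrict_to V N) W" for W
  proof -
    have "subrep S V W" "W \<subseteq> N"
      using that assms(1) by (auto simp: N.subrep_iff subrep_iff)
    with assms(3) show ?thesis by blast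
  qed
  with r assms(2) show ?thesis
    by (auto simp: irreducible_rep_def)
qed

end

lemma rep_homD:
  assumes "f \<in> rep_hom S V W"
  shows "f \<in> linear_maps V W"
    "g \<in> S \<Longrightarrow> v \<in> carrier V \<Longrightarrow> f (act V g v) = act W g (f v)"
  using assms by (auto simp: rep_hom_def)

locale grep_hom = V: grep S V + W: grep S W
  for S :: "('a::field^2^2) set" and V :: "('k::field, 'v, 'a^2^2) rep"
    and W :: "('k, 'w, 'a^2^2) rep" +
  fixes f :: "'v \<Rightarrow> 'w"
  assumes hom: "f \<in> rep_hom S V W"

sublocale grep_hom \<subseteq> linear_map V W f
  using rep_homD(1)[OF hom] by unfold_locales

context grep_hom
begin

lemma equivariant: "g \<in> S \<Longrightarrow> v \<in> carrier V \<Longrightarrow> f (act V g v) = act W g (f v)"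
  by (rule rep_homD(2)[OF hom])

lemma subrep_image: "subrep S V N \<Longrightarrow> subrep S W (f ` N)"
proof -
  assume N: "subrep S V N"
  then have "N \<subseteq> carrier V" by (simp add: V.subrep_iff)
  with N show ?thesis
    using subspace_image[of N] unfolding subrep_def
    by (auto simp: equivariant[symmetric] subset_iff)
qed

lemma subrep_vimage: "subrep S W N \<Longrightarrow> subrep S V {x \<in> carrier V. f x \<in> N}"
  using subspace_vimage[of N] by (auto simp: subrep_def equivariant)

end

section \<open>Invertible matrices over a field\<close>

lemma carrier_GL2 [simp]: "g \<in> carrier GL2 \<longleftrightarrow> invertible g"
  and mult_GL2 [simp]: "g \<otimes>\<^bsub>GL2\<^esub> h = g ** h"
  and one_GL2 [simp]: "\<one>\<^bsub>GL2\<^esub> = mat 1"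
  by (simp_all add: GL2_def)

lemma matrix_inv_mult:
  assumes "invertible (g :: 'a::field^'n^'n)"
  shows "g ** matrix_inv g = mat 1" "matrix_inv g ** g = mat 1"
  using someI_ex[OF assms[unfolded invertible_def]] by (simp_all add: matrix_inv_def)

lemma matrix_inv_mult_cancel [simp]:
  assumes "invertible (g :: 'a::field^'n^'n)"
  shows "g ** (matrix_inv g ** h) = h" "matrix_inv g ** (g ** h) = h"
    "h ** g ** matrix_inv g = h" "h ** matrix_inv g ** g = h"
    "g ** matrix_inv g = mat 1" "matrix_inv g ** g = mat 1"
  by (simp_all add: matrix_mul_assoc matrix_inv_mult[OF assms])
    (simp_all add: matrix_inv_mult[OF assms] flip: matrix_mul_assoc)

lemma invertible_matrix_inv [simp]:
  "invertible (g :: 'a::field^'n^'n) \<Longrightarrow> invertible (matrix_inv g)"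
  using matrix_inv_mult[of g] unfolding invertible_def[of "matrix_inv g"] by blast

lemma matrix_inv_unique_right:
  assumes "(g :: 'a::field^'n^'n) ** h = mat 1"
  shows "matrix_inv g = h" "invertible g"
proof -
  show "invertible g"
    using assms matrix_left_right_inverse[of g h] by (auto simp: invertible_def)
  then show "matrix_inv g = h"
    by (metis assms matrix_inv_mult_cancel(2) matrix_mul_rid)
qed

lemma matrix_inv_matrix_inv [simp]:
  "invertible (g :: 'a::field^'n^'n) \<Longrightarrow> matrix_inv (matrix_inv g) = g"
  by (rule matrix_inv_unique_right(1)) (simp add: matrix_inv_mult)

lemma matrix_inv_mat_1 [simp]: "matrix_inv (mat 1 :: 'a::field^'n^'n) = mat 1"
  by (rule matrix_inv_unique_right(1)) simp

lemma matrix_inv_matrix_mult: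
  assumes "invertible (g :: 'a::field^'n^'n)" "invertible (h :: 'a^'n^'n)"
  shows "matrix_inv (g ** h) = matrix_inv h ** matrix_inv g"
  by (rule matrix_inv_unique_right(1)) (simp add: assms flip: matrix_mul_assoc)

lemma invertible_mat_1 [simp]: "invertible (mat 1 :: 'a::field^'n^'n)"
  by (rule matrix_inv_unique_right(2)[of _ "mat 1"]) simp

lemma invertible_mult_iff [simp]:
  assumes "invertible (g :: 'a::field^'n^'n)"
  shows "invertible (h ** g) \<longleftrightarrow> invertible h" "invertible (g ** h) \<longleftrightarrow> invertible h"
proof -
  show "invertible (h ** g) \<longleftrightarrow> invertible h"
    using invertible_mult[of "h ** g" "matrix_inv g"] invertible_mult[of h g] assms
    by auto
  show "invertible (g ** h) \<longleftrightarrow> invertible h"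
    using invertible_mult[of "matrix_inv g" "g ** h"] invertible_mult[of g h] assms
    by auto
qed

section \<open>Change of action, direct sums, quotients and compact induction\<close>

lemma with_act_simps [simp]:
  "carrier (with_act V a) = carrier V" "zero (with_act V a) = zero V"
  "add (with_act V a) = add V" "module.smult (with_act V a) = module.smult V"
  "act (with_act V a) = a"
  by (simp_all add: with_act_def module.defs rep.defs)

text \<open>It is applied to \<open>reduction F\<close> on \<open>max_compact F\<close> and to
  \<open>K_part F\<close> on \<open>ZK F\<close>, so multiplicativity of \<open>\<phi>\<close> is
  asked for on the acting set \<open>T\<close> alone.\<close>

lemma representation_with_act:
  fixes V :: "('k::field, 'v, 'a::field^2^2) rep" and \<phi> :: "'b::field^2^2 \<Rightarrow> 'a^2^2"
  assumes "representation S V" "\<phi> \<in> T \<rightarrow> S" "\<phi> (mat 1) = mat 1"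
    and "\<And>g h. g \<in> T \<Longrightarrow> h \<in> T \<Longrightarrow> \<phi> (g ** h) = \<phi> g ** \<phi> h"
  shows "representation T (with_act V (\<lambda>g. act V (\<phi> g)))"
proof -
  interpret grep S V using assms(1) by unfold_locales
  have "kspace (with_act V (\<lambda>g. act V (\<phi> g)))"
    by (rule kspaceI) (auto simp: add.m_assoc smult_add_left smult_add smult_mult
        intro: add.m_comm)
  from kspace.module_V[OF this] show ?thesis
    using assms(2-4) act_linear
    by (auto simp: representation_def linear_maps_def act_add act_smult act_mult Pi_iff)
qed

lemma dsum_rep_simps [simp]:
  "carrier (dsum_rep V W) = carrier V \<times> carrier W"
  "\<zero>\<^bsub>dsum_rep V W\<^esub> = (\<zero>\<^bsub>V\<^esub>, \<zero>\<^bsub>W\<^esub>)"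
  "x \<oplus>\<^bsub>dsum_rep V W\<^esub> y = (fst x \<oplus>\<^bsub>V\<^esub> fst y, snd x \<oplus>\<^bsub>W\<^esub> snd y)"
  "c \<odot>\<^bsub>dsum_rep V W\<^esub> x = (c \<odot>\<^bsub>V\<^esub> fst x, c \<odot>\<^bsub>W\<^esub> snd x)"
  "act (dsum_rep V W) g x = (act V g (fst x), act W g (snd x))"
  by (simp_all add: dsum_rep_def split: prod.splits)

lemma representation_dsum:
  assumes "representation S V" "representation S W"
  shows "representation S (dsum_rep V W)"
proof -
  interpret V: grep S V using assms(1) by unfold_locales
  interpret W: grep S W using assms(2) by unfold_locales
  have "kspace (dsum_rep V W)"
    by (rule kspaceI) (auto simp: V.add.m_assoc V.smult_add_left V.smult_add V.smult_mult
        W.add.m_assoc W.smult_add_left W.smult_add W.smult_mult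
        intro: V.add.m_comm W.add.m_comm)
  from kspace.module_V[OF this] show ?thesis
    by (auto simp: representation_def linear_maps_def V.act_add V.act_smult V.act_mult
        W.act_add W.act_smult W.act_mult)
qed

lemma (in kspace) diff_zero [simp]: "x \<in> carrier V \<Longrightarrow> x \<ominus> \<zero> = x"
  and diff_self [simp]: "x \<in> carrier V \<Longrightarrow> x \<ominus> x = \<zero>"
  by (simp_all add: minus_eq r_neg)

lemma (in kspace) abelian_subgroup_of_subspace: "lin_subspace V N \<Longrightarrow> abelian_subgroup N V"
  by (rule abelian_subgroupI3)
    (auto simp: lin_subspace_def submodule_def additive_subgroup_def abelian_group_axioms)

lemma (in kspace) coset_eq_iff:
  assumes "lin_subspace V N" "x \<in> carrier V" "y \<in> carrier V"
  shows "N +> x = N +> y \<longleftrightarrow> x \<ominus> y \<in> N"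
proof -
  interpret abelian_subgroup N V
    using assms(1) by (rule abelian_subgroup_of_subspace)
  show ?thesis
    using assms(2,3) a_rcos_module[of y x] a_rcos_self[of x] a_repr_independence'[of x y]
    by (auto simp: minus_eq)
qed

lemma (in kspace) mem_coset_iff:
  assumes "lin_subspace V N" "x \<in> carrier V"
  shows "y \<in> N +> x \<longleftrightarrow> y \<in> carrier V \<and> y \<ominus> x \<in> N"
proof -
  interpret abelian_subgroup N V
    using assms(1) by (rule abelian_subgroup_of_subspace)
  show ?thesis
    using assms(2) a_rcos_module[of x y] a_elemrcos_carrier[of x y]
    by (auto simp: minus_eq)
qed

text \<open>\<open>quot_rep\<close> and \<open>H0_map\<close> describe their values as unions over
  all representatives of a coset. Since \<open>f\<close> maps \<open>N\<close> into
  \<open>N'\<close>, all representatives give the same coset, and the union collapses to it.\<close>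

lemma (in linear_map) coset_image:
  assumes "lin_subspace V N" "lin_subspace W N'" "f ` N \<subseteq> N'" "x \<in> carrier V"
  shows "(\<Union>v\<in>N +>\<^bsub>V\<^esub> x. N' +>\<^bsub>W\<^esub> f v) = N' +>\<^bsub>W\<^esub> f x"
proof -
  have "N' +>\<^bsub>W\<^esub> f v = N' +>\<^bsub>W\<^esub> f x" if "v \<in> N +>\<^bsub>V\<^esub> x" for v
    using that assms
    by (subst W.coset_eq_iff) (auto simp: V.mem_coset_iff image_subset_iff simp flip: minus)
  moreover have "x \<in> N +>\<^bsub>V\<^esub> x"
    using assms V.lin_subspaceD(2)[OF assms(1)] by (simp add: V.mem_coset_iff)
  ultimately show ?thesis
    by blast
qed

lemma (in kspace) smult_linear_map: "linear_map V V (\<lambda>x. c \<odot> x)"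
proof (intro linear_map.intro linear_map_axioms.intro kspace_axioms)
  have "c \<odot> (d \<odot> x) = d \<odot> (c \<odot> x)" if "x \<in> carrier V" for d x
    using that by (metis mult.commute smult_mult)
  then show "(\<odot>) c \<in> linear_maps V V"
    by (auto simp: linear_maps_def smult_add)
qed

locale quotient_space = kspace V for V :: "('k::field, 'v, 'g) rep" (structure) +
  fixes N :: "'v set"
  assumes N: "lin_subspace V N"
begin

abbreviation Q where "Q \<equiv> quot_rep V N"
abbreviation proj where "proj x \<equiv> N +> x"

lemma Q_carrier: "carrier Q = proj ` carrier V"
  by (auto simp: quot_rep_def A_RCOSETS_def')

lemma Q_zero: "\<zero>\<^bsub>Q\<^esub> = proj \<zero>"
  using N by (simp add: quot_rep_def lin_subspace_iff)

lemma Q_add: "x \<in> carrier V \<Longrightarrow> y \<in> carrier V \<Longrightarrow> proj x \<oplus>\<^bsub>Q\<^esub> proj y = proj (x \<oplus> y)"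
  using abelian_subgroup.a_rcos_sum[OF abelian_subgroup_of_subspace[OF N]]
  by (simp add: quot_rep_def)

lemma Q_smult: "x \<in> carrier V \<Longrightarrow> c \<odot>\<^bsub>Q\<^esub> proj x = proj (c \<odot> x)"
  using linear_map.coset_image[OF smult_linear_map N N, of c x] N
  by (simp add: quot_rep_def lin_subspace_iff image_subset_iff)

lemma proj_eq_iff: "x \<in> carrier V \<Longrightarrow> y \<in> carrier V \<Longrightarrow> proj x = proj y \<longleftrightarrow> x \<ominus> y \<in> N"
  by (rule coset_eq_iff[OF N])

lemma proj_eq_zero_iff: "x \<in> carrier V \<Longrightarrow> proj x = \<zero>\<^bsub>Q\<^esub> \<longleftrightarrow> x \<in> N"
  by (subst Q_zero, subst proj_eq_iff) auto

lemma kspace_Q: "kspace Q"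
proof (rule kspaceI, goal_cases)
  case (3 x y z)
  then show ?case
    by (auto simp: Q_carrier Q_add add.m_assoc)
next
  case (4 x y)
  then show ?case
    by (auto simp: Q_carrier Q_add add.m_comm)
qed (auto simp: Q_carrier Q_add Q_zero Q_smult smult_add_left smult_add smult_mult)

lemma proj_linear_map: "linear_map V Q proj"
  by (intro linear_map.intro linear_map_axioms.intro kspace_Q kspace_axioms)
    (auto simp: linear_maps_def Q_carrier Q_add Q_smult)

end

locale quotient_rep = grep S V for S and V :: "('k::field, 'v, 'a::field^2^2) rep" (structure) +
  fixes N :: "'v set"
  assumes subrep_N: "subrep S V N"

sublocale quotient_rep \<subseteq> quotient_space V N
  using subrep_N by unfold_locales (simp add: subrep_def)

context quotient_rep
begin

lemma Q_act: "g \<in> S \<Longrightarrow> x \<in> carrier V \<Longrightarrow> act Q g (proj x) = proj (act V g x)"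
  using linear_map.coset_image[OF act_linear_map N N, of g x] subrep_N
  by (auto simp: quot_rep_def subrep_def image_subset_iff)

lemma representation_Q:
  assumes "\<And>g h. g \<in> S \<Longrightarrow> h \<in> S \<Longrightarrow> g ** h \<in> S" "mat 1 \<in> S"
  shows "representation S Q"
  using kspace.module_V[OF kspace_Q] assms
  by (auto simp: representation_def linear_maps_def Q_carrier Q_add Q_smult Q_act
      act_add act_smult act_mult)

end

lemma c_ind_simps [simp]:
  "\<zero>\<^bsub>c_ind S V\<^esub> = (\<lambda>_. \<zero>\<^bsub>V\<^esub>)"
  "f \<oplus>\<^bsub>c_ind S V\<^esub> h = (\<lambda>x. f x \<oplus>\<^bsub>V\<^esub> h x)"
  "c \<odot>\<^bsub>c_ind S V\<^esub> f = (\<lambda>x. c \<odot>\<^bsub>V\<^esub> f x)"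
  "act (c_ind S V) g f = (\<lambda>x. f (x ** g))"
  by (simp_all add: c_ind_def)

lemma mem_c_ind_iff:
  "f \<in> carrier (c_ind S V) \<longleftrightarrow> (\<forall>x. \<not> invertible x \<longrightarrow> f x = \<zero>\<^bsub>V\<^esub>) \<and>
     (\<forall>x. invertible x \<longrightarrow> f x \<in> carrier V) \<and>
     (\<forall>k\<in>S. \<forall>x. invertible x \<longrightarrow> f (k ** x) = act V k (f x)) \<and>
     finite {S #>\<^bsub>GL2\<^esub> x | x. invertible x \<and> f x \<noteq> \<zero>\<^bsub>V\<^esub>}"
  by (simp add: c_ind_def Ball_def)

lemma mem_c_indD:
  assumes "f \<in> carrier (c_ind S V)"
  shows "\<not> invertible x \<Longrightarrow> f x = \<zero>\<^bsub>V\<^esub>"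
    and "invertible x \<Longrightarrow> f x \<in> carrier V"
    and "k \<in> S \<Longrightarrow> invertible x \<Longrightarrow> f (k ** x) = act V k (f x)"
  using assms by (auto simp: mem_c_ind_iff)

text \<open>The point that takes an argument is finiteness of the support modulo \<open>S\<close>:
  the cosets that carry the translate are those that carry \<open>f\<close>, multiplied on the right
  by the inverse of \<open>g\<close>.\<close>

lemma c_ind_translate:
  assumes g: "invertible g" and f: "f \<in> carrier (c_ind S V)"
  shows "(\<lambda>x. f (x ** g)) \<in> carrier (c_ind S V)"
proof -
  have "{S #>\<^bsub>GL2\<^esub> x | x. invertible x \<and> f (x ** g) \<noteq> \<zero>\<^bsub>V\<^esub>} \<subseteq>
    (\<lambda>C. (\<lambda>y. y ** matrix_inv g) ` C) ` {S #>\<^bsub>GL2\<^esub> x | x. invertible x \<and> f x \<noteq> \<zero>\<^bsub>V\<^esub>}"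
  proof clarify
    fix x assume x: "invertible x" "f (x ** g) \<noteq> \<zero>\<^bsub>V\<^esub>"
    have "S #>\<^bsub>GL2\<^esub> x = (\<lambda>y. y ** matrix_inv g) ` (S #>\<^bsub>GL2\<^esub> (x ** g))"
      using g by (auto simp: r_coset_def matrix_mul_assoc image_iff)
    with x g show "S #>\<^bsub>GL2\<^esub> x \<in> (\<lambda>C. (\<lambda>y. y ** matrix_inv g) ` C) `
        {S #>\<^bsub>GL2\<^esub> x | x. invertible x \<and> f x \<noteq> \<zero>\<^bsub>V\<^esub>}"
      by (intro image_eqI[where x = "S #>\<^bsub>GL2\<^esub> (x ** g)"]) auto
  qed
  then have "finite {S #>\<^bsub>GL2\<^esub> x | x. invertible x \<and> f (x ** g) \<noteq> \<zero>\<^bsub>V\<^esub>}"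
    by (rule finite_subset) (use f in \<open>simp add: mem_c_ind_iff\<close>)
  with f g show ?thesis
    by (simp add: mem_c_ind_iff flip: matrix_mul_assoc)
qed

lemma (in grep) c_ind_val_closed: "f \<in> carrier (c_ind S V) \<Longrightarrow> f x \<in> carrier V"
  by (cases "invertible x") (auto dest: mem_c_indD)

lemma (in grep) kspace_c_ind: "kspace (c_ind S V)"
proof (rule kspaceI, goal_cases)
  case (2 f h)
  have "finite {S #>\<^bsub>GL2\<^esub> x | x. invertible x \<and> f x \<oplus> h x \<noteq> \<zero>}"
    by (rule finite_subset[where B = "{S #>\<^bsub>GL2\<^esub> x | x. invertible x \<and> f x \<noteq> \<zero>} \<union>
        {S #>\<^bsub>GL2\<^esub> x | x. invertible x \<and> h x \<noteq> \<zero>}"])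
      (use 2 in \<open>auto simp: mem_c_ind_iff\<close>)
  with 2 show ?case
    by (simp add: mem_c_ind_iff act_add)
next
  case (6 c f)
  have "finite {S #>\<^bsub>GL2\<^esub> x | x. invertible x \<and> c \<odot> f x \<noteq> \<zero>}"
    by (rule finite_subset[where B = "{S #>\<^bsub>GL2\<^esub> x | x. invertible x \<and> f x \<noteq> \<zero>}"])
      (use 6 in \<open>auto simp: mem_c_ind_iff\<close>)
  with 6 show ?case
    by (simp add: mem_c_ind_iff act_smult)
next
  case 1
  then show ?case
    by (simp add: mem_c_ind_iff)
next
  case (4 f h)
  then show ?case
    by (simp add: fun_eq_iff c_ind_val_closed add.m_comm)
qed (simp_all add: fun_eq_iff c_ind_val_closed add.m_assoc smult_add_left smult_add smult_mult)

lemma (in grep) representation_c_ind: "representation (carrier GL2) (c_ind S V)"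
  unfolding representation_def
proof (intro conjI ballI)
  fix g :: "'a^2^2" assume "g \<in> carrier GL2"
  then show "act (c_ind S V) g \<in> linear_maps (c_ind S V) (c_ind S V)"
    using c_ind_translate[of g _ S V] by (auto simp: linear_maps_def)
qed (simp_all add: kspace.module_V[OF kspace_c_ind] matrix_mul_assoc)

subsection \<open>Unipotent groups in the defining characteristic\<close>

no_notation fps_nth (infixl \<open>$\<close> 75)

lemma mat2_nth [simp]:
  "(mat2 a b c d)$1$1 = a" "(mat2 a b c d)$1$2 = b"
  "(mat2 a b c d)$2$1 = c" "(mat2 a b c d)$2$2 = d"
  by (simp_all add: mat2_def)

lemma matrix_eq_2: "g = h \<longleftrightarrow> g$1$1 = h$1$1 \<and> g$1$2 = h$1$2 \<and> g$2$1 = h$2$1 \<and> g$2$2 = h$2$2"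
  for g h :: "'a^2^2"
  unfolding vec_eq_iff forall_2 by blast

lemma matrix_mult_2 [simp]:
  "((g :: 'a::semiring_1^2^2) ** h) $ i $ j = g$i$1 * h$1$j + g$i$2 * h$2$j"
  by (simp add: matrix_matrix_mult_def sum_2)

lemma mat_nth_2 [simp]:
  "(mat c :: 'a::zero^2^2) $ 1 $ 1 = c" "(mat c :: 'a^2^2) $ 1 $ 2 = 0"
  "(mat c :: 'a^2^2) $ 2 $ 1 = 0" "(mat c :: 'a^2^2) $ 2 $ 2 = c"
  by (simp_all add: mat_def)

lemma smat_nth [simp]:
  "(smat :: 'a::field^2^2) $ 1 $ 1 = 0" "(smat :: 'a^2^2) $ 1 $ 2 = 1"
  "(smat :: 'a^2^2) $ 2 $ 1 = 1" "(smat :: 'a^2^2) $ 2 $ 2 = 0"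
  by (simp_all add: smat_def)

lemma invertible_2: "invertible (g :: 'a::field^2^2) \<longleftrightarrow> g$1$1 * g$2$2 - g$1$2 * g$2$1 \<noteq> 0"
  by (simp add: invertible_det_nz det_2)

lemma smat_smat [simp]: "smat ** smat = mat 1" "smat ** (smat ** g) = g" for g :: "'a::field^2^2"
  by (simp_all add: matrix_eq_2)

lemma matrix_inv_smat [simp]: "matrix_inv smat = smat"
  by (rule matrix_inv_unique_right(1)) simp

definition up :: "'a::field \<Rightarrow> 'a^2^2" where "up t = mat2 1 t 0 1"
definition lo :: "'a::field \<Rightarrow> 'a^2^2" where "lo t = mat2 1 0 t 1"
definition diag2 :: "'a::field \<Rightarrow> 'a \<Rightarrow> 'a^2^2" where "diag2 a d = mat2 a 0 0 d"

lemma up_nth [simp]: "(up t)$1$1 = 1" "(up t)$1$2 = t" "(up t)$2$1 = 0" "(up t)$2$2 = 1"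
  and lo_nth [simp]: "(lo t)$1$1 = 1" "(lo t)$1$2 = 0" "(lo t)$2$1 = t" "(lo t)$2$2 = 1"
  and diag2_nth [simp]: "(diag2 a d)$1$1 = a" "(diag2 a d)$1$2 = 0"
    "(diag2 a d)$2$1 = 0" "(diag2 a d)$2$2 = d"
  by (simp_all add: up_def lo_def diag2_def)

lemma up_add: "up (s + t) = up s ** up t" and lo_add: "lo (s + t) = lo s ** lo t"
  and up_zero [simp]: "up 0 = mat 1" and lo_zero [simp]: "lo 0 = mat 1"
  by (simp_all add: matrix_eq_2)

lemma invertible_up [simp]: "invertible (up t)" and invertible_lo [simp]: "invertible (lo t)"
  and invertible_smat [simp]: "invertible smat"
  and invertible_diag2 [simp]: "invertible (diag2 a d) \<longleftrightarrow> a \<noteq> 0 \<and> d \<noteq> 0"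
  by (simp_all add: invertible_2)

lemma mem_unip2_iff: "u \<in> unip2 \<longleftrightarrow> (\<exists>t. u = up t)"
  by (auto simp: unip2_def matrix_eq_2)

lemma up_mem_unip2 [simp]: "up t \<in> unip2"
  by (auto simp: mem_unip2_iff)

lemma mem_borel2_iff: "b \<in> borel2 \<longleftrightarrow> b$2$1 = 0 \<and> b$1$1 \<noteq> 0 \<and> b$2$2 \<noteq> 0"
  by (auto simp: borel2_def invertible_2)

lemma mem_torus2_iff: "h \<in> torus2 \<longleftrightarrow> (\<exists>a d. a \<noteq> 0 \<and> d \<noteq> 0 \<and> h = diag2 a d)"
  by (auto simp: torus2_def invertible_2 matrix_eq_2)

lemma (in kspace) add_minus_one_smult: "y \<in> carrier V \<Longrightarrow> x \<oplus> (-1) \<odot> y = x \<ominus> y"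
  by (simp add: minus_eq minus_eq_smult)

lemma (in kspace) subspace_cases_zero:
  "lin_subspace V N \<Longrightarrow> N \<noteq> {\<zero>} \<Longrightarrow> \<exists>v\<in>N. v \<noteq> \<zero>"
  using lin_subspaceD(2) by blast

text \<open>The value at \<open>x\<close> of the polynomial \<open>P\<close> in the operator
  \<open>A\<close>, by Horner's rule. It transports identities of the commutative ring
  \<open>'k poly\<close> to operators that are linear on a carrier set only.\<close>

definition poly_act ::
  "('k::field, 'v, 'm) module_scheme \<Rightarrow> ('v \<Rightarrow> 'v) \<Rightarrow> 'v \<Rightarrow> 'k poly \<Rightarrow> 'v" where
  "poly_act V A x P = fold_coeffs (\<lambda>a y. a \<odot>\<^bsub>V\<^esub> x \<oplus>\<^bsub>V\<^esub> A y) P \<zero>\<^bsub>V\<^esub>"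

locale endo = linear_map V V A
  for V :: "('k::field, 'v, 'm) module_scheme" (structure) and A :: "'v \<Rightarrow> 'v"
begin

lemma poly_act_0 [simp]: "poly_act V A x 0 = \<zero>"
  by (simp add: poly_act_def)

lemma poly_act_pCons [simp]:
  "x \<in> carrier V \<Longrightarrow> poly_act V A x (pCons a P) = a \<odot> x \<oplus> A (poly_act V A x P)"
  \<comment> \<open>\<open>pCons 0 0\<close> is the zero polynomial, on which
    \<open>fold_coeffs\<close> makes no step; there the right-hand side vanishes because
    \<open>A\<close> fixes zero.\<close>
  by (cases "a = 0 \<and> P = 0") (auto simp: poly_act_def)

lemma poly_act_closed [simp]: "x \<in> carrier V \<Longrightarrow> poly_act V A x P \<in> carrier V"
  by (induction P) auto

lemma poly_act_add: "x \<in> carrier V \<Longrightarrow> poly_act V A x (P + Q) = poly_act V A x P \<oplus> poly_act V A x Q"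
  by (induction P Q rule: poly_induct2) (auto simp: V.smult_add_left add V.add.m_ac)

lemma poly_act_smult: "x \<in> carrier V \<Longrightarrow> poly_act V A x (Polynomial.smult c P) = c \<odot> poly_act V A x P"
  by (induction P) (auto simp: V.smult_mult V.smult_add smult)

abbreviation diff where "diff x \<equiv> A x \<ominus> x"

lemma diff_linear_map: "linear_map V V diff"
  by (intro linear_map.intro linear_map_axioms.intro V.kspace_axioms)
    (auto simp: linear_maps_def add smult V.minus_eq V.minus_add V.add.m_ac V.smult_add V.smult_a_inv)

lemma diff_pow_closed [simp]: "x \<in> carrier V \<Longrightarrow> (diff ^^ n) x \<in> carrier V"
  by (induction n) auto

lemma poly_act_diff_pow: "x \<in> carrier V \<Longrightarrow> poly_act V A x ([:-1, 1:] ^ n) = (diff ^^ n) x"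
proof (induction n)
  case 0
  then show ?case
    by (simp add: one_pCons)
next
  case (Suc n)
  let ?P = "[:-1, 1:] ^ n :: 'k poly"
  have "[:-1, 1:] ^ Suc n = pCons 0 ?P + Polynomial.smult (-1) ?P"
    by simp
  then have "poly_act V A x ([:-1, 1:] ^ Suc n) = A (poly_act V A x ?P) \<oplus> (-1) \<odot> poly_act V A x ?P"
    using Suc.prems by (simp only: poly_act_add poly_act_smult poly_act_pCons) simp
  with Suc show ?case
    by (simp add: V.add_minus_one_smult)
qed

lemma poly_act_monom: "x \<in> carrier V \<Longrightarrow> poly_act V A x (monom 1 n) = (A ^^ n) x"
proof (induction n)
  case (Suc n)
  then show ?case
    using poly_act_closed[of x "monom 1 n"] by (simp add: monom_Suc)
qed (simp add: monom_0)

text \<open>In \<open>'k poly\<close> the p-th power map is additive; applied to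
  \<open>X = (X - 1) + 1\<close> it gives \<open>(X - 1)^p = X^p - 1\<close>. Starting from this sum
  avoids any discussion of the sign of \<open>(-1)^p\<close>.\<close>

lemma diff_pow_CHAR:
  assumes p: "prime CHAR('k)" and A: "(A ^^ CHAR('k)) x = x" and x: "x \<in> carrier V"
  shows "(diff ^^ CHAR('k)) x = \<zero>"
proof -
  have "([:-1, 1:] + 1 :: 'k poly) ^ CHAR('k) = [:-1, 1:] ^ CHAR('k) + 1 ^ CHAR('k)"
    by (rule freshmans_dream) (use p in simp_all)
  moreover have "[:-1, 1:] + 1 = (monom 1 1 :: 'k poly)"
    by (simp add: one_pCons monom_Suc monom_0)
  ultimately have "[:-1, 1:] ^ CHAR('k) = monom 1 CHAR('k) + Polynomial.smult (-1) (1 :: 'k poly)"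
    by (simp add: monom_power) (simp add: one_pCons)
  then have "(diff ^^ CHAR('k)) x = poly_act V A x (monom 1 CHAR('k)) \<oplus> (-1) \<odot> poly_act V A x 1"
    using x by (simp only: poly_act_diff_pow[symmetric] poly_act_add poly_act_smult)
  then show ?thesis
    using x A by (simp add: poly_act_monom one_pCons V.add_minus_one_smult)
qed

end

text \<open>Upper and lower unipotent matrices are treated at once, as two homomorphisms from the
  additive group of \<open>'q\<close>. As the scalars have the characteristic p of
  \<open>'q\<close>, the p-th power of every \<open>u t\<close> acts trivially and every
  \<open>D t\<close> is nilpotent.\<close>

locale additive_rep = grep S V for S and V :: "('k::field, 'v, 'a::field^2^2) rep" (structure) +
  fixes u :: "'q::finite_field \<Rightarrow> 'a^2^2"
  assumes u_mem [simp, intro]: "u t \<in> S" and u_add: "u (s + t) = u s ** u t" and u_zero [simp]: "u 0 = mat 1"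
    and CHAR_k: "CHAR('k) = CHAR('q)"
begin

abbreviation D where "D t x \<equiv> act V (u t) x \<ominus> x"

sublocale U: endo V "act V (u t)" for t
  by (intro endo.intro act_linear_map u_mem)

lemma u_commute: "x \<in> carrier V \<Longrightarrow> act V (u s) (act V (u t) x) = act V (u t) (act V (u s) x)"
  by (metis act_mult add.commute u_add u_mem)

lemma u_power: "x \<in> carrier V \<Longrightarrow> (act V (u t) ^^ n) x = act V (u (of_nat n * t)) x"
  by (induction n) (auto simp: u_add algebra_simps simp flip: act_mult)

lemma D_pow_CHAR: "x \<in> carrier V \<Longrightarrow> (D t ^^ CHAR('k)) x = \<zero>"
  by (rule U.diff_pow_CHAR) (auto simp: u_power CHAR_k)

lemma D_pow_commute: "x \<in> carrier V \<Longrightarrow> act V (u s) ((D t ^^ n) x) = (D t ^^ n) (act V (u s) x)"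
proof (induction n)
  case (Suc n)
  then show ?case
    using U.diff_pow_closed[of x n t] by (simp add: act_minus u_commute[of _ s t])
qed simp

text \<open>A p-group acting in characteristic p fixes a non-zero vector, also in infinite
  dimension. The parameters are added one at a time: the last non-zero iterate of \<open>D t\<close>
  on a vector fixed by \<open>T\<close> is killed by \<open>D t\<close>, and it is still fixed by
  \<open>T\<close> because the group is commutative.\<close>

lemma fixed_vector:
  assumes N: "lin_subspace V N" "N \<noteq> {\<zero>}" and stable: "\<And>t x. x \<in> N \<Longrightarrow> act V (u t) x \<in> N"
  shows "\<exists>v\<in>N. v \<noteq> \<zero> \<and> (\<forall>t. act V (u t) v = v)"
proof -
  have "\<exists>v\<in>N. v \<noteq> \<zero> \<and> (\<forall>t\<in>T. act V (u t) v = v)" for T :: "'q set"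
  proof (induction T rule: finite_induct[OF finite])
    case 1
    then show ?case
      using subspace_cases_zero[OF N] by blast
  next
    case (2 t T)
    then obtain v where v: "v \<in> N" "v \<noteq> \<zero>" "\<And>s. s \<in> T \<Longrightarrow> act V (u s) v = v"
      by blast
    note carr = lin_subspaceD(1)[OF N(1)]
    define j where "j = (LEAST j. (D t ^^ j) v = \<zero>)"
    have j: "(D t ^^ j) v = \<zero>"
      unfolding j_def by (rule LeastI[of _ "CHAR('k)"]) (use D_pow_CHAR carr v(1) in blast)
    with v(2) have "j \<noteq> 0"
      by (cases j) auto
    define w where "w = (D t ^^ (j - 1)) v"
    have "w \<noteq> \<zero>"
      using not_less_Least[of "j - 1" "\<lambda>j. (D t ^^ j) v = \<zero>"] \<open>j \<noteq> 0\<close> by (auto simp: w_def j_def)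
    moreover have "(D t ^^ i) v \<in> N" for i
      by (induction i) (auto simp: v(1) stable intro: lin_subspaceD(6)[OF N(1)])
    then have "w \<in> N"
      by (simp add: w_def)
    moreover have "D t w = \<zero>"
      using j \<open>j \<noteq> 0\<close> by (cases j) (auto simp: w_def)
    then have "act V (u t) w = w"
      using carr[OF \<open>w \<in> N\<close>] by simp
    moreover have "act V (u s) w = w" if "s \<in> T" for s
      using v that carr by (simp add: w_def D_pow_commute)
    ultimately show ?case
      by blast
  qed
  from this[of UNIV] show ?thesis
    by simp
qed

text \<open>The quotient by this subspace is the space of coinvariants of the subgroup generated by
  the \<open>u t\<close> with \<open>t\<close> in \<open>T\<close>.\<close>

definition aug :: "'q set \<Rightarrow> 'v set" where
  "aug T = lin_span V {D t x | t x. t \<in> T \<and> x \<in> carrier V}"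

lemma aug_subspace: "lin_subspace V (aug T)"
  unfolding aug_def by (rule lin_subspace_span) auto

lemma D_mem_aug: "t \<in> T \<Longrightarrow> x \<in> carrier V \<Longrightarrow> D t x \<in> aug T"
  unfolding aug_def by (rule lin_span_mono[THEN subsetD]) blast

lemma aug_stable:
  assumes "x \<in> aug T"
  shows "act V (u s) x \<in> aug T"
proof -
  let ?N = "{x \<in> carrier V. act V (u s) x \<in> aug T}"
  have "act V (u s) (D t x) = D t (act V (u s) x)" if "x \<in> carrier V" for t x
    using D_pow_commute[of x s 1 t] that by simp
  then have "{D t x | t x. t \<in> T \<and> x \<in> carrier V} \<subseteq> ?N"
    by (auto simp: D_mem_aug)
  then have "aug T \<subseteq> ?N"
    using linear_map.subspace_vimage[OF act_linear_map[OF u_mem] aug_subspace]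
    unfolding aug_def by (intro lin_span_least) auto
  with assms show ?thesis
    by blast
qed

text \<open>The dual of \<open>fixed_vector\<close>: a non-zero representation has non-zero
  coinvariants. If \<open>V = D t V + aug T\<close>, then substituting this equation into itself
  gives \<open>V = (D t)^n V + aug T\<close> for all \<open>n\<close>, and nilpotency of
  \<open>D t\<close> leaves \<open>V = aug T\<close>, to which the induction hypothesis
  applies.\<close>

lemma aug_proper:
  assumes "aug T = carrier V"
  shows "carrier V = {\<zero>}"
  using finite[of T] assms
proof (induction T rule: finite_induct)
  case empty
  have "aug {} \<subseteq> {\<zero>}"
    unfolding aug_def by (rule lin_span_least) (auto simp: lin_subspace_zero)
  with empty show ?case
    by auto
next
  case (insert t T)
  note Y = aug_subspace[of T]
  note carr = lin_subspaceD(1)[OF Y]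
  \<comment> \<open>The image of \<open>D t\<close> plus \<open>aug T\<close>; it contains all
    generators of \<open>aug (insert t T)\<close>, so by assumption it is the whole space.\<close>
  let ?Z = "{D t x \<oplus> y | x y. x \<in> carrier V \<and> y \<in> aug T}"
  have "lin_subspace V ?Z"
    unfolding lin_subspace_iff
  proof (intro conjI ballI allI)
    show "\<zero> \<in> ?Z"
    proof -
      have "\<zero> = D t \<zero> \<oplus> \<zero>"
        by simp
      then show ?thesis
        using lin_subspaceD(2)[OF Y] by blast
    qed
    show "?Z \<subseteq> carrier V"
      using carr by auto
  next
    fix z z' assume "z \<in> ?Z" "z' \<in> ?Z"
    then obtain x y x' y' where *: "z = D t x \<oplus> y" "z' = D t x' \<oplus> y'" "x \<in> carrier V"
      "x' \<in> carrier V" "y \<in> aug T" "y' \<in> aug T"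
      by blast
    then have "z \<oplus> z' = D t (x \<oplus> x') \<oplus> (y \<oplus> y')"
      using carr by (simp add: act_add minus_eq minus_add add.m_ac)
    then show "z \<oplus> z' \<in> ?Z"
      using * lin_subspaceD(3)[OF Y] by blast
  next
    fix c z assume "z \<in> ?Z"
    then obtain x y where *: "z = D t x \<oplus> y" "x \<in> carrier V" "y \<in> aug T"
      by blast
    then have "c \<odot> z = D t (c \<odot> x) \<oplus> (c \<odot> y)"
      using carr by (simp add: act_smult minus_eq smult_add smult_a_inv)
    then show "c \<odot> z \<in> ?Z"
      using * lin_subspaceD(4)[OF Y] by blast
  qed
  moreover have "D s x \<in> ?Z" if "s \<in> insert t T" "x \<in> carrier V" for s x
  proof (cases "s = t")
    case True
    then have "D s x = D t x \<oplus> \<zero>"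
      using that by simp
    then show ?thesis
      using that lin_subspaceD(2)[OF Y] by blast
  next
    case False
    then have "D s x \<in> aug T"
      using that by (auto intro: D_mem_aug)
    moreover have "D s x = D t \<zero> \<oplus> D s x"
      using that by simp
    ultimately show ?thesis
      by blast
  qed
  ultimately have "aug (insert t T) \<subseteq> ?Z"
    unfolding aug_def[of "insert t T"] by (intro lin_span_least) blast+
  with insert.prems have Z: "\<exists>x\<in>carrier V. \<exists>y\<in>aug T. z = D t x \<oplus> y" if "z \<in> carrier V" for z
    using that by blast
  have DY: "(D t ^^ n) y \<in> aug T" if "y \<in> aug T" for n y
    using that by (induction n) (auto simp: aug_stable intro: lin_subspaceD(6)[OF Y])
  have D_pow_add: "(D t ^^ n) (x \<oplus> y) = (D t ^^ n) x \<oplus> (D t ^^ n) y"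
    if "x \<in> carrier V" "y \<in> carrier V" for n x y
    using that by (induction n) (auto simp: linear_map.add[OF U.diff_linear_map])
  have "\<exists>x\<in>carrier V. \<exists>y\<in>aug T. z = (D t ^^ n) x \<oplus> y" if z: "z \<in> carrier V" for z n
  proof (induction n)
    case 0
    have "z = (D t ^^ 0) z \<oplus> \<zero>"
      using z by simp
    then show ?case
      using z lin_subspaceD(2)[OF Y] by blast
  next
    case (Suc n)
    then obtain x y where xy: "x \<in> carrier V" "y \<in> aug T" "z = (D t ^^ n) x \<oplus> y"
      by blast
    from Z[OF xy(1)] obtain x' y' where xy': "x' \<in> carrier V" "y' \<in> aug T" "x = D t x' \<oplus> y'"
      by blast
    then have "z = (D t ^^ Suc n) x' \<oplus> ((D t ^^ n) y' \<oplus> y)"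
      using xy carr[of y'] carr[of y] DY[of y' n] by (simp add: D_pow_add add.m_assoc funpow_Suc_right
          del: funpow.simps(2))
    moreover have "(D t ^^ n) y' \<oplus> y \<in> aug T"
      using xy xy' DY lin_subspaceD(3)[OF Y] by blast
    ultimately show ?case
      using xy' by blast
  qed
  from this[where n = "CHAR('k)"] have "carrier V \<subseteq> aug T"
    using D_pow_CHAR carr by fastforce
  then have "aug T = carrier V"
    using carr by blast
  with insert.IH show ?case
    by blast
qed

end

lemma (in grep) cyclic_subrep:
  assumes "v \<in> carrier V" "\<And>g h. g \<in> S \<Longrightarrow> h \<in> S \<Longrightarrow> g ** h \<in> S"
  shows "subrep S V (lin_span V {act V g v | g. g \<in> S})"
proof -
  let ?N = "lin_span V {act V g v | g. g \<in> S}"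
  have N: "lin_subspace V ?N"
    using assms(1) by (intro lin_subspace_span) auto
  have "act V g x \<in> ?N" if g: "g \<in> S" and x: "x \<in> ?N" for g x
  proof -
    have "{act V g v | g. g \<in> S} \<subseteq> {x \<in> carrier V. act V g x \<in> ?N}"
      using assms g by (auto simp flip: act_mult intro!: lin_span_mono[THEN subsetD])
    then have "?N \<subseteq> {x \<in> carrier V. act V g x \<in> ?N}"
      using linear_map.subspace_vimage[OF act_linear_map[OF g] N] by (intro lin_span_least)
    with x show ?thesis
      by blast
  qed
  with N show ?thesis
    by (simp add: subrep_def)
qed

lemma (in kspace) inverse_smult_smult [simp]:
  "c \<noteq> 0 \<Longrightarrow> x \<in> carrier V \<Longrightarrow> inverse c \<odot> (c \<odot> x) = x"
  by (simp flip: smult_mult)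

lemma (in kspace) smult_left_cancel:
  "c \<noteq> 0 \<Longrightarrow> x \<in> carrier V \<Longrightarrow> y \<in> carrier V \<Longrightarrow> c \<odot> x = c \<odot> y \<longleftrightarrow> x = y"
  by (metis inverse_smult_smult)

lemma borel2_invertible: "b \<in> borel2 \<Longrightarrow> invertible b"
  by (simp add: borel2_def)

text \<open>For \<open>t \<noteq> 0\<close> these elements lie in the product of the lower unipotent
  group and the Borel subgroup; the Borel factor is needed explicitly in
  \<open>smat_mem_lo_span\<close>.\<close>

lemma up_smat: "t \<noteq> 0 \<Longrightarrow> up t ** smat = lo (inverse t) ** mat2 t 1 0 (- inverse t)"
  for t :: "'a::field"
  by (simp add: matrix_eq_2)

text \<open>LU decomposition if the top left entry is non-zero; if it is zero, exchanging the rows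
  already gives an upper triangular matrix.\<close>

lemma bruhat_lower:
  fixes g :: "'a::field^2^2"
  assumes "invertible g"
  obtains b t where "b \<in> borel2" "g = lo t ** b" | b where "b \<in> borel2" "g = smat ** b"
proof (cases "g$1$1 = 0")
  case True
  then have "smat ** g \<in> borel2" "g = smat ** (smat ** g)"
    using assms by (simp_all add: mem_borel2_iff invertible_2)
  with that(2) show ?thesis
    by blast
next
  case False
  let ?b = "mat2 (g$1$1) (g$1$2) 0 (g$2$2 - g$1$2 * g$2$1 / g$1$1)"
  have "?b \<in> borel2"
    using False assms by (auto simp: mem_borel2_iff invertible_2 field_simps)
  moreover have "g = lo (g$2$1 / g$1$1) ** ?b"
    using False by (simp add: matrix_eq_2 field_simps)
  ultimately show ?thesis
    using that(1) by blast
qed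

subsection \<open>Irreducible representations with regular character\<close>

locale GL2_rep = grep "carrier GL2" \<rho>
  for \<rho> :: "('q::finite_field alg_closure, 'v, 'q^2^2) rep" (structure)

sublocale GL2_rep \<subseteq> upper: additive_rep "carrier GL2" \<rho> up
  by unfold_locales (simp_all add: up_add)

sublocale GL2_rep \<subseteq> lower: additive_rep "carrier GL2" \<rho> lo
  by unfold_locales (simp_all add: lo_add)

context GL2_rep
begin

lemma invariantsD:
  assumes "v \<in> invariants unip2 \<rho>"
  shows "v \<in> carrier \<rho>" "act \<rho> (up t) v = v"
  using assms by (auto simp: invariants_def)

lemma invariantsI: "v \<in> carrier \<rho> \<Longrightarrow> (\<And>t. act \<rho> (up t) v = v) \<Longrightarrow> v \<in> invariants unip2 \<rho>"
  by (auto simp: invariants_def mem_unip2_iff)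

lemma exists_invariant:
  assumes "subrep (carrier GL2) \<rho> N" "N \<noteq> {\<zero>}"
  shows "\<exists>v\<in>N. v \<noteq> \<zero> \<and> v \<in> invariants unip2 \<rho>"
proof -
  have "\<exists>v\<in>N. v \<noteq> \<zero> \<and> (\<forall>t. act \<rho> (up t) v = v)"
    using assms by (intro upper.fixed_vector) (auto simp: subrep_def)
  then show ?thesis
    using assms(1) invariantsI unfolding subrep_iff by blast
qed

definition orbit_span :: "'v \<Rightarrow> 'v set" where
  "orbit_span v = lin_span \<rho> {act \<rho> g v | g. g \<in> carrier GL2}"

lemma orbit_span_subrep: "v \<in> carrier \<rho> \<Longrightarrow> subrep (carrier GL2) \<rho> (orbit_span v)"
  unfolding orbit_span_def by (rule cyclic_subrep) (auto simp: invertible_mult)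

lemma mem_orbit_span: "v \<in> carrier \<rho> \<Longrightarrow> v \<in> orbit_span v"
  unfolding orbit_span_def
  by (rule lin_span_mono[THEN subsetD]) (auto intro!: exI[of _ "mat 1"])

text \<open>On \<open>U\<close>-invariants this is the Hecke operator of the double coset
  \<open>U s U\<close>.\<close>

definition weyl_sum :: "'v \<Rightarrow> 'v" where
  "weyl_sum m = (\<Oplus>\<^bsub>\<rho>\<^esub> t\<in>UNIV. act \<rho> (up t ** smat) m)"

lemma act_weyl_sum:
  assumes "m \<in> carrier \<rho>" "g \<in> carrier GL2"
  shows "act \<rho> g (weyl_sum m) = (\<Oplus>\<^bsub>\<rho>\<^esub> t\<in>UNIV. act \<rho> (g ** up t ** smat) m)"
proof -
  have "act \<rho> g (weyl_sum m) = (\<Oplus>\<^bsub>\<rho>\<^esub> t\<in>UNIV. act \<rho> g (act \<rho> (up t ** smat) m))"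
    unfolding weyl_sum_def using assms
    by (intro linear_map.finsum[OF act_linear_map]) auto
  also have "\<dots> = (\<Oplus>\<^bsub>\<rho>\<^esub> t\<in>UNIV. act \<rho> (g ** up t ** smat) m)"
    using assms by (intro finsum_cong') (auto simp flip: act_mult simp: matrix_mul_assoc)
  finally show ?thesis .
qed

lemma weyl_sum_closed: "m \<in> carrier \<rho> \<Longrightarrow> weyl_sum m \<in> carrier \<rho>"
  unfolding weyl_sum_def by (intro finsum_closed) auto

lemma weyl_sum_reindex:
  assumes m: "m \<in> carrier \<rho>" and h: "bij h"
  shows "(\<Oplus>\<^bsub>\<rho>\<^esub> t\<in>UNIV. act \<rho> (up (h t) ** smat) m) = weyl_sum m"
  using finsum_reindex[of "\<lambda>t. act \<rho> (up t ** smat) m" h UNIV] m h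
  by (auto simp: weyl_sum_def bij_def)

lemma weyl_sum_invariant:
  assumes "m \<in> carrier \<rho>"
  shows "weyl_sum m \<in> invariants unip2 \<rho>"
proof (rule invariantsI)
  fix r :: 'q
  have "bij (\<lambda>t. r + t)"
    by (intro bijI injI) (auto intro: surjI[of _ "\<lambda>t. t - r"])
  then show "act \<rho> (up r) (weyl_sum m) = weyl_sum m"
    using weyl_sum_reindex[of m "\<lambda>t. r + t"] assms by (simp add: act_weyl_sum flip: up_add)
qed (use assms in \<open>rule weyl_sum_closed\<close>)

end

lemma diag2_mem_torus2 [simp]: "a \<noteq> 0 \<Longrightarrow> d \<noteq> 0 \<Longrightarrow> diag2 a d \<in> torus2"
  by (auto simp only: mem_torus2_iff)

lemma char_s_diag2: "char_s chi (diag2 a d) = chi (diag2 d a)"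
proof -
  have "smat ** diag2 a d ** smat = diag2 d a"
    by (simp add: matrix_eq_2)
  then show ?thesis
    by (simp add: char_s_def)
qed

text \<open>The case \<open>chi \<noteq> char_s chi\<close> of \<open>is_rho\<close>. The
  assumptions prescribe the character on all \<open>U\<close>-invariants but leave their dimension
  open; it is determined in \<open>invariants_one_dim\<close>.\<close>

locale borel_char_rep = GL2_rep \<rho>
  for \<rho> :: "('q::finite_field alg_closure, 'v, 'q^2^2) rep" (structure) +
  fixes chi :: "'q^2^2 \<Rightarrow> 'q alg_closure"
  assumes irreducible: "irreducible_rep (carrier GL2) \<rho>"
    and borel_act: "b \<in> borel2 \<Longrightarrow> v \<in> invariants unip2 \<rho> \<Longrightarrow>
      act \<rho> b v = chi (mat2 (b$1$1) 0 0 (b$2$2)) \<odot> v"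
    and regular: "\<exists>h\<in>torus2. chi h \<noteq> char_s chi h"
begin

lemma subrep_cases: "subrep (carrier GL2) \<rho> N \<Longrightarrow> N \<noteq> {\<zero>} \<Longrightarrow> N = carrier \<rho>"
  using irreducible by (auto simp: irreducible_rep_def)

lemma torus_act:
  assumes "a \<noteq> 0" "d \<noteq> 0" "v \<in> invariants unip2 \<rho>"
  shows "act \<rho> (diag2 a d) v = chi (diag2 a d) \<odot> v"
  using borel_act[of "diag2 a d" v] assms by (simp add: mem_borel2_iff) (simp add: diag2_def)

text \<open>The operator \<^const>\<open>weyl_sum\<close> maps the eigenspace of \<^term>\<open>chi\<close> to that of \<^term>\<open>char_s chi\<close>, which is zero.\<close>

lemma weyl_sum_zero:
  assumes m: "m \<in> invariants unip2 \<rho>"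
  shows "weyl_sum m = \<zero>"
proof -
  note mc = invariantsD(1)[OF m]
  obtain a d where ad: "a \<noteq> 0" "d \<noteq> 0" "chi (diag2 a d) \<noteq> chi (diag2 d a)"
    using regular by (auto simp: mem_torus2_iff char_s_diag2)
  \<comment> \<open>Moving a torus element to the right past \<open>up t ** smat\<close> rescales
    \<open>t\<close>, which permutes the summands, and exchanges the two diagonal entries.\<close>
  have eq: "diag2 a d ** up t ** smat = up (a / d * t) ** smat ** diag2 d a" for t
    using ad by (simp add: matrix_eq_2)
  have "act \<rho> (diag2 a d) (weyl_sum m) =
      (\<Oplus>\<^bsub>\<rho>\<^esub> t\<in>UNIV. act \<rho> (up (a / d * t) ** smat) (chi (diag2 d a) \<odot> m))"
    using mc ad by (simp add: act_weyl_sum eq act_mult torus_act[OF _ _ m, symmetric])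
  also have "\<dots> = weyl_sum (chi (diag2 d a) \<odot> m)"
    using ad mc by (intro weyl_sum_reindex) (auto intro!: o_bij[of "\<lambda>t. d / a * t"])
  also have "\<dots> = chi (diag2 d a) \<odot> weyl_sum m"
  proof -
    have "linear_map \<rho> \<rho> (\<lambda>x. chi (diag2 d a) \<odot> x)"
      by (rule smult_linear_map)
    from linear_map.finsum[OF this, of "\<lambda>t. act \<rho> (up t ** smat) m" UNIV] show ?thesis
      using mc by (simp add: weyl_sum_def act_smult)
  qed
  \<comment> \<open>\<open>weyl_sum m\<close> is itself \<open>U\<close>-invariant, so
    \<open>torus_act\<close> computes the same vector with the eigenvalue of
    \<open>diag2 a d\<close>; the two eigenvalues differ by the choice of \<open>a\<close> and
    \<open>d\<close>.\<close>
  finally have "chi (diag2 d a) \<odot> weyl_sum m = chi (diag2 a d) \<odot> weyl_sum m"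
    using torus_act[OF ad(1,2) weyl_sum_invariant[OF mc]] by simp
  then have "(chi (diag2 d a) - chi (diag2 a d)) \<odot> weyl_sum m = \<zero>"
    using weyl_sum_closed[OF mc]
    by (simp add: smult_add_left minus_smult r_neg diff_conv_add_uminus del: add_uminus_conv_diff)
  then show ?thesis
    using smult_eq_zeroD[OF weyl_sum_closed[OF mc]] ad by fastforce
qed

definition lo_span :: "'v \<Rightarrow> 'v set" where
  "lo_span v = lin_span \<rho> {act \<rho> (lo t) v | t. True}"

lemma lo_span_subspace: "v \<in> carrier \<rho> \<Longrightarrow> lin_subspace \<rho> (lo_span v)"
  unfolding lo_span_def by (rule lin_subspace_span) auto

lemma lo_act_mem_lo_span: "act \<rho> (lo t) v \<in> lo_span v"
  unfolding lo_span_def by (rule lin_span_mono[THEN subsetD]) auto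

text \<open>The relation \<open>weyl_sum m = \<zero>\<close> can be solved for the summand at
  \<open>t = 0\<close>; by \<open>up_smat\<close> all other summands are multiples of lower
  unipotent translates of \<open>m\<close>.\<close>

lemma smat_mem_lo_span:
  assumes m: "m \<in> invariants unip2 \<rho>"
  shows "act \<rho> smat m \<in> lo_span m"
proof -
  note mc = invariantsD(1)[OF m] and X = lo_span_subspace[OF invariantsD(1)[OF m]]
  let ?r = "\<Oplus>\<^bsub>\<rho>\<^esub> t\<in>UNIV - {0}. act \<rho> (up t ** smat) m"
  have "insert 0 (UNIV - {0}) = (UNIV :: 'q set)"
    by auto
  then have "act \<rho> smat m \<oplus> ?r = weyl_sum m"
    using finsum_insert[of "UNIV - {0}" "0::'q" "\<lambda>t. act \<rho> (up t ** smat) m"] mc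
    by (simp add: weyl_sum_def)
  then have "act \<rho> smat m \<oplus> ?r = \<zero>"
    by (simp add: weyl_sum_zero[OF m])
  moreover have "?r \<in> lo_span m"
  proof (rule finsum_in_subspace[OF X])
    fix t :: 'q assume "t \<in> UNIV - {0}"
    then have t: "t \<noteq> 0" by simp
    then have b: "mat2 t 1 0 (- inverse t) \<in> borel2"
      by (simp add: mem_borel2_iff)
    then have "invertible (mat2 t 1 0 (- inverse t))"
      by (simp add: borel2_def)
    then have "act \<rho> (up t ** smat) m =
        chi (mat2 t 0 0 (- inverse t)) \<odot> act \<rho> (lo (inverse t)) m"
      using mc borel_act[OF b m] by (simp add: up_smat[OF t] act_mult act_smult)
    then show "act \<rho> (up t ** smat) m \<in> lo_span m"
      using lin_subspaceD(4)[OF X lo_act_mem_lo_span] by simp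
  qed
  ultimately show ?thesis
    using mc lin_subspaceD(1,5)[OF X] minus_equality[of "act \<rho> smat m" ?r]
    by (metis act_closed carrier_GL2 invertible_smat)
qed

text \<open>By \<open>bruhat_lower\<close>, since the Borel subgroup only scales \<open>m\<close>:
  the lower unipotent group alone already spans the subrepresentation generated by an invariant
  vector.\<close>

lemma orbit_span_subset:
  assumes m: "m \<in> invariants unip2 \<rho>"
  shows "orbit_span m \<subseteq> lo_span m"
proof -
  note mc = invariantsD(1)[OF m] and X = lo_span_subspace[OF invariantsD(1)[OF m]]
  have "act \<rho> g m \<in> lo_span m" if "invertible g" for g
    using that
  proof (cases rule: bruhat_lower)
    case (1 b t)
    then have "act \<rho> g m = chi (mat2 (b$1$1) 0 0 (b$2$2)) \<odot> act \<rho> (lo t) m"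
      using borel_act[OF 1(1) m] mc by (simp add: act_mult act_smult borel2_def)
    then show ?thesis
      using lin_subspaceD(4)[OF X lo_act_mem_lo_span] by simp
  next
    case (2 b)
    then have "act \<rho> g m = chi (mat2 (b$1$1) 0 0 (b$2$2)) \<odot> act \<rho> smat m"
      using borel_act[OF 2(1) m] mc by (simp add: act_mult act_smult borel2_def)
    then show ?thesis
      using lin_subspaceD(4)[OF X smat_mem_lo_span[OF m]] by simp
  qed
  then show ?thesis
    unfolding orbit_span_def by (intro lin_span_least[OF X]) auto
qed

text \<open>The augmentation submodule of the lower unipotent group is a complement to any invariant
  line, and it contains no invariant vector, as such a vector would generate it.\<close>

lemma invariants_one_dim:
  assumes v: "v \<in> invariants unip2 \<rho>" "v \<noteq> \<zero>" and m: "m \<in> invariants unip2 \<rho>"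
  shows "\<exists>c. m = c \<odot> v"
proof -
  note vc = invariantsD(1)[OF v(1)] and mc = invariantsD(1)[OF m]
  let ?Y = "lower.aug UNIV"
  note Y = lower.aug_subspace[of UNIV]
  note Yc = lin_subspaceD(1)[OF Y]
  have proper: "?Y \<noteq> carrier \<rho>"
    using lower.aug_proper[of UNIV] vc v(2) by auto
  \<comment> \<open>This space contains every translate of \<open>v\<close> by \<open>lo t\<close>,
    which is \<open>v\<close> plus an element of the augmentation; as \<open>v\<close> generates,
    the space is everything.\<close>
  let ?L = "{c \<odot> v \<oplus> y | c y. y \<in> ?Y}"
  have "lin_subspace \<rho> ?L"
    unfolding lin_subspace_iff
  proof (intro conjI ballI allI)
    show "?L \<subseteq> carrier \<rho>"
      using Yc vc by auto
    have "\<zero> = 0 \<odot> v \<oplus> \<zero>"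
      using vc by simp
    then show "\<zero> \<in> ?L"
      using lin_subspaceD(2)[OF Y] by blast
  next
    fix x x' assume "x \<in> ?L" "x' \<in> ?L"
    then obtain c y c' y' where *: "x = c \<odot> v \<oplus> y" "x' = c' \<odot> v \<oplus> y'" "y \<in> ?Y" "y' \<in> ?Y"
      by blast
    then have "x \<oplus> x' = (c + c') \<odot> v \<oplus> (y \<oplus> y')"
      using vc Yc by (simp add: smult_add_left add.m_ac)
    then show "x \<oplus> x' \<in> ?L"
      using * lin_subspaceD(3)[OF Y] by blast
  next
    fix d x assume "x \<in> ?L"
    then obtain c y where *: "x = c \<odot> v \<oplus> y" "y \<in> ?Y"
      by blast
    then have "d \<odot> x = (d * c) \<odot> v \<oplus> d \<odot> y"
      using vc Yc by (simp add: smult_add smult_mult)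
    then show "d \<odot> x \<in> ?L"
      using * lin_subspaceD(4)[OF Y] by blast
  qed
  moreover have "act \<rho> (lo t) v \<in> ?L" for t
  proof -
    have "act \<rho> (lo t) v = 1 \<odot> v \<oplus> (act \<rho> (lo t) v \<ominus> v)"
      using vc by (simp add: minus_eq add.m_lcomm[of v] r_neg)
    then show ?thesis
      using lower.D_mem_aug[of t UNIV v] vc by blast
  qed
  ultimately have "lo_span v \<subseteq> ?L"
    unfolding lo_span_def by (intro lin_span_least) blast+
  moreover have "orbit_span v = carrier \<rho>"
    using subrep_cases[OF orbit_span_subrep[OF vc]] mem_orbit_span[OF vc] v(2) by blast
  ultimately obtain c y where cy: "m = c \<odot> v \<oplus> y" "y \<in> ?Y"
    using orbit_span_subset[OF v(1)] mc by blast
  have y: "y \<in> invariants unip2 \<rho>"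
  proof (rule invariantsI)
    fix t
    have "c \<odot> v \<oplus> act \<rho> (up t) y = c \<odot> v \<oplus> y"
      using cy vc Yc invariantsD(2)[OF m, of t] invariantsD(2)[OF v(1), of t]
      by (simp add: act_add act_smult)
    then show "act \<rho> (up t) y = y"
      using cy vc Yc by simp
  qed (use cy Yc in blast)
  have "lo_span y \<subseteq> ?Y"
    unfolding lo_span_def by (intro lin_span_least[OF Y]) (use cy lower.aug_stable in blast)
  then have "orbit_span y \<noteq> carrier \<rho>"
    using orbit_span_subset[OF y] proper Yc by blast
  then have "y = \<zero>"
    using subrep_cases[OF orbit_span_subrep[OF invariantsD(1)[OF y]]]
      mem_orbit_span[OF invariantsD(1)[OF y]] by blast
  with cy vc show ?thesis
    by auto
qed

end

subsection \<open>The Steinberg representation\<close>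

lemma trivial_rep_simps [simp]:
  "carrier trivial_rep = UNIV" "\<zero>\<^bsub>trivial_rep\<^esub> = 0" "x \<oplus>\<^bsub>trivial_rep\<^esub> y = x + y"
  "c \<odot>\<^bsub>trivial_rep\<^esub> x = c * x" "act trivial_rep g x = x"
  by (simp_all add: trivial_rep_def)

lemma representation_trivial: "representation S trivial_rep"
proof -
  have "kspace trivial_rep"
    by (rule kspaceI) (auto simp: algebra_simps)
  from kspace.module_V[OF this] show ?thesis
    by (auto simp: representation_def linear_maps_def)
qed

abbreviation borel_ind :: "('q::finite_field alg_closure, 'q^2^2 \<Rightarrow> 'q alg_closure, 'q^2^2) rep" where
  "borel_ind \<equiv> c_ind borel2 trivial_rep"

definition const_fun :: "'q::finite_field alg_closure \<Rightarrow> 'q^2^2 \<Rightarrow> 'q alg_closure" where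
  "const_fun c = (\<lambda>g. if invertible g then c else 0)"

definition borel_ind1 :: "'q::finite_field^2^2 \<Rightarrow> 'q alg_closure" where
  "borel_ind1 = (\<lambda>g. if g \<in> borel2 then 1 else 0)"

lemma mem_borel_ind_iff:
  "f \<in> carrier borel_ind \<longleftrightarrow> (\<forall>x. \<not> invertible x \<longrightarrow> f x = 0) \<and>
     (\<forall>b\<in>borel2. \<forall>x. invertible x \<longrightarrow> f (b ** x) = f x)"
  by (simp add: mem_c_ind_iff)

lemma const_fun_mem: "const_fun c \<in> carrier borel_ind"
  by (simp add: mem_borel_ind_iff const_fun_def borel2_invertible)

lemma borel_ind1_mem: "borel_ind1 \<in> carrier borel_ind"
  by (auto simp: mem_borel_ind_iff borel_ind1_def mem_borel2_iff invertible_2)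

text \<open>The coset \<open>B x\<close> is the point of the projective line given by the bottom row
  of \<open>x\<close>. The identity represents the point \<open>(0 : 1)\<close>, and
  \<open>smat ** up t\<close> the point \<open>(1 : t)\<close>.\<close>

lemma borel_ind_value:
  assumes f: "f \<in> carrier borel_ind" and x: "invertible x"
  shows "f x = (if x$2$1 = 0 then f (mat 1) else f (smat ** up (x$2$2 / x$2$1)))"
proof (cases "x$2$1 = 0")
  case True
  then have "x \<in> borel2"
    using x by (simp add: borel2_def)
  then have "f (x ** mat 1) = f (mat 1)"
    using f unfolding mem_borel_ind_iff by (metis invertible_mat_1)
  then show ?thesis
    using True by simp
next
  case False
  let ?b = "mat2 (x$1$2 - x$1$1 * x$2$2 / x$2$1) (x$1$1) 0 (x$2$1)"
  have "?b \<in> borel2"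
    using x False by (auto simp: mem_borel2_iff invertible_2 field_simps)
  moreover have "x = ?b ** (smat ** up (x$2$2 / x$2$1))"
    using False by (simp add: matrix_eq_2 field_simps)
  moreover have "invertible (smat ** up (x$2$2 / x$2$1))"
    by simp
  ultimately have "f x = f (smat ** up (x$2$2 / x$2$1))"
    using f unfolding mem_borel_ind_iff by metis
  then show ?thesis
    using False by simp
qed

lemma borel_ind_eqI:
  assumes "f \<in> carrier borel_ind" "h \<in> carrier borel_ind" "f (mat 1) = h (mat 1)"
    and "\<And>t. f (smat ** up t) = h (smat ** up t)"
  shows "f = h"
proof
  fix x
  show "f x = h x"
  proof (cases "invertible x")
    case True
    then show ?thesis
      using borel_ind_value[OF assms(1) True] borel_ind_value[OF assms(2) True] assms(3,4) by simp
  next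
    case False
    then show ?thesis
      using assms(1,2) by (simp add: mem_borel_ind_iff)
  qed
qed

lemma mat_1_mem_borel2 [simp]: "mat 1 \<in> borel2"
  by (simp add: borel2_def)

lemma representation_borel_ind: "representation (carrier GL2) borel_ind"
proof -
  interpret grep borel2 trivial_rep
    by unfold_locales (rule representation_trivial)
  show ?thesis
    by (rule representation_c_ind)
qed

lemma subrep_const:
  "subrep (carrier GL2) (borel_ind :: ('q::finite_field alg_closure, _, _) rep) (range const_fun)"
proof -
  interpret grep "carrier GL2" "borel_ind :: ('q alg_closure, _, _) rep"
    by unfold_locales (rule representation_borel_ind)
  show ?thesis
    unfolding subrep_iff
  proof (intro conjI ballI allI)
    show "\<zero>\<^bsub>borel_ind\<^esub> \<in> range const_fun"
      by (rule range_eqI[of _ _ 0]) (simp add: const_fun_def)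
  next
    fix f h :: "'q^2^2 \<Rightarrow> 'q alg_closure"
    assume "f \<in> range const_fun" "h \<in> range const_fun"
    then obtain c d where "f = const_fun c" "h = const_fun d"
      by blast
    then show "f \<oplus>\<^bsub>borel_ind\<^esub> h \<in> range const_fun"
      by (intro range_eqI[of _ _ "c + d"]) (simp add: const_fun_def fun_eq_iff)
  next
    fix e and f :: "'q^2^2 \<Rightarrow> 'q alg_closure"
    assume "f \<in> range const_fun"
    then obtain c where "f = const_fun c"
      by blast
    then show "e \<odot>\<^bsub>borel_ind\<^esub> f \<in> range const_fun"
      by (intro range_eqI[of _ _ "e * c"]) (simp add: const_fun_def fun_eq_iff)
  next
    fix g :: "'q^2^2" and f :: "'q^2^2 \<Rightarrow> 'q alg_closure"
    assume "f \<in> range const_fun" "g \<in> carrier GL2"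
    then obtain c where "f = const_fun c"
      by blast
    then show "act borel_ind g f \<in> range const_fun"
      using \<open>g \<in> carrier GL2\<close> by (intro range_eqI[of _ _ c]) (simp add: const_fun_def fun_eq_iff)
  qed (auto intro: const_fun_mem)
qed

interpretation St: quotient_rep "carrier GL2" borel_ind "range const_fun"
  by unfold_locales (rule representation_borel_ind, rule subrep_const)

lemma steinberg_eq: "steinberg = quot_rep borel_ind (range const_fun)"
  by (simp add: steinberg_def const_fun_def)

lemma twist_det_simps [simp]:
  "carrier (twist_det \<eta> V) = carrier V" "zero (twist_det \<eta> V) = zero V"
  "add (twist_det \<eta> V) = add V" "module.smult (twist_det \<eta> V) = module.smult V"
  "act (twist_det \<eta> V) g v = \<eta> (det g) \<odot>\<^bsub>V\<^esub> act V g v"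
  by (simp_all add: twist_det_def)

text \<open>Invariance modulo constants is honest invariance: the identity coset is fixed by
  \<open>U\<close>, and evaluation there shows that the constant is zero. As \<open>U\<close>
  permutes the remaining points transitively, \<open>f\<close> is determined by its values at
  \<open>mat 1\<close> and \<open>smat\<close>.\<close>

lemma unipotent_translate:
  assumes f: "f \<in> carrier borel_ind" and inv: "\<And>t. (\<lambda>x. f (x ** up t) - f x) \<in> range const_fun"
  shows "(\<lambda>x. f x - (f (mat 1) - f smat) * borel_ind1 x) \<in> range const_fun"
proof -
  have "f (smat ** up t) = f smat" for t
  proof -
    obtain c where c: "\<And>x. f (x ** up t) - f x = const_fun c x"
      using inv[of t] by (auto simp: fun_eq_iff)
    have "f (up t) = f (mat 1)"
      using borel_ind_value[OF f, of "up t"] by simp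
    then have "c = 0"
      using c[of "mat 1"] by (simp add: const_fun_def)
    then show ?thesis
      using c[of smat] by (simp add: const_fun_def)
  qed
  then have "f x - (f (mat 1) - f smat) * borel_ind1 x = const_fun (f smat) x" for x
  proof (cases "invertible x")
    case True
    then show ?thesis
      using borel_ind_value[OF f True] \<open>\<And>t. f (smat ** up t) = f smat\<close>
      by (simp add: const_fun_def borel_ind1_def borel2_def)
  next
    case False
    then show ?thesis
      using f by (auto simp: const_fun_def mem_borel_ind_iff borel_ind1_def dest: borel2_invertible)
  qed
  then show ?thesis
    by (intro range_eqI ext)
qed

text \<open>Within this locale \<open>F\<close> is an isomorphism onto a Steinberg twist, not the
  data of a local field.\<close>

locale steinberg_twist = GL2_rep \<rho>
  for \<rho> :: "('q::finite_field alg_closure, 'v, 'q^2^2) rep" (structure) +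
  fixes \<eta> :: "'q \<Rightarrow> 'q alg_closure" and F :: "'v \<Rightarrow> ('q^2^2 \<Rightarrow> 'q alg_closure) set"
  assumes eta_nz: "x \<noteq> 0 \<Longrightarrow> \<eta> x \<noteq> 0" and eta_mult: "x \<noteq> 0 \<Longrightarrow> y \<noteq> 0 \<Longrightarrow> \<eta> (x * y) = \<eta> x * \<eta> y"
    and iso: "rep_iso_map (carrier GL2) \<rho> (twist_det \<eta> steinberg) F"
begin

lemma eta_one [simp]: "\<eta> 1 = 1"
  using eta_mult[of 1 1] eta_nz[of 1] by simp

lemma F_bij: "bij_betw F (carrier \<rho>) (carrier St.Q)"
  using iso by (simp add: rep_iso_map_def steinberg_eq)

lemma F_linear: "linear_map \<rho> St.Q F"
  using iso kspace_axioms St.kspace_Q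
  by (auto simp: rep_iso_map_def rep_hom_def steinberg_eq linear_map_def linear_map_axioms_def
      linear_maps_def)

lemma F_act: "invertible g \<Longrightarrow> v \<in> carrier \<rho> \<Longrightarrow> F (act \<rho> g v) = \<eta> (det g) \<odot>\<^bsub>St.Q\<^esub> act St.Q g (F v)"
  using iso by (auto simp: rep_iso_map_def rep_hom_def steinberg_eq)

interpretation F: linear_map \<rho> St.Q F
  by (rule F_linear)

lemma F_rep:
  assumes "v \<in> carrier \<rho>"
  obtains f where "f \<in> carrier borel_ind" "F v = St.proj f"
  using F.closed[OF assms] by (auto simp: St.Q_carrier)

lemma F_inj: "v \<in> carrier \<rho> \<Longrightarrow> w \<in> carrier \<rho> \<Longrightarrow> F v = F w \<Longrightarrow> v = w"
  using F_bij by (auto simp: bij_betw_def inj_on_def)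

text \<open>Its image is the class of the indicator function of \<open>B\<close>. It spans the
  \<open>U\<close>-invariants (\<open>invariant_multiple\<close>) and generates
  \<open>\<rho>\<close> (\<open>subrep_eq_carrier\<close>).\<close>

definition e where "e = inv_into (carrier \<rho>) F (St.proj borel_ind1)"

lemma e_mem [simp]: "e \<in> carrier \<rho>" and F_e: "F e = St.proj borel_ind1"
proof -
  have "St.proj borel_ind1 \<in> F ` carrier \<rho>"
    using F_bij borel_ind1_mem by (auto simp: bij_betw_def St.Q_carrier)
  then show "e \<in> carrier \<rho>" "F e = St.proj borel_ind1"
    by (simp_all add: e_def inv_into_into f_inv_into_f)
qed

lemma borel_ind_diff:
  "f \<in> carrier borel_ind \<Longrightarrow> h \<in> carrier borel_ind \<Longrightarrow> f \<ominus>\<^bsub>borel_ind\<^esub> h = (\<lambda>x. f x - h x)"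
  using St.minus_eq_smult[of h] by (simp add: St.minus_eq)

text \<open>Unipotent matrices have determinant 1, so the twist is invisible on them; a function
  representing \<open>F v\<close> is thus invariant modulo constants, and
  \<open>unipotent_translate\<close> applies.\<close>

lemma invariant_multiple:
  assumes v: "v \<in> carrier \<rho>" and inv: "\<And>t. act \<rho> (up t) v = v"
  shows "\<exists>c. v = c \<odot> e"
proof -
  obtain f where f: "f \<in> carrier borel_ind" "F v = St.proj f"
    using F_rep[OF v] .
  have "(\<lambda>x. f (x ** up t) - f x) \<in> range const_fun" for t
  proof -
    have mem: "(\<lambda>x. f (x ** up t)) \<in> carrier borel_ind"
      using f by (intro c_ind_translate) auto
    have "F v = St.proj (\<lambda>x. f (x ** up t))"
      using F_act[of "up t" v] inv[of t] f v mem St.Q_act[of "up t" f]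
      by (simp add: det_2 St.Q_smult)
    then have "St.proj (\<lambda>x. f (x ** up t)) = St.proj f"
      using f by simp
    then show ?thesis
      using f mem by (simp add: St.proj_eq_iff borel_ind_diff)
  qed
  then have r: "(\<lambda>x. f x - (f (mat 1) - f smat) * borel_ind1 x) \<in> range const_fun"
    using f by (intro unipotent_translate)
  let ?c = "f (mat 1) - f smat"
  have "?c \<odot>\<^bsub>borel_ind\<^esub> borel_ind1 \<in> carrier borel_ind"
    using borel_ind1_mem by (rule St.smult_closed)
  then have "St.proj f = St.proj (?c \<odot>\<^bsub>borel_ind\<^esub> borel_ind1)"
    using f r by (subst St.proj_eq_iff) (simp_all add: borel_ind_diff)
  then have "F v = F (?c \<odot> e)"
    using f by (simp add: F.smult F_e St.Q_smult borel_ind1_mem)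
  then have "v = ?c \<odot> e"
    by (rule F_inj[OF v smult_closed[OF e_mem]])
  then show ?thesis ..
qed

text \<open>The translates of the indicator function of \<open>B\<close> include the indicator
  functions of all points of the projective line, so they span the induced representation, and their
  classes span the quotient.\<close>

lemma subrep_eq_carrier:
  assumes N: "subrep (carrier GL2) \<rho> N" and e: "e \<in> N"
  shows "N = carrier \<rho>"
proof -
  let ?N = "{f \<in> carrier borel_ind. St.proj f \<in> F ` N}"
  have lin: "lin_subspace borel_ind ?N"
    using linear_map.subspace_vimage[OF St.proj_linear_map F.subspace_image[of N]] N
    by (simp add: subrep_def)
  note D = St.lin_subspaceD[OF lin]
  have translate: "(\<lambda>x. borel_ind1 (x ** g)) \<in> ?N" if g: "invertible g" for g
  proof -
    have *: "(\<lambda>x. borel_ind1 (x ** g)) \<in> carrier borel_ind"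
      using g borel_ind1_mem by (intro c_ind_translate)
    have nz: "det g \<noteq> 0"
      using g by (simp add: invertible_det_nz)
    have "act \<rho> g e \<in> N"
      using N e g by (simp add: subrep_def)
    then have "inverse (\<eta> (det g)) \<odot> act \<rho> g e \<in> N"
      using N lin_subspaceD(4)[of N] by (simp add: subrep_def)
    moreover have "F (inverse (\<eta> (det g)) \<odot> act \<rho> g e) = St.proj (\<lambda>x. borel_ind1 (x ** g))"
      using g F_act[OF g e_mem] eta_nz[OF nz] * St.Q_act[of g borel_ind1]
      by (simp add: F.smult F_e borel_ind1_mem St.Q_carrier)
    ultimately show ?thesis
      using * by (auto intro: rev_image_eqI)
  qed
  \<comment> \<open>The case of functions that vanish at \<open>(0 : 1)\<close>, by induction on a
    finite set \<open>T\<close> such that \<open>f\<close> vanishes at all \<open>(1 : t)\<close>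
    with \<open>t\<close> outside \<open>T\<close>.\<close>
  have vanish: "f \<in> ?N" if "f \<in> carrier borel_ind" "f (mat 1) = 0"
    "\<And>t. t \<notin> T \<Longrightarrow> f (smat ** up t) = 0" for f and T :: "'q set"
    using finite[of T] that
  proof (induction T arbitrary: f rule: finite_induct)
    case empty
    then have "f = \<zero>\<^bsub>borel_ind\<^esub>"
      using D(1)[OF D(2)] by (intro borel_ind_eqI) auto
    then show ?case
      using D(2) by simp
  next
    case (insert s T)
    \<comment> \<open>The indicator function of the point \<open>(1 : s)\<close>, obtained by moving
      that point to \<open>(0 : 1)\<close>.\<close>
    define h where "h = (\<lambda>x. borel_ind1 (x ** (up (- s) ** smat)))"
    have h: "h \<in> ?N"
      unfolding h_def by (rule translate) simp
    have h1: "h (mat 1) = 0"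
      by (simp add: h_def borel_ind1_def mem_borel2_iff)
    have ht: "h (smat ** up t) = (if t = s then 1 else 0)" for t
      by (simp add: h_def borel_ind1_def mem_borel2_iff)
    let ?c = "f (smat ** up s)"
    let ?f = "f \<ominus>\<^bsub>borel_ind\<^esub> (?c \<odot>\<^bsub>borel_ind\<^esub> h)"
    have ch: "?c \<odot>\<^bsub>borel_ind\<^esub> h \<in> ?N"
      using h by (rule D(4))
    have f_eq: "?f = (\<lambda>x. f x - ?c * h x)"
      using borel_ind_diff[OF insert.prems(1) D(1)[OF ch]] by simp
    have "?f \<in> ?N"
    proof (rule insert.IH)
      show "?f \<in> carrier borel_ind"
        using insert.prems(1) D(1)[OF ch] by (rule St.minus_closed)
      show "?f (mat 1) = 0"
        unfolding f_eq using insert.prems(2) by (simp add: h1)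
      show "?f (smat ** up t) = 0" if "t \<notin> T" for t
        unfolding f_eq using insert.prems(3)[of t] that by (cases "t = s") (simp_all add: ht)
    qed
    then have "?f \<oplus>\<^bsub>borel_ind\<^esub> (?c \<odot>\<^bsub>borel_ind\<^esub> h) \<in> ?N"
      using ch by (rule D(3))
    then show ?case
      unfolding f_eq by simp
  qed
  have all: "f \<in> ?N" if f: "f \<in> carrier borel_ind" for f
  proof -
    let ?f = "f \<ominus>\<^bsub>borel_ind\<^esub> (f (mat 1) \<odot>\<^bsub>borel_ind\<^esub> borel_ind1)"
    have "borel_ind1 \<in> ?N"
      using translate[of "mat 1"] by simp
    then have c: "f (mat 1) \<odot>\<^bsub>borel_ind\<^esub> borel_ind1 \<in> ?N"
      by (rule D(4))
    have f_eq: "?f = (\<lambda>x. f x - f (mat 1) * borel_ind1 x)"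
      using borel_ind_diff[OF f D(1)[OF c]] by simp
    have "?f \<in> ?N"
    proof (rule vanish[of _ UNIV])
      show "?f \<in> carrier borel_ind"
        using f D(1)[OF c] by (rule St.minus_closed)
    qed (unfold f_eq, simp_all add: borel_ind1_def)
    then have "?f \<oplus>\<^bsub>borel_ind\<^esub> (f (mat 1) \<odot>\<^bsub>borel_ind\<^esub> borel_ind1) \<in> ?N"
      using c by (rule D(3))
    then show ?thesis
      unfolding f_eq by simp
  qed
  have "v \<in> N" if v: "v \<in> carrier \<rho>" for v
  proof -
    obtain f where f: "f \<in> carrier borel_ind" "F v = St.proj f"
      using F_rep[OF v] .
    have "F v \<in> F ` N"
      using all[OF f(1)] f(2) by simp
    then obtain w where "w \<in> N" "F v = F w"
      by blast
    then show ?thesis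
      using F_inj[OF v] N by (auto simp: subrep_iff)
  qed
  then show ?thesis
    using N by (auto simp: subrep_iff)
qed

lemma borel_ind1_not_const: "(borel_ind1 :: 'q^2^2 \<Rightarrow> _) \<notin> range const_fun"
proof
  assume "(borel_ind1 :: 'q^2^2 \<Rightarrow> _) \<in> range const_fun"
  then obtain c where "(borel_ind1 :: 'q^2^2 \<Rightarrow> _) = const_fun c"
    by blast
  from fun_cong[OF this, of "mat 1"] fun_cong[OF this, of smat] show False
    by (simp add: borel_ind1_def const_fun_def mem_borel2_iff)
qed

lemma e_nonzero: "e \<noteq> \<zero>"
proof
  assume "e = \<zero>"
  then have "St.proj borel_ind1 = F \<zero>"
    using F_e by simp
  also have "F \<zero> = \<zero>\<^bsub>St.Q\<^esub>"
    by (rule F.zero)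
  finally show False
    using borel_ind1_not_const by (subst (asm) St.proj_eq_zero_iff) (auto intro: borel_ind1_mem)
qed

lemma irreducible: "irreducible_rep (carrier GL2) \<rho>"
proof -
  have "N = carrier \<rho>" if N: "subrep (carrier GL2) \<rho> N" "N \<noteq> {\<zero>}" for N
  proof (rule subrep_eq_carrier[OF N(1)])
    obtain v where v: "v \<in> N" "v \<noteq> \<zero>" "v \<in> invariants unip2 \<rho>"
      using exists_invariant[OF N] by blast
    then obtain c where c: "v = c \<odot> e"
      using invariant_multiple invariantsD by blast
    with v(2) have "c \<noteq> 0"
      by auto
    have "inverse c \<odot> v \<in> N"
      using N(1) v(1) by (simp add: subrep_iff)
    then show "e \<in> N"
      using c \<open>c \<noteq> 0\<close> by (simp flip: smult_mult)
  qed
  then show ?thesis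
    using rep e_nonzero e_mem by (auto simp: irreducible_rep_def)
qed

text \<open>This separates a Steinberg twist from the character with the same \<open>\<eta>\<close>.
  Such a \<open>v\<close>, if non-zero, would be a non-zero multiple of \<open>e\<close>, so
  \<open>smat\<close> would fix the indicator function of \<open>B\<close> up to a constant
  function.\<close>

lemma no_character:
  assumes v: "v \<in> carrier \<rho>" and eta: "\<And>g. invertible g \<Longrightarrow> act \<rho> g v = \<eta> (det g) \<odot> v"
  shows "v = \<zero>"
proof (rule ccontr)
  assume nz: "v \<noteq> \<zero>"
  obtain c where c: "v = c \<odot> e"
    using invariant_multiple[OF v] eta[of "up _"] v by (auto simp: det_2)
  with nz have "c \<noteq> 0"
    by auto
  have "c \<odot> act \<rho> smat e = c \<odot> (\<eta> (det smat) \<odot> e)"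
    using eta[of smat] c by (simp add: act_smult mult.commute flip: smult_mult)
  then have se: "act \<rho> smat e = \<eta> (det smat) \<odot> e"
    using \<open>c \<noteq> 0\<close> by (simp add: smult_left_cancel)
  have nz': "\<eta> (det (smat :: 'q^2^2)) \<noteq> 0"
    by (rule eta_nz) (simp add: det_2)
  have mem: "(\<lambda>x :: 'q^2^2. borel_ind1 (x ** smat)) \<in> carrier borel_ind"
    using borel_ind1_mem by (intro c_ind_translate) auto
  have "\<eta> (det smat) \<odot>\<^bsub>St.Q\<^esub> St.proj (\<lambda>x :: 'q^2^2. borel_ind1 (x ** smat)) =
      \<eta> (det smat) \<odot>\<^bsub>St.Q\<^esub> St.proj borel_ind1"
    using F_act[of smat e] se by (simp add: F.smult F_e St.Q_act borel_ind1_mem)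
  then have "St.proj (\<lambda>x :: 'q^2^2. borel_ind1 (x ** smat)) = St.proj borel_ind1"
    using nz' mem borel_ind1_mem by (subst (asm) F.W.smult_left_cancel) (simp_all add: St.Q_carrier borel_ind1_mem)
  then have "(\<lambda>x :: 'q^2^2. borel_ind1 (x ** smat) - borel_ind1 x) \<in> range const_fun"
    using St.proj_eq_iff[OF mem borel_ind1_mem] borel_ind_diff[OF mem borel_ind1_mem] by simp
  then obtain d where d: "\<And>x :: 'q^2^2. borel_ind1 (x ** smat) - borel_ind1 x = const_fun d x"
    by (auto simp: fun_eq_iff)
  \<comment> \<open>At \<open>(1 : 1)\<close>, a third point of the projective line, both functions
    vanish, so the constant is 0; at \<open>(0 : 1)\<close> it is -1.\<close>
  from d[of "smat ** up 1"] d[of "mat 1"] show False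
    by (simp add: borel_ind1_def const_fun_def mem_borel2_iff)
qed

end

text \<open>For \<open>chi \<noteq> char_s chi\<close> irreducibility is part of
  \<open>is_rho\<close>; otherwise it is read off from the model. The second claim, that the
  invariants are at most a line, is what later makes \<open>\<psi>\<close> equivariant under
  \<Pi>.\<close>

lemma is_rho_irreducible:
  assumes rho: "is_rho chi J \<rho>" and J: "J \<subseteq> J0 chi"
  shows "irreducible_rep (carrier GL2) \<rho>"
    and "v \<in> invariants unip2 \<rho> \<Longrightarrow> v \<noteq> \<zero>\<^bsub>\<rho>\<^esub> \<Longrightarrow> m \<in> invariants unip2 \<rho> \<Longrightarrow> \<exists>c. m = c \<odot>\<^bsub>\<rho>\<^esub> v"
proof -
  have rep: "representation (carrier GL2) \<rho>"
    using rho by (simp add: is_rho_def)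
  interpret GL2_rep \<rho>
    by unfold_locales (rule rep)
  have "irreducible_rep (carrier GL2) \<rho> \<and> (\<forall>v m. v \<in> invariants unip2 \<rho> \<longrightarrow> v \<noteq> \<zero>\<^bsub>\<rho>\<^esub> \<longrightarrow>
      m \<in> invariants unip2 \<rho> \<longrightarrow> (\<exists>c. m = c \<odot>\<^bsub>\<rho>\<^esub> v))"
  proof (cases "J0 chi = {}")
    case True
    then have "\<exists>h\<in>torus2. chi h \<noteq> char_s chi h"
      by (auto simp: J0_def split: if_splits)
    then interpret borel_char_rep \<rho> chi
      using rho True by unfold_locales (auto simp: is_rho_def)
    show ?thesis
      using irreducible invariants_one_dim by blast
  next
    case False
    then obtain \<eta> where eta: "\<forall>x. x \<noteq> 0 \<longrightarrow> \<eta> x \<noteq> 0"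
      "\<forall>x y. x \<noteq> 0 \<and> y \<noteq> 0 \<longrightarrow> \<eta> (x * y) = \<eta> x * \<eta> y"
      and iso: "if J = {smat} then rep_isomorphic (carrier GL2) \<rho> (twist_det \<eta> trivial_rep)
        else rep_isomorphic (carrier GL2) \<rho> (twist_det \<eta> steinberg)"
      using rho by (auto simp: is_rho_def)
    show ?thesis
    proof (cases "J = {smat}")
      case True
      with iso obtain f where f: "f \<in> linear_maps \<rho> (trivial_rep :: (_, _, 'a^2^2) rep)" "bij_betw f (carrier \<rho>) UNIV"
        by (auto simp: rep_isomorphic_def rep_iso_map_def rep_hom_def linear_maps_def)
      note fD = linear_mapsD[OF f(1)]
      have inj: "inj_on f (carrier \<rho>)" and surj: "f ` carrier \<rho> = UNIV"
        using f(2) by (auto simp: bij_betw_def)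
      interpret f: linear_map \<rho> "trivial_rep :: (_, _, 'a^2^2) rep" f
        using f(1) kspace_of_representation[OF representation_trivial] kspace_axioms
        by (simp add: linear_map_def linear_map_axioms_def)
      have mult: "\<exists>c. m = c \<odot>\<^bsub>\<rho>\<^esub> v" if "v \<in> carrier \<rho>" "v \<noteq> \<zero>\<^bsub>\<rho>\<^esub>" "m \<in> carrier \<rho>" for v m
      proof -
        have "f v \<noteq> 0"
          using that inj f.zero inj_onD[OF inj, of v "\<zero>\<^bsub>\<rho>\<^esub>"] by auto
        then have "f m = f ((f m / f v) \<odot>\<^bsub>\<rho>\<^esub> v)"
          using that by (simp add: f.smult)
        then show ?thesis
          using inj_onD[OF inj, of m] that by blast
      qed
      obtain x where x: "x \<in> carrier \<rho>" "f x = 1"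
        using surj by (metis UNIV_I imageE)
      then have "x \<noteq> \<zero>\<^bsub>\<rho>\<^esub>"
        using f.zero by auto
      have "N = carrier \<rho>" if N: "subrep (carrier GL2) \<rho> N" "N \<noteq> {\<zero>\<^bsub>\<rho>\<^esub>}" for N
      proof -
        obtain v where v: "v \<in> N" "v \<noteq> \<zero>\<^bsub>\<rho>\<^esub>"
          using N(1) subspace_cases_zero[OF _ N(2)] unfolding subrep_def by blast
        then have "m \<in> N" if "m \<in> carrier \<rho>" for m
        proof -
          have "v \<in> carrier \<rho>"
            using N(1) v(1) by (auto simp: subrep_iff)
          from mult[OF this v(2) that] show ?thesis
            using N(1) v(1) by (auto simp: subrep_iff)
        qed
        with N(1) show ?thesis
          by (auto simp: subrep_iff)
      qed
      then have "irreducible_rep (carrier GL2) \<rho>"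
        using rep x(1) \<open>x \<noteq> \<zero>\<^bsub>\<rho>\<^esub>\<close> by (auto simp: irreducible_rep_def)
      with mult show ?thesis
        by (auto simp: invariants_def)
    next
      case False
      with iso obtain f where "rep_iso_map (carrier GL2) \<rho> (twist_det \<eta> steinberg) f"
        by (auto simp: rep_isomorphic_def)
      then interpret S: steinberg_twist \<rho> \<eta> f
        using eta by unfold_locales auto
      have "\<exists>c. m = c \<odot>\<^bsub>\<rho>\<^esub> v" if v: "v \<in> invariants unip2 \<rho>" "v \<noteq> \<zero>\<^bsub>\<rho>\<^esub>" and m: "m \<in> invariants unip2 \<rho>" for v m
      proof -
        obtain c d where cd: "v = c \<odot>\<^bsub>\<rho>\<^esub> S.e" "m = d \<odot>\<^bsub>\<rho>\<^esub> S.e"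
          using S.invariant_multiple invariantsD v m by meson
        then have "c \<noteq> 0"
          using v(2) by auto
        then have "m = (d / c) \<odot>\<^bsub>\<rho>\<^esub> v"
          using cd by (simp flip: smult_mult)
        then show ?thesis
          by blast
      qed
      with S.irreducible show ?thesis
        by blast
    qed
  qed
  then show "irreducible_rep (carrier GL2) \<rho>"
    and "v \<in> invariants unip2 \<rho> \<Longrightarrow> v \<noteq> \<zero>\<^bsub>\<rho>\<^esub> \<Longrightarrow> m \<in> invariants unip2 \<rho> \<Longrightarrow> \<exists>c. m = c \<odot>\<^bsub>\<rho>\<^esub> v"
    by blast+
qed

lemma char_s_char_s: "char_s (char_s chi) = chi" for chi :: "'q::finite_field^2^2 \<Rightarrow> 'k"
proof
  fix h :: "'q^2^2"
  have "smat ** (smat ** h ** smat) ** smat = h"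
    by (simp add: matrix_eq_2)
  then show "char_s (char_s chi) h = chi h"
    by (simp add: char_s_def)
qed

lemma J0_char_s: "J0 (char_s chi) = J0 chi"
  by (auto simp: J0_def char_s_char_s)

text \<open>The character and the Steinberg twist each come with their own \<open>\<eta>\<close>.
  Both give the same function on the torus, where the determinant takes all non-zero values, so a
  single \<open>\<eta>\<close> serves both.\<close>

lemma char_steinberg_pair:
  assumes "is_rho chi {smat} \<rho>" "is_rho chi' {} \<rho>'" "J0 chi \<noteq> {}" "J0 chi' \<noteq> {}"
    and chi: "\<And>h. h \<in> torus2 \<Longrightarrow> chi h = chi' h"
  shows "\<exists>\<eta>. (\<forall>g v. invertible g \<longrightarrow> v \<in> carrier \<rho> \<longrightarrow> act \<rho> g v = \<eta> (det g) \<odot>\<^bsub>\<rho>\<^esub> v) \<and>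
    (\<forall>v\<in>carrier \<rho>'. (\<forall>g. invertible g \<longrightarrow> act \<rho>' g v = \<eta> (det g) \<odot>\<^bsub>\<rho>'\<^esub> v) \<longrightarrow> v = \<zero>\<^bsub>\<rho>'\<^esub>)"
proof -
  have smat_ne: "{} \<noteq> {smat :: 'a^2^2}"
    by simp
  interpret GL2_rep \<rho>
    by unfold_locales (use assms(1) in \<open>simp add: is_rho_def\<close>)
  interpret \<rho>': GL2_rep \<rho>'
    by unfold_locales (use assms(2) in \<open>simp add: is_rho_def\<close>)
  obtain \<eta> where eta: "\<forall>h\<in>torus2. chi h = \<eta> (det h)"
      and "rep_isomorphic (carrier GL2) \<rho> (twist_det \<eta> trivial_rep)"
    using assms(1,3) by (auto simp: is_rho_def)
  then obtain f where f: "f \<in> linear_maps \<rho> trivial_rep" "inj_on f (carrier \<rho>)"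
    "\<And>g v. invertible g \<Longrightarrow> v \<in> carrier \<rho> \<Longrightarrow> f (act \<rho> g v) = \<eta> (det g) * f v"
    by (auto simp: rep_isomorphic_def rep_iso_map_def rep_hom_def linear_maps_def bij_betw_def)
  have act: "act \<rho> g v = \<eta> (det g) \<odot>\<^bsub>\<rho>\<^esub> v" if "invertible g" "v \<in> carrier \<rho>" for g v
    using inj_onD[OF f(2), of "act \<rho> g v" "\<eta> (det g) \<odot>\<^bsub>\<rho>\<^esub> v"] that f(3)[OF that]
      linear_mapsD(3)[OF f(1) that(2)] by simp
  obtain \<eta>' h where eta': "\<forall>x. x \<noteq> 0 \<longrightarrow> \<eta>' x \<noteq> 0"
      "\<forall>x y. x \<noteq> 0 \<and> y \<noteq> 0 \<longrightarrow> \<eta>' (x * y) = \<eta>' x * \<eta>' y"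
      "\<forall>h\<in>torus2. chi' h = \<eta>' (det h)"
      and h: "rep_iso_map (carrier GL2) \<rho>' (twist_det \<eta>' steinberg) h"
    using assms(2,4) smat_ne by (auto simp: is_rho_def rep_isomorphic_def)
  interpret S: steinberg_twist \<rho>' \<eta>' h
    using eta' h by unfold_locales auto
  have "\<eta> x = \<eta>' x" if "x \<noteq> 0" for x
  proof -
    have "diag2 x 1 \<in> torus2"
      using that by simp
    then show ?thesis
      using eta eta'(3) chi[of "diag2 x 1"] by (auto simp: det_2)
  qed
  then have "\<eta> (det g) = \<eta>' (det g)" if "invertible g" for g :: "'a^2^2"
    using that by (simp add: invertible_det_nz)
  then have "v = \<zero>\<^bsub>\<rho>'\<^esub>" if "v \<in> carrier \<rho>'" "\<forall>g. invertible g \<longrightarrow> act \<rho>' g v = \<eta> (det g) \<odot>\<^bsub>\<rho>'\<^esub> v" for v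
    using S.no_character[OF that(1)] that(2) by simp
  with act show ?thesis
    by blast
qed

subsection \<open>Valuations\<close>

locale local_field_loc =
  fixes F :: "('f::field, 'q::finite_field) local_field_data"
  assumes local_field: "local_field F"
begin

abbreviation v where "v \<equiv> val F"
abbreviation R where "R \<equiv> valuation_ring F"
abbreviation \<pi> where "\<pi> \<equiv> unif F"

text \<open>The value of \<^term>\<open>v 0\<close> is unspecified, hence the separate case.\<close>

definition vge :: "int \<Rightarrow> 'f \<Rightarrow> bool" where "vge m x \<longleftrightarrow> x = 0 \<or> m \<le> v x"

lemma mem_R_iff: "x \<in> R \<longleftrightarrow> vge 0 x"
  by (simp add: valuation_ring_def vge_def)

lemma v_mult: "x \<noteq> 0 \<Longrightarrow> y \<noteq> 0 \<Longrightarrow> v (x * y) = v x + v y"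
  and v_unif [simp]: "v \<pi> = 1" and unif_nz [simp]: "\<pi> \<noteq> 0"
  using local_field by (simp_all add: local_field_def)

lemma v_one [simp]: "v 1 = 0"
  using v_mult[of 1 1] by simp

lemma v_minus [simp]: "v (- x) = v x"
proof (cases "x = 0")
  case False
  have "v (- 1) = 0"
    using v_mult[of "- 1" "- 1"] by simp
  then show ?thesis
    using v_mult[of "- 1" x] False by simp
qed simp

lemma v_inverse [simp]: "x \<noteq> 0 \<Longrightarrow> v (inverse x) = - v x"
  using v_mult[of x "inverse x"] by simp

lemma v_divide: "x \<noteq> 0 \<Longrightarrow> y \<noteq> 0 \<Longrightarrow> v (x / y) = v x - v y"
  by (simp add: divide_inverse v_mult)

lemma v_power: "x \<noteq> 0 \<Longrightarrow> v (x ^ n) = int n * v x"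
  by (induction n) (auto simp: v_mult algebra_simps)

lemma v_power_int: "x \<noteq> 0 \<Longrightarrow> v (x powi j) = j * v x"
  by (cases j rule: int_cases2) (auto simp: power_int_minus v_power)

lemma vge_0 [simp]: "vge m 0"
  by (simp add: vge_def)

lemma vge_add: "vge m x \<Longrightarrow> vge m y \<Longrightarrow> vge m (x + y)"
proof (cases "x = 0 \<or> y = 0 \<or> x + y = 0")
  case False
  then have "min (v x) (v y) \<le> v (x + y)"
    using local_field by (simp add: local_field_def)
  then show "vge m x \<Longrightarrow> vge m y \<Longrightarrow> vge m (x + y)"
    using False by (auto simp: vge_def)
qed (auto simp: vge_def)

lemma vge_minus [simp]: "vge m (- x) \<longleftrightarrow> vge m x"
  by (simp add: vge_def)

lemma vge_diff: "vge m x \<Longrightarrow> vge m y \<Longrightarrow> vge m (x - y)"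
  using vge_add[of m x "- y"] by simp

lemma vge_mult: "vge m x \<Longrightarrow> vge n y \<Longrightarrow> vge (m + n) (x * y)"
  by (cases "x = 0"; cases "y = 0") (auto simp: vge_def v_mult)

lemma vge_mult_0: "vge 0 x \<Longrightarrow> vge 0 y \<Longrightarrow> vge 0 (x * y)"
  and vge_mult_1: "vge 0 x \<Longrightarrow> vge 1 y \<Longrightarrow> vge 1 (x * y)"
  and vge_mult_1': "vge 1 x \<Longrightarrow> vge 0 y \<Longrightarrow> vge 1 (x * y)"
  using vge_mult[of 0 x 0 y] vge_mult[of 0 x 1 y] vge_mult[of 1 x 0 y] by auto

lemma vge_one [simp]: "vge 0 1" and vge_unif [simp]: "vge 1 \<pi>" "vge 0 \<pi>"
  by (simp_all add: vge_def)

lemma vge_divide_unit: "vge m x \<Longrightarrow> y \<noteq> 0 \<Longrightarrow> v y = 0 \<Longrightarrow> vge m (x / y)"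
  by (cases "x = 0") (auto simp: vge_def v_divide)

lemma vge_unit_mult: "u \<noteq> 0 \<Longrightarrow> v u = 0 \<Longrightarrow> vge m (u * x) \<longleftrightarrow> vge m x"
  by (cases "x = 0") (auto simp: vge_def v_mult)

lemma vge_unif_divide_iff: "vge m (x / \<pi>) \<longleftrightarrow> vge (m + 1) x"
  by (cases "x = 0") (auto simp: vge_def v_divide)

lemma vge_inverse_unif_iff: "vge 0 (inverse \<pi> * x) \<longleftrightarrow> vge 1 x"
  using vge_unif_divide_iff[of 0 x] by (simp add: divide_inverse mult.commute)

lemmas vge_intros = vge_add vge_diff vge_mult_0 vge_mult_1 vge_mult_1'

lemma res_add: "vge 0 x \<Longrightarrow> vge 0 y \<Longrightarrow> res F (x + y) = res F x + res F y"
  and res_mult: "vge 0 x \<Longrightarrow> vge 0 y \<Longrightarrow> res F (x * y) = res F x * res F y"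
  and res_one [simp]: "res F 1 = 1"
  and res_eq_0_iff: "vge 0 x \<Longrightarrow> res F x = 0 \<longleftrightarrow> vge 1 x"
  using local_field by (simp_all add: local_field_def mem_R_iff[symmetric]) (simp add: vge_def)

lemma res_surj: "\<exists>x. vge 0 x \<and> res F x = y"
  using local_field unfolding local_field_def mem_R_iff[symmetric] by (metis UNIV_I imageE)

lemma res_0 [simp]: "res F 0 = 0"
  by (simp add: res_eq_0_iff)

lemma res_minus: "vge 0 x \<Longrightarrow> res F (- x) = - res F x"
  using res_add[of x "- x"] by (simp add: eq_neg_iff_add_eq_0 add.commute)

lemma res_diff: "vge 0 x \<Longrightarrow> vge 0 y \<Longrightarrow> res F (x - y) = res F x - res F y"
  using res_add[of x "- y"] res_minus[of y] by simp

lemma unit_iff: "vge 0 x \<Longrightarrow> res F x \<noteq> 0 \<longleftrightarrow> x \<noteq> 0 \<and> v x = 0"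
  by (auto simp: res_eq_0_iff) (auto simp: vge_def)

subsection \<open>The group of integral matrices\<close>

lemma forall_ij: "(\<forall>(i::2) (j::2). P i j) \<longleftrightarrow> P 1 1 \<and> P 1 2 \<and> P 2 1 \<and> P 2 2"
  by (auto simp: forall_2)

definition integral2 :: "'f^2^2 \<Rightarrow> bool" where
  "integral2 g \<longleftrightarrow> vge 0 (g$1$1) \<and> vge 0 (g$1$2) \<and> vge 0 (g$2$1) \<and> vge 0 (g$2$2)"

abbreviation K where "K \<equiv> max_compact F"

lemma mem_K_iff: "g \<in> K \<longleftrightarrow> integral2 g \<and> det g \<noteq> 0 \<and> v (det g) = 0"
  by (auto simp: max_compact_def integral2_def mem_R_iff forall_ij)

lemma integral2_mult: "integral2 g \<Longrightarrow> integral2 h \<Longrightarrow> integral2 (g ** h)"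
  by (simp add: integral2_def vge_intros)

lemma integral2_det: "integral2 g \<Longrightarrow> vge 0 (det g)"
  by (simp add: integral2_def det_2 vge_intros)

lemma matrix_inv_2:
  assumes "invertible (g :: 'f^2^2)"
  shows "matrix_inv g = mat2 (g$2$2 / det g) (- g$1$2 / det g) (- g$2$1 / det g) (g$1$1 / det g)"
proof (rule matrix_inv_unique_right(1))
  have "det g \<noteq> 0"
    using assms by (simp add: invertible_det_nz)
  then show "g ** mat2 (g$2$2 / det g) (- g$1$2 / det g) (- g$2$1 / det g) (g$1$1 / det g) = mat 1"
    by (simp add: matrix_eq_2 divide_simps) (simp add: det_2 mult.commute)
qed

lemma K_invertible: "g \<in> K \<Longrightarrow> invertible g"
  by (simp add: mem_K_iff invertible_det_nz)

lemma K_mult: "g \<in> K \<Longrightarrow> h \<in> K \<Longrightarrow> g ** h \<in> K"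
  by (simp add: mem_K_iff integral2_mult det_mul v_mult)

lemma K_inv: "g \<in> K \<Longrightarrow> matrix_inv g \<in> K"
proof -
  assume g: "g \<in> K"
  have "det (matrix_inv g) * det g = 1"
    using K_invertible[OF g] by (simp flip: det_mul)
  moreover from this have "det (matrix_inv g) \<noteq> 0"
    by auto
  ultimately have "det (matrix_inv g) \<noteq> 0" "v (det (matrix_inv g)) = 0"
    using g v_mult[of "det (matrix_inv g)" "det g"] by (auto simp: mem_K_iff)
  moreover have "integral2 (matrix_inv g)"
    using g by (auto simp: matrix_inv_2[OF K_invertible[OF g]] mem_K_iff integral2_def
        intro!: vge_divide_unit)
  ultimately show ?thesis
    by (simp add: mem_K_iff)
qed

lemma K_one [simp]: "mat 1 \<in> K" and K_smat: "smat \<in> K"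
  by (simp_all add: mem_K_iff integral2_def det_2)

lemma reduction_nth: "reduction F g $ i $ j = res F (g$i$j)"
  by (simp add: reduction_def)

lemma reduction_mult: "integral2 g \<Longrightarrow> integral2 h \<Longrightarrow> reduction F (g ** h) = reduction F g ** reduction F h"
  by (simp add: matrix_eq_2 reduction_nth integral2_def res_add res_mult vge_intros)

lemma reduction_one [simp]: "reduction F (mat 1) = mat 1"
  by (simp add: matrix_eq_2 reduction_nth)

lemma det_reduction: "integral2 g \<Longrightarrow> det (reduction F g) = res F (det g)"
  by (simp add: det_2 reduction_nth integral2_def res_diff res_mult vge_intros)

lemma K_reduction: "integral2 g \<Longrightarrow> g \<in> K \<longleftrightarrow> invertible (reduction F g)"
  by (simp add: mem_K_iff invertible_det_nz det_reduction unit_iff integral2_det)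

lemma K_integral: "g \<in> K \<Longrightarrow> integral2 g"
  by (simp add: mem_K_iff)

text \<open>Lift the entries one by one; by \<open>K_reduction\<close> the determinant of the lift
  is then automatically a unit.\<close>

lemma reduction_surj:
  assumes "invertible \<gamma>"
  shows "\<exists>g\<in>K. reduction F g = \<gamma>"
proof -
  obtain s where s: "\<And>y. vge 0 (s y)" "\<And>y. res F (s y) = y"
    using res_surj by metis
  define g where "g = mat2 (s (\<gamma>$1$1)) (s (\<gamma>$1$2)) (s (\<gamma>$2$1)) (s (\<gamma>$2$2))"
  have "integral2 g" "reduction F g = \<gamma>"
    using s by (simp_all add: g_def integral2_def matrix_eq_2 reduction_nth)
  with assms show ?thesis
    using K_reduction by auto
qed

abbreviation I where "I \<equiv> iwahori F"

lemma mem_I_iff: "g \<in> I \<longleftrightarrow> g \<in> K \<and> vge 1 (g$2$1)"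
  using K_reduction[of g]
  by (auto simp: iwahori_def borel2_def reduction_nth res_eq_0_iff mem_K_iff integral2_def)

lemma I_K: "g \<in> I \<Longrightarrow> g \<in> K"
  by (simp add: mem_I_iff)

lemma I_mult: "g \<in> I \<Longrightarrow> h \<in> I \<Longrightarrow> g ** h \<in> I"
  by (simp add: mem_I_iff K_mult) (simp add: mem_K_iff integral2_def vge_intros)

lemma I_inv: "g \<in> I \<Longrightarrow> matrix_inv g \<in> I"
proof -
  assume g: "g \<in> I"
  then have "(matrix_inv g)$2$1 = - (g$2$1 / det g)"
    by (simp add: matrix_inv_2[OF K_invertible[OF I_K]])
  moreover have "vge 1 (g$2$1 / det g)"
    using g by (intro vge_divide_unit) (auto simp: mem_I_iff mem_K_iff)
  ultimately show ?thesis
    using g K_inv by (simp add: mem_I_iff)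
qed

lemma I_one [simp]: "mat 1 \<in> I"
  by (simp add: mem_I_iff)

subsection \<open>Centre, uniformiser and stabilisers\<close>

lemma mat_comm: "mat c ** g = g ** mat c" for g :: "'f^2^2"
  by (simp add: matrix_eq_2 mult.commute)

lemma mat_mat: "mat c ** mat d = (mat (c * d) :: 'f^2^2)"
  by (simp add: matrix_eq_2)

lemma invertible_mat [simp]: "invertible (mat c :: 'f^2^2) \<longleftrightarrow> c \<noteq> 0"
  by (simp add: invertible_2)

lemma matrix_inv_mat: "c \<noteq> 0 \<Longrightarrow> matrix_inv (mat c :: 'f^2^2) = mat (inverse c)"
  by (rule matrix_inv_unique_right(1)) (simp add: mat_mat)

lemma det_mat [simp]: "det (mat c :: 'f^2^2) = c * c"
  by (simp add: det_2)

abbreviation FK where "FK \<equiv> ZK F"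
abbreviation FI where "FI \<equiv> ZI F"

text \<open>Common form of \<open>ZK F\<close> and \<open>ZI F\<close>, so that both are shown to be
  closed under products and inverses at once.\<close>

definition F_closure :: "('f^2^2) set \<Rightarrow> ('f^2^2) set" where
  "F_closure S = {mat c ** k | c k. c \<noteq> 0 \<and> k \<in> S}"

lemma FK_eq: "FK = F_closure K" and FI_eq: "FI = F_closure I"
  by (simp_all add: ZK_def ZI_def F_closure_def)

lemma F_closure_mult:
  assumes "\<And>g h. g \<in> S \<Longrightarrow> h \<in> S \<Longrightarrow> g ** h \<in> S" "g \<in> F_closure S" "h \<in> F_closure S"
  shows "g ** h \<in> F_closure S"
proof -
  obtain c k d l where *: "g = mat c ** k" "h = mat d ** l" "c \<noteq> 0" "d \<noteq> 0" "k \<in> S" "l \<in> S"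
    using assms(2,3) by (auto simp: F_closure_def)
  have "g ** h = mat c ** (k ** mat d) ** l"
    by (simp add: * matrix_mul_assoc)
  also have "k ** mat d = mat d ** k"
    by (rule mat_comm[symmetric])
  also have "mat c ** (mat d ** k) ** l = mat (c * d) ** (k ** l)"
    by (simp add: mat_mat matrix_mul_assoc)
  finally show ?thesis
    using * assms(1) unfolding F_closure_def by (metis (mono_tags, lifting) CollectI mult_eq_0_iff)
qed

lemma F_closure_inv:
  assumes "\<And>g. g \<in> S \<Longrightarrow> matrix_inv g \<in> S" "S \<subseteq> K" "g \<in> F_closure S"
  shows "matrix_inv g \<in> F_closure S"
proof -
  obtain c k where *: "g = mat c ** k" "c \<noteq> 0" "k \<in> S"
    using assms(3) by (auto simp: F_closure_def)
  then have "invertible k"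
    using K_invertible assms(2) by blast
  then have "matrix_inv g = matrix_inv k ** mat (inverse c)"
    using * by (simp add: matrix_inv_matrix_mult matrix_inv_mat)
  then have "matrix_inv g = mat (inverse c) ** matrix_inv k"
    by (simp only: mat_comm)
  then show ?thesis
    using * assms(1) unfolding F_closure_def by (metis (mono_tags, lifting) CollectI inverse_nonzero_iff_nonzero)
qed

lemma FK_mult: "g \<in> FK \<Longrightarrow> h \<in> FK \<Longrightarrow> g ** h \<in> FK"
  and FI_mult: "g \<in> FI \<Longrightarrow> h \<in> FI \<Longrightarrow> g ** h \<in> FI"
  unfolding FK_eq FI_eq by (rule F_closure_mult; use K_mult I_mult in blast)+

lemma FK_inv: "g \<in> FK \<Longrightarrow> matrix_inv g \<in> FK"
  and FI_inv: "g \<in> FI \<Longrightarrow> matrix_inv g \<in> FI"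
  unfolding FK_eq FI_eq by (rule F_closure_inv; use K_inv I_inv I_K in blast)+

lemma mat_mult_mem_FK: "c \<noteq> 0 \<Longrightarrow> k \<in> K \<Longrightarrow> mat c ** k \<in> FK"
  and mat_mult_mem_FI: "c \<noteq> 0 \<Longrightarrow> i \<in> I \<Longrightarrow> mat c ** i \<in> FI"
  by (auto simp: FK_eq FI_eq F_closure_def)

lemma K_FK: "k \<in> K \<Longrightarrow> k \<in> FK" and I_FI: "i \<in> I \<Longrightarrow> i \<in> FI"
  and mat_FK: "c \<noteq> 0 \<Longrightarrow> mat c \<in> FK" and mat_FI: "c \<noteq> 0 \<Longrightarrow> mat c \<in> FI"
  using mat_mult_mem_FK[of 1 k] mat_mult_mem_FI[of 1 i] mat_mult_mem_FK[of c "mat 1"]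
    mat_mult_mem_FI[of c "mat 1"] by simp_all

lemma FI_FK: "g \<in> FI \<Longrightarrow> g \<in> FK"
  using I_K by (auto simp: FK_eq FI_eq F_closure_def)

lemma FK_invertible: "g \<in> FK \<Longrightarrow> invertible g"
  using K_invertible by (auto simp: FK_eq F_closure_def)

lemma FK_one [simp]: "mat 1 \<in> FK" and FI_one [simp]: "mat 1 \<in> FI"
  by (simp_all add: mat_FK mat_FI)

text \<open>Parity of the valuation of the determinant keeps \<Pi> out of \<open>ZK F\<close> and
  thereby, in \<open>vtx_Pi_ne\<close>, the two ends of an edge apart.\<close>

lemma even_v_det_FK: "g \<in> FK \<Longrightarrow> even (v (det g))"
  by (auto simp: FK_eq F_closure_def mem_K_iff det_mul v_mult)

lemma unif_decomp:
  assumes "c \<noteq> 0"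
  obtains u where "c = \<pi> powi (v c) * u" "u \<noteq> 0" "v u = 0"
proof
  show "c = \<pi> powi (v c) * (c / \<pi> powi (v c))"
    by simp
  show "c / \<pi> powi (v c) \<noteq> 0" "v (c / \<pi> powi (v c)) = 0"
    using assms by (simp_all add: v_divide v_power_int)
qed

lemma mat_unit_K: "u \<noteq> 0 \<Longrightarrow> v u = 0 \<Longrightarrow> mat u ** k \<in> K \<longleftrightarrow> k \<in> K"
  by (auto simp: mem_K_iff integral2_def det_mul v_mult vge_unit_mult)

lemma K_part_unique:
  assumes "mat (\<pi> powi i) ** k = mat (\<pi> powi j) ** l" "k \<in> K" "l \<in> K"
  shows "i = j" "k = l"
proof -
  have "\<pi> powi i * \<pi> powi i * det k = \<pi> powi j * \<pi> powi j * det l"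
    using arg_cong[OF assms(1), of det] by (simp add: det_mul)
  then have "v (\<pi> powi i * \<pi> powi i * det k) = v (\<pi> powi j * \<pi> powi j * det l)"
    by simp
  then show "i = j"
    using assms(2,3) by (simp add: v_mult v_power_int mem_K_iff)
  then have "matrix_inv (mat (\<pi> powi i)) ** (mat (\<pi> powi i) ** k) =
      matrix_inv (mat (\<pi> powi i)) ** (mat (\<pi> powi i) ** l)"
    using assms(1) by simp
  then show "k = l"
    by simp
qed

text \<open>The unit part of the scalar is absorbed into \<open>K\<close>, which leaves a power of
  the uniformiser; that power is determined by the valuation of the determinant.\<close>

lemma K_part:
  assumes "g \<in> FK"
  shows "K_part F g \<in> K \<and> (\<exists>j. g = mat (\<pi> powi j) ** K_part F g)"
  unfolding K_part_def
proof (rule theI')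
  obtain c k where *: "g = mat c ** k" "c \<noteq> 0" "k \<in> K"
    using assms by (auto simp: FK_eq F_closure_def)
  obtain u where u: "c = \<pi> powi (v c) * u" "u \<noteq> 0" "v u = 0"
    using unif_decomp[OF *(2)] .
  then have "g = mat (\<pi> powi (v c)) ** (mat u ** k)" "mat u ** k \<in> K"
    using * by (simp_all add: matrix_mul_assoc mat_mat mat_unit_K flip: u(1))
  then show "\<exists>!k. k \<in> K \<and> (\<exists>j. g = mat (\<pi> powi j) ** k)"
    using K_part_unique by (intro ex1I[of _ "mat u ** k"]) blast+
qed

lemma K_part_eqI: "k \<in> K \<Longrightarrow> K_part F (mat (\<pi> powi j) ** k) = k"
  using K_part[of "mat (\<pi> powi j) ** k"] K_part_unique mat_mult_mem_FK[of "\<pi> powi j" k] by fastforce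

lemma K_part_K: "k \<in> K \<Longrightarrow> K_part F k = k"
  using K_part_eqI[of k 0] by simp

lemma K_part_mult:
  assumes "g \<in> FK" "h \<in> FK"
  shows "K_part F (g ** h) = K_part F g ** K_part F h"
proof -
  obtain i j where *: "g = mat (\<pi> powi i) ** K_part F g" "h = mat (\<pi> powi j) ** K_part F h"
    using K_part assms by blast
  have "g ** h = mat (\<pi> powi i) ** (K_part F g ** mat (\<pi> powi j)) ** K_part F h"
    by (subst *(1), subst *(2)) (simp add: matrix_mul_assoc)
  also have "K_part F g ** mat (\<pi> powi j) = mat (\<pi> powi j) ** K_part F g"
    by (rule mat_comm[symmetric])
  also have "mat (\<pi> powi i) ** (mat (\<pi> powi j) ** K_part F g) ** K_part F h =
      mat (\<pi> powi (i + j)) ** (K_part F g ** K_part F h)"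
    by (simp add: matrix_mul_assoc mat_mat power_int_add)
  finally show ?thesis
    using K_part_eqI K_mult K_part assms by simp
qed

abbreviation \<Pi>0 where "\<Pi>0 \<equiv> Pi_mat F"

lemma Pi_nth [simp]: "\<Pi>0$1$1 = 0" "\<Pi>0$1$2 = 1" "\<Pi>0$2$1 = \<pi>" "\<Pi>0$2$2 = 0"
  by (simp_all add: Pi_mat_def)

lemma invertible_Pi [simp]: "invertible \<Pi>0"
  by (simp add: invertible_2)

lemma Pi_Pi: "\<Pi>0 ** \<Pi>0 = mat \<pi>"
  by (simp add: matrix_eq_2)

lemma matrix_inv_Pi: "matrix_inv \<Pi>0 = mat2 0 (inverse \<pi>) 1 0"
  by (rule matrix_inv_unique_right(1)) (simp add: matrix_eq_2)

lemma matrix_inv_Pi_eq: "matrix_inv \<Pi>0 = mat (inverse \<pi>) ** \<Pi>0"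
  by (simp add: matrix_inv_Pi matrix_eq_2)

lemma Pi_not_FK: "\<Pi>0 \<notin> FK"
  using even_v_det_FK[of \<Pi>0] by (auto simp: det_2)

lemma Pi_conj_eq: "matrix_inv \<Pi>0 ** k ** \<Pi>0 = mat2 (k$2$2) (k$2$1 / \<pi>) (k$1$2 * \<pi>) (k$1$1)"
  by (simp add: matrix_inv_Pi matrix_eq_2 field_simps)

text \<open>The conjugate has the entry \<open>k$2$1 / \<pi>\<close>, whose integrality is the
  Iwahori condition.\<close>

lemma Pi_conj_K: "k \<in> K \<Longrightarrow> matrix_inv \<Pi>0 ** k ** \<Pi>0 \<in> K \<longleftrightarrow> k \<in> I"
  by (simp add: Pi_conj_eq mem_I_iff mem_K_iff integral2_def det_2 vge_unif_divide_iff vge_mult_0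
      mult.commute)

lemma Pi_conj_I: "k \<in> I \<Longrightarrow> matrix_inv \<Pi>0 ** k ** \<Pi>0 \<in> I"
  using Pi_conj_K[of k] by (simp add: Pi_conj_eq mem_I_iff mem_K_iff integral2_def vge_mult_1)

lemma conj_mat: "invertible h \<Longrightarrow> matrix_inv h ** (mat c ** g) ** h = mat c ** (matrix_inv h ** g ** h)"
  for h :: "'f^2^2"
  by (metis mat_comm matrix_mul_assoc)

lemma Pi_conj_FI: "g \<in> FI \<Longrightarrow> matrix_inv \<Pi>0 ** g ** \<Pi>0 \<in> FI"
  using Pi_conj_I unfolding FI_eq F_closure_def by (auto simp: conj_mat) blast

text \<open>Together with \<open>Pi_conj_FI\<close>: the subgroup fixing both ends of the standard
  edge is \<open>ZI F\<close>. Since conjugation preserves determinants, the scalar \<open>d\<close>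
  in the conjugate of \<open>k\<close> is a unit and can be moved into \<open>K\<close>.\<close>

lemma Pi_conj_FK:
  assumes g: "g \<in> FK" and conj: "matrix_inv \<Pi>0 ** g ** \<Pi>0 \<in> FK"
  shows "g \<in> FI"
proof -
  obtain c k where *: "g = mat c ** k" "c \<noteq> 0" "k \<in> K"
    using g by (auto simp: FK_eq F_closure_def)
  let ?h = "matrix_inv \<Pi>0 ** k ** \<Pi>0"
  have "mat (inverse c) ** (matrix_inv \<Pi>0 ** g ** \<Pi>0) = ?h"
    using *(2) by (simp only: *(1) conj_mat[OF invertible_Pi]) (simp add: matrix_mul_assoc mat_mat)
  then have "?h \<in> FK"
    using conj mat_FK[of "inverse c"] FK_mult * by (metis inverse_nonzero_iff_nonzero)
  then obtain d l where dl: "?h = mat d ** l" "d \<noteq> 0" "l \<in> K"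
    by (auto simp: FK_eq F_closure_def)
  have "det ?h = det k"
    by (simp add: det_2 matrix_inv_Pi field_simps)
  then have "v (d * d * det l) = v (det k)"
    using dl by (simp add: det_mul)
  then have "v d = 0"
    using dl * by (simp add: v_mult mem_K_iff)
  then have "?h \<in> K"
    using dl by (simp add: mat_unit_K)
  then have "k \<in> I"
    using * by (simp add: Pi_conj_K)
  then show ?thesis
    using * by (simp add: mat_mult_mem_FI)
qed

lemma group_GL2: "group (GL2 :: ('f^2^2) monoid)"
proof (rule groupI)
  fix x :: "'f^2^2" assume "x \<in> carrier GL2"
  then show "\<exists>y\<in>carrier GL2. y \<otimes>\<^bsub>GL2\<^esub> x = \<one>\<^bsub>GL2\<^esub>"
    by (intro bexI[of _ "matrix_inv x"]) auto
qed (simp_all add: invertible_mult matrix_mul_assoc)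

lemma inv_GL2: "invertible g \<Longrightarrow> inv\<^bsub>GL2\<^esub> g = matrix_inv g" for g :: "'f^2^2"
  using group.inv_equality[OF group_GL2, of "matrix_inv g" g] by simp

abbreviation SE where "SE \<equiv> stab_edge F"

lemma SE_one [simp]: "mat 1 \<in> SE"
  using generate.one[of GL2] by (simp add: stab_edge_def)

lemma SE_mult: "g \<in> SE \<Longrightarrow> h \<in> SE \<Longrightarrow> g ** h \<in> SE"
  using generate.eng[of g GL2 _ h] by (simp add: stab_edge_def)

lemma Pi_SE [simp]: "\<Pi>0 \<in> SE" and inv_Pi_SE [simp]: "matrix_inv \<Pi>0 \<in> SE" and I_SE: "g \<in> I \<Longrightarrow> g \<in> SE"
  using generate.incl[of \<Pi>0 "insert \<Pi>0 I" GL2] generate.inv[of \<Pi>0 "insert \<Pi>0 I" GL2]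
    generate.incl[of g "insert \<Pi>0 I" GL2] by (simp_all add: stab_edge_def inv_GL2)

lemma mat_powi_SE: "mat (\<pi> powi j) \<in> SE"
proof -
  have "mat (\<pi> ^ n) \<in> SE" "mat (inverse \<pi> ^ n) \<in> SE" for n
  proof (induction n)
    case (Suc n)
    have "mat (inverse \<pi>) = matrix_inv \<Pi>0 ** matrix_inv \<Pi>0"
      by (simp add: matrix_inv_Pi matrix_eq_2)
    then have "mat \<pi> \<in> SE" "mat (inverse \<pi>) \<in> SE"
      using SE_mult[of \<Pi>0 \<Pi>0] SE_mult[of "matrix_inv \<Pi>0" "matrix_inv \<Pi>0"] by (simp_all add: Pi_Pi)
    with Suc show "mat (\<pi> ^ Suc n) \<in> SE" "mat (inverse \<pi> ^ Suc n) \<in> SE"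
      using SE_mult by (simp_all add: mat_mat[symmetric])
  qed simp_all
  then show ?thesis
    by (simp add: power_int_def)
qed

lemma FI_SE: "g \<in> FI \<Longrightarrow> g \<in> SE"
proof -
  assume "g \<in> FI"
  then obtain c k where *: "g = mat c ** k" "c \<noteq> 0" "k \<in> I"
    by (auto simp: FI_eq F_closure_def)
  obtain u where u: "c = \<pi> powi (v c) * u" "u \<noteq> 0" "v u = 0"
    using unif_decomp[OF *(2)] .
  then have "g = mat (\<pi> powi (v c)) ** (mat u ** k)"
    using * by (simp add: matrix_mul_assoc mat_mat flip: u(1))
  moreover have "mat u ** k \<in> I"
    using * u by (simp add: mem_I_iff mat_unit_K vge_unit_mult)
  ultimately show ?thesis
    using SE_mult[OF mat_powi_SE I_SE] by simp
qed

text \<open>\<open>stab_edge\<close> is given by generators; as \<Pi> normalises \<open>ZI F\<close>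
  and its square is a scalar, the words in the generators fill just two cosets.\<close>

lemma SE_cases:
  assumes "g \<in> SE"
  obtains "g \<in> FI" | z where "z \<in> FI" "g = \<Pi>0 ** z"
proof -
  have PiPi: "\<Pi>0 ** (\<Pi>0 ** z) = mat \<pi> ** z" for z
    by (simp add: matrix_mul_assoc Pi_Pi)
  have zPi: "z ** \<Pi>0 = \<Pi>0 ** (matrix_inv \<Pi>0 ** z ** \<Pi>0)" for z
    by (simp add: matrix_mul_assoc)
  have "g \<in> FI \<or> (\<exists>z\<in>FI. g = \<Pi>0 ** z)"
    using assms unfolding stab_edge_def
  proof (induction g rule: generate.induct)
    case one
    then show ?case by simp
  next
    case (incl h)
    then show ?case
      using I_FI FI_one by (metis insertE matrix_mul_rid)
  next
    case (inv h)
    then show ?case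
    proof
      assume "h = \<Pi>0"
      then show ?thesis
        using mat_FI[of "inverse \<pi>"] by (auto simp: inv_GL2 matrix_inv_Pi_eq mat_comm[of _ \<Pi>0])
    next
      assume "h \<in> I"
      then show ?thesis
        using I_FI I_inv K_invertible I_K by (simp add: inv_GL2)
    qed
  next
    case (eng h1 h2)
    have conj: "h ** (\<Pi>0 ** z) = \<Pi>0 ** ((matrix_inv \<Pi>0 ** h ** \<Pi>0) ** z)" for h z
      by (simp add: matrix_mul_assoc)
    from eng.IH consider "h1 \<in> FI" "h2 \<in> FI" | z where "z \<in> FI" "h2 = \<Pi>0 ** z" "h1 \<in> FI"
      | z where "z \<in> FI" "h1 = \<Pi>0 ** z" "h2 \<in> FI"
      | z z' where "z \<in> FI" "z' \<in> FI" "h1 = \<Pi>0 ** z" "h2 = \<Pi>0 ** z'"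
      by blast
    then show ?case
    proof cases
      case 1
      then show ?thesis by (simp add: FI_mult)
    next
      case (2 z)
      then show ?thesis
        using FI_mult[OF Pi_conj_FI[OF 2(3)] 2(1)] conj[of h1 z] by auto
    next
      case (3 z)
      then show ?thesis
        using FI_mult by (auto simp flip: matrix_mul_assoc)
    next
      case (4 z z')
      have "h1 ** h2 = \<Pi>0 ** (z ** (\<Pi>0 ** z'))"
        by (simp add: 4 matrix_mul_assoc)
      also have "\<dots> = mat \<pi> ** ((matrix_inv \<Pi>0 ** z ** \<Pi>0) ** z')"
        by (simp only: conj[of z z'] PiPi)
      finally show ?thesis
        using FI_mult[OF mat_FI FI_mult[OF Pi_conj_FI]] 4 by simp
    qed
  qed
  then show ?thesis
    using that by blast
qed

lemma SE_invertible: "g \<in> SE \<Longrightarrow> invertible g"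
  using FK_invertible FI_FK by (elim SE_cases) (auto simp: invertible_mult)

lemma SE_inv: "g \<in> SE \<Longrightarrow> matrix_inv g \<in> SE"
proof (elim SE_cases)
  fix z assume "z \<in> FI" "g = \<Pi>0 ** z"
  then show ?thesis
    using FI_SE[OF FI_inv] SE_mult FK_invertible[OF FI_FK] by (simp add: matrix_inv_matrix_mult)
qed (use FI_inv FI_SE in blast)

subsection \<open>The tree\<close>

abbreviation L0 where "L0 \<equiv> lattice0 F"
abbreviation img :: "'f^2^2 \<Rightarrow> ('f^2) set \<Rightarrow> ('f^2) set" where "img g L \<equiv> (\<lambda>x. g *v x) ` L"

text \<open>The parametrisation of the vertices by the cosets \<open>g F^x K\<close>; see
  \<open>vtx_eq_iff\<close> and \<open>vertices_eq\<close>.\<close>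

definition vtx :: "'f^2^2 \<Rightarrow> 'f vertex" where "vtx g = homothety_class (img g L0)"

lemma mv_nth: "((g :: 'f^2^2) *v x)$i = g$i$1 * x$1 + g$i$2 * x$2"
  by (simp add: matrix_vector_mult_def sum_2)

lemma vec2_eq_iff: "(x :: 'f^2) = y \<longleftrightarrow> x$1 = y$1 \<and> x$2 = y$2"
  by (simp add: vec_eq_iff forall_2)

lemma mem_L0_iff: "x \<in> L0 \<longleftrightarrow> vge 0 (x$1) \<and> vge 0 (x$2)"
  by (simp add: lattice0_def mem_R_iff forall_2)

lemma img_mult: "img (g ** h) L = img g (img h L)"
  by (simp add: image_image matrix_vector_mul_assoc)

lemma smult_img: "(\<lambda>x. c *s x) ` L = img (mat c) L" for L :: "('f^2) set"
  by (intro image_cong) (auto simp: vec2_eq_iff mv_nth)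

lemma img_inv [simp]: "invertible g \<Longrightarrow> img (matrix_inv g) (img g L) = L"
  "invertible g \<Longrightarrow> img g (img (matrix_inv g) L) = L"
  by (simp_all flip: img_mult del: image_image)

lemma homothety_class_eq: "homothety_class L = {img (mat c) L | c. c \<noteq> 0}" for L :: "('f^2) set"
  by (simp add: homothety_class_def smult_img)

lemma homothety_class_mem: "L' \<in> homothety_class L \<Longrightarrow> homothety_class L' = homothety_class L"
  for L :: "('f^2) set"
proof -
  assume "L' \<in> homothety_class L"
  then obtain c where c: "c \<noteq> 0" "L' = img (mat c) L"
    by (auto simp: homothety_class_eq)
  have "img (mat d) L' = img (mat (d * c)) L" for d
    by (simp add: c flip: img_mult mat_mat del: image_image)
  moreover have "img (mat d) L = img (mat (d / c)) L'" for d
    using c(1) by (simp add: c(2) mat_mat flip: img_mult del: image_image)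
  ultimately show ?thesis
    using c(1) unfolding homothety_class_eq by (safe; metis divide_eq_0_iff mult_eq_0_iff)
qed

lemma homothety_class_self: "L \<in> homothety_class L" for L :: "('f^2) set"
  unfolding homothety_class_eq by (rule CollectI, rule exI[of _ 1]) simp

lemma vertex_act_class: "vertex_act g (homothety_class L) = homothety_class (img g L)" for L :: "('f^2) set"
proof -
  have "img g (img (mat c) L) = img (mat c) (img g L)" for c
    by (simp only: img_mult[symmetric] mat_comm)
  moreover have "vertex_act g (homothety_class L) = {img g (img (mat c) L) | c. c \<noteq> 0}"
    unfolding vertex_act_def homothety_class_eq by blast
  ultimately show ?thesis
    by (simp only: homothety_class_eq)
qed

lemma vertex_act_vtx: "vertex_act g (vtx h) = vtx (g ** h)"
  by (simp only: vtx_def vertex_act_class img_mult)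

text \<open>Stability of \<open>L0\<close> says that \<open>g\<close> and its inverse are integral,
  and then the valuations of their determinants are non-negative with sum zero.\<close>

lemma img_L0_eq_iff: "invertible g \<Longrightarrow> img g L0 = L0 \<longleftrightarrow> g \<in> K"
proof -
  have sub: "img g L0 \<subseteq> L0 \<longleftrightarrow> integral2 g" for g
  proof
    assume sub: "img g L0 \<subseteq> L0"
    have "vector [1, 0] \<in> L0" "vector [0, 1] \<in> L0"
      by (simp_all add: mem_L0_iff)
    then have "g *v vector [1, 0] \<in> L0" "g *v vector [0, 1] \<in> L0"
      using sub by blast+
    then show "integral2 g"
      by (simp add: integral2_def mem_L0_iff mv_nth)
  next
    assume "integral2 g"
    then show "img g L0 \<subseteq> L0"
      by (auto simp: integral2_def mem_L0_iff mv_nth intro!: vge_add vge_mult_0)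
  qed
  assume g: "invertible g"
  show ?thesis
  proof
    assume eq: "img g L0 = L0"
    then have "img (matrix_inv g) L0 = L0"
      using img_inv(1)[OF g, of L0] by simp
    then have i: "integral2 g" "integral2 (matrix_inv g)"
      using sub eq by blast+
    have "det (matrix_inv g) * det g = 1"
      using g by (simp flip: det_mul)
    moreover from this have "det (matrix_inv g) \<noteq> 0" "det g \<noteq> 0"
      by auto
    ultimately have "v (det (matrix_inv g)) + v (det g) = 0"
      using v_mult[of "det (matrix_inv g)" "det g"] by simp
    moreover have "0 \<le> v (det g)" "0 \<le> v (det (matrix_inv g))"
      using i[THEN integral2_det] \<open>det (matrix_inv g) \<noteq> 0\<close> \<open>det g \<noteq> 0\<close> by (auto simp: vge_def)
    ultimately show "g \<in> K"
      using i \<open>det g \<noteq> 0\<close> by (simp add: mem_K_iff)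
  next
    assume "g \<in> K"
    then have "img g L0 \<subseteq> L0" "img (matrix_inv g) L0 \<subseteq> L0"
      using sub K_integral K_inv by blast+
    then show "img g L0 = L0"
      using image_mono[of "img (matrix_inv g) L0" L0 "\<lambda>x. g *v x"] g img_inv(2)[OF g, of L0] by auto
  qed
qed

lemma vtx_eq_iff:
  assumes "invertible g" "invertible h"
  shows "vtx g = vtx h \<longleftrightarrow> matrix_inv g ** h \<in> FK"
proof -
  have "vtx g = vtx h \<longleftrightarrow> img h L0 \<in> homothety_class (img g L0)"
    using homothety_class_mem[of "img h L0" "img g L0"] homothety_class_self[of "img h L0"]
    unfolding vtx_def by metis
  also have "\<dots> \<longleftrightarrow> (\<exists>c. c \<noteq> 0 \<and> img h L0 = img (mat c) (img g L0))"
    unfolding homothety_class_eq by blast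
  also have "\<dots> \<longleftrightarrow> (\<exists>c. c \<noteq> 0 \<and> mat (inverse c) ** (matrix_inv g ** h) \<in> K)"
  proof (intro ex_cong1 conj_cong refl)
    fix c :: 'f assume c: "c \<noteq> 0"
    have inv: "invertible (mat (inverse c) ** (matrix_inv g ** h))" "invertible (mat c ** g)"
      using c assms by (simp_all add: invertible_mult)
    have eq: "mat (inverse c) ** (matrix_inv g ** h) = matrix_inv (mat c ** g) ** h"
      using c assms by (simp add: matrix_inv_matrix_mult matrix_inv_mat matrix_mul_assoc
          mat_comm[of _ "matrix_inv g"])
    have "img h L0 = img (mat c ** g) L0 \<longleftrightarrow> img (matrix_inv (mat c ** g)) (img h L0) = L0"
      using img_inv[OF inv(2)] by metis
    then show "img h L0 = img (mat c) (img g L0) \<longleftrightarrow> mat (inverse c) ** (matrix_inv g ** h) \<in> K"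
      using img_L0_eq_iff[OF inv(1)] by (simp only: eq img_mult)
  qed
  also have "\<dots> \<longleftrightarrow> matrix_inv g ** h \<in> FK"
  proof
    assume "\<exists>c. c \<noteq> 0 \<and> mat (inverse c) ** (matrix_inv g ** h) \<in> K"
    then obtain c where c: "c \<noteq> 0" "mat (inverse c) ** (matrix_inv g ** h) \<in> K"
      by blast
    then show "matrix_inv g ** h \<in> FK"
      using mat_mult_mem_FK[OF c] by (simp add: matrix_mul_assoc mat_mat)
  next
    assume "matrix_inv g ** h \<in> FK"
    then obtain c k where c: "c \<noteq> 0" "k \<in> K" "matrix_inv g ** h = mat c ** k"
      by (auto simp: FK_eq F_closure_def)
    then show "\<exists>c. c \<noteq> 0 \<and> mat (inverse c) ** (matrix_inv g ** h) \<in> K"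
      by (intro exI[of _ c]) (simp add: matrix_mul_assoc mat_mat)
  qed
  finally show ?thesis .
qed

lemma vertices_eq: "vertices F = {vtx g | g. invertible g}"
  by (simp only: vertices_def is_lattice_def vtx_def Bex_def carrier_GL2) blast

lemma vtx_vertices: "invertible g \<Longrightarrow> vtx g \<in> vertices F"
  by (auto simp: vertices_eq)

lemma mem_lattice1_iff: "x \<in> lattice1 F \<longleftrightarrow> vge 0 (x$1) \<and> vge 1 (x$2)"
  by (auto simp: lattice1_def mem_R_iff vge_def)

lemma lattice1_eq: "lattice1 F = img \<Pi>0 L0"
proof -
  have "x \<in> lattice1 F \<longleftrightarrow> x \<in> img \<Pi>0 L0" for x
  proof
    assume "x \<in> lattice1 F"
    then have x: "vge 0 (x$1)" "vge 1 (x$2)"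
      by (simp_all add: mem_lattice1_iff)
    then show "x \<in> img \<Pi>0 L0"
      by (intro image_eqI[of _ _ "vector [x$2 / \<pi>, x$1]"])
        (simp_all add: vec2_eq_iff mv_nth mem_L0_iff vge_unif_divide_iff)
  next
    assume "x \<in> img \<Pi>0 L0"
    then obtain y where "x = \<Pi>0 *v y" "y \<in> L0"
      by blast
    then have "vge 0 (x$1)" "vge 1 (x$2)"
      by (simp_all add: mv_nth mem_L0_iff vge_mult_1')
    then show "x \<in> lattice1 F"
      by (simp add: mem_lattice1_iff)
  qed
  then show ?thesis
    by blast
qed

lemma sigma0_eq: "sigma0 F = {vtx (mat 1)}" and sigma1_eq: "sigma1 F = {vtx (mat 1), vtx \<Pi>0}"
  by (simp_all add: sigma0_def sigma1_def vtx_def lattice1_eq)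

lemma simplex_act_sigma0: "simplex_act g (sigma0 F) = {vtx g}"
  and simplex_act_sigma1: "simplex_act g (sigma1 F) = {vtx g, vtx (g ** \<Pi>0)}"
  by (simp_all add: simplex_act_def sigma0_eq sigma1_eq vertex_act_vtx)

lemma vtx_Pi_ne: "invertible g \<Longrightarrow> vtx g \<noteq> vtx (g ** \<Pi>0)"
  using Pi_not_FK by (simp add: vtx_eq_iff invertible_mult)

text \<open>Conjugation by \<Pi> turns the second equation into a condition on the same matrix, so
  the claim is that \<open>ZK F\<close> meets its conjugate in \<open>ZI F\<close>.\<close>

lemma edge_eq_iff:
  assumes "invertible g" "invertible h"
  shows "vtx g = vtx h \<and> vtx (g ** \<Pi>0) = vtx (h ** \<Pi>0) \<longleftrightarrow> matrix_inv g ** h \<in> FI"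
proof -
  have "matrix_inv (g ** \<Pi>0) ** (h ** \<Pi>0) = matrix_inv \<Pi>0 ** (matrix_inv g ** h) ** \<Pi>0"
    using assms by (simp add: matrix_inv_matrix_mult matrix_mul_assoc)
  then show ?thesis
    using Pi_conj_FK[of "matrix_inv g ** h"] Pi_conj_FI[of "matrix_inv g ** h"] FI_FK assms
    by (auto simp: vtx_eq_iff invertible_mult)
qed

lemma vtx_mult_FK: "invertible g \<Longrightarrow> k \<in> FK \<Longrightarrow> vtx (g ** k) = vtx g"
  using vtx_eq_iff[of g "g ** k"] FK_invertible by (auto simp: invertible_mult)

lemma simplex_act_sigma0_eq_iff:
  assumes "invertible g" "invertible h"
  shows "simplex_act g (sigma0 F) = simplex_act h (sigma0 F) \<longleftrightarrow> matrix_inv g ** h \<in> FK"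
  using vtx_eq_iff[OF assms] by (simp add: simplex_act_sigma0)

text \<open>Matching the ends of the two edges in order gives \<open>ZI F\<close>; matching them
  crosswise gives the other coset in \<open>SE_cases\<close>, as the square of \<Pi> is a scalar and
  fixes every vertex.\<close>

lemma simplex_act_sigma1_eq_iff:
  assumes "invertible g" "invertible h"
  shows "simplex_act g (sigma1 F) = simplex_act h (sigma1 F) \<longleftrightarrow> matrix_inv g ** h \<in> SE"
proof
  have PP: "vtx (k ** \<Pi>0 ** \<Pi>0) = vtx k" if "invertible k" for k
    using vtx_mult_FK[OF that mat_FK[OF unif_nz]] by (simp add: Pi_Pi flip: matrix_mul_assoc)
  {
    assume "simplex_act g (sigma1 F) = simplex_act h (sigma1 F)"
    then consider "vtx g = vtx h" "vtx (g ** \<Pi>0) = vtx (h ** \<Pi>0)"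
      | "vtx g = vtx (h ** \<Pi>0)" "vtx (g ** \<Pi>0) = vtx h"
      by (auto simp: simplex_act_sigma1 doubleton_eq_iff)
    then show "matrix_inv g ** h \<in> SE"
    proof cases
      case 1
      then show ?thesis
        using edge_eq_iff[OF assms] FI_SE by blast
    next
      case 2
      then have "matrix_inv g ** (h ** \<Pi>0) \<in> FI"
        using edge_eq_iff[of g "h ** \<Pi>0"] assms PP by (simp add: invertible_mult)
      then have "matrix_inv g ** (h ** \<Pi>0) ** matrix_inv \<Pi>0 \<in> SE"
        using SE_mult FI_SE by simp
      then show ?thesis
        by (simp add: matrix_mul_assoc)
    qed
  }
  assume "matrix_inv g ** h \<in> SE"
  then show "simplex_act g (sigma1 F) = simplex_act h (sigma1 F)"
  proof (cases rule: SE_cases)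
    case 1
    then show ?thesis
      using edge_eq_iff[OF assms] by (simp add: simplex_act_sigma1)
  next
    case (2 z)
    then have "h = (g ** \<Pi>0) ** z"
      using assms by (metis matrix_inv_mult_cancel(1) matrix_mul_assoc)
    then have "matrix_inv (g ** \<Pi>0) ** h \<in> FI"
      using 2(1) assms by (simp add: invertible_mult)
    then have "vtx (g ** \<Pi>0) = vtx h \<and> vtx (g ** \<Pi>0 ** \<Pi>0) = vtx (h ** \<Pi>0)"
      using edge_eq_iff[of "g ** \<Pi>0" h] assms by (simp add: invertible_mult)
    then show ?thesis
      using PP[OF assms(1)] by (auto simp: simplex_act_sigma1)
  qed
qed

text \<open>The column is completed by whichever standard basis vector makes the determinant a
  unit.\<close>

lemma primitive_column:
  assumes "vge 0 x" "vge 0 y" "\<not> (vge 1 x \<and> vge 1 y)"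
  shows "\<exists>k\<in>K. k$1$1 = x \<and> k$2$1 = y"
proof (cases "vge 1 x")
  case False
  then have "mat2 x 0 y 1 \<in> K"
    using assms by (simp add: mem_K_iff integral2_def det_2) (auto simp: vge_def)
  then show ?thesis
    by (intro bexI[of _ "mat2 x 0 y 1"]) simp_all
next
  case True
  then have "mat2 x 1 y 0 \<in> K"
    using assms by (simp add: mem_K_iff integral2_def det_2) (auto simp: vge_def)
  then show ?thesis
    by (intro bexI[of _ "mat2 x 1 y 0"]) simp_all
qed

text \<open>A vector of \<open>M\<close> whose second coordinate is a unit would span
  \<open>L0\<close> together with the first basis vector. So all second coordinates lie in the
  maximal ideal, and every integral vector with this property is in \<open>M\<close> because \<pi>
  \<open>L0\<close> and the first basis vector are.\<close>

lemma sublattice_L1: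
  assumes M: "M \<subseteq> L0" "M \<noteq> L0" "img (mat \<pi>) L0 \<subseteq> M" "vector [1, 0] \<in> M"
    and lin: "\<And>x y. x \<in> M \<Longrightarrow> y \<in> M \<Longrightarrow> x + y \<in> M" "\<And>c x. vge 0 c \<Longrightarrow> x \<in> M \<Longrightarrow> c *s x \<in> M"
  shows "M = img \<Pi>0 L0"
proof -
  have "vge 1 (y$2)" if y: "y \<in> M" for y
  proof (rule ccontr)
    assume "\<not> vge 1 (y$2)"
    then have y2: "y$2 \<noteq> 0" "v (y$2) = 0"
      using y M(1) by (auto simp: mem_L0_iff vge_def)
    have "z \<in> M" if z: "z \<in> L0" for z
    proof -
      have "vge 0 (z$2 / y$2)"
        using z y2 by (intro vge_divide_unit) (auto simp: mem_L0_iff)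
      moreover from this have "vge 0 (z$1 - z$2 / y$2 * y$1)"
        using z y M(1) by (intro vge_diff vge_mult_0) (auto simp: mem_L0_iff)
      ultimately have "(z$1 - z$2 / y$2 * y$1) *s vector [1, 0] + (z$2 / y$2) *s y \<in> M"
        using lin M(4) y by blast
      moreover have "(z$1 - z$2 / y$2 * y$1) *s vector [1, 0] + (z$2 / y$2) *s y = z"
        using y2 by (simp add: vec2_eq_iff)
      ultimately show ?thesis
        by simp
    qed
    with M(1,2) show False
      by blast
  qed
  moreover have "y \<in> M" if y: "vge 0 (y$1)" "vge 1 (y$2)" for y
  proof -
    have "mat \<pi> *v vector [0, y$2 / \<pi>] \<in> M"
      using M(3) y by (auto simp: mem_L0_iff vge_unif_divide_iff)
    then have "(y$1) *s vector [1, 0] + mat \<pi> *v vector [0, y$2 / \<pi>] \<in> M"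
      using lin M(4) y by blast
    moreover have "(y$1) *s vector [1, 0] + mat \<pi> *v vector [0, y$2 / \<pi>] = y"
      by (simp add: vec2_eq_iff mv_nth)
    ultimately show ?thesis
      by simp
  qed
  ultimately have "M = lattice1 F"
    using M(1) by (auto simp: lattice1_def mem_R_iff mem_L0_iff vge_def)
  then show ?thesis
    by (simp add: lattice1_eq)
qed

text \<open>Every edge is a translate of the standard one. For the inclusion from left to right,
  \<open>L\<close> is moved to \<open>L0\<close>, then an element of \<open>K\<close> is used to
  move a primitive vector of the sublattice to the first basis vector, and
  \<open>sublattice_L1\<close> identifies the result.\<close>

lemma oriented_edges_eq: "oriented_edges F = {(vtx g, vtx (g ** \<Pi>0)) | g. invertible g}"
proof (intro equalityI subsetI)
  fix e assume "e \<in> {(vtx g, vtx (g ** \<Pi>0)) | g. invertible g}"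
  then obtain g where g: "invertible g" "e = (vtx g, vtx (g ** \<Pi>0))"
    by blast
  have a: "img (mat \<pi>) L0 \<subset> img \<Pi>0 L0" "img \<Pi>0 L0 \<subset> L0"
  proof -
    have "x \<in> img \<Pi>0 L0" if "x \<in> img (mat \<pi>) L0" for x
      using that by (auto simp: lattice1_eq[symmetric] mem_lattice1_iff mem_L0_iff mv_nth vge_mult_0
          vge_mult_1')
    moreover have "vector [1, 0] \<in> img \<Pi>0 L0"
      by (simp add: lattice1_eq[symmetric] mem_lattice1_iff)
    moreover have "vector [1, 0] \<notin> img (mat \<pi>) L0"
    proof
      assume "vector [1, 0] \<in> img (mat \<pi>) L0"
      then obtain y where "vector [1, 0] = mat \<pi> *v y" "y \<in> L0"
        by blast
      then have "1 = \<pi> * y$1" "vge 0 (y$1)"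
        by (auto simp: vec2_eq_iff mv_nth mem_L0_iff)
      then have "vge 1 1"
        using vge_mult_1'[of \<pi> "y$1"] by simp
      then show False
        by (simp add: vge_def)
    qed
    ultimately show "img (mat \<pi>) L0 \<subset> img \<Pi>0 L0"
      by blast
    have "x \<in> L0" if "x \<in> img \<Pi>0 L0" for x
      using that by (auto simp: mem_L0_iff mv_nth vge_mult_0)
    moreover have "vector [0, 1] \<in> L0" "vector [0, 1] \<notin> img \<Pi>0 L0"
      by (simp_all add: lattice1_eq[symmetric] mem_lattice1_iff mem_L0_iff) (simp add: vge_def)
    ultimately show "img \<Pi>0 L0 \<subset> L0"
      by blast
  qed
  have inj: "inj (\<lambda>x. g *v x)"
    using g(1) by (intro inj_on_inverseI[of _ "\<lambda>x. matrix_inv g *v x"]) (simp add: matrix_vector_mul_assoc)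
  have strict: "A \<subset> B \<Longrightarrow> img g A \<subset> img g B" for A B
    using inj by (metis image_mono inj_image_eq_iff psubset_eq)
  have "img (mat \<pi>) (img g L0) = img g (img (mat \<pi>) L0)"
    by (simp only: img_mult[symmetric] mat_comm)
  then have "img (mat \<pi>) (img g L0) \<subset> img (g ** \<Pi>0) L0" "img (g ** \<Pi>0) L0 \<subset> img g L0"
    using strict[OF a(1)] strict[OF a(2)] by (simp_all only: img_mult)
  moreover have "img g L0 \<in> vtx g" "img (g ** \<Pi>0) L0 \<in> vtx (g ** \<Pi>0)"
    unfolding vtx_def by (rule homothety_class_self)+
  ultimately have "\<exists>L\<in>vtx g. \<exists>L'\<in>vtx (g ** \<Pi>0). img (mat \<pi>) L \<subset> L' \<and> L' \<subset> L"
    by blast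
  moreover have "vtx g \<in> vertices F" "vtx (g ** \<Pi>0) \<in> vertices F"
    using g(1) by (simp_all add: vtx_vertices invertible_mult)
  ultimately show "e \<in> oriented_edges F"
    unfolding oriented_edges_def smult_img g(2) by blast
next
  fix e assume "e \<in> oriented_edges F"
  then obtain \<sigma> \<sigma>' L L' where e: "e = (\<sigma>, \<sigma>')" "\<sigma> \<in> vertices F" "\<sigma>' \<in> vertices F" "L \<in> \<sigma>" "L' \<in> \<sigma>'"
    "img (mat \<pi>) L \<subset> L'" "L' \<subset> L"
    unfolding oriented_edges_def smult_img by blast
  \<comment> \<open>A vertex is a class of lattices, so its matrix is adjusted by a scalar to
    produce the given member \<open>L\<close> exactly.\<close>
  have lat: "\<exists>g. invertible g \<and> L = img g L0 \<and> \<sigma> = vtx g" if lat: "\<sigma> \<in> vertices F" "L \<in> \<sigma>" for \<sigma> L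
  proof -
    obtain g where g: "invertible g" "\<sigma> = vtx g"
      using lat(1) by (auto simp: vertices_eq)
    then obtain c where c: "c \<noteq> 0" "L = img (mat c) (img g L0)"
      using lat(2) by (auto simp: vtx_def homothety_class_eq simp del: image_image)
    then have "L = img (mat c ** g) L0" "invertible (mat c ** g)"
      using g by (simp_all only: img_mult) (simp add: invertible_mult)
    moreover have "\<sigma> = homothety_class L"
      using homothety_class_mem[of L "img g L0"] lat(2) g by (simp add: vtx_def)
    ultimately show ?thesis
      by (auto simp: vtx_def)
  qed
  obtain g where g: "invertible g" "L = img g L0" "\<sigma> = vtx g"
    using lat e by blast
  obtain h where h: "invertible h" "L' = img h L0" "\<sigma>' = vtx h"
    using lat e by blast
  define M where "M = img (matrix_inv g ** h) L0"
  have L': "L' = img g M"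
    using g by (simp add: h M_def img_mult[symmetric] matrix_mul_assoc del: image_image)
  have inj: "inj (\<lambda>x. g *v x)"
    using g(1) by (intro inj_on_inverseI[of _ "\<lambda>x. matrix_inv g *v x"]) (simp add: matrix_vector_mul_assoc)
  have "img (mat \<pi>) L = img g (img (mat \<pi>) L0)"
    by (simp only: g img_mult[symmetric] mat_comm)
  then have M: "img (mat \<pi>) L0 \<subset> M" "M \<subset> L0"
    using e(6,7) inj by (simp_all add: L' g(2) inj_image_subset_iff psubset_eq inj_image_eq_iff)
  have lin: "\<And>x y. x \<in> img a L0 \<Longrightarrow> y \<in> img a L0 \<Longrightarrow> x + y \<in> img a L0"
    "\<And>c x. vge 0 c \<Longrightarrow> x \<in> img a L0 \<Longrightarrow> c *s x \<in> img a L0" for a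
  proof -
    fix x y assume "x \<in> img a L0" "y \<in> img a L0"
    then obtain x' y' where *: "x = a *v x'" "y = a *v y'" "x' \<in> L0" "y' \<in> L0"
      by blast
    then have "x + y = a *v (x' + y')" "x' + y' \<in> L0"
      by (simp_all add: matrix_vector_right_distrib mem_L0_iff vge_add)
    then show "x + y \<in> img a L0"
      by blast
  next
    fix c x assume "vge 0 c" "x \<in> img a L0"
    then obtain x' where *: "x = a *v x'" "x' \<in> L0"
      by blast
    then have "c *s x = a *v (c *s x')" "c *s x' \<in> L0"
      using \<open>vge 0 c\<close> by (simp_all add: vec2_eq_iff mv_nth algebra_simps mem_L0_iff vge_mult_0)
    then show "c *s x \<in> img a L0"
      by blast
  qed
  \<comment> \<open>A vector of \<open>M\<close> outside \<pi> \<open>L0\<close> is primitive, hence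
    the first column of some \<open>k\<close> in \<open>K\<close>.\<close>
  obtain x where x: "x \<in> M" "x \<notin> img (mat \<pi>) L0"
    using M by blast
  have "\<not> (vge 1 (x$1) \<and> vge 1 (x$2))"
  proof
    assume "vge 1 (x$1) \<and> vge 1 (x$2)"
    then have "x = mat \<pi> *v vector [x$1 / \<pi>, x$2 / \<pi>]" "vector [x$1 / \<pi>, x$2 / \<pi>] \<in> L0"
      by (simp_all add: vec2_eq_iff mv_nth mem_L0_iff vge_unif_divide_iff)
    with x(2) show False
      by blast
  qed
  moreover have "x \<in> L0"
    using x(1) M(2) by blast
  ultimately obtain k where k: "k \<in> K" "k$1$1 = x$1" "k$2$1 = x$2"
    using primitive_column[of "x$1" "x$2"] unfolding mem_L0_iff by blast
  note ki = K_invertible[OF k(1)]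
  define M' where "M' = img (matrix_inv k) M"
  have kL0: "img (matrix_inv k) L0 = L0"
    using img_L0_eq_iff[of "matrix_inv k"] K_inv[OF k(1)] ki by simp
  have injk: "inj (\<lambda>x. matrix_inv k *v x)"
    using ki by (intro inj_on_inverseI[of _ "\<lambda>x. k *v x"]) (simp add: matrix_vector_mul_assoc)
  have "M' = img \<Pi>0 L0"
  proof (rule sublattice_L1)
    show "M' \<subseteq> L0" "M' \<noteq> L0"
      using M(2) kL0 injk unfolding M'_def by (metis image_mono psubset_imp_subset, metis inj_image_eq_iff psubset_eq)
    have "img (mat \<pi>) L0 = img (matrix_inv k) (img (mat \<pi>) L0)"
      using kL0 by (metis img_mult mat_comm)
    then show "img (mat \<pi>) L0 \<subseteq> M'"
      using M(1) unfolding M'_def by (metis image_mono psubset_imp_subset)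
    have "k *v vector [1, 0] = x"
      using k by (simp add: vec2_eq_iff mv_nth)
    then have "matrix_inv k *v x = vector [1, 0]"
      using ki by (auto simp: matrix_vector_mul_assoc)
    then show "vector [1, 0] \<in> M'"
      using x(1) unfolding M'_def by (metis imageI)
    have "M' = img (matrix_inv k ** (matrix_inv g ** h)) L0"
      unfolding M'_def M_def by (simp only: img_mult)
    then show "\<And>x y. x \<in> M' \<Longrightarrow> y \<in> M' \<Longrightarrow> x + y \<in> M'" "\<And>c x. vge 0 c \<Longrightarrow> x \<in> M' \<Longrightarrow> c *s x \<in> M'"
      using lin by simp_all
  qed
  then have "img k M' = img (k ** \<Pi>0) L0"
    by (simp only: img_mult)
  then have "L' = img (g ** k ** \<Pi>0) L0"
    using ki unfolding L' M'_def by (simp add: img_mult del: image_image)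
  then have "\<sigma>' = vtx (g ** k ** \<Pi>0)"
    using h by (simp add: vtx_def)
  moreover have "\<sigma> = vtx (g ** k)"
    using g vtx_mult_FK[OF g(1) K_FK[OF k(1)]] by simp
  ultimately show "e \<in> {(vtx g, vtx (g ** \<Pi>0)) | g. invertible g}"
    using e(1) g ki by (auto simp: invertible_mult)
qed

text \<open>The distance of \<^term>\<open>vtx g\<close> from the base vertex, as the minimum is attained by a primitive multiple
  of \<^term>\<open>g\<close>.\<close>

definition dist0 :: "'f^2^2 \<Rightarrow> nat" where
  "dist0 g = (LEAST n. \<exists>c. c \<noteq> 0 \<and> integral2 (mat c ** g) \<and> v (det (mat c ** g)) = int n)"

lemma mat_mult_nth: "(mat c ** g :: 'f^2^2)$i$j = c * g$i$j"
  using exhaust_2[of i] by auto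

lemma integral_multiple: "\<exists>c. c \<noteq> 0 \<and> integral2 (mat c ** g)"
proof -
  define N where "N = max (max \<bar>v (g$1$1)\<bar> \<bar>v (g$1$2)\<bar>) (max \<bar>v (g$2$1)\<bar> \<bar>v (g$2$2)\<bar>)"
  have "vge 0 (\<pi> powi N * x)" if "\<bar>v x\<bar> \<le> N" for x
    using that by (cases "x = 0") (auto simp: vge_def v_mult v_power_int)
  moreover have "\<bar>v (g$1$1)\<bar> \<le> N" "\<bar>v (g$1$2)\<bar> \<le> N" "\<bar>v (g$2$1)\<bar> \<le> N" "\<bar>v (g$2$2)\<bar> \<le> N"
    by (simp_all add: N_def le_max_iff_disj)
  ultimately show ?thesis
    by (intro exI[of _ "\<pi> powi N"]) (simp add: integral2_def)
qed

lemma dist0_le: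
  assumes "invertible g" "c \<noteq> 0" "integral2 (mat c ** g)"
  shows "int (dist0 g) \<le> v (det (mat c ** g))"
proof -
  have "det (mat c ** g) \<noteq> 0"
    using assms by (simp add: invertible_det_nz det_mul)
  then have "0 \<le> v (det (mat c ** g))"
    using integral2_det[OF assms(3)] by (simp add: vge_def)
  then obtain n where n: "v (det (mat c ** g)) = int n"
    using nonneg_int_cases by blast
  then have "dist0 g \<le> n"
    unfolding dist0_def using assms by (intro Least_le) blast
  with n show ?thesis
    by simp
qed

lemma dist0_attained:
  assumes "invertible g"
  shows "\<exists>c. c \<noteq> 0 \<and> integral2 (mat c ** g) \<and> v (det (mat c ** g)) = int (dist0 g)"
  unfolding dist0_def
proof (rule LeastI_ex)
  obtain c where c: "c \<noteq> 0" "integral2 (mat c ** g)"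
    using integral_multiple by blast
  have "det (mat c ** g) \<noteq> 0"
    using assms c by (simp add: invertible_det_nz det_mul)
  then have "0 \<le> v (det (mat c ** g))"
    using integral2_det[OF c(2)] by (simp add: vge_def)
  then show "\<exists>n c. c \<noteq> 0 \<and> integral2 (mat c ** g) \<and> v (det (mat c ** g)) = int n"
    using c nonneg_int_cases by metis
qed

text \<open>A scalar in \<open>k\<close> is compensated by changing the multiplier \<open>c\<close>,
  and the factor in \<open>K\<close> changes neither integrality nor the valuation of the
  determinant. Equality follows by applying the inequality to the inverse of \<open>k\<close>
  too.\<close>

lemma dist0_FK:
  assumes "invertible g" "k \<in> FK"
  shows "dist0 (g ** k) = dist0 g"
proof -
  have le: "dist0 (g ** k) \<le> dist0 g" if g: "invertible g" and k: "k \<in> FK" for g k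
  proof -
    obtain d l where dl: "d \<noteq> 0" "l \<in> K" "k = mat d ** l"
      using k by (auto simp: FK_eq F_closure_def)
    obtain c where c: "c \<noteq> 0" "integral2 (mat c ** g)" "v (det (mat c ** g)) = int (dist0 g)"
      using dist0_attained[OF g] by blast
    have eq: "mat (c / d) ** (g ** k) = (mat c ** g) ** l"
      using dl by (simp add: matrix_eq_2 field_simps)
    then have "integral2 (mat (c / d) ** (g ** k))"
      using integral2_mult[OF c(2) K_integral[OF dl(2)]] by simp
    then have "int (dist0 (g ** k)) \<le> v (det (mat (c / d) ** (g ** k)))"
      using dl c g FK_invertible[OF k] by (intro dist0_le) (auto simp: invertible_mult)
    also have "\<dots> = v (det (mat c ** g))"
    proof -
      have "det (mat c ** g) \<noteq> 0"
        using g c by (simp add: invertible_det_nz det_mul)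
      then show ?thesis
        unfolding eq det_mul[of "mat c ** g"] using dl(2) by (simp add: v_mult mem_K_iff)
    qed
    finally show ?thesis
      using c by simp
  qed
  have "dist0 g = dist0 (g ** k ** matrix_inv k)"
    using FK_invertible[OF assms(2)] by simp
  also have "\<dots> \<le> dist0 (g ** k)"
    using assms FK_invertible[OF assms(2)] FK_inv by (intro le) (auto simp: invertible_mult)
  finally show ?thesis
    using le[OF assms] by simp
qed

lemma dist0_vtx: "invertible g \<Longrightarrow> invertible h \<Longrightarrow> vtx g = vtx h \<Longrightarrow> dist0 g = dist0 h"
  using dist0_FK[of g "matrix_inv g ** h"] by (simp add: vtx_eq_iff)

lemma dist0_eq_0:
  assumes "invertible g" "dist0 g = 0"
  shows "g \<in> FK"
proof -
  obtain c where c: "c \<noteq> 0" "integral2 (mat c ** g)" "v (det (mat c ** g)) = 0"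
    using dist0_attained[OF assms(1)] assms(2) by auto
  then have "mat c ** g \<in> K"
    using assms(1) by (simp add: mem_K_iff invertible_det_nz det_mul)
  then have "mat (inverse c) ** (mat c ** g) \<in> FK"
    using c by (intro mat_mult_mem_FK) auto
  then show ?thesis
    using c by (simp add: matrix_mul_assoc mat_mat)
qed

text \<open>Representatives \<^term>\<open>h\<close> of a vertex that realise the distance are primitive. The neighbour
  given by \<^term>\<open>k\<close> is closer to the base vertex precisely if the first column of \<^term>\<open>k\<close> is in the
  kernel of \<^term>\<open>h\<close> modulo the maximal ideal.\<close>

definition kills :: "'f^2^2 \<Rightarrow> 'f^2^2 \<Rightarrow> bool" where
  "kills h k \<longleftrightarrow> vge 1 ((h ** k)$1$1) \<and> vge 1 ((h ** k)$2$1)"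

text \<open>Otherwise division by \<pi> would give an integral multiple whose determinant has
  valuation smaller by 2.\<close>

lemma dist0_primitive:
  assumes "invertible h" "integral2 h" "v (det h) = int (dist0 h)"
  shows "\<not> (vge 1 (h$1$1) \<and> vge 1 (h$1$2) \<and> vge 1 (h$2$1) \<and> vge 1 (h$2$2))"
proof
  assume "vge 1 (h$1$1) \<and> vge 1 (h$1$2) \<and> vge 1 (h$2$1) \<and> vge 1 (h$2$2)"
  then have "integral2 (mat (inverse \<pi>) ** h)"
    by (simp add: integral2_def vge_inverse_unif_iff)
  then have "int (dist0 h) \<le> v (det (mat (inverse \<pi>) ** h))"
    using assms by (intro dist0_le) auto
  also have "\<dots> = v (det h) - 2"
    using assms by (simp add: det_mul v_mult invertible_det_nz)
  finally show False
    using assms(3) by simp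
qed

text \<open>Rescaling to a multiple that attains the minimum: scalars are central and change neither
  vertices nor distances, so \<open>h\<close> can replace \<open>g\<close> in statements about
  neighbours.\<close>

lemma exists_primitive:
  assumes "invertible g"
  obtains h where "invertible h" "vtx h = vtx g" "integral2 h" "v (det h) = int (dist0 h)"
    "\<And>k. vtx (h ** k) = vtx (g ** k)" "\<And>k. invertible k \<Longrightarrow> dist0 (h ** k) = dist0 (g ** k)"
proof -
  obtain c where c: "c \<noteq> 0" "integral2 (mat c ** g)" "v (det (mat c ** g)) = int (dist0 g)"
    using dist0_attained[OF assms] by blast
  have eq: "mat c ** g ** k = g ** k ** mat c" for k :: "'f^2^2"
    using mat_comm[of c "g ** k"] by (simp only: matrix_mul_assoc)
  have inv: "invertible (mat c ** g)"
    using c assms by (simp add: invertible_mult)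
  have eq1: "mat c ** g = g ** mat c"
    by (rule mat_comm)
  have v1: "vtx (mat c ** g) = vtx g" and d1: "dist0 (mat c ** g) = dist0 g"
    unfolding eq1 using vtx_mult_FK[OF assms mat_FK[OF c(1)]] dist0_FK[OF assms mat_FK[OF c(1)]] by auto
  have vm: "vtx (mat c ** k) = vtx k" for k
  proof -
    have "vtx (mat c ** k) = homothety_class (img (mat c) (img k L0))"
      by (simp only: vtx_def img_mult)
    also have "\<dots> = homothety_class (img k L0)"
      by (rule homothety_class_mem) (use c(1) in \<open>auto simp only: homothety_class_eq\<close>)
    finally show ?thesis
      by (simp only: vtx_def)
  qed
  have "vtx (mat c ** g ** k) = vtx (g ** k)" for k
    using vm[of "g ** k"] by (simp only: matrix_mul_assoc)
  moreover have "dist0 (mat c ** g ** k) = dist0 (g ** k)" if "invertible k" for k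
    unfolding eq using that assms c by (intro dist0_FK mat_FK) (auto simp: invertible_mult)
  ultimately show ?thesis
    using that[of "mat c ** g"] inv v1 c d1 by simp
qed

text \<open>Up to order, the columns of \<open>h ** k ** \<Pi>0\<close> are those of
  \<open>h ** k\<close> with the second one multiplied by \<pi>, so the determinant gains valuation
  1. If \<pi> divides the first column as well, it can be divided out, which lowers that valuation
  by 2; if not, no multiplier of negative valuation keeps the matrix integral.\<close>

lemma dist0_neighbour:
  assumes h: "invertible h" "integral2 h" "v (det h) = int (dist0 h)" and k: "k \<in> K"
  shows "kills h k \<Longrightarrow> dist0 (h ** k ** \<Pi>0) < dist0 h"
    and "\<not> kills h k \<Longrightarrow> dist0 h < dist0 (h ** k ** \<Pi>0)"
proof -
  let ?g = "h ** k ** \<Pi>0"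
  have inv: "invertible ?g"
    using h K_invertible[OF k] by (simp add: invertible_mult)
  have hk: "integral2 (h ** k)"
    using h(2) K_integral[OF k] by (rule integral2_mult)
  have nz: "det h \<noteq> 0"
    using h by (simp add: invertible_det_nz)
  have nz': "det ?g \<noteq> 0"
    using inv by (simp add: invertible_det_nz)
  have "det \<Pi>0 = - \<pi>"
    by (simp add: det_2)
  then have "det ?g = det h * det k * (- \<pi>)"
    by (simp only: det_mul)
  then have det: "v (det ?g) = int (dist0 h) + 1"
    using nz k h(3) by (simp only:) (simp add: v_mult mem_K_iff)
  have col: "?g$1$1 = (h ** k)$1$2 * \<pi>" "?g$2$1 = (h ** k)$2$2 * \<pi>" "?g$1$2 = (h ** k)$1$1"
    "?g$2$2 = (h ** k)$2$1"
    by (simp_all del: matrix_mult_2 add: matrix_mult_2[of "h ** k" \<Pi>0])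
  {
    assume "kills h k"
    then have "integral2 (mat (inverse \<pi>) ** ?g)"
      using hk unfolding integral2_def kills_def mat_mult_nth col vge_inverse_unif_iff
      by (auto intro: vge_mult_1)
    then have "int (dist0 ?g) \<le> v (det (mat (inverse \<pi>) ** ?g))"
      using inv by (intro dist0_le) auto
    also have "\<dots> = v (det ?g) - 2"
      unfolding det_mul[of "mat (inverse \<pi>)"] using nz' by (simp add: v_mult)
    finally show "dist0 ?g < dist0 h"
      using det by simp
  }
  assume nk: "\<not> kills h k"
  obtain c where c: "c \<noteq> 0" "integral2 (mat c ** ?g)" "v (det (mat c ** ?g)) = int (dist0 ?g)"
    using dist0_attained[OF inv] by blast
  have "0 \<le> v c"
  proof -
    have u: "vge 0 x \<Longrightarrow> \<not> vge 1 x \<Longrightarrow> vge 0 (c * x) \<Longrightarrow> 0 \<le> v c" for x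
      using c(1) by (auto simp: vge_def v_mult)
    have "vge 0 (c * (h ** k)$1$1)" "vge 0 (c * (h ** k)$2$1)"
      using c(2) unfolding integral2_def mat_mult_nth col by auto
    then show ?thesis
      using nk u hk unfolding kills_def integral2_def by blast
  qed
  moreover have "v (det (mat c ** ?g)) = 2 * v c + v (det ?g)"
    unfolding det_mul[of "mat c"] using nz' c(1) by (simp add: v_mult)
  ultimately show "dist0 h < dist0 ?g"
    using c(3) det by simp
qed

text \<open>Both sides say that the first columns are proportional modulo the maximal ideal:
  \<open>K / I\<close> is the projective line over the residue field.\<close>

lemma K_iwahori_iff:
  assumes "k \<in> K" "k' \<in> K"
  shows "matrix_inv k ** k' \<in> I \<longleftrightarrow> vge 1 (k$1$1 * k'$2$1 - k$2$1 * k'$1$1)"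
proof -
  have "(matrix_inv k ** k')$2$1 = (k$1$1 * k'$2$1 - k$2$1 * k'$1$1) / det k"
    by (simp add: matrix_inv_2[OF K_invertible[OF assms(1)]] diff_divide_distrib)
  moreover have "vge 1 (x / det k) \<longleftrightarrow> vge 1 x" for x
    using vge_unit_mult[of "inverse (det k)" 1 x] assms(1)
    by (simp add: mem_K_iff divide_inverse mult.commute)
  ultimately show ?thesis
    using K_mult[OF K_inv] assms by (simp add: mem_I_iff)
qed

lemma neighbour_eqI:
  assumes g: "invertible g" and k: "k \<in> K" "k' \<in> K" "matrix_inv k ** k' \<in> I"
  shows "vtx (g ** k ** \<Pi>0) = vtx (g ** k' ** \<Pi>0)"
proof -
  have "matrix_inv (g ** k) ** (g ** k') = matrix_inv k ** k'"
    using g K_invertible[OF k(1)] by (simp add: matrix_inv_matrix_mult flip: matrix_mul_assoc)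
  then show ?thesis
    using edge_eq_iff[of "g ** k" "g ** k'"] g k K_invertible I_FI by (simp add: invertible_mult)
qed

text \<open>\<open>kills\<close> puts both first columns into the kernel of \<open>h\<close> modulo
  the maximal ideal. Being primitive, \<open>h\<close> is non-zero there, so this kernel is at most
  a line, the columns are proportional and the neighbours equal.\<close>

lemma at_most_one_closer:
  assumes g: "invertible g" and k: "k \<in> K" "k' \<in> K"
    and d: "dist0 (g ** k ** \<Pi>0) \<le> dist0 g" "dist0 (g ** k' ** \<Pi>0) \<le> dist0 g"
  shows "vtx (g ** k ** \<Pi>0) = vtx (g ** k' ** \<Pi>0)"
proof -
  obtain h where h: "invertible h" "vtx h = vtx g" "integral2 h" "v (det h) = int (dist0 h)"
    "\<And>k. invertible k \<Longrightarrow> dist0 (h ** k) = dist0 (g ** k)"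
    using exists_primitive[OF g] by metis
  have hg: "dist0 h = dist0 g"
    using dist0_vtx[OF h(1) g h(2)] .
  have dd: "dist0 (h ** k ** \<Pi>0) = dist0 (g ** k ** \<Pi>0)" if "k \<in> K" for k
    using h(5)[of "k ** \<Pi>0"] K_invertible[OF that] by (simp add: invertible_mult matrix_mul_assoc)
  have "kills h k" "kills h k'"
    using dist0_neighbour(2)[OF h(1,3,4)] d k dd hg by fastforce+
  then have kk: "vge 1 (h$1$1 * k$1$1 + h$1$2 * k$2$1)" "vge 1 (h$2$1 * k$1$1 + h$2$2 * k$2$1)"
    "vge 1 (h$1$1 * k'$1$1 + h$1$2 * k'$2$1)" "vge 1 (h$2$1 * k'$1$1 + h$2$2 * k'$2$1)"
    by (simp_all add: kills_def)
  have int: "vge 0 (k$1$1)" "vge 0 (k$2$1)" "vge 0 (k'$1$1)" "vge 0 (k'$2$1)"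
    "vge 0 (h$1$1)" "vge 0 (h$1$2)" "vge 0 (h$2$1)" "vge 0 (h$2$2)"
    using K_integral[OF k(1)] K_integral[OF k(2)] h(3) by (auto simp: integral2_def)
  let ?D = "k$1$1 * k'$2$1 - k$2$1 * k'$1$1"
  have D: "vge 0 ?D"
    using int by (intro vge_diff vge_mult_0)
  \<comment> \<open>Cramer's rule for a row \<open>(a, b)\<close> of \<open>h\<close> that kills
    both columns: \<open>a * ?D\<close> and \<open>b * ?D\<close> are combinations of quantities
    divisible by \<pi>.\<close>
  have "vge 1 (a * ?D)" "vge 1 (b * ?D)"
    if ab: "vge 1 (a * k$1$1 + b * k$2$1)" "vge 1 (a * k'$1$1 + b * k'$2$1)" "vge 0 a" "vge 0 b" for a b
  proof -
    have "a * ?D = (a * k$1$1 + b * k$2$1) * k'$2$1 - (a * k'$1$1 + b * k'$2$1) * k$2$1"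
      "b * ?D = (a * k'$1$1 + b * k'$2$1) * k$1$1 - (a * k$1$1 + b * k$2$1) * k'$1$1"
      by (simp_all add: algebra_simps)
    then show "vge 1 (a * ?D)" "vge 1 (b * ?D)"
      using ab int vge_diff vge_mult_1' by presburger+
  qed
  then have "vge 1 (h$1$1 * ?D)" "vge 1 (h$1$2 * ?D)" "vge 1 (h$2$1 * ?D)" "vge 1 (h$2$2 * ?D)"
    using kk int by blast+
  moreover have "vge 1 ?D" if "vge 1 (x * ?D)" "vge 0 x" "\<not> vge 1 x" for x
    using that D vge_unit_mult[of x 1 ?D] by (auto simp: vge_def)
  ultimately have "vge 1 ?D"
    using dist0_primitive[OF h(1,3,4)] int by blast
  then show ?thesis
    using neighbour_eqI[OF g k] K_iwahori_iff[OF k] by blast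
qed

text \<open>A non-zero distance means that the determinant of the primitive \<open>h\<close> is
  divisible by \<pi>. So \<open>h\<close> has a kernel modulo the maximal ideal, and a kernel vector
  is read off from a row of \<open>h\<close> that does not vanish there.\<close>

lemma exists_closer:
  assumes g: "invertible g" and d: "dist0 g \<noteq> 0"
  shows "\<exists>k\<in>K. dist0 (g ** k ** \<Pi>0) < dist0 g"
proof -
  obtain h where h: "invertible h" "vtx h = vtx g" "integral2 h" "v (det h) = int (dist0 h)"
    "\<And>k. invertible k \<Longrightarrow> dist0 (h ** k) = dist0 (g ** k)"
    using exists_primitive[OF g] by metis
  have hg: "dist0 h = dist0 g"
    using dist0_vtx[OF h(1) g h(2)] .
  have int: "vge 0 (h$1$1)" "vge 0 (h$1$2)" "vge 0 (h$2$1)" "vge 0 (h$2$2)"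
    using h(3) by (auto simp: integral2_def)
  have det: "vge 1 (h$1$1 * h$2$2 - h$1$2 * h$2$1)"
    using h(4) d hg by (auto simp: vge_def det_2)
  have "\<exists>x y. vge 0 x \<and> vge 0 y \<and> \<not> (vge 1 x \<and> vge 1 y) \<and>
      vge 1 (h$1$1 * x + h$1$2 * y) \<and> vge 1 (h$2$1 * x + h$2$2 * y)"
  proof (cases "vge 1 (h$1$1) \<and> vge 1 (h$1$2)")
    case True
    then have "\<not> (vge 1 (- h$2$2) \<and> vge 1 (h$2$1))"
      using dist0_primitive[OF h(1,3,4)] by auto
    moreover have "vge 1 (h$1$1 * (- h$2$2) + h$1$2 * h$2$1)"
      using det vge_minus[of 1 "h$1$1 * h$2$2 - h$1$2 * h$2$1"] by simp
    moreover have "vge 1 (h$2$1 * (- h$2$2) + h$2$2 * h$2$1)"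
      by (simp add: mult.commute)
    ultimately show ?thesis
      using int vge_minus by blast
  next
    case False
    then have "\<not> (vge 1 (- h$1$2) \<and> vge 1 (h$1$1))"
      by auto
    moreover have "vge 1 (h$1$1 * (- h$1$2) + h$1$2 * h$1$1)"
      by (simp add: mult.commute)
    moreover have "vge 1 (h$2$1 * (- h$1$2) + h$2$2 * h$1$1)"
      using det by (simp add: mult.commute)
    ultimately show ?thesis
      using int vge_minus by blast
  qed
  then obtain x y where xy: "vge 0 x" "vge 0 y" "\<not> (vge 1 x \<and> vge 1 y)"
      "vge 1 (h$1$1 * x + h$1$2 * y)" "vge 1 (h$2$1 * x + h$2$2 * y)"
    by blast
  obtain k where k: "k \<in> K" "k$1$1 = x" "k$2$1 = y"
    using primitive_column[OF xy(1-3)] by blast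
  then have "kills h k"
    using xy by (simp add: kills_def)
  then have "dist0 (h ** (k ** \<Pi>0)) < dist0 h"
    using dist0_neighbour(1)[OF h(1,3,4) k(1)] by (simp add: matrix_mul_assoc)
  then have "dist0 (g ** (k ** \<Pi>0)) < dist0 g"
    using h(5)[of "k ** \<Pi>0"] hg K_invertible[OF k(1)] by (simp add: invertible_mult)
  with k(1) show ?thesis
    by (auto simp: matrix_mul_assoc)
qed

text \<open>The representative \<open>g\<close> of the vertex may be kept fixed: any other differs
  from it by an element of \<open>K\<close> and a scalar, and the scalar is central.\<close>

lemma neighbours_eq:
  assumes "invertible g"
  shows "{\<sigma>'. (vtx g, \<sigma>') \<in> oriented_edges F} = (\<lambda>k. vtx (g ** k ** \<Pi>0)) ` K"
proof (intro equalityI subsetI)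
  fix \<sigma>' assume "\<sigma>' \<in> {\<sigma>'. (vtx g, \<sigma>') \<in> oriented_edges F}"
  then obtain h where h: "invertible h" "vtx g = vtx h" "\<sigma>' = vtx (h ** \<Pi>0)"
    by (auto simp: oriented_edges_eq)
  then obtain c k where ck: "c \<noteq> 0" "k \<in> K" "matrix_inv g ** h = mat c ** k"
    using vtx_eq_iff[OF assms h(1)] by (auto simp: FK_eq F_closure_def)
  then have "h = g ** (mat c ** k)"
    using assms by (metis matrix_inv_mult_cancel(1))
  also have "mat c ** k = k ** mat c"
    by (rule mat_comm)
  finally have "h ** \<Pi>0 = g ** k ** (mat c ** \<Pi>0)"
    by (simp only: matrix_mul_assoc)
  also have "mat c ** \<Pi>0 = \<Pi>0 ** mat c"
    by (rule mat_comm)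
  also have "g ** k ** (\<Pi>0 ** mat c) = (g ** k ** \<Pi>0) ** mat c"
    by (simp only: matrix_mul_assoc)
  finally have "vtx (h ** \<Pi>0) = vtx (g ** k ** \<Pi>0)"
    using vtx_mult_FK[of "g ** k ** \<Pi>0" "mat c"] assms ck K_invertible mat_FK
    by (simp add: invertible_mult)
  with h ck show "\<sigma>' \<in> (\<lambda>k. vtx (g ** k ** \<Pi>0)) ` K"
    by blast
next
  fix \<sigma>' assume "\<sigma>' \<in> (\<lambda>k. vtx (g ** k ** \<Pi>0)) ` K"
  then obtain k where k: "k \<in> K" "\<sigma>' = vtx (g ** k ** \<Pi>0)"
    by blast
  then have "vtx g = vtx (g ** k)" "invertible (g ** k)"
    using assms vtx_mult_FK K_FK K_invertible by (simp_all add: invertible_mult)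
  with k show "\<sigma>' \<in> {\<sigma>'. (vtx g, \<sigma>') \<in> oriented_edges F}"
    unfolding oriented_edges_eq by auto
qed

text \<open>A neighbour depends only on the residues of the first column of \<open>k\<close>.
  Finiteness matters for \<open>boundary\<close>, since \<open>finsum\<close> over an infinite set
  is a default value.\<close>

lemma finite_neighbours:
  assumes "\<sigma> \<in> vertices F"
  shows "finite {\<sigma>'. (\<sigma>, \<sigma>') \<in> oriented_edges F}"
proof -
  obtain g where g: "invertible g" "\<sigma> = vtx g"
    using assms by (auto simp: vertices_eq)
  define p where "p k = (res F (k$1$1), res F (k$2$1))" for k :: "'f^2^2"
  define f where "f k = vtx (g ** k ** \<Pi>0)" for k
  have "f k = f k'" if k: "k \<in> K" "k' \<in> K" "p k = p k'" for k k'
  proof -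
    have int: "vge 0 (k$1$1)" "vge 0 (k$2$1)" "vge 0 (k'$1$1)" "vge 0 (k'$2$1)"
      using K_integral[OF k(1)] K_integral[OF k(2)] by (auto simp: integral2_def)
    then have "res F (k$1$1 * k'$2$1 - k$2$1 * k'$1$1) = 0"
      using k(3) by (simp add: p_def res_diff res_mult vge_mult_0 mult.commute)
    then have "vge 1 (k$1$1 * k'$2$1 - k$2$1 * k'$1$1)"
      using int by (subst res_eq_0_iff[symmetric]) (auto intro!: vge_diff vge_mult_0)
    then show ?thesis
      unfolding f_def using neighbour_eqI[OF g(1) k(1,2)] K_iwahori_iff[OF k(1,2)] by blast
  qed
  then have "f k = f (inv_into K p (p k))" if "k \<in> K" for k
    using that by (metis f_inv_into_f imageI inv_into_into)
  then have "f ` K \<subseteq> (\<lambda>z. f (inv_into K p z)) ` UNIV"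
    by blast
  then have "finite (f ` K)"
    by (rule finite_subset) simp
  then show ?thesis
    using neighbours_eq[OF g(1)] g(2) by (simp add: f_def[abs_def])
qed

text \<open>The square of \<Pi> is a scalar, so passing from \<open>g\<close> to
  \<open>g ** \<Pi>0\<close> reverses the edge.\<close>

lemma edge_sym:
  assumes "(\<sigma>, \<sigma>') \<in> oriented_edges F"
  shows "(\<sigma>', \<sigma>) \<in> oriented_edges F"
proof -
  obtain g where g: "invertible g" "\<sigma> = vtx g" "\<sigma>' = vtx (g ** \<Pi>0)"
    using assms by (auto simp: oriented_edges_eq)
  have "vtx (g ** \<Pi>0 ** \<Pi>0) = vtx g"
    using vtx_mult_FK[OF g(1) mat_FK[OF unif_nz]] by (simp add: Pi_Pi flip: matrix_mul_assoc)
  then show ?thesis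
    using g unfolding oriented_edges_eq by (auto simp: invertible_mult intro!: exI[of _ "g ** \<Pi>0"])
qed

end

subsection \<open>Coefficient systems of diagrams\<close>

lemma (in kspace) a_inv_zero [simp]: "\<ominus> \<zero> = \<zero>"
  by (simp add: minus_eq_smult)

lemma (in kspace) finsum_single:
  assumes "finite A" "i \<in> A" "f i \<in> carrier V" "\<And>j. j \<in> A \<Longrightarrow> j \<noteq> i \<Longrightarrow> f j = \<zero>"
  shows "finsum V f A = f i"
proof -
  have "finsum V f A = finsum V (\<lambda>j. if j = i then f j else \<zero>) A"
    using assms by (intro finsum_cong') auto
  also have "\<dots> = finsum V (\<lambda>j. if j = i then (\<lambda>_. f i) j else \<zero>) A"
    by (intro arg_cong[of _ _ "\<lambda>f. finsum V f A"]) auto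
  also have "\<dots> = f i"
    using add.finprod_singleton_swap[of i A "\<lambda>_. f i"] assms by auto
  finally show ?thesis .
qed

text \<open>The standard function \<open>[g, y]\<close> of a compact induction: supported on
  \<open>S\<close> times the inverse of \<open>g\<close>, with value \<open>y\<close> at that
  inverse.\<close>

definition ind :: "('f::field^2^2) set \<Rightarrow> ('k, 'v, 'f^2^2) rep \<Rightarrow> 'f^2^2 \<Rightarrow> 'v \<Rightarrow> 'f^2^2 \<Rightarrow> 'v" where
  "ind S V g y = (\<lambda>x. if x ** g \<in> S then act V (x ** g) y else \<zero>\<^bsub>V\<^esub>)"

lemma orbit_space_simps [simp]:
  "\<zero>\<^bsub>orbit_space S V \<sigma> \<tau>\<^esub> = (\<lambda>_. \<zero>\<^bsub>V\<^esub>)"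
  "f \<oplus>\<^bsub>orbit_space S V \<sigma> \<tau>\<^esub> h = (\<lambda>x. f x \<oplus>\<^bsub>V\<^esub> h x)"
  "c \<odot>\<^bsub>orbit_space S V \<sigma> \<tau>\<^esub> f = (\<lambda>x. c \<odot>\<^bsub>V\<^esub> f x)"
  by (simp_all add: orbit_space_def module.defs)

text \<open>Vertices with \<open>ZK F\<close> and edges with \<open>stab_edge F\<close> are both
  instances, so the spaces of a coefficient system are described once for both.\<close>

locale orbit = grep S V
  for S :: "('f::field^2^2) set" and V :: "('k::field, 'v, 'f^2^2) rep" (structure) +
  fixes \<sigma> :: "'f simplex"
  assumes S_one [simp]: "mat 1 \<in> S"
    and S_mult: "g \<in> S \<Longrightarrow> h \<in> S \<Longrightarrow> g ** h \<in> S"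
    and S_inv: "g \<in> S \<Longrightarrow> matrix_inv g \<in> S"
    and S_invertible: "g \<in> S \<Longrightarrow> invertible g"
    and stab: "invertible g \<Longrightarrow> invertible h \<Longrightarrow>
      simplex_act g \<sigma> = simplex_act h \<sigma> \<longleftrightarrow> matrix_inv g ** h \<in> S"
begin

abbreviation sp where "sp g \<equiv> orbit_space S V \<sigma> (simplex_act g \<sigma>)"

lemma S_mult_left_iff: "k \<in> S \<Longrightarrow> k ** x \<in> S \<longleftrightarrow> x \<in> S"
  by (metis S_inv S_invertible S_mult matrix_inv_mult_cancel(2))

lemma S_mult_right_iff: "k \<in> S \<Longrightarrow> x ** k \<in> S \<longleftrightarrow> x \<in> S"
  by (metis S_inv S_invertible S_mult matrix_inv_mult_cancel(3))

lemma mem_coset_iff': "invertible g \<Longrightarrow> x \<in> S #>\<^bsub>GL2\<^esub> matrix_inv g \<longleftrightarrow> x ** g \<in> S"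
proof
  assume g: "invertible g"
  show "x ** g \<in> S \<Longrightarrow> x \<in> S #>\<^bsub>GL2\<^esub> matrix_inv g"
    using g by (auto simp: r_coset_def intro!: bexI[of _ "x ** g"])
  show "x \<in> S #>\<^bsub>GL2\<^esub> matrix_inv g \<Longrightarrow> x ** g \<in> S"
    using g by (auto simp: r_coset_def)
qed

lemma ind_self [simp]: "invertible g \<Longrightarrow> y \<in> carrier V \<Longrightarrow> ind S V g y (matrix_inv g) = y"
  by (simp add: ind_def)

lemma ind_mult: "k \<in> S \<Longrightarrow> y \<in> carrier V \<Longrightarrow> ind S V (g ** k) y = ind S V g (act V k y)"
  by (auto simp: ind_def fun_eq_iff matrix_mul_assoc S_mult_right_iff act_mult)

lemma ind_translate: "(\<lambda>x. ind S V g y (x ** h)) = ind S V (h ** g) y"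
  by (auto simp: ind_def fun_eq_iff matrix_mul_assoc)

lemma ind_closed [simp]: "y \<in> carrier V \<Longrightarrow> ind S V g y x \<in> carrier V"
  by (simp add: ind_def)

lemma ind_add: "y \<in> carrier V \<Longrightarrow> z \<in> carrier V \<Longrightarrow> (\<lambda>x. ind S V g y x \<oplus> ind S V g z x) = ind S V g (y \<oplus> z)"
  and ind_smult: "y \<in> carrier V \<Longrightarrow> (\<lambda>x. c \<odot> ind S V g y x) = ind S V g (c \<odot> y)"
  and ind_zero: "ind S V g \<zero> = (\<lambda>_. \<zero>)"
  by (auto simp: ind_def fun_eq_iff act_add act_smult)

lemma ind_inj: "invertible g \<Longrightarrow> y \<in> carrier V \<Longrightarrow> z \<in> carrier V \<Longrightarrow> ind S V g y = ind S V g z \<Longrightarrow> y = z"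
  by (metis ind_self)

lemma ind_mem:
  assumes g: "invertible g" and y: "y \<in> carrier V"
  shows "ind S V g y \<in> carrier (sp g)"
proof -
  let ?f = "ind S V g y"
  have "{S #>\<^bsub>GL2\<^esub> x | x. invertible x \<and> ?f x \<noteq> \<zero>} \<subseteq> {S #>\<^bsub>GL2\<^esub> matrix_inv g}"
  proof clarify
    fix x assume "?f x \<noteq> \<zero>"
    then have xg: "x ** g \<in> S"
      by (auto simp: ind_def split: if_splits)
    show "S #>\<^bsub>GL2\<^esub> x = S #>\<^bsub>GL2\<^esub> matrix_inv g"
    proof (intro equalityI subsetI)
      fix z assume "z \<in> S #>\<^bsub>GL2\<^esub> x"
      then obtain s where s: "s \<in> S" "z = s ** x"
        by (auto simp: r_coset_def)
      then have "z ** g = s ** (x ** g)"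
        by (simp add: matrix_mul_assoc)
      then show "z \<in> S #>\<^bsub>GL2\<^esub> matrix_inv g"
        using s xg g S_mult by (simp add: mem_coset_iff')
    next
      fix z assume "z \<in> S #>\<^bsub>GL2\<^esub> matrix_inv g"
      then have "z ** g \<in> S"
        using g by (simp add: mem_coset_iff')
      then have "(z ** g) ** matrix_inv (x ** g) \<in> S"
        using xg S_inv S_mult by blast
      moreover have "invertible x"
        using S_invertible[OF xg] g by simp
      moreover from this have "z = ((z ** g) ** matrix_inv (x ** g)) ** x"
        using g by (simp add: matrix_inv_matrix_mult matrix_mul_assoc)
      ultimately show "z \<in> S #>\<^bsub>GL2\<^esub> x"
        unfolding r_coset_def mult_GL2 by blast
    qed
  qed
  then have fin: "finite {S #>\<^bsub>GL2\<^esub> x | x. invertible x \<and> ?f x \<noteq> \<zero>}"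
    by (rule finite_subset) simp
  have "?f x = \<zero>" if "\<not> invertible x" for x
    using that g S_invertible[of "x ** g"] by (auto simp: ind_def)
  moreover have "?f (k ** x) = act V k (?f x)" if "k \<in> S" for k x
    using that y by (auto simp: ind_def S_mult_left_iff act_mult simp flip: matrix_mul_assoc)
  moreover have "?f x \<in> carrier V" for x
    using y by (auto simp: ind_def)
  ultimately have f: "?f \<in> carrier (c_ind S V)"
    using fin unfolding mem_c_ind_iff by blast
  have "{x. ?f x \<noteq> \<zero>} \<subseteq> S #>\<^bsub>GL2\<^esub> matrix_inv h" if h: "invertible h" "simplex_act h \<sigma> = simplex_act g \<sigma>" for h
  proof
    fix x assume "x \<in> {x. ?f x \<noteq> \<zero>}"
    then have "x ** g \<in> S"
      by (auto simp: ind_def split: if_splits)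
    moreover have "matrix_inv g ** h \<in> S"
      using stab[OF g h(1)] h(2) by simp
    ultimately have "(x ** g) ** (matrix_inv g ** h) \<in> S"
      by (rule S_mult)
    then have "x ** h \<in> S"
      using g by (simp add: matrix_mul_assoc)
    then show "x \<in> S #>\<^bsub>GL2\<^esub> matrix_inv h"
      using h by (simp add: mem_coset_iff')
  qed
  with f show ?thesis
    by (simp add: orbit_space_def module.defs)
qed

text \<open>The support lies in one coset, so a function is determined by its value at the inverse
  of \<open>g\<close>; the space at a translate of \<open>\<sigma>\<close> is a copy of
  \<open>V\<close>.\<close>

lemma mem_sp_iff:
  assumes g: "invertible g"
  shows "f \<in> carrier (sp g) \<longleftrightarrow> (\<exists>y\<in>carrier V. f = ind S V g y)"
proof
  assume f: "f \<in> carrier (sp g)"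
  then have c: "f \<in> carrier (c_ind S V)" and supp: "{x. f x \<noteq> \<zero>} \<subseteq> S #>\<^bsub>GL2\<^esub> matrix_inv g"
    using g by (auto simp: orbit_space_def module.defs)
  let ?y = "f (matrix_inv g)"
  have "f x = ind S V g ?y x" for x
  proof (cases "x ** g \<in> S")
    case True
    then have "f ((x ** g) ** matrix_inv g) = act V (x ** g) ?y"
      using mem_c_indD(3)[OF c True, of "matrix_inv g"] g by simp
    then show ?thesis
      using g True by (simp add: ind_def)
  next
    case False
    then have "x \<notin> S #>\<^bsub>GL2\<^esub> matrix_inv g"
      using g by (simp add: mem_coset_iff')
    then show ?thesis
      using False supp by (auto simp: ind_def)
  qed
  then have "f = ind S V g ?y"
    by blast
  moreover have "?y \<in> carrier V"
    using c g by (auto simp: mem_c_ind_iff)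
  ultimately show "\<exists>y\<in>carrier V. f = ind S V g y"
    by blast
qed (use ind_mem[OF g] in auto)

lemma kspace_sp:
  assumes "invertible g"
  shows "kspace (sp g)"
proof (rule kspaceI, goal_cases)
  case 1
  then show ?case
    using ind_mem[OF assms zero_closed] by (simp add: ind_zero)
next
  case (2 x y)
  then show ?case
    using assms by (auto simp: mem_sp_iff ind_add)
next
  case (3 x y z)
  then show ?case
    using assms by (auto simp: mem_sp_iff add.m_assoc)
next
  case (4 x y)
  then show ?case
    using assms by (auto simp: mem_sp_iff ind_add add.m_comm)
next
  case (5 x)
  then show ?case
    using assms by (auto simp: mem_sp_iff ind_add simp flip: ind_zero)
next
  case (6 c x)
  then show ?case
    using assms by (auto simp: mem_sp_iff ind_smult)
next
  case (7 a b x)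
  then show ?case
    using assms by (auto simp: mem_sp_iff ind_add ind_smult smult_add_left)
next
  case (8 a x y)
  then show ?case
    using assms by (auto simp: mem_sp_iff ind_add ind_smult smult_add)
next
  case (9 a b x)
  then show ?case
    using assms by (auto simp: mem_sp_iff ind_smult smult_mult)
next
  case (10 x)
  then show ?case
    using assms by (auto simp: mem_sp_iff ind_smult)
next
  case (11 x)
  then show ?case
    using assms by (auto simp: mem_sp_iff ind_smult ind_zero)
qed

end

lemma coeff_system_simps [simp]:
  "cs_space (coeff_of_diagram F D) = diagram_space F D"
  "cs_act (coeff_of_diagram F D) g \<tau> f = (\<lambda>x. f (x ** g))"
  by (simp_all add: coeff_of_diagram_def)

locale diagram_loc = local_field_loc F
  for F :: "('f::field, 'q::finite_field) local_field_data" +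
  fixes D :: "('k::field, 'v, 'f^2^2) diagram"
  assumes rep0: "representation FK (diag0 D)" and rep1: "representation SE (diag1 D)"
    and r_linear: "diag_r D \<in> linear_maps (diag1 D) (diag0 D)"
    and r_equivariant: "g \<in> FI \<Longrightarrow> y \<in> carrier (diag1 D) \<Longrightarrow>
      diag_r D (act (diag1 D) g y) = act (diag0 D) g (diag_r D y)"

sublocale diagram_loc \<subseteq> V0: orbit FK "diag0 D" "sigma0 F"
  by unfold_locales
    (use rep0 FK_mult FK_inv FK_invertible simplex_act_sigma0_eq_iff in auto)

sublocale diagram_loc \<subseteq> V1: orbit SE "diag1 D" "sigma1 F"
  by unfold_locales
    (use rep1 SE_mult SE_inv SE_invertible simplex_act_sigma1_eq_iff in auto)

sublocale diagram_loc \<subseteq> r: linear_map "diag1 D" "diag0 D" "diag_r D"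
  by unfold_locales (rule r_linear)

context diagram_loc
begin

abbreviation V0 where "V0 \<equiv> diag0 D"
abbreviation V1 where "V1 \<equiv> diag1 D"
abbreviation r where "r \<equiv> diag_r D"
abbreviation ind0 where "ind0 \<equiv> ind FK V0"
abbreviation ind1 where "ind1 \<equiv> ind SE V1"
abbreviation cs where "cs \<equiv> coeff_of_diagram F D"
abbreviation Sp where "Sp \<sigma> \<equiv> diagram_space F D {\<sigma>}"
abbreviation Ed where "Ed \<sigma> \<sigma>' \<equiv> diagram_space F D {\<sigma>, \<sigma>'}"
abbreviation C0 where "C0 \<equiv> chains0 F cs"
abbreviation C1 where "C1 \<equiv> chains1 F cs"
abbreviation bd where "bd \<equiv> boundary F cs"
abbreviation edges where "edges \<equiv> oriented_edges F"
abbreviation nbrs where "nbrs \<sigma> \<equiv> {\<sigma>'. (\<sigma>, \<sigma>') \<in> edges}"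

lemma Sp_eq: "Sp (vtx g) = V0.sp g"
  by (simp add: diagram_space_def simplex_act_sigma0)

lemma Ed_eq: "invertible g \<Longrightarrow> Ed (vtx g) (vtx (g ** \<Pi>0)) = V1.sp g"
  using vtx_Pi_ne[of g] by (simp add: diagram_space_def simplex_act_sigma1 is_singleton_def)

lemma vertexE:
  assumes "\<sigma> \<in> vertices F"
  obtains g where "invertible g" "\<sigma> = vtx g"
  using assms by (auto simp: vertices_eq)

lemma edgeE:
  assumes "(\<sigma>, \<sigma>') \<in> edges"
  obtains g where "invertible g" "\<sigma> = vtx g" "\<sigma>' = vtx (g ** \<Pi>0)"
  using assms by (auto simp: oriented_edges_eq)

lemma edge_vertices: "(\<sigma>, \<sigma>') \<in> edges \<Longrightarrow> \<sigma> \<in> vertices F"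
  by (auto elim!: edgeE intro: vtx_vertices)

lemma kspace_Sp: "\<sigma> \<in> vertices F \<Longrightarrow> kspace (Sp \<sigma>)"
  by (auto elim!: vertexE simp: Sp_eq V0.kspace_sp)

lemma kspace_Ed: "(\<sigma>, \<sigma>') \<in> edges \<Longrightarrow> kspace (Ed \<sigma> \<sigma>')"
  by (auto elim!: edgeE simp: Ed_eq V1.kspace_sp)

lemma Ed_sym: "Ed \<sigma> \<sigma>' = Ed \<sigma>' \<sigma>"
  by (simp add: insert_commute)

lemma Sp_simps: "\<sigma> \<in> vertices F \<Longrightarrow> \<zero>\<^bsub>Sp \<sigma>\<^esub> = (\<lambda>_. \<zero>\<^bsub>V0\<^esub>)"
  "\<sigma> \<in> vertices F \<Longrightarrow> f \<oplus>\<^bsub>Sp \<sigma>\<^esub> h = (\<lambda>x. f x \<oplus>\<^bsub>V0\<^esub> h x)"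
  "\<sigma> \<in> vertices F \<Longrightarrow> c \<odot>\<^bsub>Sp \<sigma>\<^esub> f = (\<lambda>x. c \<odot>\<^bsub>V0\<^esub> f x)"
  by (auto elim!: vertexE simp: Sp_eq)

lemma Ed_simps: "(\<sigma>, \<sigma>') \<in> edges \<Longrightarrow> \<zero>\<^bsub>Ed \<sigma> \<sigma>'\<^esub> = (\<lambda>_. \<zero>\<^bsub>V1\<^esub>)"
  "(\<sigma>, \<sigma>') \<in> edges \<Longrightarrow> f \<oplus>\<^bsub>Ed \<sigma> \<sigma>'\<^esub> h = (\<lambda>x. f x \<oplus>\<^bsub>V1\<^esub> h x)"
  "(\<sigma>, \<sigma>') \<in> edges \<Longrightarrow> c \<odot>\<^bsub>Ed \<sigma> \<sigma>'\<^esub> f = (\<lambda>x. c \<odot>\<^bsub>V1\<^esub> f x)"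
  by (auto elim!: edgeE simp: Ed_eq)

lemma SpE:
  assumes "f \<in> carrier (Sp (vtx g))" "invertible g"
  obtains y where "y \<in> carrier V0" "f = ind0 g y"
  using assms by (auto simp: Sp_eq V0.mem_sp_iff)

lemma EdE:
  assumes "f \<in> carrier (Ed (vtx g) (vtx (g ** \<Pi>0)))" "invertible g"
  obtains y where "y \<in> carrier V1" "f = ind1 g y"
  using assms by (auto simp: Ed_eq V1.mem_sp_iff)

lemma ind0_mem: "invertible g \<Longrightarrow> y \<in> carrier V0 \<Longrightarrow> ind0 g y \<in> carrier (Sp (vtx g))"
  by (simp add: Sp_eq V0.ind_mem)

lemma ind1_mem: "invertible g \<Longrightarrow> y \<in> carrier V1 \<Longrightarrow> ind1 g y \<in> carrier (Ed (vtx g) (vtx (g ** \<Pi>0)))"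
  by (simp add: Ed_eq V1.ind_mem)

text \<open>\<open>coeff_of_diagram\<close> picks the restriction by \<open>THE\<close>, from one
  condition for each \<open>h\<close> that carries the standard vertex and edge to the given ones.
  Any such \<open>h\<close> differs from \<open>g\<close> by an element of \<open>ZI F\<close>, so
  equivariance of \<open>r\<close> makes the conditions consistent; the one for \<open>g\<close>
  gives uniqueness.\<close>

lemma res_ind1:
  assumes g: "invertible g" and y: "y \<in> carrier V1"
  shows "cs_res cs {vtx g} {vtx g, vtx (g ** \<Pi>0)} (ind1 g y) = ind0 g (r y)"
proof -
  let ?P = "\<lambda>f'. f' \<in> carrier (Sp (vtx g)) \<and>
    (\<forall>h\<in>carrier GL2. simplex_act h (sigma0 F) = {vtx g} \<and>
       simplex_act h (sigma1 F) = {vtx g, vtx (g ** \<Pi>0)} \<longrightarrow>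
       f' (matrix_inv h) = r (ind1 g y (matrix_inv h)))"
  have "(THE f'. ?P f') = ind0 g (r y)"
  proof (rule the_equality)
    have "ind0 g (r y) (matrix_inv h) = r (ind1 g y (matrix_inv h))"
      if h: "invertible h" "{vtx h} = {vtx g}" "{vtx h, vtx (h ** \<Pi>0)} = {vtx g, vtx (g ** \<Pi>0)}" for h
    proof -
      have "vtx h = vtx g \<and> vtx (h ** \<Pi>0) = vtx (g ** \<Pi>0)"
        using h by (auto simp: doubleton_eq_iff)
      then have x: "matrix_inv h ** g \<in> FI"
        using edge_eq_iff[OF h(1) g] by simp
      then show ?thesis
        using y FI_FK[OF x] FI_SE[OF x] by (simp add: ind_def r_equivariant)
    qed
    then show "?P (ind0 g (r y))"
      using g y by (auto simp: ind0_mem simplex_act_sigma0 simplex_act_sigma1)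
  next
    fix f' assume f': "?P f'"
    then obtain z where z: "z \<in> carrier V0" "f' = ind0 g z"
      using SpE g by blast
    have "f' (matrix_inv g) = r (ind1 g y (matrix_inv g))"
      using f' g by (auto simp: simplex_act_sigma0 simplex_act_sigma1)
    then have "z = r y"
      using z g y by simp
    with z show "f' = ind0 g (r y)"
      by simp
  qed
  moreover have "{vtx g} \<noteq> {vtx g, vtx (g ** \<Pi>0)}"
    using vtx_Pi_ne[OF g] by blast
  ultimately show ?thesis
    by (simp add: coeff_of_diagram_def)
qed

abbreviation res where "res \<sigma> \<sigma>' \<equiv> cs_res cs {\<sigma>} {\<sigma>, \<sigma>'}"

lemma res_linear:
  assumes "(\<sigma>, \<sigma>') \<in> edges"
  shows "linear_map (Ed \<sigma> \<sigma>') (Sp \<sigma>) (res \<sigma> \<sigma>')"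
proof -
  obtain g where g: "invertible g" "\<sigma> = vtx g" "\<sigma>' = vtx (g ** \<Pi>0)"
    using edgeE[OF assms] .
  have "res \<sigma> \<sigma>' \<in> linear_maps (Ed \<sigma> \<sigma>') (Sp \<sigma>)"
    using g by (auto simp: linear_maps_def res_ind1 ind0_mem V1.ind_add V0.ind_add r.add
        V1.ind_smult V0.ind_smult r.smult Ed_eq Sp_eq V1.mem_sp_iff V0.ind_mem)
  then show ?thesis
    using kspace_Ed[OF assms] kspace_Sp[OF edge_vertices[OF assms]]
    by (simp add: linear_map_def linear_map_axioms_def)
qed

section \<open>Chains in degree zero\<close>

definition sgl :: "'f^2^2 \<Rightarrow> 'v \<Rightarrow> 'f vertex \<Rightarrow> 'f^2^2 \<Rightarrow> 'v" where
  "sgl g y = (\<lambda>\<sigma>\<in>vertices F. if \<sigma> = vtx g then ind0 g y else (\<lambda>_. \<zero>\<^bsub>V0\<^esub>))"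

lemma C0_simps:
  "\<zero>\<^bsub>C0\<^esub> = (\<lambda>\<sigma>\<in>vertices F. \<zero>\<^bsub>Sp \<sigma>\<^esub>)"
  "\<omega> \<oplus>\<^bsub>C0\<^esub> \<omega>' = (\<lambda>\<sigma>\<in>vertices F. \<omega> \<sigma> \<oplus>\<^bsub>Sp \<sigma>\<^esub> \<omega>' \<sigma>)"
  "c \<odot>\<^bsub>C0\<^esub> \<omega> = (\<lambda>\<sigma>\<in>vertices F. c \<odot>\<^bsub>Sp \<sigma>\<^esub> \<omega> \<sigma>)"
  "act C0 g \<omega> = (\<lambda>\<sigma>\<in>vertices F. \<lambda>x. \<omega> (vertex_act (matrix_inv g) \<sigma>) (x ** g))"
  by (simp_all add: chains0_def)

lemma mem_C0_iff: "\<omega> \<in> carrier C0 \<longleftrightarrow> \<omega> \<in> extensional (vertices F) \<and>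
    (\<forall>\<sigma>\<in>vertices F. \<omega> \<sigma> \<in> carrier (Sp \<sigma>)) \<and> finite {\<sigma> \<in> vertices F. \<omega> \<sigma> \<noteq> \<zero>\<^bsub>Sp \<sigma>\<^esub>}"
  by (simp add: chains0_def)

lemma C0_eqI:
  assumes "\<omega> \<in> extensional (vertices F)" "\<omega>' \<in> extensional (vertices F)"
    and "\<And>\<sigma>. \<sigma> \<in> vertices F \<Longrightarrow> \<omega> \<sigma> = \<omega>' \<sigma>"
  shows "\<omega> = \<omega>'"
  using assms by (rule extensionalityI)

lemma kspace_C0: "kspace C0"
proof -
  have K: "\<sigma> \<in> vertices F \<Longrightarrow> kspace (Sp \<sigma>)" for \<sigma>
    by (rule kspace_Sp)
  have AG: "\<sigma> \<in> vertices F \<Longrightarrow> abelian_group (Sp \<sigma>)" for \<sigma>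
    using K by (auto simp: kspace_def Module.module_def)
  note facts = abelian_monoid.a_closed[OF abelian_group.axioms(1)[OF AG]]
    abelian_monoid.zero_closed[OF abelian_group.axioms(1)[OF AG]]
    abelian_monoid.l_zero[OF abelian_group.axioms(1)[OF AG]]
    kspace.smult_closed[OF K] kspace.smult_add_left[OF K] kspace.smult_add[OF K]
    kspace.smult_mult[OF K] kspace.one_smult[OF K] kspace.zero_smult[OF K] kspace.smult_zero[OF K]
  show ?thesis
  proof (rule kspaceI, goal_cases)
    case (2 \<omega> \<omega>')
    have "finite {\<sigma> \<in> vertices F. \<omega> \<sigma> \<oplus>\<^bsub>Sp \<sigma>\<^esub> \<omega>' \<sigma> \<noteq> \<zero>\<^bsub>Sp \<sigma>\<^esub>}"
      by (rule finite_subset[where B = "{\<sigma> \<in> vertices F. \<omega> \<sigma> \<noteq> \<zero>\<^bsub>Sp \<sigma>\<^esub>} \<union> {\<sigma> \<in> vertices F. \<omega>' \<sigma> \<noteq> \<zero>\<^bsub>Sp \<sigma>\<^esub>}"])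
        (use 2 facts in \<open>auto simp: mem_C0_iff\<close>)
    with 2 show ?case
      by (auto simp: mem_C0_iff C0_simps facts cong: conj_cong)
  next
    case (3 x y z)
    have "x \<sigma> \<oplus>\<^bsub>Sp \<sigma>\<^esub> y \<sigma> \<oplus>\<^bsub>Sp \<sigma>\<^esub> z \<sigma> = x \<sigma> \<oplus>\<^bsub>Sp \<sigma>\<^esub> (y \<sigma> \<oplus>\<^bsub>Sp \<sigma>\<^esub> z \<sigma>)" if "\<sigma> \<in> vertices F" for \<sigma>
      using 3 that abelian_monoid.a_assoc[OF abelian_group.axioms(1)[OF AG[OF that]]] by (simp add: mem_C0_iff)
    then show ?case
      by (auto simp: C0_simps intro!: restrict_ext)
  next
    case (4 x y)
    have "x \<sigma> \<oplus>\<^bsub>Sp \<sigma>\<^esub> y \<sigma> = y \<sigma> \<oplus>\<^bsub>Sp \<sigma>\<^esub> x \<sigma>" if "\<sigma> \<in> vertices F" for \<sigma>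
      using 4 that abelian_monoid.a_comm[OF abelian_group.axioms(1)[OF AG[OF that]]] by (simp add: mem_C0_iff)
    then show ?case
      by (auto simp: C0_simps intro!: restrict_ext)
  next
    case (6 c \<omega>)
    have "finite {\<sigma> \<in> vertices F. c \<odot>\<^bsub>Sp \<sigma>\<^esub> \<omega> \<sigma> \<noteq> \<zero>\<^bsub>Sp \<sigma>\<^esub>}"
      by (rule finite_subset[where B = "{\<sigma> \<in> vertices F. \<omega> \<sigma> \<noteq> \<zero>\<^bsub>Sp \<sigma>\<^esub>}"])
        (use 6 facts in \<open>auto simp: mem_C0_iff\<close>)
    with 6 show ?case
      by (auto simp: mem_C0_iff C0_simps facts cong: conj_cong)
  next
    case 1
    show ?case
      by (auto simp: mem_C0_iff C0_simps facts cong: conj_cong)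
  qed (auto simp: C0_simps mem_C0_iff facts intro!: C0_eqI)
qed

lemma vertex_act_vertices: "invertible h \<Longrightarrow> \<sigma> \<in> vertices F \<Longrightarrow> vertex_act h \<sigma> \<in> vertices F"
  by (auto elim!: vertexE simp: vertex_act_vtx vtx_vertices invertible_mult)

lemma vertex_act_cancel: "invertible h \<Longrightarrow> \<sigma> \<in> vertices F \<Longrightarrow> vertex_act h (vertex_act (matrix_inv h) \<sigma>) = \<sigma>"
  "invertible h \<Longrightarrow> \<sigma> \<in> vertices F \<Longrightarrow> vertex_act (matrix_inv h) (vertex_act h \<sigma>) = \<sigma>"
  by (auto elim!: vertexE simp: vertex_act_vtx)

lemma translate_Sp:
  assumes "invertible h" "\<sigma> \<in> vertices F" "f \<in> carrier (Sp (vertex_act (matrix_inv h) \<sigma>))"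
  shows "(\<lambda>x. f (x ** h)) \<in> carrier (Sp \<sigma>)"
proof -
  obtain g where g: "invertible g" "\<sigma> = vtx g"
    using vertexE[OF assms(2)] .
  then obtain y where "y \<in> carrier V0" "f = ind0 (matrix_inv h ** g) y"
    using assms SpE[of f "matrix_inv h ** g"] by (auto simp: vertex_act_vtx invertible_mult)
  then show ?thesis
    using g assms(1) by (simp add: V0.ind_translate ind0_mem)
qed

lemma representation_C0: "representation (carrier GL2) C0"
  unfolding representation_def
proof (intro conjI ballI)
  show "Module.module ring_of_type_algebra C0"
    by (rule kspace.module_V[OF kspace_C0])
next
  fix h :: "'f^2^2" assume "h \<in> carrier GL2"
  then have h: "invertible h" by simp
  then have hi: "invertible (matrix_inv h)" by simp
  have closed: "act C0 h \<omega> \<in> carrier C0" if \<omega>: "\<omega> \<in> carrier C0" for \<omega>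
  proof -
    have "{\<sigma> \<in> vertices F. act C0 h \<omega> \<sigma> \<noteq> \<zero>\<^bsub>Sp \<sigma>\<^esub>} \<subseteq> vertex_act h ` {\<sigma> \<in> vertices F. \<omega> \<sigma> \<noteq> \<zero>\<^bsub>Sp \<sigma>\<^esub>}"
    proof
      fix \<sigma> assume \<sigma>: "\<sigma> \<in> {\<sigma> \<in> vertices F. act C0 h \<omega> \<sigma> \<noteq> \<zero>\<^bsub>Sp \<sigma>\<^esub>}"
      let ?\<tau> = "vertex_act (matrix_inv h) \<sigma>"
      have "?\<tau> \<in> vertices F"
        using h \<sigma> by (simp add: vertex_act_vertices)
      moreover from this have "\<omega> ?\<tau> \<noteq> \<zero>\<^bsub>Sp ?\<tau>\<^esub>"
        using \<sigma> by (auto simp: C0_simps Sp_simps)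
      ultimately show "\<sigma> \<in> vertex_act h ` {\<sigma> \<in> vertices F. \<omega> \<sigma> \<noteq> \<zero>\<^bsub>Sp \<sigma>\<^esub>}"
        using h \<sigma> by (intro image_eqI[of _ _ ?\<tau>]) (auto simp: vertex_act_cancel)
    qed
    then have "finite {\<sigma> \<in> vertices F. act C0 h \<omega> \<sigma> \<noteq> \<zero>\<^bsub>Sp \<sigma>\<^esub>}"
      by (rule finite_subset) (use \<omega> in \<open>simp add: mem_C0_iff\<close>)
    moreover have "act C0 h \<omega> \<sigma> \<in> carrier (Sp \<sigma>)" if "\<sigma> \<in> vertices F" for \<sigma>
    proof -
      have "\<omega> (vertex_act (matrix_inv h) \<sigma>) \<in> carrier (Sp (vertex_act (matrix_inv h) \<sigma>))"
        using \<omega> h that by (simp add: mem_C0_iff vertex_act_vertices)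
      then show ?thesis
        using translate_Sp[OF h that] that by (simp add: C0_simps)
    qed
    moreover have "act C0 h \<omega> \<in> extensional (vertices F)"
      by (simp add: C0_simps)
    ultimately show ?thesis
      unfolding mem_C0_iff by blast
  qed
  have add: "act C0 h (\<omega> \<oplus>\<^bsub>C0\<^esub> \<omega>') = act C0 h \<omega> \<oplus>\<^bsub>C0\<^esub> act C0 h \<omega>'" for \<omega> \<omega>'
    unfolding C0_simps by (rule restrict_ext) (simp add: Sp_simps vertex_act_vertices[OF hi])
  have smult: "act C0 h (c \<odot>\<^bsub>C0\<^esub> \<omega>) = c \<odot>\<^bsub>C0\<^esub> act C0 h \<omega>" for c \<omega>
    unfolding C0_simps by (rule restrict_ext) (simp add: Sp_simps vertex_act_vertices[OF hi])
  show "act C0 h \<in> linear_maps C0 C0"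
    using closed add smult unfolding linear_maps_def by blast
next
  fix \<omega> assume "\<omega> \<in> carrier C0"
  then show "act C0 (mat 1) \<omega> = \<omega>"
    by (intro C0_eqI) (auto simp: C0_simps mem_C0_iff vertex_act_vtx elim!: vertexE)
next
  fix g h :: "'f^2^2" and \<omega> assume "g \<in> carrier GL2" "h \<in> carrier GL2" "\<omega> \<in> carrier C0"
  then have gh: "invertible g" "invertible h" by simp_all
  show "act C0 (g ** h) \<omega> = act C0 g (act C0 h \<omega>)"
  proof (rule C0_eqI)
    fix \<sigma> assume "\<sigma> \<in> vertices F"
    then obtain k where "invertible k" "\<sigma> = vtx k"
      by (rule vertexE)
    then show "act C0 (g ** h) \<omega> \<sigma> = act C0 g (act C0 h \<omega>) \<sigma>"
      using gh by (simp add: C0_simps vertex_act_vtx vtx_vertices invertible_mult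
          matrix_inv_matrix_mult matrix_mul_assoc)
  qed (simp_all add: C0_simps)
qed

end

sublocale diagram_loc \<subseteq> C: grep "carrier GL2" "chains0 F (coeff_of_diagram F D)"
  by unfold_locales (rule representation_C0)

context diagram_loc
begin

lemma sgl_mem: "invertible g \<Longrightarrow> y \<in> carrier V0 \<Longrightarrow> sgl g y \<in> carrier C0"
proof -
  assume g: "invertible g" and y: "y \<in> carrier V0"
  have "{\<sigma> \<in> vertices F. sgl g y \<sigma> \<noteq> \<zero>\<^bsub>Sp \<sigma>\<^esub>} \<subseteq> {vtx g}"
    by (auto simp: sgl_def Sp_simps)
  then have "finite {\<sigma> \<in> vertices F. sgl g y \<sigma> \<noteq> \<zero>\<^bsub>Sp \<sigma>\<^esub>}"
    by (rule finite_subset) simp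
  moreover have "sgl g y \<sigma> \<in> carrier (Sp \<sigma>)" if "\<sigma> \<in> vertices F" for \<sigma>
  proof -
    interpret kspace "Sp \<sigma>"
      using that by (rule kspace_Sp)
    show ?thesis
      using that g y zero_closed by (auto simp: sgl_def ind0_mem Sp_simps)
  qed
  ultimately show ?thesis
    by (auto simp: mem_C0_iff sgl_def)
qed

lemma act_sgl:
  assumes "invertible g" "invertible h"
  shows "act C0 h (sgl g y) = sgl (h ** g) y"
proof (rule C0_eqI)
  fix \<sigma> assume "\<sigma> \<in> vertices F"
  then obtain k where k: "invertible k" "\<sigma> = vtx k"
    by (rule vertexE)
  have "vtx (matrix_inv h ** k) = vtx g \<longleftrightarrow> vtx k = vtx (h ** g)"
    using assms k by (simp add: vtx_eq_iff invertible_mult matrix_inv_matrix_mult matrix_mul_assoc)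
  then show "act C0 h (sgl g y) \<sigma> = sgl (h ** g) y \<sigma>"
    using assms k by (simp add: C0_simps sgl_def vertex_act_vtx vtx_vertices invertible_mult V0.ind_translate)
qed (simp_all add: C0_simps sgl_def)

lemma sgl_mult: "invertible g \<Longrightarrow> k \<in> FK \<Longrightarrow> y \<in> carrier V0 \<Longrightarrow> sgl (g ** k) y = sgl g (act V0 k y)"
  by (auto simp: sgl_def vtx_mult_FK V0.ind_mult intro!: restrict_ext)

lemma sgl_add: "y \<in> carrier V0 \<Longrightarrow> z \<in> carrier V0 \<Longrightarrow> sgl g (y \<oplus>\<^bsub>V0\<^esub> z) = sgl g y \<oplus>\<^bsub>C0\<^esub> sgl g z"
  and sgl_smult: "y \<in> carrier V0 \<Longrightarrow> sgl g (c \<odot>\<^bsub>V0\<^esub> y) = c \<odot>\<^bsub>C0\<^esub> sgl g y"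
  by (auto simp: sgl_def C0_simps Sp_simps V0.ind_add V0.ind_smult intro!: restrict_ext)

lemma sgl_linear: "invertible g \<Longrightarrow> linear_map V0 C0 (sgl g)"
  by (intro linear_map.intro linear_map_axioms.intro V0.kspace_axioms kspace_C0)
    (auto simp: linear_maps_def sgl_mem sgl_add sgl_smult)

text \<open>Induction on a finite set containing the support, removing one value at a time. It
  reduces claims about all of \<open>H0\<close> to chains at a single vertex.\<close>

lemma C0_spanned:
  assumes N: "lin_subspace C0 N" and sgl: "\<And>g y. invertible g \<Longrightarrow> y \<in> carrier V0 \<Longrightarrow> sgl g y \<in> N"
    and \<omega>: "\<omega> \<in> carrier C0"
  shows "\<omega> \<in> N"
proof -
  have "\<omega> \<in> N" if "finite A" "\<omega> \<in> carrier C0" "\<And>\<sigma>. \<sigma> \<in> vertices F \<Longrightarrow> \<sigma> \<notin> A \<Longrightarrow> \<omega> \<sigma> = \<zero>\<^bsub>Sp \<sigma>\<^esub>" for A \<omega>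
    using that
  proof (induction A arbitrary: \<omega> rule: finite_induct)
    case empty
    then have "\<omega> = \<zero>\<^bsub>C0\<^esub>"
      by (intro C0_eqI) (auto simp: C0_simps mem_C0_iff)
    then show ?case
      using C.lin_subspaceD(2)[OF N] by simp
  next
    case (insert \<tau> A)
    show ?case
    proof (cases "\<tau> \<in> vertices F")
      case False
      then show ?thesis
        using insert.IH[of \<omega>] insert.prems by blast
    next
      case True
      then obtain g where g: "invertible g" "\<tau> = vtx g"
        by (rule vertexE)
      have "\<omega> \<tau> \<in> carrier (Sp \<tau>)"
        using insert.prems(1) True by (simp add: mem_C0_iff)
      then obtain y where y: "y \<in> carrier V0" "\<omega> \<tau> = ind0 g y"
        using SpE g by metis
      let ?\<omega>' = "\<omega> \<ominus>\<^bsub>C0\<^esub> sgl g y"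
      have s: "sgl g y \<in> carrier C0"
        using g y by (simp add: sgl_mem)
      have eq: "?\<omega>' \<sigma> = \<omega> \<sigma> \<oplus>\<^bsub>Sp \<sigma>\<^esub> (- 1) \<odot>\<^bsub>Sp \<sigma>\<^esub> sgl g y \<sigma>" if "\<sigma> \<in> vertices F" for \<sigma>
        using that by (simp only: C.minus_eq C.minus_eq_smult[OF s]) (simp add: C0_simps)
      have "?\<omega>' \<in> N"
      proof (rule insert.IH)
        show "?\<omega>' \<in> carrier C0"
          using insert.prems(1) s by (rule C.minus_closed)
        fix \<sigma> assume \<sigma>: "\<sigma> \<in> vertices F" "\<sigma> \<notin> A"
        interpret S: kspace "Sp \<sigma>"
          using \<sigma>(1) by (rule kspace_Sp)
        show "?\<omega>' \<sigma> = \<zero>\<^bsub>Sp \<sigma>\<^esub>"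
        proof (cases "\<sigma> = \<tau>")
          case True
          have "\<omega> \<sigma> \<in> carrier (Sp \<sigma>)" "sgl g y \<sigma> = \<omega> \<sigma>"
            using True g y \<sigma> insert.prems(1) by (simp_all add: sgl_def ind0_mem)
          then show ?thesis
            unfolding eq[OF \<sigma>(1)] by (simp add: S.minus_smult S.r_neg)
        next
          case False
          then have "sgl g y \<sigma> = \<zero>\<^bsub>Sp \<sigma>\<^esub>" "\<omega> \<sigma> = \<zero>\<^bsub>Sp \<sigma>\<^esub>"
            using \<sigma> g insert.prems(2) by (simp_all add: sgl_def Sp_simps)
          then show ?thesis
            using eq[OF \<sigma>(1)] by simp
        qed
      qed
      then have "?\<omega>' \<oplus>\<^bsub>C0\<^esub> sgl g y \<in> N"
        using sgl[OF g(1) y(1)] by (rule C.lin_subspaceD(3)[OF N])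
      moreover have "?\<omega>' \<oplus>\<^bsub>C0\<^esub> sgl g y = \<omega>"
        using insert.prems(1) s by (simp add: C.minus_eq C.add.m_assoc C.l_neg)
      ultimately show ?thesis
        by simp
    qed
  qed
  from this[of "{\<sigma> \<in> vertices F. \<omega> \<sigma> \<noteq> \<zero>\<^bsub>Sp \<sigma>\<^esub>}" \<omega>] show ?thesis
    using \<omega> by (auto simp: mem_C0_iff)
qed

subsection \<open>The boundary map\<close>

lemma C1_I:
  assumes "\<omega> \<in> extensional edges"
    and "\<And>\<sigma> \<sigma>'. (\<sigma>, \<sigma>') \<in> edges \<Longrightarrow> \<omega> (\<sigma>, \<sigma>') \<in> carrier (Ed \<sigma> \<sigma>')"
    and "\<And>\<sigma> \<sigma>'. (\<sigma>, \<sigma>') \<in> edges \<Longrightarrow> \<omega> (\<sigma>', \<sigma>) = \<ominus>\<^bsub>Ed \<sigma> \<sigma>'\<^esub> \<omega> (\<sigma>, \<sigma>')"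
    and "finite A" "\<And>\<sigma> \<sigma>'. (\<sigma>, \<sigma>') \<in> edges \<Longrightarrow> (\<sigma>, \<sigma>') \<notin> A \<Longrightarrow> \<omega> (\<sigma>, \<sigma>') = (\<lambda>_. \<zero>\<^bsub>V1\<^esub>)"
  shows "\<omega> \<in> C1"
proof -
  have "{(\<sigma>, \<sigma>') \<in> edges. \<omega> (\<sigma>, \<sigma>') \<noteq> \<zero>\<^bsub>Ed \<sigma> \<sigma>'\<^esub>} \<subseteq> A"
    using assms(5) by (auto simp: Ed_simps)
  then have "finite {(\<sigma>, \<sigma>') \<in> edges. \<omega> (\<sigma>, \<sigma>') \<noteq> \<zero>\<^bsub>Ed \<sigma> \<sigma>'\<^esub>}"
    using assms(4) by (rule finite_subset)
  then show ?thesis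
    using assms(1-3) unfolding chains1_def coeff_system_simps by blast
qed

lemma C1_D:
  assumes "\<omega> \<in> C1"
  shows "\<omega> \<in> extensional edges"
    and "(\<sigma>, \<sigma>') \<in> edges \<Longrightarrow> \<omega> (\<sigma>, \<sigma>') \<in> carrier (Ed \<sigma> \<sigma>')"
    and "(\<sigma>, \<sigma>') \<in> edges \<Longrightarrow> \<omega> (\<sigma>', \<sigma>) = \<ominus>\<^bsub>Ed \<sigma> \<sigma>'\<^esub> \<omega> (\<sigma>, \<sigma>')"
    and "finite {e \<in> edges. \<omega> e \<noteq> (\<lambda>_. \<zero>\<^bsub>V1\<^esub>)}"
proof -
  have "{e \<in> edges. \<omega> e \<noteq> (\<lambda>_. \<zero>\<^bsub>V1\<^esub>)} = {(\<sigma>, \<sigma>') \<in> edges. \<omega> (\<sigma>, \<sigma>') \<noteq> \<zero>\<^bsub>Ed \<sigma> \<sigma>'\<^esub>}"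
    by (auto simp: Ed_simps)
  moreover have "finite {(\<sigma>, \<sigma>') \<in> edges. \<omega> (\<sigma>, \<sigma>') \<noteq> \<zero>\<^bsub>Ed \<sigma> \<sigma>'\<^esub>}"
    using assms unfolding chains1_def coeff_system_simps by blast
  ultimately show "finite {e \<in> edges. \<omega> e \<noteq> (\<lambda>_. \<zero>\<^bsub>V1\<^esub>)}"
    by simp
qed (use assms in \<open>auto simp: chains1_def\<close>)

lemma bd_apply: "\<sigma> \<in> vertices F \<Longrightarrow> bd \<omega> \<sigma> = (\<Oplus>\<^bsub>Sp \<sigma>\<^esub> \<sigma>' \<in> nbrs \<sigma>. res \<sigma> \<sigma>' (\<omega> (\<sigma>, \<sigma>')))"
  and bd_ext: "bd \<omega> \<in> extensional (vertices F)"
  by (simp_all add: boundary_def)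

lemma res_closed: "(\<sigma>, \<sigma>') \<in> edges \<Longrightarrow> f \<in> carrier (Ed \<sigma> \<sigma>') \<Longrightarrow> res \<sigma> \<sigma>' f \<in> carrier (Sp \<sigma>)"
  by (rule linear_map.closed[OF res_linear])

lemma res_zero: "(\<sigma>, \<sigma>') \<in> edges \<Longrightarrow> res \<sigma> \<sigma>' (\<lambda>_. \<zero>\<^bsub>V1\<^esub>) = \<zero>\<^bsub>Sp \<sigma>\<^esub>"
  using linear_map.zero[OF res_linear] by (simp add: Ed_simps)

lemma bd_mem:
  assumes "\<omega> \<in> C1"
  shows "bd \<omega> \<in> carrier C0"
proof -
  note D = C1_D[OF assms]
  have "bd \<omega> \<sigma> \<in> carrier (Sp \<sigma>)" if "\<sigma> \<in> vertices F" for \<sigma>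
  proof -
    interpret kspace "Sp \<sigma>"
      using that by (rule kspace_Sp)
    show ?thesis
      using that D(2) by (auto simp: bd_apply intro!: finsum_closed res_closed)
  qed
  moreover have "{\<sigma> \<in> vertices F. bd \<omega> \<sigma> \<noteq> \<zero>\<^bsub>Sp \<sigma>\<^esub>} \<subseteq> fst ` {e \<in> edges. \<omega> e \<noteq> (\<lambda>_. \<zero>\<^bsub>V1\<^esub>)}"
  proof
    fix \<sigma> assume \<sigma>: "\<sigma> \<in> {\<sigma> \<in> vertices F. bd \<omega> \<sigma> \<noteq> \<zero>\<^bsub>Sp \<sigma>\<^esub>}"
    then interpret kspace "Sp \<sigma>"
      using kspace_Sp by blast
    show "\<sigma> \<in> fst ` {e \<in> edges. \<omega> e \<noteq> (\<lambda>_. \<zero>\<^bsub>V1\<^esub>)}"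
    proof (rule ccontr)
      assume "\<not> ?thesis"
      then have z: "\<omega> (\<sigma>, \<sigma>') = (\<lambda>_. \<zero>\<^bsub>V1\<^esub>)" if "(\<sigma>, \<sigma>') \<in> edges" for \<sigma>'
        using that by force
      have "\<sigma> \<in> vertices F"
        using \<sigma> by simp
      from bd_apply[OF this] have "bd \<omega> \<sigma> = (\<Oplus>\<^bsub>Sp \<sigma>\<^esub> \<sigma>' \<in> nbrs \<sigma>. \<zero>\<^bsub>Sp \<sigma>\<^esub>)"
        by (simp only:) (intro finsum_cong'; simp add: z res_zero)
      with \<sigma> show False
        by simp
    qed
  qed
  then have "finite {\<sigma> \<in> vertices F. bd \<omega> \<sigma> \<noteq> \<zero>\<^bsub>Sp \<sigma>\<^esub>}"
    by (rule finite_subset) (use D(4) in blast)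
  ultimately show ?thesis
    by (simp add: mem_C0_iff bd_ext)
qed

lemma edge_act: "invertible h \<Longrightarrow> (\<sigma>, \<sigma>') \<in> edges \<Longrightarrow> (vertex_act h \<sigma>, vertex_act h \<sigma>') \<in> edges"
proof -
  assume h: "invertible h" and "(\<sigma>, \<sigma>') \<in> edges"
  then obtain g where g: "invertible g" "\<sigma> = vtx g" "\<sigma>' = vtx (g ** \<Pi>0)"
    using edgeE by blast
  then have "(vertex_act h \<sigma>, vertex_act h \<sigma>') = (vtx (h ** g), vtx (h ** g ** \<Pi>0))"
    by (simp add: vertex_act_vtx matrix_mul_assoc)
  moreover have "invertible (h ** g)"
    using h g by (simp add: invertible_mult)
  ultimately show ?thesis
    unfolding oriented_edges_eq by blast
qed

lemma translate_Ed_linear: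
  assumes h: "invertible h" and e: "(\<sigma>, \<sigma>') \<in> edges"
  shows "linear_map (Ed \<sigma> \<sigma>') (Ed (vertex_act h \<sigma>) (vertex_act h \<sigma>')) (\<lambda>f x. f (x ** h))"
proof -
  obtain g where g: "invertible g" "\<sigma> = vtx g" "\<sigma>' = vtx (g ** \<Pi>0)"
    using edgeE[OF e] .
  have hg: "invertible (h ** g)"
    using h g by (simp add: invertible_mult)
  have Ed': "Ed (vertex_act h \<sigma>) (vertex_act h \<sigma>') = V1.sp (h ** g)"
    using Ed_eq[OF hg] g by (simp add: vertex_act_vtx matrix_mul_assoc)
  have "(\<lambda>f x. f (x ** h)) \<in> linear_maps (Ed \<sigma> \<sigma>') (Ed (vertex_act h \<sigma>) (vertex_act h \<sigma>'))"
    unfolding Ed' using g h hg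
    by (auto simp: linear_maps_def Ed_eq V1.mem_sp_iff V1.ind_translate) blast
  then show ?thesis
    using kspace_Ed[OF e] kspace_Ed[OF edge_act[OF h e]]
    by (simp add: linear_map_def linear_map_axioms_def)
qed

lemma translate_Sp_linear:
  assumes h: "invertible h" and \<sigma>: "\<sigma> \<in> vertices F"
  shows "linear_map (Sp \<sigma>) (Sp (vertex_act h \<sigma>)) (\<lambda>f x. f (x ** h))"
proof -
  obtain g where g: "invertible g" "\<sigma> = vtx g"
    using vertexE[OF \<sigma>] .
  have hg: "invertible (h ** g)"
    using h g by (simp add: invertible_mult)
  have "(\<lambda>f x. f (x ** h)) \<in> linear_maps (Sp \<sigma>) (Sp (vertex_act h \<sigma>))"
    using g h hg
    by (auto simp: linear_maps_def Sp_eq V0.mem_sp_iff V0.ind_translate vertex_act_vtx) blast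
  then show ?thesis
    using kspace_Sp[OF \<sigma>] kspace_Sp[OF vertex_act_vertices[OF h \<sigma>]]
    by (simp add: linear_map_def linear_map_axioms_def)
qed

lemma translate_res:
  assumes h: "invertible h" and e: "(\<sigma>, \<sigma>') \<in> edges" and f: "f \<in> carrier (Ed \<sigma> \<sigma>')"
  shows "res (vertex_act h \<sigma>) (vertex_act h \<sigma>') (\<lambda>x. f (x ** h)) = (\<lambda>x. res \<sigma> \<sigma>' f (x ** h))"
proof -
  obtain g where g: "invertible g" "\<sigma> = vtx g" "\<sigma>' = vtx (g ** \<Pi>0)"
    using edgeE[OF e] .
  then obtain y where y: "y \<in> carrier V1" "f = ind1 g y"
    using f EdE by blast
  have "invertible (h ** g)"
    using h g by (simp add: invertible_mult)
  then show ?thesis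
    using g y res_ind1[of "h ** g" y]
    by (simp add: vertex_act_vtx matrix_mul_assoc V1.ind_translate V0.ind_translate res_ind1)
qed

text \<open>This makes \<open>H0\<close> a quotient representation. The substantial point is
  stability under the group: a 1-chain is translated edge by edge, and the sum over neighbours is
  reindexed.\<close>

lemma bd_image_subrep: "subrep (carrier GL2) C0 (bd ` C1)"
  unfolding C.subrep_iff
proof (intro conjI ballI allI)
  show "bd ` C1 \<subseteq> carrier C0"
    using bd_mem by blast
next
  let ?z = "\<lambda>e\<in>edges. (\<lambda>_. \<zero>\<^bsub>V1\<^esub>)"
  have zm: "(\<lambda>_. \<zero>\<^bsub>V1\<^esub>) \<in> carrier (Ed \<sigma> \<sigma>')" "\<ominus>\<^bsub>Ed \<sigma> \<sigma>'\<^esub> (\<lambda>_. \<zero>\<^bsub>V1\<^esub>) = (\<lambda>_. \<zero>\<^bsub>V1\<^esub>)"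
    if e: "(\<sigma>, \<sigma>') \<in> edges" for \<sigma> \<sigma>'
  proof -
    interpret kspace "Ed \<sigma> \<sigma>'"
      using e by (rule kspace_Ed)
    show "(\<lambda>_. \<zero>\<^bsub>V1\<^esub>) \<in> carrier (Ed \<sigma> \<sigma>')" "\<ominus>\<^bsub>Ed \<sigma> \<sigma>'\<^esub> (\<lambda>_. \<zero>\<^bsub>V1\<^esub>) = (\<lambda>_. \<zero>\<^bsub>V1\<^esub>)"
      using zero_closed a_inv_zero by (simp_all only: Ed_simps[OF e])
  qed
  have z: "?z \<in> C1"
    by (rule C1_I[where A = "{}"]) (auto simp: zm edge_sym)
  have "bd ?z = \<zero>\<^bsub>C0\<^esub>"
  proof (rule C0_eqI)
    fix \<sigma> assume \<sigma>: "\<sigma> \<in> vertices F"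
    then interpret kspace "Sp \<sigma>"
      by (rule kspace_Sp)
    have "bd ?z \<sigma> = (\<Oplus>\<^bsub>Sp \<sigma>\<^esub> \<sigma>' \<in> nbrs \<sigma>. \<zero>\<^bsub>Sp \<sigma>\<^esub>)"
      unfolding bd_apply[OF \<sigma>] by (intro finsum_cong') (auto simp: res_zero)
    then show "bd ?z \<sigma> = \<zero>\<^bsub>C0\<^esub> \<sigma>"
      using \<sigma> by (simp add: C0_simps)
  qed (simp_all add: bd_ext C0_simps)
  from this[symmetric] z show "\<zero>\<^bsub>C0\<^esub> \<in> bd ` C1"
    by (rule image_eqI)
next
  fix x y assume "x \<in> bd ` C1" "y \<in> bd ` C1"
  then obtain \<omega> \<omega>' where *: "\<omega> \<in> C1" "\<omega>' \<in> C1" "x = bd \<omega>" "y = bd \<omega>'"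
    by blast
  note D = C1_D[OF *(1)] and D' = C1_D[OF *(2)]
  let ?s = "\<lambda>e\<in>edges. \<omega> e \<oplus>\<^bsub>Ed (fst e) (snd e)\<^esub> \<omega>' e"
  have s: "?s \<in> C1"
  proof (rule C1_I)
    show "finite ({e \<in> edges. \<omega> e \<noteq> (\<lambda>_. \<zero>\<^bsub>V1\<^esub>)} \<union> {e \<in> edges. \<omega>' e \<noteq> (\<lambda>_. \<zero>\<^bsub>V1\<^esub>)})"
      using D(4) D'(4) by simp
    fix \<sigma> \<sigma>' assume e: "(\<sigma>, \<sigma>') \<in> edges"
    interpret kspace "Ed \<sigma> \<sigma>'"
      using e by (rule kspace_Ed)
    show "?s (\<sigma>, \<sigma>') \<in> carrier (Ed \<sigma> \<sigma>')"
      using e D(2) D'(2) by simp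
    show "?s (\<sigma>', \<sigma>) = \<ominus>\<^bsub>Ed \<sigma> \<sigma>'\<^esub> ?s (\<sigma>, \<sigma>')"
      using e D(2,3)[OF e] D'(2,3)[OF e]
      by (simp add: edge_sym Ed_sym[of \<sigma>' \<sigma>] minus_add)
    show "?s (\<sigma>, \<sigma>') = (\<lambda>_. \<zero>\<^bsub>V1\<^esub>)"
      if "(\<sigma>, \<sigma>') \<notin> {e \<in> edges. \<omega> e \<noteq> (\<lambda>_. \<zero>\<^bsub>V1\<^esub>)} \<union> {e \<in> edges. \<omega>' e \<noteq> (\<lambda>_. \<zero>\<^bsub>V1\<^esub>)}"
      using that e by (simp add: Ed_simps)
  qed simp
  have "bd ?s = x \<oplus>\<^bsub>C0\<^esub> y"
  proof (rule C0_eqI)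
    fix \<sigma> assume \<sigma>: "\<sigma> \<in> vertices F"
    interpret kspace "Sp \<sigma>"
      using \<sigma> by (rule kspace_Sp)
    have "bd ?s \<sigma> = (\<Oplus>\<^bsub>Sp \<sigma>\<^esub> \<sigma>' \<in> nbrs \<sigma>. res \<sigma> \<sigma>' (\<omega> (\<sigma>, \<sigma>')) \<oplus>\<^bsub>Sp \<sigma>\<^esub> res \<sigma> \<sigma>' (\<omega>' (\<sigma>, \<sigma>')))"
      unfolding bd_apply[OF \<sigma>]
      by (intro finsum_cong') (auto simp: linear_map.add[OF res_linear] D(2) D'(2) res_closed)
    also have "\<dots> = bd \<omega> \<sigma> \<oplus>\<^bsub>Sp \<sigma>\<^esub> bd \<omega>' \<sigma>"
      unfolding bd_apply[OF \<sigma>] by (rule finsum_addf) (auto simp: D(2) D'(2) res_closed)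
    finally show "bd ?s \<sigma> = (x \<oplus>\<^bsub>C0\<^esub> y) \<sigma>"
      using \<sigma> * by (simp add: C0_simps)
  qed (simp_all add: bd_ext C0_simps)
  from this[symmetric] s show "x \<oplus>\<^bsub>C0\<^esub> y \<in> bd ` C1"
    by (rule image_eqI)
next
  fix c x assume "x \<in> bd ` C1"
  then obtain \<omega> where *: "\<omega> \<in> C1" "x = bd \<omega>"
    by blast
  note D = C1_D[OF *(1)]
  let ?s = "\<lambda>e\<in>edges. c \<odot>\<^bsub>Ed (fst e) (snd e)\<^esub> \<omega> e"
  have s: "?s \<in> C1"
  proof (rule C1_I)
    show "finite {e \<in> edges. \<omega> e \<noteq> (\<lambda>_. \<zero>\<^bsub>V1\<^esub>)}"
      using D(4) .
    fix \<sigma> \<sigma>' assume e: "(\<sigma>, \<sigma>') \<in> edges"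
    interpret kspace "Ed \<sigma> \<sigma>'"
      using e by (rule kspace_Ed)
    show "?s (\<sigma>, \<sigma>') \<in> carrier (Ed \<sigma> \<sigma>')"
      using e D(2) by simp
    show "?s (\<sigma>', \<sigma>) = \<ominus>\<^bsub>Ed \<sigma> \<sigma>'\<^esub> ?s (\<sigma>, \<sigma>')"
      using e D(2,3)[OF e] by (simp add: edge_sym Ed_sym[of \<sigma>' \<sigma>] smult_a_inv)
    show "?s (\<sigma>, \<sigma>') = (\<lambda>_. \<zero>\<^bsub>V1\<^esub>)" if "(\<sigma>, \<sigma>') \<notin> {e \<in> edges. \<omega> e \<noteq> (\<lambda>_. \<zero>\<^bsub>V1\<^esub>)}"
      using that e by (simp add: Ed_simps)
  qed simp
  have "bd ?s = c \<odot>\<^bsub>C0\<^esub> x"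
  proof (rule C0_eqI)
    fix \<sigma> assume \<sigma>: "\<sigma> \<in> vertices F"
    interpret kspace "Sp \<sigma>"
      using \<sigma> by (rule kspace_Sp)
    have sm: "linear_map (Sp \<sigma>) (Sp \<sigma>) (\<lambda>f. c \<odot>\<^bsub>Sp \<sigma>\<^esub> f)"
      by (rule smult_linear_map)
    have "bd ?s \<sigma> = (\<Oplus>\<^bsub>Sp \<sigma>\<^esub> \<sigma>' \<in> nbrs \<sigma>. c \<odot>\<^bsub>Sp \<sigma>\<^esub> res \<sigma> \<sigma>' (\<omega> (\<sigma>, \<sigma>')))"
      unfolding bd_apply[OF \<sigma>]
      by (intro finsum_cong') (auto simp: linear_map.smult[OF res_linear] D(2) res_closed)
    also have "\<dots> = c \<odot>\<^bsub>Sp \<sigma>\<^esub> bd \<omega> \<sigma>"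
      unfolding bd_apply[OF \<sigma>]
      by (rule linear_map.finsum[OF sm, symmetric]) (auto simp: D(2) res_closed)
    finally show "bd ?s \<sigma> = (c \<odot>\<^bsub>C0\<^esub> x) \<sigma>"
      using \<sigma> * by (simp add: C0_simps)
  qed (simp_all add: bd_ext C0_simps)
  from this[symmetric] s show "c \<odot>\<^bsub>C0\<^esub> x \<in> bd ` C1"
    by (rule image_eqI)
next
  fix h :: "'f^2^2" and x assume "h \<in> carrier GL2" "x \<in> bd ` C1"
  then obtain \<omega> where *: "\<omega> \<in> C1" "x = bd \<omega>" and h: "invertible h"
    by auto
  note D = C1_D[OF *(1)]
  let ?h = "vertex_act h" and ?i = "vertex_act (matrix_inv h)"
  have hi: "invertible (matrix_inv h)"
    using h by simp
  have cancel: "?h (?i \<sigma>) = \<sigma>" "?i (?h \<sigma>) = \<sigma>" if "\<sigma> \<in> vertices F" for \<sigma>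
    using vertex_act_cancel[OF h that] by auto
  let ?s = "\<lambda>e\<in>edges. \<lambda>x. \<omega> (?i (fst e), ?i (snd e)) (x ** h)"
  have ends: "\<sigma> \<in> vertices F" "\<sigma>' \<in> vertices F" if "(\<sigma>, \<sigma>') \<in> edges" for \<sigma> \<sigma>'
    using that edge_vertices edge_sym by blast+
  have T: "linear_map (Ed (?i \<sigma>) (?i \<sigma>')) (Ed \<sigma> \<sigma>') (\<lambda>f x. f (x ** h))" if e: "(\<sigma>, \<sigma>') \<in> edges" for \<sigma> \<sigma>'
    using translate_Ed_linear[OF h edge_act[OF hi e]] cancel ends[OF e] by simp
  have s: "?s \<in> C1"
  proof (rule C1_I)
    show "finite (map_prod ?h ?h ` {e \<in> edges. \<omega> e \<noteq> (\<lambda>_. \<zero>\<^bsub>V1\<^esub>)})"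
      using D(4) by simp
    fix \<sigma> \<sigma>' assume e: "(\<sigma>, \<sigma>') \<in> edges"
    note e' = edge_act[OF hi e]
    interpret T: linear_map "Ed (?i \<sigma>) (?i \<sigma>')" "Ed \<sigma> \<sigma>'" "\<lambda>f x. f (x ** h)"
      using T[OF e] .
    show "?s (\<sigma>, \<sigma>') \<in> carrier (Ed \<sigma> \<sigma>')"
      using e T.closed[OF D(2)[OF e']] by simp
    show "?s (\<sigma>', \<sigma>) = \<ominus>\<^bsub>Ed \<sigma> \<sigma>'\<^esub> ?s (\<sigma>, \<sigma>')"
      using e T.a_inv[OF D(2)[OF e']] D(3)[OF e'] by (simp add: edge_sym)
    show "?s (\<sigma>, \<sigma>') = (\<lambda>_. \<zero>\<^bsub>V1\<^esub>)" if n: "(\<sigma>, \<sigma>') \<notin> map_prod ?h ?h ` {e \<in> edges. \<omega> e \<noteq> (\<lambda>_. \<zero>\<^bsub>V1\<^esub>)}"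
    proof -
      have "(\<sigma>, \<sigma>') = map_prod ?h ?h (?i \<sigma>, ?i \<sigma>')"
        using cancel ends[OF e] by simp
      then have "\<omega> (?i \<sigma>, ?i \<sigma>') = (\<lambda>_. \<zero>\<^bsub>V1\<^esub>)"
        using n e' by (metis (mono_tags, lifting) image_eqI mem_Collect_eq)
      then show ?thesis
        using e by simp
    qed
  qed simp
  have "bd ?s = act C0 h x"
  proof (rule C0_eqI)
    fix \<sigma> assume \<sigma>: "\<sigma> \<in> vertices F"
    let ?\<tau> = "?i \<sigma>"
    have \<tau>: "?\<tau> \<in> vertices F"
      using hi \<sigma> by (rule vertex_act_vertices)
    interpret T: linear_map "Sp ?\<tau>" "Sp \<sigma>" "\<lambda>f x. f (x ** h)"
      using translate_Sp_linear[OF h \<tau>] cancel \<sigma> by simp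
    have nb: "nbrs \<sigma> = ?h ` nbrs ?\<tau>"
    proof (intro equalityI subsetI)
      fix \<sigma>' assume "\<sigma>' \<in> nbrs \<sigma>"
      then have e: "(\<sigma>, \<sigma>') \<in> edges" by simp
      then show "\<sigma>' \<in> ?h ` nbrs ?\<tau>"
        using edge_act[OF hi e] cancel ends[OF e] by (intro image_eqI[of _ _ "?i \<sigma>'"]) auto
    next
      fix \<sigma>' assume "\<sigma>' \<in> ?h ` nbrs ?\<tau>"
      then obtain \<tau>' where "(?\<tau>, \<tau>') \<in> edges" "\<sigma>' = ?h \<tau>'"
        by blast
      then show "\<sigma>' \<in> nbrs \<sigma>"
        using edge_act[OF h, of ?\<tau> \<tau>'] cancel \<sigma> by simp
    qed
    have inj: "inj_on ?h (nbrs ?\<tau>)"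
    proof (rule inj_on_inverseI[of _ ?i])
      fix \<tau>' assume "\<tau>' \<in> nbrs ?\<tau>"
      then show "?i (?h \<tau>') = \<tau>'"
        using cancel(2) ends(2) by blast
    qed
    have step: "res \<sigma> (?h \<tau>') (?s (\<sigma>, ?h \<tau>')) = (\<lambda>x. res ?\<tau> \<tau>' (\<omega> (?\<tau>, \<tau>')) (x ** h))"
      if e: "(?\<tau>, \<tau>') \<in> edges" for \<tau>'
    proof -
      have "(\<sigma>, ?h \<tau>') \<in> edges"
        using edge_act[OF h e] cancel \<sigma> by simp
      then show ?thesis
        using translate_res[OF h e D(2)[OF e]] cancel \<sigma> ends[OF e] by simp
    qed
    have "bd ?s \<sigma> = (\<Oplus>\<^bsub>Sp \<sigma>\<^esub> \<tau>' \<in> nbrs ?\<tau>. res \<sigma> (?h \<tau>') (?s (\<sigma>, ?h \<tau>')))"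
      unfolding bd_apply[OF \<sigma>] nb
    proof (rule T.W.finsum_reindex[OF _ inj])
      show "(\<lambda>\<sigma>'. res \<sigma> \<sigma>' (?s (\<sigma>, \<sigma>'))) \<in> ?h ` nbrs ?\<tau> \<rightarrow> carrier (Sp \<sigma>)"
        unfolding nb[symmetric] using C1_D(2)[OF s] res_closed by blast
    qed
    also have "\<dots> = (\<Oplus>\<^bsub>Sp \<sigma>\<^esub> \<tau>' \<in> nbrs ?\<tau>. (\<lambda>x. res ?\<tau> \<tau>' (\<omega> (?\<tau>, \<tau>')) (x ** h)))"
    proof (rule T.W.finsum_cong')
      show "(\<lambda>\<tau>'. (\<lambda>x. res ?\<tau> \<tau>' (\<omega> (?\<tau>, \<tau>')) (x ** h))) \<in> nbrs ?\<tau> \<rightarrow> carrier (Sp \<sigma>)"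
        using T.closed[OF res_closed[OF _ D(2)]] by blast
    qed (use step in blast)+
    also have "\<dots> = (\<lambda>x. bd \<omega> ?\<tau> (x ** h))"
      unfolding bd_apply[OF \<tau>]
      by (rule T.finsum[symmetric]) (use res_closed[OF _ D(2)] in blast)
    finally show "bd ?s \<sigma> = act C0 h x \<sigma>"
      using \<sigma> * by (simp add: C0_simps)
  qed (simp_all add: bd_ext C0_simps)
  from this[symmetric] s show "act C0 h x \<in> bd ` C1"
    by (rule image_eqI)
qed

text \<open>The relation in \<open>H\<^sub>0\<close> given by the edge with endpoints \<^term>\<open>vtx g\<close> and \<^term>\<open>vtx (g ** \<Pi>0)\<close>.\<close>

lemma edge_relation:
  assumes g: "invertible g" and y: "y \<in> carrier V1"
  shows "sgl g (r y) \<ominus>\<^bsub>C0\<^esub> sgl (g ** \<Pi>0) (r (act V1 (matrix_inv \<Pi>0) y)) \<in> bd ` C1"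
proof -
  let ?a = "vtx g" and ?b = "vtx (g ** \<Pi>0)" and ?y' = "act V1 (matrix_inv \<Pi>0) y"
  have ab: "?a \<noteq> ?b"
    using vtx_Pi_ne[OF g] .
  have gP: "invertible (g ** \<Pi>0)"
    using g by (simp add: invertible_mult)
  have y': "?y' \<in> carrier V1"
    using y by simp
  have e: "(?a, ?b) \<in> edges"
    using g by (auto simp: oriented_edges_eq)
  note e' = edge_sym[OF e]
  have gPP: "vtx (g ** \<Pi>0 ** \<Pi>0) = ?a"
    using vtx_mult_FK[OF g mat_FK[OF unif_nz]] by (simp add: Pi_Pi flip: matrix_mul_assoc)
  define f where "f = ind1 g y"
  have f: "f \<in> carrier (Ed ?a ?b)"
    using g y by (simp add: f_def ind1_mem)
  \<comment> \<open>Seen from its other end, the same function on the edge has the parameter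
    \<open>?y'\<close>, because \<open>g\<close> is \<open>g ** \<Pi>0\<close> times the inverse of
    \<Pi>.\<close>
  have f': "f = ind1 (g ** \<Pi>0) ?y'"
    using V1.ind_mult[OF inv_Pi_SE y, of "g ** \<Pi>0"] by (simp add: f_def)
  interpret Ed: kspace "Ed ?a ?b"
    using e by (rule kspace_Ed)
  \<comment> \<open>The chain supported on this edge; antisymmetry forces the negative of
    \<open>f\<close> on the reversed edge, which is the source of the minus sign in the
    relation.\<close>
  define \<omega> where "\<omega> = (\<lambda>e\<in>edges. if e = (?a, ?b) then f else if e = (?b, ?a) then \<ominus>\<^bsub>Ed ?a ?b\<^esub> f else (\<lambda>_. \<zero>\<^bsub>V1\<^esub>))"
  have \<omega>: "\<omega> \<in> C1"
  proof (rule C1_I[where A = "{(?a, ?b), (?b, ?a)}"])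
    fix \<sigma> \<sigma>' assume ed: "(\<sigma>, \<sigma>') \<in> edges"
    interpret E: kspace "Ed \<sigma> \<sigma>'"
      using ed by (rule kspace_Ed)
    have z: "(\<lambda>_. \<zero>\<^bsub>V1\<^esub>) \<in> carrier (Ed \<sigma> \<sigma>')" "\<ominus>\<^bsub>Ed \<sigma> \<sigma>'\<^esub> (\<lambda>_. \<zero>\<^bsub>V1\<^esub>) = (\<lambda>_. \<zero>\<^bsub>V1\<^esub>)"
      using E.zero_closed E.a_inv_zero by (simp_all only: Ed_simps[OF ed])
    show "\<omega> (\<sigma>, \<sigma>') \<in> carrier (Ed \<sigma> \<sigma>')"
      using ed f z Ed.a_inv_closed[OF f] by (auto simp: \<omega>_def Ed_sym[of ?b ?a])
    consider "(\<sigma>, \<sigma>') = (?a, ?b)" | "(\<sigma>, \<sigma>') = (?b, ?a)" | "(\<sigma>, \<sigma>') \<notin> {(?a, ?b), (?b, ?a)}"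
      by blast
    then show "\<omega> (\<sigma>', \<sigma>) = \<ominus>\<^bsub>Ed \<sigma> \<sigma>'\<^esub> \<omega> (\<sigma>, \<sigma>')"
    proof cases
      case 1
      then show ?thesis
        using ed ab edge_sym[OF ed] by (simp add: \<omega>_def)
    next
      case 2
      then show ?thesis
        using ed ab edge_sym[OF ed] f by (simp add: \<omega>_def Ed_sym[of ?b ?a])
    next
      case 3
      then have "(\<sigma>, \<sigma>') \<noteq> (?a, ?b)" "(\<sigma>, \<sigma>') \<noteq> (?b, ?a)" "(\<sigma>', \<sigma>) \<noteq> (?a, ?b)" "(\<sigma>', \<sigma>) \<noteq> (?b, ?a)"
        by blast+
      then have "\<omega> (\<sigma>, \<sigma>') = (\<lambda>_. \<zero>\<^bsub>V1\<^esub>)" "\<omega> (\<sigma>', \<sigma>) = (\<lambda>_. \<zero>\<^bsub>V1\<^esub>)"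
        using ed edge_sym[OF ed] by (simp_all only: \<omega>_def restrict_apply' if_False)
      then show ?thesis
        using z(2) by simp
    qed
    show "\<omega> (\<sigma>, \<sigma>') = (\<lambda>_. \<zero>\<^bsub>V1\<^esub>)" if "(\<sigma>, \<sigma>') \<notin> {(?a, ?b), (?b, ?a)}"
    proof -
      have "(\<sigma>, \<sigma>') \<noteq> (?a, ?b)" "(\<sigma>, \<sigma>') \<noteq> (?b, ?a)"
        using that by blast+
      then show ?thesis
        using ed by (simp only: \<omega>_def restrict_apply' if_False)
    qed
  qed (simp_all add: \<omega>_def)
  have resf: "res ?a ?b f = ind0 g (r y)" "res ?b ?a f = ind0 (g ** \<Pi>0) (r ?y')"
    using res_ind1[OF g y] res_ind1[OF gP y'] by (simp_all add: f_def[symmetric] f'[symmetric] gPP)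
  have s: "sgl g (r y) \<in> carrier C0" "sgl (g ** \<Pi>0) (r ?y') \<in> carrier C0"
    using g gP y y' by (simp_all add: sgl_mem)
  have "bd \<omega> = sgl g (r y) \<ominus>\<^bsub>C0\<^esub> sgl (g ** \<Pi>0) (r ?y')"
  proof (rule C0_eqI)
    fix \<sigma> assume \<sigma>: "\<sigma> \<in> vertices F"
    interpret S: kspace "Sp \<sigma>"
      using \<sigma> by (rule kspace_Sp)
    have eq: "(sgl g (r y) \<ominus>\<^bsub>C0\<^esub> sgl (g ** \<Pi>0) (r ?y')) \<sigma> =
        sgl g (r y) \<sigma> \<ominus>\<^bsub>Sp \<sigma>\<^esub> sgl (g ** \<Pi>0) (r ?y') \<sigma>"
      using s \<sigma> by (simp only: C.minus_eq C.minus_eq_smult[OF s(2)] S.minus_eq)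
        (simp add: C0_simps mem_C0_iff S.minus_eq_smult)
    consider "\<sigma> = ?a" | "\<sigma> = ?b" | "\<sigma> \<notin> {?a, ?b}"
      by blast
    then show "bd \<omega> \<sigma> = (sgl g (r y) \<ominus>\<^bsub>C0\<^esub> sgl (g ** \<Pi>0) (r ?y')) \<sigma>"
    proof cases
      case 1
      have "bd \<omega> \<sigma> = res \<sigma> ?b (\<omega> (\<sigma>, ?b))"
        unfolding bd_apply[OF \<sigma>]
      proof (rule S.finsum_single)
        show "finite (nbrs \<sigma>)"
          using \<sigma> by (rule finite_neighbours)
        show "?b \<in> nbrs \<sigma>"
          using e 1 by simp
        show "res \<sigma> ?b (\<omega> (\<sigma>, ?b)) \<in> carrier (Sp \<sigma>)"
          using e 1 C1_D(2)[OF \<omega>] by (intro res_closed) auto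
        show "res \<sigma> \<sigma>' (\<omega> (\<sigma>, \<sigma>')) = \<zero>\<^bsub>Sp \<sigma>\<^esub>" if "\<sigma>' \<in> nbrs \<sigma>" "\<sigma>' \<noteq> ?b" for \<sigma>'
          using that 1 ab res_zero[of \<sigma> \<sigma>'] by (simp add: \<omega>_def)
      qed
      also have "\<dots> = ind0 g (r y)"
        using 1 e resf by (simp add: \<omega>_def)
      finally have bd: "bd \<omega> \<sigma> = ind0 g (r y)" .
      have v: "sgl g (r y) \<sigma> = ind0 g (r y)" "sgl (g ** \<Pi>0) (r ?y') \<sigma> = \<zero>\<^bsub>Sp \<sigma>\<^esub>"
        using 1 ab \<sigma> by (simp_all add: sgl_def Sp_simps)
      have "ind0 g (r y) \<in> carrier (Sp \<sigma>)"
        using 1 g y by (simp add: ind0_mem)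
      then show ?thesis
        unfolding eq v bd by simp
    next
      case 2
      have "bd \<omega> \<sigma> = res \<sigma> ?a (\<omega> (\<sigma>, ?a))"
        unfolding bd_apply[OF \<sigma>]
      proof (rule S.finsum_single)
        show "finite (nbrs \<sigma>)"
          using \<sigma> by (rule finite_neighbours)
        show "?a \<in> nbrs \<sigma>"
          using e' 2 by simp
        show "res \<sigma> ?a (\<omega> (\<sigma>, ?a)) \<in> carrier (Sp \<sigma>)"
          using e' 2 C1_D(2)[OF \<omega>] by (intro res_closed) auto
        show "res \<sigma> \<sigma>' (\<omega> (\<sigma>, \<sigma>')) = \<zero>\<^bsub>Sp \<sigma>\<^esub>" if "\<sigma>' \<in> nbrs \<sigma>" "\<sigma>' \<noteq> ?a" for \<sigma>'
          using that 2 ab res_zero[of \<sigma> \<sigma>'] by (simp add: \<omega>_def)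
      qed
      also have "\<dots> = \<ominus>\<^bsub>Sp \<sigma>\<^esub> ind0 (g ** \<Pi>0) (r ?y')"
        using 2 ab e' f resf linear_map.a_inv[OF res_linear[OF e'], of f]
        by (simp add: \<omega>_def Ed_sym[of ?b ?a])
      finally have bd: "bd \<omega> \<sigma> = \<ominus>\<^bsub>Sp \<sigma>\<^esub> ind0 (g ** \<Pi>0) (r ?y')" .
      have v: "sgl g (r y) \<sigma> = \<zero>\<^bsub>Sp \<sigma>\<^esub>" "sgl (g ** \<Pi>0) (r ?y') \<sigma> = ind0 (g ** \<Pi>0) (r ?y')"
        using 2 ab \<sigma> by (simp_all add: sgl_def Sp_simps)
      have "ind0 (g ** \<Pi>0) (r ?y') \<in> carrier (Sp \<sigma>)"
        using 2 gP y' by (simp add: ind0_mem)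
      then show ?thesis
        unfolding eq v bd by (simp add: S.minus_eq)
    next
      case 3
      have "bd \<omega> \<sigma> = (\<Oplus>\<^bsub>Sp \<sigma>\<^esub> \<sigma>' \<in> nbrs \<sigma>. \<zero>\<^bsub>Sp \<sigma>\<^esub>)"
        unfolding bd_apply[OF \<sigma>] using 3 res_zero by (intro S.finsum_cong') (auto simp: \<omega>_def)
      then have bd: "bd \<omega> \<sigma> = \<zero>\<^bsub>Sp \<sigma>\<^esub>"
        by simp
      have v: "sgl g (r y) \<sigma> = \<zero>\<^bsub>Sp \<sigma>\<^esub>" "sgl (g ** \<Pi>0) (r ?y') \<sigma> = \<zero>\<^bsub>Sp \<sigma>\<^esub>"
        using 3 \<sigma> by (simp_all add: sgl_def Sp_simps)
      show ?thesis
        unfolding eq v bd by simp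
    qed
  qed (simp_all add: bd_ext C0_simps C.minus_eq C.minus_eq_smult[OF s(2)])
  from this[symmetric] \<omega> show ?thesis
    by (rule image_eqI)
qed

text \<open>As the tree has no cycles and the restriction maps are injective, a chain whose boundary is
  supported at the base vertex vanishes: look at an edge with an endpoint at maximal distance.\<close>

lemma bd_supported_at_base:
  assumes inj: "inj_on r (carrier V1)" and \<omega>: "\<omega> \<in> C1"
    and bd: "\<And>\<sigma>. \<sigma> \<in> vertices F \<Longrightarrow> \<sigma> \<noteq> vtx (mat 1) \<Longrightarrow> bd \<omega> \<sigma> = \<zero>\<^bsub>Sp \<sigma>\<^esub>"
    and e: "(\<sigma>, \<sigma>') \<in> edges"
  shows "\<omega> (\<sigma>, \<sigma>') = (\<lambda>_. \<zero>\<^bsub>V1\<^esub>)"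
proof (rule ccontr)
  note D = C1_D[OF \<omega>]
  define S where "S = {e \<in> edges. \<omega> e \<noteq> (\<lambda>_. \<zero>\<^bsub>V1\<^esub>)}"
  \<comment> \<open>A distance on vertices rather than on matrices; the choice is harmless because
    \<open>dist0\<close> depends on the vertex only.\<close>
  define d where "d \<sigma> = dist0 (SOME g. invertible g \<and> \<sigma> = vtx g)" for \<sigma>
  have d_vtx: "d (vtx g) = dist0 g" if "invertible g" for g
  proof -
    have "invertible (SOME h. invertible h \<and> vtx g = vtx h) \<and> vtx g = vtx (SOME h. invertible h \<and> vtx g = vtx h)"
      by (rule someI_ex) (use that in blast)
    then show ?thesis
      unfolding d_def using dist0_vtx[OF that] by metis
  qed
  assume "\<not> ?thesis"
  with e have "S \<noteq> {}"
    by (auto simp: S_def)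
  moreover have "finite S"
    using D(4) by (simp add: S_def)
  ultimately have fin: "finite ((d \<circ> fst) ` S)" and "(d \<circ> fst) ` S \<noteq> {}"
    by simp_all
  then have "Max ((d \<circ> fst) ` S) \<in> (d \<circ> fst) ` S"
    by (rule Max_in)
  \<comment> \<open>\<open>a\<close> is an origin of maximal distance in the support. The support is
    closed under reversal, so no endpoint is farther away either.\<close>
  then obtain a b where ab: "(a, b) \<in> S" "Max ((d \<circ> fst) ` S) = d a"
    by force
  have max: "d \<sigma> \<le> d a" if "(\<sigma>, \<sigma>') \<in> S" for \<sigma> \<sigma>'
    using Max_ge[OF fin imageI[OF that]] ab(2) by simp
  note ab = ab(1)
  have sym: "(\<sigma>', \<sigma>) \<in> S" if S: "(\<sigma>, \<sigma>') \<in> S" for \<sigma> \<sigma>'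
  proof -
    have ed: "(\<sigma>, \<sigma>') \<in> edges" and nz: "\<omega> (\<sigma>, \<sigma>') \<noteq> (\<lambda>_. \<zero>\<^bsub>V1\<^esub>)"
      using S by (auto simp: S_def)
    interpret kspace "Ed \<sigma> \<sigma>'"
      using ed by (rule kspace_Ed)
    have "\<omega> (\<sigma>', \<sigma>) \<noteq> (\<lambda>_. \<zero>\<^bsub>V1\<^esub>)"
      using D(2,3)[OF ed] nz add.inv_eq_1_iff by (simp add: Ed_simps[OF ed])
    then show ?thesis
      using ed by (simp add: S_def edge_sym)
  qed
  have abe: "(a, b) \<in> edges"
    using ab by (simp add: S_def)
  then obtain g where g: "invertible g" "a = vtx g" "b = vtx (g ** \<Pi>0)"
    by (rule edgeE)
  have av: "a \<in> vertices F"
    using edge_vertices[OF abe] .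
  \<comment> \<open>Both \<open>\<sigma>'\<close> and \<open>b\<close> are at distance at most that
    of \<open>a\<close>, and \<open>at_most_one_closer\<close> allows only one such
    neighbour.\<close>
  have closer: "\<sigma>' = b" if S: "(a, \<sigma>') \<in> S" for \<sigma>'
  proof -
    have nb: "\<sigma>' \<in> (\<lambda>k. vtx (g ** k ** \<Pi>0)) ` K" "b \<in> (\<lambda>k. vtx (g ** k ** \<Pi>0)) ` K"
      using S abe g(2) neighbours_eq[OF g(1)] by (auto simp: S_def)
    then obtain k k' where k: "k \<in> K" "k' \<in> K" "\<sigma>' = vtx (g ** k ** \<Pi>0)" "b = vtx (g ** k' ** \<Pi>0)"
      by blast
    have "d \<sigma>' \<le> d a" "d b \<le> d a"
      using max sym S ab by blast+
    then have "dist0 (g ** k ** \<Pi>0) \<le> dist0 g" "dist0 (g ** k' ** \<Pi>0) \<le> dist0 g"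
      using k g K_invertible by (simp_all add: d_vtx invertible_mult)
    then show ?thesis
      using at_most_one_closer[OF g(1) k(1,2)] k by simp
  qed
  \<comment> \<open>If \<open>a\<close> were the base vertex, \<open>b\<close> too would have
    distance 0 and hence coincide with \<open>a\<close>.\<close>
  have "a \<noteq> vtx (mat 1)"
  proof
    assume a: "a = vtx (mat 1)"
    have "dist0 (mat 1) = 0"
      unfolding dist0_def by (rule Least_eq_0) (auto intro!: exI[of _ 1] simp: integral2_def)
    then have "d a = 0"
      using d_vtx[of "mat 1"] a by simp
    moreover have "d b \<le> d a"
      using max sym ab by blast
    ultimately have "dist0 (g ** \<Pi>0) = 0"
      using d_vtx[of "g ** \<Pi>0"] g by (simp add: invertible_mult)
    then have "g ** \<Pi>0 \<in> FK"
      using g by (intro dist0_eq_0) (simp add: invertible_mult)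
    then have "b = vtx (mat 1)"
      using vtx_mult_FK[of "mat 1" "g ** \<Pi>0"] g by simp
    then show False
      using a g vtx_Pi_ne[OF g(1)] by simp
  qed
  then have "bd \<omega> a = \<zero>\<^bsub>Sp a\<^esub>"
    using bd av by blast
  \<comment> \<open>By \<open>closer\<close> the sum at \<open>a\<close> has a single term. It must
    vanish, and injectivity of \<open>r\<close> carries this back to
    \<open>\<omega> (a, b)\<close>.\<close>
  moreover have "bd \<omega> a = res a b (\<omega> (a, b))"
  proof -
    interpret kspace "Sp a"
      using av by (rule kspace_Sp)
    show ?thesis
      unfolding bd_apply[OF av]
    proof (rule finsum_single)
      show "finite (nbrs a)"
        using av by (rule finite_neighbours)
      show "b \<in> nbrs a"
        using abe by simp
      show "res a b (\<omega> (a, b)) \<in> carrier (Sp a)"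
        using res_closed[OF abe D(2)[OF abe]] .
      show "res a \<sigma>' (\<omega> (a, \<sigma>')) = \<zero>\<^bsub>Sp a\<^esub>" if "\<sigma>' \<in> nbrs a" "\<sigma>' \<noteq> b" for \<sigma>'
      proof -
        have "(a, \<sigma>') \<notin> S"
          using that(2) closer by blast
        then show ?thesis
          using that(1) res_zero[of a \<sigma>'] by (simp add: S_def)
      qed
    qed
  qed
  ultimately have z: "res a b (\<omega> (a, b)) = (\<lambda>_. \<zero>\<^bsub>V0\<^esub>)"
    using av by (simp add: Sp_simps)
  obtain y where y: "y \<in> carrier V1" "\<omega> (a, b) = ind1 g y"
    using D(2)[OF abe] EdE g by metis
  have "ind0 g (r y) = ind0 g \<zero>\<^bsub>V0\<^esub>"
    using z res_ind1[OF g(1) y(1)] g y by (simp add: V0.ind_zero)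
  then have "r y = \<zero>\<^bsub>V0\<^esub>"
    using V0.ind_inj[OF g(1)] y by simp
  then have "y = \<zero>\<^bsub>V1\<^esub>"
    using inj_onD[OF inj, of y "\<zero>\<^bsub>V1\<^esub>"] y by simp
  then show False
    using ab y by (simp add: S_def V1.ind_zero)
qed

end

subsection \<open>Homology\<close>

sublocale diagram_loc \<subseteq> H: quotient_rep "carrier GL2" "chains0 F (coeff_of_diagram F D)"
    "boundary F (coeff_of_diagram F D) ` chains1 F (coeff_of_diagram F D)"
  by unfold_locales (rule bd_image_subrep)

context diagram_loc
begin

lemma H0_eq: "H0 F cs = H.Q"
  by (simp add: H0_def)

lemma representation_H0: "representation (carrier GL2) (H0 F cs)"
  unfolding H0_eq by (rule H.representation_Q) (auto simp: invertible_mult)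

definition cls :: "'f^2^2 \<Rightarrow> 'v \<Rightarrow> ('f vertex \<Rightarrow> 'f^2^2 \<Rightarrow> 'v) set" where
  "cls g y = H.proj (sgl g y)"

lemma cls_linear: "invertible g \<Longrightarrow> linear_map V0 (H0 F cs) (cls g)"
proof -
  assume g: "invertible g"
  interpret s: linear_map V0 C0 "sgl g"
    using g by (rule sgl_linear)
  show ?thesis
    unfolding H0_eq
    by (intro linear_map.intro linear_map_axioms.intro V0.kspace_axioms H.kspace_Q)
      (auto simp: linear_maps_def cls_def H.Q_carrier s.add s.smult H.Q_add H.Q_smult)
qed

lemma act_cls: "invertible g \<Longrightarrow> invertible h \<Longrightarrow> y \<in> carrier V0 \<Longrightarrow> act (H0 F cs) h (cls g y) = cls (h ** g) y"
  unfolding H0_eq cls_def by (subst H.Q_act) (auto simp: sgl_mem act_sgl)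

lemma cls_FK: "invertible g \<Longrightarrow> k \<in> FK \<Longrightarrow> y \<in> carrier V0 \<Longrightarrow> cls (g ** k) y = cls g (act V0 k y)"
  by (simp add: cls_def sgl_mult)

lemma cls_edge:
  assumes "invertible g" "y \<in> carrier V1"
  shows "cls g (r y) = cls (g ** \<Pi>0) (r (act V1 (matrix_inv \<Pi>0) y))"
  unfolding cls_def using assms edge_relation[OF assms]
  by (subst H.proj_eq_iff) (simp_all add: sgl_mem invertible_mult)

end

section \<open>Diagrams whose restriction map is the identity\<close>

locale constant_diagram = diagram_loc F D
  for F :: "('f::field, 'q::finite_field) local_field_data"
    and D :: "('k::field, 'v, 'f^2^2) diagram" +
  assumes trunc: "module.truncate (diag1 D) = module.truncate (diag0 D)"
    and r_id: "diag_r D = id"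
begin

lemma V1_carrier: "carrier V1 = carrier V0"
  using trunc by (simp add: module.defs)

lemma cls_Pi: "invertible g \<Longrightarrow> y \<in> carrier V0 \<Longrightarrow> cls (g ** \<Pi>0) y = cls g (act V1 \<Pi>0 y)"
  using cls_edge[of g "act V1 \<Pi>0 y"] V1.act_mult[of "matrix_inv \<Pi>0" \<Pi>0 y, symmetric]
  by (simp add: r_id V1_carrier V1.act_closed[unfolded V1_carrier])

text \<open>As \<open>r\<close> is the identity, \<open>cls_edge\<close> moves any class to a
  neighbour, and \<open>exists_closer\<close> provides one nearer to the base. The vector is first
  transported by \<open>k\<close>, so that this neighbour becomes the one in the direction of
  \<Pi>.\<close>

lemma cls_base: "invertible g \<Longrightarrow> y \<in> carrier V0 \<Longrightarrow> \<exists>z\<in>carrier V0. cls g y = cls (mat 1) z"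
proof (induction "dist0 g" arbitrary: g y rule: less_induct)
  case less
  note g = less.prems(1)
  show ?case
  proof (cases "dist0 g = 0")
    case True
    then have k: "g \<in> FK"
      using g by (intro dist0_eq_0)
    then show ?thesis
      using cls_FK[of "mat 1" g y] less.prems(2) by auto
  next
    case False
    then obtain k where k: "k \<in> K" "dist0 (g ** k ** \<Pi>0) < dist0 g"
      using exists_closer[OF g] by blast
    have kF: "k \<in> FK" "matrix_inv k \<in> FK"
      using K_FK K_inv k(1) by blast+
    have gk: "invertible (g ** k)"
      using g k(1) K_invertible by (simp add: invertible_mult)
    let ?y = "act V0 (matrix_inv k) y"
    let ?z = "act V1 (matrix_inv \<Pi>0) ?y"
    have y: "?y \<in> carrier V0"
      using kF less.prems(2) by simp
    then have z: "?z \<in> carrier V0"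
      using V1.act_closed[of "matrix_inv \<Pi>0" ?y] by (simp add: V1_carrier)
    have "cls g y = cls (g ** k) ?y"
      using cls_FK[OF gk kF(2) less.prems(2)] K_invertible[OF k(1)] by simp
    also have "\<dots> = cls (g ** k ** \<Pi>0) ?z"
      using cls_edge[OF gk, of ?y] y by (simp add: r_id V1_carrier)
    finally show ?thesis
      using less.hyps[OF k(2) _ z] gk by (simp add: invertible_mult)
  qed
qed

lemma H0_spanned: "A \<in> carrier (H0 F cs) \<Longrightarrow> \<exists>y\<in>carrier V0. A = cls (mat 1) y"
proof -
  assume "A \<in> carrier (H0 F cs)"
  then obtain \<omega> where \<omega>: "\<omega> \<in> carrier C0" "A = H.proj \<omega>"
    by (auto simp: H0_eq H.Q_carrier)
  interpret c: linear_map V0 "H0 F cs" "cls (mat 1)"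
    by (rule cls_linear) simp
  let ?N = "{\<omega> \<in> carrier C0. H.proj \<omega> \<in> cls (mat 1) ` carrier V0}"
  have "lin_subspace C0 ?N"
    using linear_map.subspace_vimage[OF H.proj_linear_map]
      c.subspace_image[OF V0.lin_subspace_carrier] by (simp add: H0_eq)
  moreover have "sgl g y \<in> ?N" if "invertible g" "y \<in> carrier V0" for g y
    using cls_base[OF that] that by (auto simp: sgl_mem cls_def)
  ultimately have "\<omega> \<in> ?N"
    using \<omega>(1) by (rule C0_spanned)
  then show ?thesis
    using \<omega>(2) by auto
qed

text \<open>If the chain at the base vertex is the boundary of \<open>\<omega>\<close>, then
  \<open>bd_supported_at_base\<close> kills \<open>\<omega>\<close>, and with it the chain.\<close>

lemma cls_injective:
  assumes y: "y \<in> carrier V0" and z: "cls (mat 1) y = \<zero>\<^bsub>H0 F cs\<^esub>"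
  shows "y = \<zero>\<^bsub>V0\<^esub>"
proof -
  have s: "sgl (mat 1) y \<in> carrier C0"
    using y by (simp add: sgl_mem)
  then have "sgl (mat 1) y \<in> bd ` C1"
    using z H.proj_eq_zero_iff[OF s] by (simp add: cls_def H0_eq)
  then obtain \<omega> where \<omega>: "\<omega> \<in> C1" "sgl (mat 1) y = bd \<omega>"
    by blast
  have v1: "vtx (mat 1) \<in> vertices F"
    by (simp add: vtx_vertices)
  interpret kspace "Sp (vtx (mat 1))"
    using v1 by (rule kspace_Sp)
  have "\<omega> (\<sigma>, \<sigma>') = (\<lambda>_. \<zero>\<^bsub>V1\<^esub>)" if "(\<sigma>, \<sigma>') \<in> edges" for \<sigma> \<sigma>'
  proof (rule bd_supported_at_base[OF _ \<omega>(1) _ that])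
    show "bd \<omega> \<tau> = \<zero>\<^bsub>Sp \<tau>\<^esub>" if "\<tau> \<in> vertices F" "\<tau> \<noteq> vtx (mat 1)" for \<tau>
      using that unfolding \<omega>(2)[symmetric] by (simp add: sgl_def Sp_simps)
  qed (simp add: r_id)
  then have "bd \<omega> (vtx (mat 1)) = (\<Oplus>\<^bsub>Sp (vtx (mat 1))\<^esub> \<sigma>' \<in> nbrs (vtx (mat 1)). \<zero>\<^bsub>Sp (vtx (mat 1))\<^esub>)"
    unfolding bd_apply[OF v1] by (intro finsum_cong') (auto simp: res_zero)
  then have "bd \<omega> (vtx (mat 1)) = \<zero>\<^bsub>Sp (vtx (mat 1))\<^esub>"
    by simp
  then have "ind0 (mat 1) y = ind0 (mat 1) \<zero>\<^bsub>V0\<^esub>"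
    using v1 unfolding \<omega>(2)[symmetric] by (simp add: sgl_def Sp_simps V0.ind_zero)
  then show ?thesis
    using V0.ind_inj[of "mat 1" y "\<zero>\<^bsub>V0\<^esub>"] y by simp
qed

text \<open>On the class \<open>cls (mat 1) y\<close> an element of \<open>K\<close> acts through
  \<open>y\<close>, so a congruence subgroup that fixes \<open>y\<close> fixes the class.\<close>

lemma smooth_H0:
  assumes "\<And>y. y \<in> carrier V0 \<Longrightarrow> \<exists>m. \<forall>g\<in>K \<inter> congruence F m. act V0 g y = y"
  shows "smooth_rep F (carrier GL2) (H0 F cs)"
  unfolding smooth_rep_def
proof (intro conjI ballI)
  show "representation (carrier GL2) (H0 F cs)"
    by (rule representation_H0)
  fix A assume "A \<in> carrier (H0 F cs)"
  then obtain y where y: "y \<in> carrier V0" "A = cls (mat 1) y"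
    using H0_spanned by blast
  obtain m where m: "\<forall>g\<in>K \<inter> congruence F m. act V0 g y = y"
    using assms[OF y(1)] by blast
  have "act (H0 F cs) g A = A" if "g \<in> carrier GL2 \<inter> congruence F m" for g
  proof -
    have g: "g \<in> K" "invertible g"
      using that by (auto simp: congruence_def)
    have "act (H0 F cs) g A = cls (mat 1 ** g) y"
      using act_cls[of "mat 1" g y] g y by simp
    also have "\<dots> = cls (mat 1) (act V0 g y)"
      using g y by (intro cls_FK K_FK) auto
    finally show ?thesis
      using m that g y by simp
  qed
  then show "\<exists>m. \<forall>g\<in>carrier GL2 \<inter> congruence F m. act (H0 F cs) g A = A"
    by blast
qed

definition fibre :: "('f vertex \<Rightarrow> 'f^2^2 \<Rightarrow> 'v) set set \<Rightarrow> 'v set" where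
  "fibre W = {y \<in> carrier V0. cls (mat 1) y \<in> W}"

text \<open>\<open>cls (mat 1)\<close> intertwines the action of \<open>ZK F\<close> on
  \<open>V0\<close> and that of \<Pi> on \<open>V1\<close> with the action on \<open>H0\<close>.
  Since \<open>V0\<close> and \<open>V1\<close> share one carrier, a subrepresentation of
  \<open>H0\<close> becomes a subspace stable under both stabilisers.\<close>

lemma fibre:
  assumes W: "subrep (carrier GL2) (H0 F cs) W"
  shows "subrep FK V0 (fibre W)" "\<And>g y. g \<in> SE \<Longrightarrow> y \<in> fibre W \<Longrightarrow> act V1 g y \<in> fibre W"
    "W \<noteq> {\<zero>\<^bsub>H0 F cs\<^esub>} \<Longrightarrow> fibre W \<noteq> {\<zero>\<^bsub>V0\<^esub>}"
proof -
  interpret c: linear_map V0 "H0 F cs" "cls (mat 1)"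
    by (rule cls_linear) simp
  interpret HR: grep "carrier GL2" "H0 F cs"
    by unfold_locales (rule representation_H0)
  have lin: "lin_subspace V0 (fibre W)"
    using c.subspace_vimage[of W] W by (simp add: fibre_def subrep_def)
  have FK: "act V0 k y \<in> fibre W" if "k \<in> FK" "y \<in> fibre W" for k y
  proof -
    have y: "y \<in> carrier V0" "cls (mat 1) y \<in> W" and k: "invertible k"
      using that FK_invertible by (auto simp: fibre_def)
    have "cls (mat 1) (act V0 k y) = act (H0 F cs) k (cls (mat 1) y)"
      using act_cls[of "mat 1" k y] cls_FK[of "mat 1" k y] that y k by simp
    then show ?thesis
      using y W k that by (simp add: fibre_def subrep_def)
  qed
  with lin show "subrep FK V0 (fibre W)"
    by (simp add: subrep_def)
  have Pi: "act V1 \<Pi>0 y \<in> fibre W" if "y \<in> fibre W" for y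
  proof -
    have y: "y \<in> carrier V0" "cls (mat 1) y \<in> W"
      using that by (auto simp: fibre_def)
    have "cls (mat 1) (act V1 \<Pi>0 y) = act (H0 F cs) \<Pi>0 (cls (mat 1) y)"
      using act_cls[of "mat 1" \<Pi>0 y] cls_Pi[of "mat 1" y] y by simp
    then show ?thesis
      using y W V1.act_closed[of \<Pi>0 y] by (simp add: fibre_def subrep_def V1_carrier)
  qed
  have FI: "act V1 z y = act V0 z y" if "z \<in> FI" "y \<in> carrier V0" for z y
    using r_equivariant[of z y] that by (simp add: r_id V1_carrier)
  show "act V1 g y \<in> fibre W" if g: "g \<in> SE" and y: "y \<in> fibre W" for g y
    using g
  proof (cases rule: SE_cases)
    case 1
    then show ?thesis
      using FK[OF FI_FK[OF 1] y] FI[OF 1] y by (simp add: fibre_def)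
  next
    case (2 z)
    have "y \<in> carrier V0"
      using y by (simp add: fibre_def)
    then have "act V1 g y = act V1 \<Pi>0 (act V0 z y)"
      using 2 V1.act_mult[of \<Pi>0 z y] FI_SE[OF 2(1)] FI[OF 2(1)] by (simp add: V1_carrier)
    then show ?thesis
      using Pi[OF FK[OF FI_FK[OF 2(1)] y]] by simp
  qed
  show "fibre W \<noteq> {\<zero>\<^bsub>V0\<^esub>}" if nz: "W \<noteq> {\<zero>\<^bsub>H0 F cs\<^esub>}"
  proof -
    obtain A where A: "A \<in> W" "A \<noteq> \<zero>\<^bsub>H0 F cs\<^esub>"
      using c.W.subspace_cases_zero[OF _ nz] W by (auto simp: subrep_def)
    then have "A \<in> carrier (H0 F cs)"
      using W by (auto simp: HR.subrep_iff)
    then obtain y where y: "y \<in> carrier V0" "A = cls (mat 1) y"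
      using H0_spanned by blast
    then have "y \<in> fibre W" "y \<noteq> \<zero>\<^bsub>V0\<^esub>"
      using A c.zero by (auto simp: fibre_def)
    then show ?thesis
      by blast
  qed
qed

end

section \<open>Morphisms of diagrams and the induced map on homology\<close>

locale diagram_morphism = A: diagram_loc F D + B: diagram_loc F D'
  for F :: "('f::field, 'q::finite_field) local_field_data"
    and D :: "('k::field, 'v, 'f^2^2) diagram" and D' :: "('k, 'w, 'f^2^2) diagram" +
  fixes \<psi> :: "'v \<Rightarrow> 'w"
  assumes hom0: "\<psi> \<in> rep_hom (ZK F) (diag0 D) (diag0 D')"
    and hom1: "\<psi> \<in> rep_hom (stab_edge F) (diag1 D) (diag1 D')"
    and comm: "y \<in> carrier (diag1 D) \<Longrightarrow> \<psi> (diag_r D y) = diag_r D' (\<psi> y)"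

sublocale diagram_morphism \<subseteq> p0: grep_hom "ZK F" "diag0 D" "diag0 D'" \<psi>
  by unfold_locales (rule hom0)

sublocale diagram_morphism \<subseteq> p1: grep_hom "stab_edge F" "diag1 D" "diag1 D'" \<psi>
  by unfold_locales (rule hom1)

context diagram_morphism
begin

lemma comp_ind0: "y \<in> carrier A.V0 \<Longrightarrow> \<psi> \<circ> A.ind0 g y = B.ind0 g (\<psi> y)"
  by (auto simp: ind_def fun_eq_iff p0.equivariant)

lemma comp_ind1: "y \<in> carrier A.V1 \<Longrightarrow> \<psi> \<circ> A.ind1 g y = B.ind1 g (\<psi> y)"
  by (auto simp: ind_def fun_eq_iff p1.equivariant)

lemma comp_Sp:
  assumes "\<sigma> \<in> vertices F"
  shows "linear_map (A.Sp \<sigma>) (B.Sp \<sigma>) (\<lambda>f. \<psi> \<circ> f)"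
proof -
  obtain g where g: "invertible g" "\<sigma> = A.vtx g"
    using A.vertexE[OF assms] .
  have "(\<lambda>f. \<psi> \<circ> f) \<in> linear_maps (A.Sp \<sigma>) (B.Sp \<sigma>)"
    unfolding linear_maps_def
  proof (intro CollectI conjI ballI allI)
    show "(\<lambda>f. \<psi> \<circ> f) \<in> carrier (A.Sp \<sigma>) \<rightarrow> carrier (B.Sp \<sigma>)"
      using g by (auto elim!: A.SpE simp: comp_ind0 B.ind0_mem)
  next
    fix f h assume "f \<in> carrier (A.Sp \<sigma>)" "h \<in> carrier (A.Sp \<sigma>)"
    then obtain y z where "y \<in> carrier A.V0" "z \<in> carrier A.V0" "f = A.ind0 g y" "h = A.ind0 g z"
      using A.SpE g by metis
    then show "\<psi> \<circ> (f \<oplus>\<^bsub>A.Sp \<sigma>\<^esub> h) = (\<psi> \<circ> f) \<oplus>\<^bsub>B.Sp \<sigma>\<^esub> (\<psi> \<circ> h)"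
      using assms by (simp add: A.Sp_simps B.Sp_simps fun_eq_iff p0.add)
  next
    fix c f assume "f \<in> carrier (A.Sp \<sigma>)"
    then obtain y where "y \<in> carrier A.V0" "f = A.ind0 g y"
      using A.SpE g by metis
    then show "\<psi> \<circ> (c \<odot>\<^bsub>A.Sp \<sigma>\<^esub> f) = c \<odot>\<^bsub>B.Sp \<sigma>\<^esub> (\<psi> \<circ> f)"
      using assms by (simp add: A.Sp_simps B.Sp_simps fun_eq_iff p0.smult)
  qed
  then show ?thesis
    using A.kspace_Sp[OF assms] B.kspace_Sp[OF assms]
    by (simp add: linear_map_def linear_map_axioms_def)
qed

lemma comp_Ed:
  assumes "(\<sigma>, \<sigma>') \<in> A.edges"
  shows "linear_map (A.Ed \<sigma> \<sigma>') (B.Ed \<sigma> \<sigma>') (\<lambda>f. \<psi> \<circ> f)"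
proof -
  obtain g where g: "invertible g" "\<sigma> = A.vtx g" "\<sigma>' = A.vtx (g ** A.\<Pi>0)"
    using A.edgeE[OF assms] .
  have "(\<lambda>f. \<psi> \<circ> f) \<in> linear_maps (A.Ed \<sigma> \<sigma>') (B.Ed \<sigma> \<sigma>')"
    unfolding linear_maps_def
  proof (intro CollectI conjI ballI allI)
    show "(\<lambda>f. \<psi> \<circ> f) \<in> carrier (A.Ed \<sigma> \<sigma>') \<rightarrow> carrier (B.Ed \<sigma> \<sigma>')"
      using g by (auto elim!: A.EdE simp: comp_ind1 B.ind1_mem)
  next
    fix f h assume "f \<in> carrier (A.Ed \<sigma> \<sigma>')" "h \<in> carrier (A.Ed \<sigma> \<sigma>')"
    then obtain y z where "y \<in> carrier A.V1" "z \<in> carrier A.V1" "f = A.ind1 g y" "h = A.ind1 g z"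
      using A.EdE g by metis
    then show "\<psi> \<circ> (f \<oplus>\<^bsub>A.Ed \<sigma> \<sigma>'\<^esub> h) = (\<psi> \<circ> f) \<oplus>\<^bsub>B.Ed \<sigma> \<sigma>'\<^esub> (\<psi> \<circ> h)"
      using assms by (simp add: A.Ed_simps B.Ed_simps fun_eq_iff p1.add)
  next
    fix c f assume "f \<in> carrier (A.Ed \<sigma> \<sigma>')"
    then obtain y where "y \<in> carrier A.V1" "f = A.ind1 g y"
      using A.EdE g by metis
    then show "\<psi> \<circ> (c \<odot>\<^bsub>A.Ed \<sigma> \<sigma>'\<^esub> f) = c \<odot>\<^bsub>B.Ed \<sigma> \<sigma>'\<^esub> (\<psi> \<circ> f)"
      using assms by (simp add: A.Ed_simps B.Ed_simps fun_eq_iff p1.smult)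
  qed
  then show ?thesis
    using A.kspace_Ed[OF assms] B.kspace_Ed[OF assms]
    by (simp add: linear_map_def linear_map_axioms_def)
qed

definition \<Psi> :: "('f vertex \<Rightarrow> 'f^2^2 \<Rightarrow> 'v) \<Rightarrow> 'f vertex \<Rightarrow> 'f^2^2 \<Rightarrow> 'w" where
  "\<Psi> \<omega> = (\<lambda>\<sigma>\<in>vertices F. \<psi> \<circ> \<omega> \<sigma>)"

lemma coeff_map_eq: "(\<lambda>\<sigma>\<in>vertices F. coeff_map \<psi> \<psi> {\<sigma>} (\<omega> \<sigma>)) = \<Psi> \<omega>"
  by (simp add: \<Psi>_def coeff_map_def)

lemma \<Psi>_mem: "\<omega> \<in> carrier A.C0 \<Longrightarrow> \<Psi> \<omega> \<in> carrier B.C0"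
proof -
  assume \<omega>: "\<omega> \<in> carrier A.C0"
  have "{\<sigma> \<in> vertices F. \<Psi> \<omega> \<sigma> \<noteq> \<zero>\<^bsub>B.Sp \<sigma>\<^esub>} \<subseteq> {\<sigma> \<in> vertices F. \<omega> \<sigma> \<noteq> \<zero>\<^bsub>A.Sp \<sigma>\<^esub>}"
    using linear_map.zero[OF comp_Sp] by (auto simp: \<Psi>_def)
  then have "finite {\<sigma> \<in> vertices F. \<Psi> \<omega> \<sigma> \<noteq> \<zero>\<^bsub>B.Sp \<sigma>\<^esub>}"
    by (rule finite_subset) (use \<omega> in \<open>simp add: A.mem_C0_iff\<close>)
  moreover have "\<Psi> \<omega> \<sigma> \<in> carrier (B.Sp \<sigma>)" if "\<sigma> \<in> vertices F" for \<sigma>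
    using linear_map.closed[OF comp_Sp[OF that]] \<omega> that by (simp add: \<Psi>_def A.mem_C0_iff)
  ultimately show ?thesis
    by (simp add: B.mem_C0_iff) (simp add: \<Psi>_def)
qed

lemma \<Psi>_hom: "\<Psi> \<in> rep_hom (carrier GL2) A.C0 B.C0"
  unfolding rep_hom_def linear_maps_def
proof (intro CollectI conjI ballI allI)
  show "\<Psi> \<in> carrier A.C0 \<rightarrow> carrier B.C0"
    using \<Psi>_mem by blast
next
  fix \<omega> \<omega>' assume *: "\<omega> \<in> carrier A.C0" "\<omega>' \<in> carrier A.C0"
  have "\<psi> \<circ> (\<omega> \<sigma> \<oplus>\<^bsub>A.Sp \<sigma>\<^esub> \<omega>' \<sigma>) = (\<psi> \<circ> \<omega> \<sigma>) \<oplus>\<^bsub>B.Sp \<sigma>\<^esub> (\<psi> \<circ> \<omega>' \<sigma>)" if "\<sigma> \<in> vertices F" for \<sigma>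
    using linear_map.add[OF comp_Sp[OF that]] * that by (simp add: A.mem_C0_iff)
  then show "\<Psi> (\<omega> \<oplus>\<^bsub>A.C0\<^esub> \<omega>') = \<Psi> \<omega> \<oplus>\<^bsub>B.C0\<^esub> \<Psi> \<omega>'"
    unfolding \<Psi>_def A.C0_simps B.C0_simps by (intro restrict_ext) simp
next
  fix c \<omega> assume *: "\<omega> \<in> carrier A.C0"
  have "\<psi> \<circ> (c \<odot>\<^bsub>A.Sp \<sigma>\<^esub> \<omega> \<sigma>) = c \<odot>\<^bsub>B.Sp \<sigma>\<^esub> (\<psi> \<circ> \<omega> \<sigma>)" if "\<sigma> \<in> vertices F" for \<sigma>
    using linear_map.smult[OF comp_Sp[OF that]] * that by (simp add: A.mem_C0_iff)
  then show "\<Psi> (c \<odot>\<^bsub>A.C0\<^esub> \<omega>) = c \<odot>\<^bsub>B.C0\<^esub> \<Psi> \<omega>"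
    unfolding \<Psi>_def A.C0_simps B.C0_simps by (intro restrict_ext) simp
next
  fix g :: "'f^2^2" and \<omega> assume "g \<in> carrier GL2"
  then have "vertex_act (matrix_inv g) \<sigma> \<in> vertices F" if "\<sigma> \<in> vertices F" for \<sigma>
    using that by (simp add: A.vertex_act_vertices)
  then show "\<Psi> (act A.C0 g \<omega>) = act B.C0 g (\<Psi> \<omega>)"
    unfolding \<Psi>_def A.C0_simps B.C0_simps by (intro restrict_ext) (simp add: comp_def)
qed

end

sublocale diagram_morphism \<subseteq> P: grep_hom "carrier GL2" "chains0 F (coeff_of_diagram F D)"
    "chains0 F (coeff_of_diagram F D')" \<Psi>
  by unfold_locales (rule \<Psi>_hom)

context diagram_morphism
begin

lemma \<Psi>_sgl: "y \<in> carrier A.V0 \<Longrightarrow> \<Psi> (A.sgl g y) = B.sgl g (\<psi> y)"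
  unfolding \<Psi>_def A.sgl_def B.sgl_def
  by (intro restrict_ext) (auto simp: comp_ind0[unfolded comp_def] comp_def)

lemma comp_res:
  assumes e: "(\<sigma>, \<sigma>') \<in> A.edges" and f: "f \<in> carrier (A.Ed \<sigma> \<sigma>')"
  shows "\<psi> \<circ> A.res \<sigma> \<sigma>' f = B.res \<sigma> \<sigma>' (\<psi> \<circ> f)"
proof -
  obtain g where g: "invertible g" "\<sigma> = A.vtx g" "\<sigma>' = A.vtx (g ** A.\<Pi>0)"
    using A.edgeE[OF e] .
  then obtain y where "y \<in> carrier A.V1" "f = A.ind1 g y"
    using f A.EdE by blast
  then show ?thesis
    using g by (simp add: A.res_ind1 comp_ind0 comp_ind1 B.res_ind1 comm)
qed

text \<open>Composition with \<open>\<psi>\<close> commutes with the restriction maps, hence with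
  the boundary; this is what lets \<open>\<Psi>\<close> pass to homology.\<close>

lemma \<Psi>_bd:
  assumes \<omega>: "\<omega> \<in> A.C1"
  shows "\<Psi> (A.bd \<omega>) \<in> B.bd ` B.C1"
proof -
  note D = A.C1_D[OF \<omega>]
  let ?s = "\<lambda>e\<in>A.edges. \<psi> \<circ> \<omega> e"
  have s: "?s \<in> B.C1"
  proof (rule B.C1_I)
    show "finite {e \<in> A.edges. \<omega> e \<noteq> (\<lambda>_. \<zero>\<^bsub>A.V1\<^esub>)}"
      using D(4) .
    fix \<sigma> \<sigma>' assume e: "(\<sigma>, \<sigma>') \<in> A.edges"
    interpret E: linear_map "A.Ed \<sigma> \<sigma>'" "B.Ed \<sigma> \<sigma>'" "\<lambda>f. \<psi> \<circ> f"
      using e by (rule comp_Ed)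
    show "?s (\<sigma>, \<sigma>') \<in> carrier (B.Ed \<sigma> \<sigma>')"
      using e E.closed[OF D(2)[OF e]] by simp
    show "?s (\<sigma>', \<sigma>) = \<ominus>\<^bsub>B.Ed \<sigma> \<sigma>'\<^esub> ?s (\<sigma>, \<sigma>')"
      using e E.a_inv[OF D(2)[OF e]] D(3)[OF e] by (simp add: A.edge_sym)
    show "?s (\<sigma>, \<sigma>') = (\<lambda>_. \<zero>\<^bsub>B.V1\<^esub>)" if "(\<sigma>, \<sigma>') \<notin> {e \<in> A.edges. \<omega> e \<noteq> (\<lambda>_. \<zero>\<^bsub>A.V1\<^esub>)}"
      using that e by (simp add: comp_def)
  qed simp
  have "\<Psi> (A.bd \<omega>) = B.bd ?s"
  proof (rule B.C0_eqI)
    fix \<sigma> assume \<sigma>: "\<sigma> \<in> vertices F"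
    interpret S: linear_map "A.Sp \<sigma>" "B.Sp \<sigma>" "\<lambda>f. \<psi> \<circ> f"
      using \<sigma> by (rule comp_Sp)
    have "\<Psi> (A.bd \<omega>) \<sigma> = \<psi> \<circ> (\<Oplus>\<^bsub>A.Sp \<sigma>\<^esub> \<sigma>' \<in> A.nbrs \<sigma>. A.res \<sigma> \<sigma>' (\<omega> (\<sigma>, \<sigma>')))"
      using \<sigma> by (simp add: \<Psi>_def A.bd_apply)
    also have "\<dots> = (\<Oplus>\<^bsub>B.Sp \<sigma>\<^esub> \<sigma>' \<in> A.nbrs \<sigma>. \<psi> \<circ> A.res \<sigma> \<sigma>' (\<omega> (\<sigma>, \<sigma>')))"
      by (rule S.finsum) (use A.res_closed[OF _ D(2)] in blast)
    also have "\<dots> = B.bd ?s \<sigma>"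
      unfolding B.bd_apply[OF \<sigma>]
    proof (rule S.W.finsum_cong')
      show "(\<lambda>\<sigma>'. B.res \<sigma> \<sigma>' (?s (\<sigma>, \<sigma>'))) \<in> A.nbrs \<sigma> \<rightarrow> carrier (B.Sp \<sigma>)"
        using B.res_closed[OF _ B.C1_D(2)[OF s]] by blast
      fix \<sigma>' assume "\<sigma>' \<in> A.nbrs \<sigma>"
      then have e: "(\<sigma>, \<sigma>') \<in> A.edges" by simp
      show "\<psi> \<circ> A.res \<sigma> \<sigma>' (\<omega> (\<sigma>, \<sigma>')) = B.res \<sigma> \<sigma>' (?s (\<sigma>, \<sigma>'))"
        using comp_res[OF e D(2)[OF e]] e by simp
    qed simp
    finally show "\<Psi> (A.bd \<omega>) \<sigma> = B.bd ?s \<sigma>" .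
  qed (simp_all add: \<Psi>_def B.bd_ext)
  from this s show ?thesis
    by (rule image_eqI)
qed

lemma H0_map_proj:
  assumes "\<omega> \<in> carrier A.C0"
  shows "H0_map F B.cs (coeff_map \<psi> \<psi>) (A.H.proj \<omega>) = B.H.proj (\<Psi> \<omega>)"
  unfolding H0_map_def coeff_map_eq
  by (rule P.coset_image[OF A.H.N B.H.N _ assms]) (use \<Psi>_bd in blast)

lemma H0_map_image:
  "H0_map F B.cs (coeff_map \<psi> \<psi>) ` carrier (H0 F A.cs) = (\<lambda>\<omega>. B.H.proj (\<Psi> \<omega>)) ` carrier A.C0"
  by (simp add: A.H0_eq A.H.Q_carrier image_image H0_map_proj)

lemma proj_\<Psi>_hom: "grep_hom (carrier GL2) A.C0 (H0 F B.cs) (\<lambda>\<omega>. B.H.proj (\<Psi> \<omega>))"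
  by (intro grep_hom.intro grep_hom_axioms.intro A.C.grep_axioms grep.intro B.representation_H0)
    (auto simp: rep_hom_def linear_maps_def B.H0_eq B.H.Q_carrier B.H.Q_add B.H.Q_smult B.H.Q_act
      P.add P.smult P.equivariant)

lemma image_subrep: "subrep (carrier GL2) (H0 F B.cs) (H0_map F B.cs (coeff_map \<psi> \<psi>) ` carrier (H0 F A.cs))"
  unfolding H0_map_image
  by (rule grep_hom.subrep_image[OF proj_\<Psi>_hom]) (auto simp: subrep_def A.C.lin_subspace_carrier)

lemma cls_mem_image:
  assumes "invertible g" "y \<in> carrier A.V0"
  shows "B.cls g (\<psi> y) \<in> H0_map F B.cs (coeff_map \<psi> \<psi>) ` carrier (H0 F A.cs)"
  unfolding H0_map_image B.cls_def using assms
  by (intro image_eqI[of _ _ "A.sgl g y"]) (simp_all add: \<Psi>_sgl A.sgl_mem)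

text \<open>The image is generated by classes at the base vertex: a chain at \<open>vtx g\<close> is
  the \<open>g\<close>-translate of one at the base, and \<open>W\<close> is stable.\<close>

lemma image_subset:
  assumes W: "subrep (carrier GL2) (H0 F B.cs) W" and sub: "\<And>y. y \<in> carrier A.V0 \<Longrightarrow> B.cls (mat 1) (\<psi> y) \<in> W"
  shows "H0_map F B.cs (coeff_map \<psi> \<psi>) ` carrier (H0 F A.cs) \<subseteq> W"
proof -
  interpret Q: grep_hom "carrier GL2" A.C0 "H0 F B.cs" "\<lambda>\<omega>. B.H.proj (\<Psi> \<omega>)"
    by (rule proj_\<Psi>_hom)
  let ?N = "{\<omega> \<in> carrier A.C0. B.H.proj (\<Psi> \<omega>) \<in> W}"
  have N: "lin_subspace A.C0 ?N"
    using Q.subrep_vimage[OF W] by (simp add: subrep_def)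
  have "A.sgl g y \<in> ?N" if g: "invertible g" and y: "y \<in> carrier A.V0" for g y
  proof -
    have "act (H0 F B.cs) g (B.cls (mat 1) (\<psi> y)) \<in> W"
      using W sub[OF y] g by (simp add: subrep_def)
    then have "B.cls g (\<psi> y) \<in> W"
      using B.act_cls[of "mat 1" g "\<psi> y"] g y by simp
    then show ?thesis
      using g y by (simp add: A.sgl_mem \<Psi>_sgl B.cls_def)
  qed
  then show ?thesis
    unfolding H0_map_image using A.C0_spanned[OF N] by blast
qed

end

lemma representation_subset: "representation S V \<Longrightarrow> T \<subseteq> S \<Longrightarrow> representation T V"
  unfolding representation_def by (blast dest: subsetD)

subsection \<open>Pairs of irreducible representations\<close>

lemma dsum_minus_smult:
  assumes "kspace V" "kspace W" "x \<in> carrier V" "y \<in> carrier V" "x' \<in> carrier W" "y' \<in> carrier W"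
  shows "(x, x') \<oplus>\<^bsub>dsum_rep V W\<^esub> ((- c) \<odot>\<^bsub>dsum_rep V W\<^esub> (y, y')) = (x \<ominus>\<^bsub>V\<^esub> (c \<odot>\<^bsub>V\<^esub> y), x' \<ominus>\<^bsub>W\<^esub> (c \<odot>\<^bsub>W\<^esub> y'))"
proof -
  interpret V: kspace V by fact
  interpret W: kspace W by fact
  show ?thesis
    using assms by (simp add: V.minus_smult W.minus_smult V.minus_eq W.minus_eq)
qed

locale rep_pair = V: grep S V + W: grep S W
  for S :: "('a::field^2^2) set" and V :: "('k::field, 'v, 'a^2^2) rep" and W :: "('k, 'w, 'a^2^2) rep"

sublocale rep_pair \<subseteq> VW: grep S "dsum_rep V W"
  by unfold_locales (rule representation_dsum[OF V.rep W.rep])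

context rep_pair
begin

lemma inl_hom: "grep_hom S V (dsum_rep V W) (\<lambda>x. (x, \<zero>\<^bsub>W\<^esub>))"
  and inr_hom: "grep_hom S W (dsum_rep V W) (\<lambda>y. (\<zero>\<^bsub>V\<^esub>, y))"
  and fst_hom: "grep_hom S (dsum_rep V W) V fst"
  by (intro grep_hom.intro grep_hom_axioms.intro V.grep_axioms W.grep_axioms VW.grep_axioms;
    force simp: rep_hom_def linear_maps_def)+

lemma subrep_inl: "subrep S (dsum_rep V W) N \<Longrightarrow> subrep S V {x \<in> carrier V. (x, \<zero>\<^bsub>W\<^esub>) \<in> N}"
  by (rule grep_hom.subrep_vimage[OF inl_hom])

lemma subrep_inr: "subrep S (dsum_rep V W) N \<Longrightarrow> subrep S W {y \<in> carrier W. (\<zero>\<^bsub>V\<^esub>, y) \<in> N}"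
  by (rule grep_hom.subrep_vimage[OF inr_hom])

lemma subrep_fst: "subrep S (dsum_rep V W) N \<Longrightarrow> subrep S V (fst ` N)"
  by (rule grep_hom.subrep_image[OF fst_hom])

lemma subrep_contains_summand:
  assumes irr: "irreducible_rep S V" "irreducible_rep S W" and N: "subrep S (dsum_rep V W) N"
    and nz: "(\<exists>x. x \<noteq> \<zero>\<^bsub>V\<^esub> \<and> (x, \<zero>\<^bsub>W\<^esub>) \<in> N) \<or> (\<exists>y. y \<noteq> \<zero>\<^bsub>W\<^esub> \<and> (\<zero>\<^bsub>V\<^esub>, y) \<in> N)"
  shows "carrier V \<times> {\<zero>\<^bsub>W\<^esub>} \<subseteq> N \<or> {\<zero>\<^bsub>V\<^esub>} \<times> carrier W \<subseteq> N"
proof -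
  have NN: "N \<subseteq> carrier V \<times> carrier W"
    using N by (simp add: VW.subrep_iff)
  let ?N1 = "{x \<in> carrier V. (x, \<zero>\<^bsub>W\<^esub>) \<in> N}" and ?N2 = "{y \<in> carrier W. (\<zero>\<^bsub>V\<^esub>, y) \<in> N}"
  have *: "?N1 = {\<zero>\<^bsub>V\<^esub>} \<or> ?N1 = carrier V" "?N2 = {\<zero>\<^bsub>W\<^esub>} \<or> ?N2 = carrier W"
    using irr subrep_inl[OF N] subrep_inr[OF N] unfolding irreducible_rep_def by blast+
  from nz show ?thesis
  proof
    assume "\<exists>x. x \<noteq> \<zero>\<^bsub>V\<^esub> \<and> (x, \<zero>\<^bsub>W\<^esub>) \<in> N"
    then have "?N1 = carrier V"
      using *(1) NN by blast
    then show ?thesis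
      by blast
  next
    assume "\<exists>y. y \<noteq> \<zero>\<^bsub>W\<^esub> \<and> (\<zero>\<^bsub>V\<^esub>, y) \<in> N"
    then have "?N2 = carrier W"
      using *(2) NN by blast
    then show ?thesis
      by blast
  qed
qed

text \<open>Essentiality is used once per summand. Projecting \<open>N\<close> gives a non-zero
  element with first coordinate in \<open>A\<close>. The second coordinates of all elements with
  this property form a subrepresentation \<open>?N'\<close> of \<open>W\<close>, which meets
  \<open>B\<close> non-trivially unless it is zero; in that case the element found first has second
  coordinate zero.\<close>

lemma essential_dsum:
  assumes A: "essential_subrep S V A" and B: "essential_subrep S W B"
    and N: "subrep S (dsum_rep V W) N" "N \<noteq> {\<zero>\<^bsub>dsum_rep V W\<^esub>}"
  shows "\<exists>x\<in>A. \<exists>y\<in>B. (x, y) \<in> N \<and> (x, y) \<noteq> (\<zero>\<^bsub>V\<^esub>, \<zero>\<^bsub>W\<^esub>)"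
proof -
  have sub: "subrep S V A" "subrep S W B"
    using A B by (auto simp: essential_subrep_def)
  note z = V.subrep_iff[THEN iffD1, OF sub(1)] W.subrep_iff[THEN iffD1, OF sub(2)]
  note NN = VW.subrep_iff[THEN iffD1, OF N(1)]
  note fstN = subrep_fst[OF N(1)]
  obtain x0 y0 where x0: "(x0, y0) \<in> N" "x0 \<in> A" "(x0, y0) \<noteq> (\<zero>\<^bsub>V\<^esub>, \<zero>\<^bsub>W\<^esub>)"
  proof (cases "fst ` N = {\<zero>\<^bsub>V\<^esub>}")
    case True
    obtain x y where e: "(x, y) \<in> N" "(x, y) \<noteq> (\<zero>\<^bsub>V\<^esub>, \<zero>\<^bsub>W\<^esub>)"
      using N(2) NN by auto
    then have "x \<in> fst ` N"
      by force
    then have "x \<in> A"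
      using True z by simp
    from that[OF e(1) this e(2)] show ?thesis .
  next
    case False
    then have "fst ` N \<inter> A \<noteq> {\<zero>\<^bsub>V\<^esub>}"
      using A fstN unfolding essential_subrep_def by blast
    moreover have "\<zero>\<^bsub>V\<^esub> \<in> fst ` N \<inter> A"
      using z fstN unfolding V.subrep_iff by blast
    ultimately obtain x y where "(x, y) \<in> N" "x \<in> A" "x \<noteq> \<zero>\<^bsub>V\<^esub>"
      by fastforce
    with that[of x y] show ?thesis
      by simp
  qed
  let ?N' = "{y. \<exists>x\<in>A. (x, y) \<in> N}"
  have sndN: "subrep S W ?N'"
    unfolding W.subrep_iff
  proof (intro conjI ballI allI)
    show "?N' \<subseteq> carrier W" "\<zero>\<^bsub>W\<^esub> \<in> ?N'"
      using NN z by auto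
  next
    fix y y' assume "y \<in> ?N'" "y' \<in> ?N'"
    then obtain x x' where *: "x \<in> A" "x' \<in> A" "(x, y) \<in> N" "(x', y') \<in> N"
      by blast
    then have "(x, y) \<oplus>\<^bsub>dsum_rep V W\<^esub> (x', y') \<in> N" "x \<oplus>\<^bsub>V\<^esub> x' \<in> A"
      using NN z by blast+
    then show "y \<oplus>\<^bsub>W\<^esub> y' \<in> ?N'"
      by auto
  next
    fix c y assume "y \<in> ?N'"
    then obtain x where *: "x \<in> A" "(x, y) \<in> N"
      by blast
    then have "c \<odot>\<^bsub>dsum_rep V W\<^esub> (x, y) \<in> N" "c \<odot>\<^bsub>V\<^esub> x \<in> A"
      using NN z by blast+
    then show "c \<odot>\<^bsub>W\<^esub> y \<in> ?N'"
      by auto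
  next
    fix g y assume g: "g \<in> S" and "y \<in> ?N'"
    then obtain x where *: "x \<in> A" "(x, y) \<in> N"
      by blast
    then have "act (dsum_rep V W) g (x, y) \<in> N" "act V g x \<in> A"
      using NN z g by blast+
    then show "act W g y \<in> ?N'"
      by auto
  qed
  show ?thesis
  proof (cases "?N' = {\<zero>\<^bsub>W\<^esub>}")
    case True
    then have "y0 = \<zero>\<^bsub>W\<^esub>"
      using x0 by blast
    then show ?thesis
      using x0 z by blast
  next
    case False
    then have "?N' \<inter> B \<noteq> {\<zero>\<^bsub>W\<^esub>}"
      using B sndN unfolding essential_subrep_def by blast
    moreover have "\<zero>\<^bsub>W\<^esub> \<in> ?N' \<inter> B"
      using z sndN unfolding W.subrep_iff by blast
    ultimately show ?thesis
      by blast
  qed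
qed

end

text \<open>A non-zero \<open>N\<close> that meets both summands in zero would be the graph of an
  isomorphism. To exclude this it is enough to follow one vector to its partner: \<open>v1\<close>
  with its torus eigenvalue if \<open>chi \<noteq> char_s chi\<close>, and otherwise a vector of the
  one-dimensional summand, whose partner contradicts \<open>char_steinberg_pair\<close>.\<close>

lemma rho_pair_contains_summand:
  assumes r1: "is_rho chi J \<rho>1" and r2: "is_rho (char_s chi) (J0 chi - J) \<rho>2" and J: "J \<subseteq> J0 chi"
    and v1: "v1 \<in> invariants unip2 \<rho>1" "v1 \<noteq> \<zero>\<^bsub>\<rho>1\<^esub>"
    and N: "subrep (carrier GL2) (dsum_rep \<rho>1 \<rho>2) N" "N \<noteq> {\<zero>\<^bsub>dsum_rep \<rho>1 \<rho>2\<^esub>}"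
  shows "carrier \<rho>1 \<times> {\<zero>\<^bsub>\<rho>2\<^esub>} \<subseteq> N \<or> {\<zero>\<^bsub>\<rho>1\<^esub>} \<times> carrier \<rho>2 \<subseteq> N"
proof -
  have irr: "irreducible_rep (carrier GL2) \<rho>1" "irreducible_rep (carrier GL2) \<rho>2"
    using is_rho_irreducible(1)[OF r1 J] is_rho_irreducible(1)[OF r2] by (auto simp: J0_char_s)
  interpret V: GL2_rep \<rho>1
    by unfold_locales (use r1 in \<open>simp add: is_rho_def\<close>)
  interpret W: GL2_rep \<rho>2
    by unfold_locales (use r2 in \<open>simp add: is_rho_def\<close>)
  interpret rep_pair "carrier GL2" \<rho>1 \<rho>2
    by unfold_locales
  note NN = VW.subrep_iff[THEN iffD1, OF N(1)]
  \<comment> \<open>\<open>N\<close> is stable under the operator of \<open>g\<close> minus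
    \<open>c\<close>; choosing \<open>c\<close> so that one coordinate is annihilated isolates the
    other one.\<close>
  have diff: "(act \<rho>1 g x \<ominus>\<^bsub>\<rho>1\<^esub> (c \<odot>\<^bsub>\<rho>1\<^esub> x), act \<rho>2 g y \<ominus>\<^bsub>\<rho>2\<^esub> (c \<odot>\<^bsub>\<rho>2\<^esub> y)) \<in> N"
    if xy: "(x, y) \<in> N" and g: "invertible g" for g c x y
  proof -
    have "act (dsum_rep \<rho>1 \<rho>2) g (x, y) \<in> N" "(- c) \<odot>\<^bsub>dsum_rep \<rho>1 \<rho>2\<^esub> (x, y) \<in> N"
      using NN xy g carrier_GL2 by blast+
    then have "act (dsum_rep \<rho>1 \<rho>2) g (x, y) \<oplus>\<^bsub>dsum_rep \<rho>1 \<rho>2\<^esub> ((- c) \<odot>\<^bsub>dsum_rep \<rho>1 \<rho>2\<^esub> (x, y)) \<in> N"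
      using NN by blast
    moreover have "x \<in> carrier \<rho>1" "y \<in> carrier \<rho>2"
      using NN xy by auto
    ultimately show ?thesis
      using g dsum_minus_smult[OF V.kspace_axioms W.kspace_axioms, of "act \<rho>1 g x" x "act \<rho>2 g y" y c]
      by simp
  qed
  obtain x0 y0 where xy0: "(x0, y0) \<in> N" "(x0, y0) \<noteq> (\<zero>\<^bsub>\<rho>1\<^esub>, \<zero>\<^bsub>\<rho>2\<^esub>)" "x0 \<in> carrier \<rho>1" "y0 \<in> carrier \<rho>2"
  proof -
    obtain e where "e \<in> N" "e \<noteq> \<zero>\<^bsub>dsum_rep \<rho>1 \<rho>2\<^esub>"
      using VW.subspace_cases_zero[OF _ N(2)] N(1) unfolding subrep_def by blast
    moreover from this have "e \<in> carrier \<rho>1 \<times> carrier \<rho>2"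
      using NN by auto
    ultimately show ?thesis
      using that[of "fst e" "snd e"] by auto
  qed
  have "(\<exists>x. x \<noteq> \<zero>\<^bsub>\<rho>1\<^esub> \<and> (x, \<zero>\<^bsub>\<rho>2\<^esub>) \<in> N) \<or> (\<exists>y. y \<noteq> \<zero>\<^bsub>\<rho>2\<^esub> \<and> (\<zero>\<^bsub>\<rho>1\<^esub>, y) \<in> N)"
  proof (rule ccontr)
    assume no: "\<not> ?thesis"
    have no1: "x = \<zero>\<^bsub>\<rho>1\<^esub>" if "(x, \<zero>\<^bsub>\<rho>2\<^esub>) \<in> N" for x
      using no that by blast
    have no2: "y = \<zero>\<^bsub>\<rho>2\<^esub>" if "(\<zero>\<^bsub>\<rho>1\<^esub>, y) \<in> N" for y
      using no that by blast
    show False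
    proof (cases "J0 chi = {}")
      case True
      then obtain a d where ad: "a \<noteq> 0" "d \<noteq> 0" "chi (diag2 a d) \<noteq> chi (diag2 d a)"
        by (auto simp: J0_def mem_torus2_iff char_s_diag2 split: if_splits)
      have torus: "diag2 a d \<in> borel2"
        using ad by (simp add: mem_borel2_iff)
      have x0: "x0 \<noteq> \<zero>\<^bsub>\<rho>1\<^esub>"
        using no2[of y0] xy0 by auto
      have "subrep (carrier GL2) \<rho>1 (fst ` N)"
        by (rule subrep_fst[OF N(1)])
      then have "fst ` N = {\<zero>\<^bsub>\<rho>1\<^esub>} \<or> fst ` N = carrier \<rho>1"
        using irr(1) unfolding irreducible_rep_def by blast
      moreover have "x0 \<in> fst ` N"
        using image_eqI[OF _ xy0(1), of x0 fst] by simp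
      ultimately have "fst ` N = carrier \<rho>1"
        using x0 by blast
      then have "v1 \<in> fst ` N"
        using V.invariantsD(1)[OF v1(1)] by simp
      then obtain y where y: "(v1, y) \<in> N"
        by force
      have yc: "y \<in> carrier \<rho>2" and v1c: "v1 \<in> carrier \<rho>1"
        using NN y by auto
      \<comment> \<open>The partner \<open>y\<close> inherits the invariance of \<open>v1\<close>.
        The torus then acts on it by the character of \<open>\<rho>2\<close>, while
        \<open>diff\<close> forces the eigenvalue of \<open>v1\<close>.\<close>
      have "act \<rho>2 (up t) y = y" for t
      proof -
        have "(\<zero>\<^bsub>\<rho>1\<^esub>, act \<rho>2 (up t) y \<ominus>\<^bsub>\<rho>2\<^esub> y) \<in> N"
          using diff[OF y, of "up t" 1] V.invariantsD(2)[OF v1(1), of t] yc v1c by simp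
        then show ?thesis
          using no2 yc by fastforce
      qed
      then have yi: "y \<in> invariants unip2 \<rho>2"
        using yc by (intro W.invariantsI)
      have a1: "act \<rho>1 (diag2 a d) v1 = chi (diag2 a d) \<odot>\<^bsub>\<rho>1\<^esub> v1"
        using r1 True torus v1(1) by (auto simp: is_rho_def diag2_def)
      have a2: "act \<rho>2 (diag2 a d) y = chi (diag2 d a) \<odot>\<^bsub>\<rho>2\<^esub> y"
        using r2 True torus yi char_s_diag2[of chi a d] by (auto simp: is_rho_def diag2_def J0_char_s)
      have "(\<zero>\<^bsub>\<rho>1\<^esub>, chi (diag2 d a) \<odot>\<^bsub>\<rho>2\<^esub> y \<ominus>\<^bsub>\<rho>2\<^esub> (chi (diag2 a d) \<odot>\<^bsub>\<rho>2\<^esub> y)) \<in> N"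
        using diff[OF y, of "diag2 a d" "chi (diag2 a d)"] ad a1 a2 v1c by simp
      then have "chi (diag2 d a) \<odot>\<^bsub>\<rho>2\<^esub> y = chi (diag2 a d) \<odot>\<^bsub>\<rho>2\<^esub> y"
        using no2 yc by fastforce
      then have "(chi (diag2 d a) - chi (diag2 a d)) \<odot>\<^bsub>\<rho>2\<^esub> y = \<zero>\<^bsub>\<rho>2\<^esub>"
        using yc W.smult_add_left[of y "chi (diag2 d a)" "- chi (diag2 a d)"]
        by (simp add: W.minus_smult W.r_neg)
      then have "y = \<zero>\<^bsub>\<rho>2\<^esub>"
        using W.smult_eq_zeroD[OF yc] ad by fastforce
      then show False
        using no1 y v1(2) by blast
    next
      case False
      then have J0: "J0 chi = {smat}" and chi: "\<And>h. h \<in> torus2 \<Longrightarrow> chi h = char_s chi h"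
        by (auto simp: J0_def split: if_splits)
      have J0_ne: "J0 chi \<noteq> {}" "J0 (char_s chi) \<noteq> {}"
        using False by (simp_all add: J0_char_s)
      consider "J = {smat}" "J0 chi - J = {}" | "J = {}" "J0 chi - J = {smat}"
      proof -
        have "J = {} \<or> J = {smat}"
          using J J0 by (simp add: subset_singleton_iff)
        with J0 that show ?thesis
          by auto
      qed
      then show False
      proof cases
        case 1
        have rs: "is_rho chi {smat} \<rho>1" "is_rho (char_s chi) {} \<rho>2"
          using r1 r2[unfolded 1(2)] unfolding 1(1) by simp_all
        obtain \<eta> where
          eta: "\<forall>g v. invertible g \<longrightarrow> v \<in> carrier \<rho>1 \<longrightarrow> act \<rho>1 g v = \<eta> (det g) \<odot>\<^bsub>\<rho>1\<^esub> v"
            "\<forall>v\<in>carrier \<rho>2. (\<forall>g. invertible g \<longrightarrow> act \<rho>2 g v = \<eta> (det g) \<odot>\<^bsub>\<rho>2\<^esub> v) \<longrightarrow> v = \<zero>\<^bsub>\<rho>2\<^esub>"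
          by (rule exE[OF char_steinberg_pair[OF rs J0_ne]]) (erule chi, blast)
        \<comment> \<open>\<open>\<rho>1\<close> is the character here, so \<open>diff\<close> with
          \<open>\<eta> (det g)\<close> annihilates the first coordinate and leaves a vector of the
          second summand.\<close>
        have "act \<rho>2 g y0 = \<eta> (det g) \<odot>\<^bsub>\<rho>2\<^esub> y0" if g: "invertible g" for g
        proof -
          have "(\<zero>\<^bsub>\<rho>1\<^esub>, act \<rho>2 g y0 \<ominus>\<^bsub>\<rho>2\<^esub> (\<eta> (det g) \<odot>\<^bsub>\<rho>2\<^esub> y0)) \<in> N"
            using diff[OF xy0(1) g, of "\<eta> (det g)"] eta(1) g xy0 by simp
          from no2[OF this] show ?thesis
            using xy0 g by simp
        qed
        then have "y0 = \<zero>\<^bsub>\<rho>2\<^esub>"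
          using eta(2) xy0 by blast
        then show False
          using no1 xy0 by blast
      next
        case 2
        have rs: "is_rho (char_s chi) {smat} \<rho>2" "is_rho chi {} \<rho>1"
          using r1 r2[unfolded 2(2)] unfolding 2(1) by simp_all
        obtain \<eta> where
          eta: "\<forall>g v. invertible g \<longrightarrow> v \<in> carrier \<rho>2 \<longrightarrow> act \<rho>2 g v = \<eta> (det g) \<odot>\<^bsub>\<rho>2\<^esub> v"
            "\<forall>v\<in>carrier \<rho>1. (\<forall>g. invertible g \<longrightarrow> act \<rho>1 g v = \<eta> (det g) \<odot>\<^bsub>\<rho>1\<^esub> v) \<longrightarrow> v = \<zero>\<^bsub>\<rho>1\<^esub>"
          by (rule exE[OF char_steinberg_pair[OF rs J0_ne(2,1)]]) (erule chi[symmetric], blast)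
        have "act \<rho>1 g x0 = \<eta> (det g) \<odot>\<^bsub>\<rho>1\<^esub> x0" if g: "invertible g" for g
        proof -
          have "(act \<rho>1 g x0 \<ominus>\<^bsub>\<rho>1\<^esub> (\<eta> (det g) \<odot>\<^bsub>\<rho>1\<^esub> x0), \<zero>\<^bsub>\<rho>2\<^esub>) \<in> N"
            using diff[OF xy0(1) g, of "\<eta> (det g)"] eta(1) g xy0 by simp
          from no1[OF this] show ?thesis
            using xy0 g by simp
        qed
        then have "x0 = \<zero>\<^bsub>\<rho>1\<^esub>"
          using eta(2) xy0 by blast
        then show False
          using no2 xy0 by blast
      qed
    qed
  qed
  with subrep_contains_summand[OF irr N(1)] show ?thesis .
qed

subsection \<open>Inflation\<close>

context local_field_loc
begin

lemma representation_inflate: "representation (carrier GL2) \<rho> \<Longrightarrow> representation K (inflate F \<rho>)"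
  unfolding inflate_def
  by (rule representation_with_act[where S = "carrier GL2"])
    (auto simp: K_reduction[symmetric] K_integral reduction_mult)

lemma representation_tilde: "representation K V \<Longrightarrow> representation FK (tilde F V)"
  unfolding tilde_def
  by (rule representation_with_act[where S = K]) (auto simp: K_part K_part_mult K_part_K)

lemma inflate_simps [simp]:
  "carrier (inflate F \<rho>) = carrier \<rho>" "zero (inflate F \<rho>) = zero \<rho>"
  "add (inflate F \<rho>) = add \<rho>" "module.smult (inflate F \<rho>) = module.smult \<rho>"
  "act (inflate F \<rho>) g = act \<rho> (reduction F g)"
  by (simp_all add: inflate_def)

lemma tilde_simps [simp]:
  "carrier (tilde F V) = carrier V" "zero (tilde F V) = zero V"
  "add (tilde F V) = add V" "module.smult (tilde F V) = module.smult V"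
  "act (tilde F V) g = act V (K_part F g)"
  by (simp_all add: tilde_def)

lemma mem_iwahori1_iff: "g \<in> iwahori1 F \<longleftrightarrow> g \<in> K \<and> reduction F g \<in> unip2"
  by (simp add: iwahori1_def)

lemma unip2_lift: "u \<in> unip2 \<Longrightarrow> \<exists>g\<in>iwahori1 F. reduction F g = u"
  by (metis mem_iwahori1_iff reduction_surj mem_unip2_iff invertible_up)

lemma invariants_inflate: "invariants (iwahori1 F) (inflate F \<rho>) = invariants unip2 \<rho>"
  unfolding invariants_def using unip2_lift by (auto simp: mem_iwahori1_iff)

lemma invariants_dsum_tilde_inflate:
  "invariants (iwahori1 F) (dsum_rep (tilde F (inflate F \<rho>1)) (tilde F (inflate F \<rho>2))) =
     invariants unip2 \<rho>1 \<times> invariants unip2 \<rho>2"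
  unfolding invariants_inflate[symmetric]
  by (auto simp: invariants_def mem_iwahori1_iff K_part_K)

text \<open>Reduction is surjective from \<open>K\<close>, so stability under \<open>K\<close> is
  stability under the finite group.\<close>

lemma subrep_inflate:
  assumes "representation (carrier GL2) \<rho>" "subrep K (inflate F \<rho>) N"
  shows "subrep (carrier GL2) \<rho> N"
proof -
  interpret V: grep "carrier GL2" \<rho>
    by unfold_locales (rule assms(1))
  interpret I: grep K "inflate F \<rho>"
    by unfold_locales (rule representation_inflate[OF assms(1)])
  have "act \<rho> \<gamma> x \<in> N" if "invertible \<gamma>" "x \<in> N" for \<gamma> x
  proof -
    obtain g where "g \<in> K" "reduction F g = \<gamma>"
      using reduction_surj \<open>invertible \<gamma>\<close> by blast
    moreover have "\<forall>g\<in>K. \<forall>v\<in>N. act (inflate F \<rho>) g v \<in> N"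
      using assms(2) by (simp add: subrep_def)
    ultimately show ?thesis
      using \<open>x \<in> N\<close> by auto
  qed
  then show ?thesis
    using assms(2) unfolding V.subrep_iff I.subrep_iff by simp
qed

lemma subrep_dsum_inflate:
  assumes "representation (carrier GL2) \<rho>1" "representation (carrier GL2) \<rho>2"
    "subrep K (dsum_rep (inflate F \<rho>1) (inflate F \<rho>2)) N"
  shows "subrep (carrier GL2) (dsum_rep \<rho>1 \<rho>2) N"
proof -
  interpret V: grep "carrier GL2" "dsum_rep \<rho>1 \<rho>2"
    by unfold_locales (rule representation_dsum[OF assms(1,2)])
  interpret I: grep K "dsum_rep (inflate F \<rho>1) (inflate F \<rho>2)"
    by unfold_locales (intro representation_dsum representation_inflate assms(1,2))
  have "act (dsum_rep \<rho>1 \<rho>2) \<gamma> x \<in> N" if "invertible \<gamma>" "x \<in> N" for \<gamma> x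
  proof -
    obtain g where "g \<in> K" "reduction F g = \<gamma>"
      using reduction_surj \<open>invertible \<gamma>\<close> by blast
    moreover have "\<forall>g\<in>K. \<forall>v\<in>N. act (dsum_rep (inflate F \<rho>1) (inflate F \<rho>2)) g v \<in> N"
      using assms(3) by (simp add: subrep_def)
    ultimately show ?thesis
      using \<open>x \<in> N\<close> by auto
  qed
  then show ?thesis
    using assms(3) unfolding V.subrep_iff I.subrep_iff by simp
qed

end

subsection \<open>The socle\<close>

text \<open>A non-zero subrepresentation contained in all others is irreducible, and an irreducible
  one that contains it equals it; so the union in \<open>socle\<close> runs over \<open>N\<close>
  alone.\<close>

lemma (in grep) socle_eq:
  assumes N: "subrep S V N" "N \<noteq> {\<zero>}" and min: "\<And>W. subrep S V W \<Longrightarrow> W \<noteq> {\<zero>} \<Longrightarrow> N \<subseteq> W"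
  shows "essential_subrep S V N" "socle S V = N"
proof -
  have zero: "\<zero> \<in> W" if "subrep S V W" for W
    using that by (simp add: subrep_iff)
  have "W \<inter> N \<noteq> {\<zero>}" if "subrep S V W" "W \<noteq> {\<zero>}" for W
    using min[OF that] N(2) by blast
  with N(1) show "essential_subrep S V N"
    by (auto simp: essential_subrep_def)
  have irr: "irreducible_rep S (restrict_to V N)"
    using N min by (intro irreducible_restrictI) blast+
  have "W = N" if W: "subrep S V W" "irreducible_rep S (restrict_to V W)" for W
  proof -
    have "W \<noteq> {\<zero>}"
      using W(2) by (simp add: irreducible_rep_def)
    then have "N \<subseteq> W"
      using min W(1) by blast
    then show ?thesis
      using irreducible_restrictD[OF W(2,1) N(1)] N(2) by blast
  qed
  then have "{W. subrep S V W \<and> irreducible_rep S (restrict_to V W)} = {N}"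
    using N(1) irr by blast
  moreover have "lin_span V N = N"
    using lin_span_mono[of N V] lin_span_least[of V N N] N(1) by (auto simp: subrep_def)
  ultimately show "socle S V = N"
    by (simp add: socle_def)
qed

lemma rep_isomorphic_refl: "rep_isomorphic S V V"
  unfolding rep_isomorphic_def rep_iso_map_def rep_hom_def linear_maps_def
  by (rule exI[of _ id]) auto

text \<open>The formula for the inverse of \<Pi> on \<open>W b + W b'\<close>, evaluated at
  \<open>v = b, w = \<zero>\<close> and at \<open>v = \<zero>, w = b'\<close>.\<close>

lemma is_Y_gamma_swap:
  assumes Y: "is_Y_gamma F E1 E2 P Y" and P: "(b, b') \<in> P" and rep: "kspace (diag0 Y)"
  shows "act (diag1 Y) (matrix_inv (Pi_mat F)) b = b'" "act (diag1 Y) (matrix_inv (Pi_mat F)) b' = b"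
    "b \<in> carrier (diag0 Y)" "b' \<in> carrier (diag0 Y)"
proof -
  interpret kspace "diag0 Y" by fact
  obtain W where W: "\<forall>b\<in>Field P. subrep (ZI F) (diag0 Y) (W b) \<and> b \<in> W b \<and>
      injective_envelope F (iwahori F) (restrict_to (diag0 Y) (lin_span (diag0 Y) {b}))
        (restrict_to (diag0 Y) (W b)) id"
    and phi: "\<forall>(b, b')\<in>P. \<exists>\<phi>.
          \<phi> \<in> linear_maps (restrict_to (diag0 Y) (W b)) (restrict_to (diag0 Y) (W b')) \<and>
          bij_betw \<phi> (W b) (W b') \<and> \<phi> b = b' \<and>
          (\<forall>g\<in>iwahori F. \<forall>v\<in>W b.
             \<phi> (act (diag0 Y) (Pi_mat F ** g ** matrix_inv (Pi_mat F)) v) = act (diag0 Y) g (\<phi> v)) \<and>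
          (\<forall>v\<in>W b. \<forall>w\<in>W b'. act (diag1 Y) (matrix_inv (Pi_mat F)) (v \<oplus>\<^bsub>diag0 Y\<^esub> w) =
             inv_into (W b) \<phi> w \<oplus>\<^bsub>diag0 Y\<^esub> \<phi> v)"
    using Y unfolding is_Y_gamma_def by blast
  have bF: "b \<in> Field P" "b' \<in> Field P"
    using P by (auto simp: Field_def)
  have sub: "lin_subspace (diag0 Y) (W b)" "lin_subspace (diag0 Y) (W b')" and mem: "b \<in> W b" "b' \<in> W b'"
    using W bF by (auto simp: subrep_def)
  obtain \<phi> where \<phi>: "\<phi> \<in> linear_maps (restrict_to (diag0 Y) (W b)) (restrict_to (diag0 Y) (W b'))"
      "bij_betw \<phi> (W b) (W b')" "\<phi> b = b'"
      "\<And>v w. v \<in> W b \<Longrightarrow> w \<in> W b' \<Longrightarrow> act (diag1 Y) (matrix_inv (Pi_mat F)) (v \<oplus>\<^bsub>diag0 Y\<^esub> w) =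
             inv_into (W b) \<phi> w \<oplus>\<^bsub>diag0 Y\<^esub> \<phi> v"
    using bspec[OF phi P, unfolded prod.case] by blast
  interpret L: linear_map "restrict_to (diag0 Y) (W b)" "restrict_to (diag0 Y) (W b')" \<phi>
    using kspace_subspace[OF kspace_axioms sub(1)] kspace_subspace[OF kspace_axioms sub(2)] \<phi>(1)
    by (simp add: linear_map_def linear_map_axioms_def)
  have \<phi>0: "\<phi> \<zero>\<^bsub>diag0 Y\<^esub> = \<zero>\<^bsub>diag0 Y\<^esub>"
    using L.zero by simp
  have z: "\<zero>\<^bsub>diag0 Y\<^esub> \<in> W b" "\<zero>\<^bsub>diag0 Y\<^esub> \<in> W b'"
    using lin_subspaceD(2) sub by blast+
  show c: "b \<in> carrier (diag0 Y)" "b' \<in> carrier (diag0 Y)"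
    using mem sub lin_subspaceD(1) by blast+
  have inj: "inj_on \<phi> (W b)"
    using \<phi>(2) by (rule bij_betw_imp_inj_on)
  have "inv_into (W b) \<phi> \<zero>\<^bsub>diag0 Y\<^esub> = \<zero>\<^bsub>diag0 Y\<^esub>"
    using inv_into_f_f[OF inj z(1)] \<phi>0 by simp
  then show "act (diag1 Y) (matrix_inv (Pi_mat F)) b = b'"
    using \<phi>(4)[OF mem(1) z(2)] c \<phi>(3) by simp
  have "inv_into (W b) \<phi> b' = b"
    using inv_into_f_f[OF inj mem(1)] \<phi>(3) by simp
  then show "act (diag1 Y) (matrix_inv (Pi_mat F)) b' = b"
    using \<phi>(4)[OF z(1) mem(2)] c \<phi>0 by simp
qed

text \<open>If \<open>chi = char_s chi\<close> on the torus and \<open>J\<close> is empty, the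
  prescribed images come in the order opposite to that of the pair, hence the disjunction.\<close>

lemma gamma_basis_pair:
  assumes "gamma_basis F n chi J E1 E2 P w1 w2"
  shows "(w1, w2) \<in> P \<or> (w2, w1) \<in> P"
  using assms unfolding gamma_basis_def Let_def by (auto split: if_splits)

context local_field_loc
begin

text \<open>On both sides \<open>tilde\<close> lets \<open>ZK F\<close> act through
  \<open>K_part\<close>, so equivariance under \<open>K\<close> carries over.\<close>

lemma rep_hom_tilde_dsum:
  assumes \<psi>: "\<psi> \<in> rep_hom K (dsum_rep (tilde F V1) (tilde F V2)) (dsum_rep (tilde F W1) (tilde F W2))"
  shows "\<psi> \<in> rep_hom FK (dsum_rep (tilde F V1) (tilde F V2)) (dsum_rep (tilde F W1) (tilde F W2))"
proof -
  have "\<psi> (act (dsum_rep (tilde F V1) (tilde F V2)) g v) =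
      act (dsum_rep (tilde F W1) (tilde F W2)) g (\<psi> v)"
    if "g \<in> FK" "v \<in> carrier (dsum_rep (tilde F V1) (tilde F V2))" for g v
    using rep_homD(2)[OF \<psi>, of "K_part F g" v] K_part[OF that(1)] that(2) by (auto simp: K_part_K)
  then show ?thesis
    using rep_homD(1)[OF \<psi>] unfolding rep_hom_def by blast
qed

text \<open>The deeper of two congruence subgroups that fix the coordinates fixes the pair.\<close>

lemma dsum_smooth:
  assumes E: "smooth_rep F K E1" "smooth_rep F K E2" and y: "y \<in> carrier E1 \<times> carrier E2"
  shows "\<exists>m. \<forall>g\<in>K \<inter> congruence F m. act (dsum_rep (tilde F E1) (tilde F E2)) g y = y"
proof -
  obtain m1 m2 where m: "\<forall>g\<in>K \<inter> congruence F m1. act E1 g (fst y) = fst y"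
      "\<forall>g\<in>K \<inter> congruence F m2. act E2 g (snd y) = snd y"
    using E y unfolding smooth_rep_def by (metis mem_Times_iff)
  have mono: "g \<in> congruence F m" if "g \<in> congruence F n" "m \<le> n" for g m n
    using that unfolding congruence_def by (auto 0 0) (meson of_nat_mono order_trans)+
  have "act (dsum_rep (tilde F E1) (tilde F E2)) g y = y" if g: "g \<in> K \<inter> congruence F (max m1 m2)" for g
  proof -
    have "g \<in> congruence F m1" "g \<in> congruence F m2"
      using mono g by (meson IntD2 max.cobounded1 max.cobounded2)+
    then show ?thesis
      using g m by (simp add: K_part_K)
  qed
  then show ?thesis
    by blast
qed

end

text \<open>The embedding \<open>\<psi>\<close> need not be compatible with the embeddings \<open>j1\<close>, \<open>j2\<close> of the envelopes, but up to
  order, the summands \<open>T1\<close>, \<open>T2\<close> of its image are the summands \<open>S1\<close>, \<open>S2\<close> of the socle given by \<open>j1\<close>,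
  \<open>j2\<close>: each \<open>Ti\<close> contains some \<open>Sj\<close>, and these are irreducible.\<close>

locale envelope_pair = local_field_loc F
  for F :: "('f::field, 'q::finite_field) local_field_data" +
  fixes chi :: "'q^2^2 \<Rightarrow> 'q alg_closure" and J :: "('q^2^2) set"
    and \<rho>1 :: "('q alg_closure, 'u1, 'q^2^2) rep" and \<rho>2 :: "('q alg_closure, 'u2, 'q^2^2) rep"
    and v1 :: 'u1 and v2 :: 'u2
    and E1 :: "('q alg_closure, 'e1, 'f^2^2) rep" and E2 :: "('q alg_closure, 'e2, 'f^2^2) rep"
    and j1 :: "'u1 \<Rightarrow> 'e1" and j2 :: "'u2 \<Rightarrow> 'e2" and \<psi> :: "'u1 \<times> 'u2 \<Rightarrow> 'e1 \<times> 'e2"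
  assumes J: "J \<subseteq> J0 chi" and rho1: "is_rho chi J \<rho>1" and rho2: "is_rho (char_s chi) (J0 chi - J) \<rho>2"
    and v1: "v1 \<in> invariants unip2 \<rho>1" "v1 \<noteq> \<zero>\<^bsub>\<rho>1\<^esub>"
    and v2: "v2 \<in> invariants unip2 \<rho>2" "v2 \<noteq> \<zero>\<^bsub>\<rho>2\<^esub>"
    and env1: "injective_envelope F (max_compact F) (inflate F \<rho>1) E1 j1"
    and env2: "injective_envelope F (max_compact F) (inflate F \<rho>2) E2 j2"
    and psi: "\<psi> \<in> rep_hom (max_compact F) (dsum_rep (tilde F (inflate F \<rho>1)) (tilde F (inflate F \<rho>2)))
        (dsum_rep (tilde F E1) (tilde F E2))"
    and psi_inj: "inj_on \<psi> (carrier \<rho>1 \<times> carrier \<rho>2)"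
begin

abbreviation "D0 \<equiv> dsum_rep (tilde F (inflate F \<rho>1)) (tilde F (inflate F \<rho>2))"
abbreviation "Y0 \<equiv> dsum_rep (tilde F E1) (tilde F E2)"

lemma rho_rep: "representation (carrier GL2) \<rho>1" "representation (carrier GL2) \<rho>2"
  using rho1 rho2 by (simp_all add: is_rho_def)

lemma rho_irr: "irreducible_rep (carrier GL2) \<rho>1" "irreducible_rep (carrier GL2) \<rho>2"
  using is_rho_irreducible(1)[OF rho1 J] is_rho_irreducible(1)[OF rho2] by (auto simp: J0_char_s)

lemma one_dim: "x \<in> invariants unip2 \<rho>1 \<Longrightarrow> \<exists>c. x = c \<odot>\<^bsub>\<rho>1\<^esub> v1" "y \<in> invariants unip2 \<rho>2 \<Longrightarrow> \<exists>c. y = c \<odot>\<^bsub>\<rho>2\<^esub> v2"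
  using is_rho_irreducible(2)[OF rho1 J v1] is_rho_irreducible(2)[OF rho2 _ v2] by (auto simp: J0_char_s)

lemma smooth_E: "smooth_rep F K E1" "smooth_rep F K E2"
  using env1 env2 by (simp_all add: injective_envelope_def injective_rep_def)

lemma rep_E: "representation K E1" "representation K E2"
  using smooth_E by (simp_all add: smooth_rep_def)

lemma rep_D0: "representation FK D0" and rep_Y0: "representation FK Y0"
  by (intro representation_dsum representation_tilde representation_inflate rho_rep rep_E)+

sublocale psi: grep_hom K D0 Y0 \<psi>
  by (intro grep_hom.intro grep_hom_axioms.intro grep.intro psi)
    (auto intro: representation_subset[OF rep_D0] representation_subset[OF rep_Y0] K_FK)

sublocale j1: grep_hom K "inflate F \<rho>1" E1 j1
  using env1 rep_E representation_inflate[OF rho_rep(1)]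
  by (simp add: injective_envelope_def grep_hom_def grep_hom_axioms_def grep_def)

sublocale j2: grep_hom K "inflate F \<rho>2" E2 j2
  using env2 rep_E representation_inflate[OF rho_rep(2)]
  by (simp add: injective_envelope_def grep_hom_def grep_hom_axioms_def grep_def)

sublocale rho: rep_pair "carrier GL2" \<rho>1 \<rho>2
  by unfold_locales (rule rho_rep)+

sublocale E: rep_pair K E1 E2
  by unfold_locales

lemma subrep_Y0: "subrep K Y0 W \<longleftrightarrow> subrep K (dsum_rep E1 E2) W"
  unfolding psi.W.subrep_iff E.VW.subrep_iff by (simp add: K_part_K)

definition S1 where "S1 = (\<lambda>x. (j1 x, \<zero>\<^bsub>E2\<^esub>)) ` carrier \<rho>1"
definition S2 where "S2 = (\<lambda>y. (\<zero>\<^bsub>E1\<^esub>, j2 y)) ` carrier \<rho>2"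
definition T1 where "T1 = (\<lambda>x. \<psi> (x, \<zero>\<^bsub>\<rho>2\<^esub>)) ` carrier \<rho>1"
definition T2 where "T2 = (\<lambda>y. \<psi> (\<zero>\<^bsub>\<rho>1\<^esub>, y)) ` carrier \<rho>2"

text \<open>\<open>essential_dsum\<close> finds a non-zero vector of \<open>W\<close> whose
  coordinates are in the images of \<open>j1\<close> and \<open>j2\<close>. So the preimage of
  \<open>W\<close> in the sum of \<open>\<rho>1\<close> and \<open>\<rho>2\<close> is non-zero, and
  by \<open>rho_pair_contains_summand\<close> it contains a summand.\<close>

lemma contains_S:
  assumes W: "subrep K Y0 W" "W \<noteq> {\<zero>\<^bsub>Y0\<^esub>}"
  shows "S1 \<subseteq> W \<or> S2 \<subseteq> W"
proof -
  have WE: "subrep K (dsum_rep E1 E2) W" "W \<noteq> {\<zero>\<^bsub>dsum_rep E1 E2\<^esub>}"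
    using W subrep_Y0 by simp_all
  have "essential_subrep K E1 (j1 ` carrier \<rho>1)" "essential_subrep K E2 (j2 ` carrier \<rho>2)"
    using env1 env2 by (simp_all add: injective_envelope_def)
  from E.essential_dsum[OF this WE] obtain x y where xy: "x \<in> carrier \<rho>1" "y \<in> carrier \<rho>2" "(j1 x, j2 y) \<in> W"
    "(j1 x, j2 y) \<noteq> (\<zero>\<^bsub>E1\<^esub>, \<zero>\<^bsub>E2\<^esub>)"
    by blast
  have j: "grep_hom K (dsum_rep (inflate F \<rho>1) (inflate F \<rho>2)) (dsum_rep E1 E2) (map_prod j1 j2)"
    by (intro grep_hom.intro grep_hom_axioms.intro grep.intro representation_dsum j1.V.rep j2.V.rep rep_E)
      (auto simp: rep_hom_def linear_maps_def j1.add j2.add j1.smult j2.smult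
        j1.equivariant[simplified] j2.equivariant[simplified] j1.closed[simplified] j2.closed[simplified]
        j1.add[simplified] j2.add[simplified] j1.smult[simplified] j2.smult[simplified])
  let ?N = "{z \<in> carrier \<rho>1 \<times> carrier \<rho>2. map_prod j1 j2 z \<in> W}"
  have "subrep K (dsum_rep (inflate F \<rho>1) (inflate F \<rho>2)) ?N"
    using grep_hom.subrep_vimage[OF j, of W] W subrep_Y0 by simp
  then have N: "subrep (carrier GL2) (dsum_rep \<rho>1 \<rho>2) ?N"
    by (rule subrep_dsum_inflate[OF rho_rep])
  have "(x, y) \<in> ?N" "(x, y) \<noteq> (\<zero>\<^bsub>\<rho>1\<^esub>, \<zero>\<^bsub>\<rho>2\<^esub>)"
    using xy j1.zero j2.zero by auto
  then have "?N \<noteq> {\<zero>\<^bsub>dsum_rep \<rho>1 \<rho>2\<^esub>}"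
    by (simp only: dsum_rep_simps) blast
  from rho_pair_contains_summand[OF rho1 rho2 J v1 N this] show ?thesis
  proof
    assume "carrier \<rho>1 \<times> {\<zero>\<^bsub>\<rho>2\<^esub>} \<subseteq> ?N"
    then have "(j1 x, \<zero>\<^bsub>E2\<^esub>) \<in> W" if "x \<in> carrier \<rho>1" for x
      using that j2.zero by fastforce
    then show ?thesis
      by (auto simp: S1_def)
  next
    assume "{\<zero>\<^bsub>\<rho>1\<^esub>} \<times> carrier \<rho>2 \<subseteq> ?N"
    then have "(\<zero>\<^bsub>E1\<^esub>, j2 y) \<in> W" if "y \<in> carrier \<rho>2" for y
      using that j1.zero by fastforce
    then show ?thesis
      by (auto simp: S2_def)
  qed
qed

lemma inl_hom: "grep_hom K (inflate F \<rho>1) Y0 (\<lambda>x. \<psi> (x, \<zero>\<^bsub>\<rho>2\<^esub>))"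
  and inr_hom: "grep_hom K (inflate F \<rho>2) Y0 (\<lambda>y. \<psi> (\<zero>\<^bsub>\<rho>1\<^esub>, y))"
proof -
  interpret D: rep_pair K "tilde F (inflate F \<rho>1)" "tilde F (inflate F \<rho>2)"
    by (intro rep_pair.intro grep.intro representation_subset[OF representation_tilde] representation_inflate rho_rep)
      (auto intro: K_FK)
  have "\<psi> (act \<rho>1 (reduction F g) x, \<zero>\<^bsub>\<rho>2\<^esub>) = act Y0 g (\<psi> (x, \<zero>\<^bsub>\<rho>2\<^esub>))" if "g \<in> K" "x \<in> carrier \<rho>1" for g x
    using psi.equivariant[OF that(1), of "(x, \<zero>\<^bsub>\<rho>2\<^esub>)"] that D.W.act_zero[OF that(1)] D.W.zero_closed
    by (simp add: K_part_K)
  then show "grep_hom K (inflate F \<rho>1) Y0 (\<lambda>x. \<psi> (x, \<zero>\<^bsub>\<rho>2\<^esub>))"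
    using psi.closed[of "(_, \<zero>\<^bsub>\<rho>2\<^esub>)"] psi.add[of "(_, \<zero>\<^bsub>\<rho>2\<^esub>)" "(_, \<zero>\<^bsub>\<rho>2\<^esub>)"] psi.smult[of "(_, \<zero>\<^bsub>\<rho>2\<^esub>)"]
      D.W.zero_closed D.W.l_zero[OF D.W.zero_closed] D.W.smult_zero
    by (intro grep_hom.intro grep_hom_axioms.intro j1.V.grep_axioms psi.W.grep_axioms)
      (simp add: rep_hom_def linear_maps_def mem_Times_iff)
  have "\<psi> (\<zero>\<^bsub>\<rho>1\<^esub>, act \<rho>2 (reduction F g) x) = act Y0 g (\<psi> (\<zero>\<^bsub>\<rho>1\<^esub>, x))" if "g \<in> K" "x \<in> carrier \<rho>2" for g x
    using psi.equivariant[OF that(1), of "(\<zero>\<^bsub>\<rho>1\<^esub>, x)"] that D.V.act_zero[OF that(1)] D.V.zero_closed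
    by (simp add: K_part_K)
  then show "grep_hom K (inflate F \<rho>2) Y0 (\<lambda>y. \<psi> (\<zero>\<^bsub>\<rho>1\<^esub>, y))"
    using psi.closed[of "(\<zero>\<^bsub>\<rho>1\<^esub>, _)"] psi.add[of "(\<zero>\<^bsub>\<rho>1\<^esub>, _)" "(\<zero>\<^bsub>\<rho>1\<^esub>, _)"] psi.smult[of "(\<zero>\<^bsub>\<rho>1\<^esub>, _)"]
      D.V.zero_closed D.V.l_zero[OF D.V.zero_closed] D.V.smult_zero
    by (intro grep_hom.intro grep_hom_axioms.intro j2.V.grep_axioms psi.W.grep_axioms)
      (simp add: rep_hom_def linear_maps_def mem_Times_iff)
qed

sublocale inl: grep_hom K "inflate F \<rho>1" Y0 "\<lambda>x. \<psi> (x, \<zero>\<^bsub>\<rho>2\<^esub>)"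
  by (rule inl_hom)

sublocale inr: grep_hom K "inflate F \<rho>2" Y0 "\<lambda>y. \<psi> (\<zero>\<^bsub>\<rho>1\<^esub>, y)"
  by (rule inr_hom)

lemma T1_sub:
  assumes W: "subrep K Y0 W" and x: "x \<in> carrier \<rho>1" "x \<noteq> \<zero>\<^bsub>\<rho>1\<^esub>" "\<psi> (x, \<zero>\<^bsub>\<rho>2\<^esub>) \<in> W"
  shows "T1 \<subseteq> W"
proof -
  have "subrep (carrier GL2) \<rho>1 {x \<in> carrier \<rho>1. \<psi> (x, \<zero>\<^bsub>\<rho>2\<^esub>) \<in> W}"
    using subrep_inflate[OF rho_rep(1)] inl.subrep_vimage[OF W] by simp
  then have "{x \<in> carrier \<rho>1. \<psi> (x, \<zero>\<^bsub>\<rho>2\<^esub>) \<in> W} = carrier \<rho>1"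
    using rho_irr(1) x unfolding irreducible_rep_def by blast
  then show ?thesis
    by (auto simp: T1_def)
qed

lemma T2_sub:
  assumes W: "subrep K Y0 W" and y: "y \<in> carrier \<rho>2" "y \<noteq> \<zero>\<^bsub>\<rho>2\<^esub>" "\<psi> (\<zero>\<^bsub>\<rho>1\<^esub>, y) \<in> W"
  shows "T2 \<subseteq> W"
proof -
  have "subrep (carrier GL2) \<rho>2 {y \<in> carrier \<rho>2. \<psi> (\<zero>\<^bsub>\<rho>1\<^esub>, y) \<in> W}"
    using subrep_inflate[OF rho_rep(2)] inr.subrep_vimage[OF W] by simp
  then have "{y \<in> carrier \<rho>2. \<psi> (\<zero>\<^bsub>\<rho>1\<^esub>, y) \<in> W} = carrier \<rho>2"
    using rho_irr(2) y unfolding irreducible_rep_def by blast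
  then show ?thesis
    by (auto simp: T2_def)
qed

lemma zeros: "\<zero>\<^bsub>\<rho>1\<^esub> \<in> carrier \<rho>1" "\<zero>\<^bsub>\<rho>2\<^esub> \<in> carrier \<rho>2" "v1 \<in> carrier \<rho>1" "v2 \<in> carrier \<rho>2"
  using rho.V.zero_closed rho.W.zero_closed v1 v2 by (auto simp: invariants_def)

lemma psi_zero: "\<psi> (\<zero>\<^bsub>\<rho>1\<^esub>, \<zero>\<^bsub>\<rho>2\<^esub>) = (\<zero>\<^bsub>E1\<^esub>, \<zero>\<^bsub>E2\<^esub>)"
  using inl.zero by simp

lemma psi_nonzero: "\<psi> (v1, \<zero>\<^bsub>\<rho>2\<^esub>) \<noteq> (\<zero>\<^bsub>E1\<^esub>, \<zero>\<^bsub>E2\<^esub>)" "\<psi> (\<zero>\<^bsub>\<rho>1\<^esub>, v2) \<noteq> (\<zero>\<^bsub>E1\<^esub>, \<zero>\<^bsub>E2\<^esub>)"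
  using psi_zero zeros v1(2) v2(2) psi_inj unfolding inj_on_def by (metis mem_Sigma_iff prod.inject)+

lemma T_subreps: "subrep K Y0 T1" "subrep K Y0 T2"
proof -
  have "subrep K (inflate F \<rho>1) (carrier (inflate F \<rho>1))" "subrep K (inflate F \<rho>2) (carrier (inflate F \<rho>2))"
    unfolding subrep_def using j1.V.lin_subspace_carrier j2.V.lin_subspace_carrier j1.V.act_closed j2.V.act_closed
    by blast+
  from inl.subrep_image[OF this(1)] inr.subrep_image[OF this(2)] show "subrep K Y0 T1" "subrep K Y0 T2"
    by (simp_all add: T1_def T2_def)
qed

lemma S_subreps: "subrep K Y0 S1" "subrep K Y0 S2"
proof -
  have "S1 = (\<lambda>x. (x, \<zero>\<^bsub>E2\<^esub>)) ` (j1 ` carrier \<rho>1)" "S2 = (\<lambda>y. (\<zero>\<^bsub>E1\<^esub>, y)) ` (j2 ` carrier \<rho>2)"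
    by (auto simp: S1_def S2_def)
  moreover have "subrep K E1 (j1 ` carrier \<rho>1)" "subrep K E2 (j2 ` carrier \<rho>2)"
    using env1 env2 by (simp_all add: injective_envelope_def essential_subrep_def)
  ultimately show "subrep K Y0 S1" "subrep K Y0 S2"
    using grep_hom.subrep_image[OF E.inl_hom] grep_hom.subrep_image[OF E.inr_hom] subrep_Y0 by simp_all
qed

lemma T_nonzero: "T1 \<noteq> {\<zero>\<^bsub>Y0\<^esub>}" "T2 \<noteq> {\<zero>\<^bsub>Y0\<^esub>}"
  using psi_nonzero zeros by (auto simp: T1_def T2_def)

lemma S_nonzero: "\<exists>s\<in>S1. s \<noteq> \<zero>\<^bsub>Y0\<^esub>" "\<exists>s\<in>S2. s \<noteq> \<zero>\<^bsub>Y0\<^esub>"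
proof -
  have "inj_on j1 (carrier \<rho>1)" "inj_on j2 (carrier \<rho>2)"
    using env1 env2 by (simp_all add: injective_envelope_def)
  then have "j1 v1 \<noteq> \<zero>\<^bsub>E1\<^esub>" "j2 v2 \<noteq> \<zero>\<^bsub>E2\<^esub>"
    using zeros v1(2) v2(2) j1.zero j2.zero unfolding inj_on_def by (metis inflate_simps(2))+
  then show "\<exists>s\<in>S1. s \<noteq> \<zero>\<^bsub>Y0\<^esub>" "\<exists>s\<in>S2. s \<noteq> \<zero>\<^bsub>Y0\<^esub>"
    using zeros by (auto simp: S1_def S2_def)
qed

lemma T_disjoint: "t \<in> T1 \<Longrightarrow> t \<in> T2 \<Longrightarrow> t = \<zero>\<^bsub>Y0\<^esub>"
proof -
  assume "t \<in> T1" "t \<in> T2"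
  then obtain x y where xy: "x \<in> carrier \<rho>1" "y \<in> carrier \<rho>2" "t = \<psi> (x, \<zero>\<^bsub>\<rho>2\<^esub>)" "t = \<psi> (\<zero>\<^bsub>\<rho>1\<^esub>, y)"
    by (auto simp: T1_def T2_def)
  then have "(x, \<zero>\<^bsub>\<rho>2\<^esub>) = (\<zero>\<^bsub>\<rho>1\<^esub>, y)"
    using psi_inj zeros unfolding inj_on_def by (metis mem_Sigma_iff)
  then show ?thesis
    using xy psi_zero by simp
qed

lemma T1_subset_S: "S \<subseteq> T1 \<Longrightarrow> subrep K Y0 S \<Longrightarrow> \<exists>s\<in>S. s \<noteq> \<zero>\<^bsub>Y0\<^esub> \<Longrightarrow> T1 \<subseteq> S"
proof -
  assume S: "S \<subseteq> T1" "subrep K Y0 S" "\<exists>s\<in>S. s \<noteq> \<zero>\<^bsub>Y0\<^esub>"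
  then obtain x where "x \<in> carrier \<rho>1" "\<psi> (x, \<zero>\<^bsub>\<rho>2\<^esub>) \<in> S" "\<psi> (x, \<zero>\<^bsub>\<rho>2\<^esub>) \<noteq> \<zero>\<^bsub>Y0\<^esub>"
    unfolding T1_def by blast
  then show ?thesis
    using T1_sub[OF S(2), of x] psi_zero by auto
qed

lemma T2_subset_S: "S \<subseteq> T2 \<Longrightarrow> subrep K Y0 S \<Longrightarrow> \<exists>s\<in>S. s \<noteq> \<zero>\<^bsub>Y0\<^esub> \<Longrightarrow> T2 \<subseteq> S"
proof -
  assume S: "S \<subseteq> T2" "subrep K Y0 S" "\<exists>s\<in>S. s \<noteq> \<zero>\<^bsub>Y0\<^esub>"
  then obtain y where "y \<in> carrier \<rho>2" "\<psi> (\<zero>\<^bsub>\<rho>1\<^esub>, y) \<in> S" "\<psi> (\<zero>\<^bsub>\<rho>1\<^esub>, y) \<noteq> \<zero>\<^bsub>Y0\<^esub>"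
    unfolding T2_def by blast
  then show ?thesis
    using T2_sub[OF S(2), of y] psi_zero by auto
qed

lemma contains_T:
  assumes W: "subrep K Y0 W" "W \<noteq> {\<zero>\<^bsub>Y0\<^esub>}"
  shows "T1 \<subseteq> W \<or> T2 \<subseteq> W"
proof -
  have "S1 \<subseteq> T1 \<or> S2 \<subseteq> T1" "S1 \<subseteq> T2 \<or> S2 \<subseteq> T2"
    using contains_S T_subreps T_nonzero by blast+
  \<comment> \<open>As \<open>\<psi>\<close> is injective, \<open>T1\<close> and \<open>T2\<close>
    meet in zero, so neither \<open>S1\<close> nor \<open>S2\<close> lies in both. The two choices
    made by \<open>contains_S\<close> are therefore different, and irreducibility of
    \<open>\<rho>1\<close> and \<open>\<rho>2\<close> gives the reverse inclusions.\<close>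
  moreover have "\<not> (S1 \<subseteq> T1 \<and> S1 \<subseteq> T2)" "\<not> (S2 \<subseteq> T1 \<and> S2 \<subseteq> T2)"
    using S_nonzero T_disjoint by blast+
  ultimately have "(T1 \<subseteq> S1 \<and> T2 \<subseteq> S2) \<or> (T1 \<subseteq> S2 \<and> T2 \<subseteq> S1)"
    using T1_subset_S T2_subset_S S_subreps S_nonzero by blast
  then show ?thesis
    using contains_S[OF W] by blast
qed

lemma image_psi_subset:
  assumes W: "subrep K Y0 W" and T: "T1 \<subseteq> W" "T2 \<subseteq> W"
  shows "\<psi> ` carrier D0 \<subseteq> W"
proof
  fix t assume "t \<in> \<psi> ` carrier D0"
  then obtain x y where xy: "x \<in> carrier \<rho>1" "y \<in> carrier \<rho>2" "t = \<psi> (x, y)"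
    by auto
  have "\<psi> (x, y) = \<psi> (x, \<zero>\<^bsub>\<rho>2\<^esub>) \<oplus>\<^bsub>Y0\<^esub> \<psi> (\<zero>\<^bsub>\<rho>1\<^esub>, y)"
    using psi.add[of "(x, \<zero>\<^bsub>\<rho>2\<^esub>)" "(\<zero>\<^bsub>\<rho>1\<^esub>, y)"] xy zeros by simp
  moreover have "\<psi> (x, \<zero>\<^bsub>\<rho>2\<^esub>) \<in> W" "\<psi> (\<zero>\<^bsub>\<rho>1\<^esub>, y) \<in> W"
    using T xy by (auto simp: T1_def T2_def)
  ultimately show "t \<in> W"
    using W xy unfolding psi.W.subrep_iff by metis
qed

text \<open>The operator \<open>S\<close> will be the action of the inverse of \<^const>\<open>Pi_mat\<close>.\<close>

lemma contains_image_psi: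
  assumes W: "subrep K Y0 W" "W \<noteq> {\<zero>\<^bsub>Y0\<^esub>}"
    and S: "\<And>y. y \<in> W \<Longrightarrow> S y \<in> W" "S (\<psi> (v1, \<zero>\<^bsub>\<rho>2\<^esub>)) = \<psi> (\<zero>\<^bsub>\<rho>1\<^esub>, v2)" "S (\<psi> (\<zero>\<^bsub>\<rho>1\<^esub>, v2)) = \<psi> (v1, \<zero>\<^bsub>\<rho>2\<^esub>)"
  shows "\<psi> ` carrier D0 \<subseteq> W"
proof -
  have "\<psi> (v1, \<zero>\<^bsub>\<rho>2\<^esub>) \<in> T1" "\<psi> (\<zero>\<^bsub>\<rho>1\<^esub>, v2) \<in> T2"
    using zeros by (auto simp: T1_def T2_def)
  then have "\<psi> (v1, \<zero>\<^bsub>\<rho>2\<^esub>) \<in> W" "\<psi> (\<zero>\<^bsub>\<rho>1\<^esub>, v2) \<in> W"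
    using contains_T[OF W] S by (metis subsetD)+
  then show ?thesis
    using T1_sub[OF W(1) zeros(3) v1(2)] T2_sub[OF W(1) zeros(4) v2(2)] image_psi_subset[OF W(1)] by blast
qed

end

section \<open>The morphism of diagrams and minimality of its image on homology\<close>

theorem corollary6p26:
  fixes F :: "('f::field, 'q::finite_field) local_field_data"
    and n :: nat
    and chi :: "'q^2^2 \<Rightarrow> 'q alg_closure"
    and J :: "('q^2^2) set"
    and \<rho>1 :: "('q alg_closure, 'u1, 'q^2^2) rep"
    and \<rho>2 :: "('q alg_closure, 'u2, 'q^2^2) rep"
    and v1 :: 'u1 and v2 :: 'u2
    and E1 :: "('q alg_closure, 'e1, 'f^2^2) rep"
    and E2 :: "('q alg_closure, 'e2, 'f^2^2) rep"
    and P :: "(('e1 \<times> 'e2) \<times> ('e1 \<times> 'e2)) set"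
    and w1 w2 :: "'e1 \<times> 'e2"
    and D :: "('q alg_closure, 'u1 \<times> 'u2, 'f^2^2) diagram"
    and Y :: "('q alg_closure, 'e1 \<times> 'e2, 'f^2^2) diagram"
    and \<psi> :: "'u1 \<times> 'u2 \<Rightarrow> 'e1 \<times> 'e2"
  assumes "local_field F"
    and "CARD('q) = CHAR('q) ^ n"
    and "torus_char chi"
    and "J \<subseteq> J0 chi"
    and "is_rho chi J \<rho>1"
    and "is_rho (char_s chi) (J0 chi - J) \<rho>2"
    and "v1 \<in> invariants (iwahori1 F) (inflate F \<rho>1)" "v1 \<noteq> \<zero>\<^bsub>\<rho>1\<^esub>"
    and "v2 \<in> invariants (iwahori1 F) (inflate F \<rho>2)" "v2 \<noteq> \<zero>\<^bsub>\<rho>2\<^esub>"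
    and "is_D_gamma F \<rho>1 \<rho>2 v1 v2 D"
    and "\<exists>j1. injective_envelope F (max_compact F) (inflate F \<rho>1) E1 j1"
    and "\<exists>j2. injective_envelope F (max_compact F) (inflate F \<rho>2) E2 j2"
    and "gamma_basis F n chi J E1 E2 P w1 w2"
    and "is_Y_gamma F E1 E2 P Y"
    and "\<psi> \<in> rep_hom (max_compact F) (diag0 D) (diag0 Y)"
    and "inj_on \<psi> (carrier (diag0 D))"
    and "\<psi> (v1, \<zero>\<^bsub>\<rho>2\<^esub>) = w1" "\<psi> (\<zero>\<^bsub>\<rho>1\<^esub>, v2) = w2"
  defines "\<V> \<equiv> coeff_of_diagram F D"
    and "\<I> \<equiv> coeff_of_diagram F Y"
  defines "\<pi> \<equiv> H0_map F \<I> (coeff_map \<psi> \<psi>) ` carrier (H0 F \<V>)"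
  shows "essential_extension F (carrier GL2) (H0 F \<I>) \<pi> \<and>
         rep_isomorphic (carrier GL2) (restrict_to (H0 F \<I>) \<pi>)
           (restrict_to (H0 F \<I>) (socle (carrier GL2) (H0 F \<I>)))"
proof -
  interpret local_field_loc F
    using assms(1) by unfold_locales
  note D = assms(11)[unfolded is_D_gamma_def]
  note Y = assms(15)[unfolded is_Y_gamma_def]
  have d0: "diag0 D = dsum_rep (tilde F (inflate F \<rho>1)) (tilde F (inflate F \<rho>2))"
    and y0: "diag0 Y = dsum_rep (tilde F E1) (tilde F E2)"
    using D Y by blast+
  have d1: "module.truncate (diag1 D) =
      module.truncate (restrict_to (diag0 D) (invariants (iwahori1 F) (diag0 D)))"
    and y1: "module.truncate (diag1 Y) = module.truncate (diag0 Y)"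
    and dr: "diag_r D = id" and yr: "diag_r Y = id"
    and dsm: "smooth_rep F SE (diag1 D)" and ysm: "smooth_rep F SE (diag1 Y)"
    and dI: "\<And>g v. g \<in> FI \<Longrightarrow> v \<in> carrier (diag1 D) \<Longrightarrow> act (diag1 D) g v = act (diag0 D) g v"
    and yI: "\<And>g v. g \<in> FI \<Longrightarrow> v \<in> carrier (diag0 Y) \<Longrightarrow> act (diag1 Y) g v = act (diag0 Y) g v"
    and dP: "act (diag1 D) (matrix_inv \<Pi>0) (v1, \<zero>\<^bsub>\<rho>2\<^esub>) = (\<zero>\<^bsub>\<rho>1\<^esub>, v2)"
      "act (diag1 D) (matrix_inv \<Pi>0) (\<zero>\<^bsub>\<rho>1\<^esub>, v2) = (v1, \<zero>\<^bsub>\<rho>2\<^esub>)"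
    using D Y by blast+
  obtain j1 j2 where env: "injective_envelope F K (inflate F \<rho>1) E1 j1" "injective_envelope F K (inflate F \<rho>2) E2 j2"
    using assms(12,13) by blast
  have "inj_on \<psi> (carrier \<rho>1 \<times> carrier \<rho>2)"
    using assms(17) d0 by simp
  interpret envelope_pair F chi J \<rho>1 \<rho>2 v1 v2 E1 E2 j1 j2 \<psi>
    by unfold_locales
      (use assms(4-10,16) env d0 y0 \<open>inj_on \<psi> (carrier \<rho>1 \<times> carrier \<rho>2)\<close> in \<open>simp_all add: invariants_inflate\<close>)
  have d1': "carrier (diag1 D) = invariants unip2 \<rho>1 \<times> invariants unip2 \<rho>2"
    "add (diag1 D) = add D0" "module.smult (diag1 D) = module.smult D0"
    using d1 unfolding d0 by (simp_all add: module.defs invariants_dsum_tilde_inflate)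
  have y1': "carrier (diag1 Y) = carrier Y0" "add (diag1 Y) = add Y0" "module.smult (diag1 Y) = module.smult Y0"
    using y1 unfolding y0 by (simp_all add: module.defs)
  have inv_sub: "invariants unip2 \<rho>1 \<times> invariants unip2 \<rho>2 \<subseteq> carrier \<rho>1 \<times> carrier \<rho>2"
    by (auto simp: invariants_def)
  have repD1: "representation SE (diag1 D)" and repY1: "representation SE (diag1 Y)"
    using dsm ysm by (simp_all add: smooth_rep_def)
  interpret DD: diagram_loc F D
  proof unfold_locales
    show "representation FK (diag0 D)"
      unfolding d0 by (rule rep_D0)
    show "diag_r D \<in> linear_maps (diag1 D) (diag0 D)"
      unfolding d0 dr using inv_sub d1' by (auto simp: linear_maps_def)
    show "diag_r D (act (diag1 D) g y) = act (diag0 D) g (diag_r D y)" if "g \<in> FI" "y \<in> carrier (diag1 D)" for g y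
      using dI[OF that] by (simp add: dr)
  qed (rule repD1)
  interpret YY: constant_diagram F Y
  proof unfold_locales
    show "representation FK (diag0 Y)"
      unfolding y0 by (rule rep_Y0)
    show "diag_r Y \<in> linear_maps (diag1 Y) (diag0 Y)"
      unfolding y0 yr using y1' by (auto simp: linear_maps_def)
    show "diag_r Y (act (diag1 Y) g y) = act (diag0 Y) g (diag_r Y y)" if "g \<in> FI" "y \<in> carrier (diag1 Y)" for g y
      using yI that y1' y0 by (simp add: yr)
  qed (rule repY1 y1 yr)+
  have wP: "(w1, w2) \<in> P \<or> (w2, w1) \<in> P"
    using assms(14) by (rule gamma_basis_pair)
  have kY: "kspace (diag0 Y)"
    by (rule YY.V0.kspace_axioms)
  have swap: "act (diag1 Y) (matrix_inv \<Pi>0) w1 = w2" "act (diag1 Y) (matrix_inv \<Pi>0) w2 = w1"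
    using wP is_Y_gamma_swap[OF assms(15) _ kY] by blast+
  have hom0: "\<psi> \<in> rep_hom FK (diag0 D) (diag0 Y)"
    using rep_hom_tilde_dsum psi unfolding d0 y0 by blast
  have linear: "\<psi> \<in> linear_maps (diag1 D) (diag1 Y)"
    unfolding linear_maps_def mem_Collect_eq d1' y1'
    using rep_homD(1)[OF hom0] inv_sub unfolding d0 y0 linear_maps_def mem_Collect_eq Pi_iff
    by (simp only: dsum_rep_simps tilde_simps inflate_simps) blast
  interpret L: linear_map "diag1 D" "diag1 Y" \<psi>
    using linear by unfold_locales
  \<comment> \<open>As both spaces of invariants are lines, \<open>diag1 D\<close> is spanned by two
    vectors; on these and on their images the inverse of \<Pi> is known.\<close>
  have inv: "\<psi> (act (diag1 D) (matrix_inv \<Pi>0) v) = act (diag1 Y) (matrix_inv \<Pi>0) (\<psi> v)"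
    if v: "v \<in> carrier (diag1 D)" for v
  proof -
    have vm: "(v1, \<zero>\<^bsub>\<rho>2\<^esub>) \<in> carrier (diag1 D)" "(\<zero>\<^bsub>\<rho>1\<^esub>, v2) \<in> carrier (diag1 D)"
      using v1(1) v2(1) zeros(1,2) rho.V.act_zero rho.W.act_zero unfolding d1'(1)
      by (auto simp: invariants_def mem_unip2_iff)
    obtain c d where cd: "v = (c \<odot>\<^bsub>\<rho>1\<^esub> v1, d \<odot>\<^bsub>\<rho>2\<^esub> v2)"
      using v one_dim unfolding d1'(1) by (metis mem_Sigma_iff surj_pair)
    have "v = (c \<odot>\<^bsub>diag1 D\<^esub> (v1, \<zero>\<^bsub>\<rho>2\<^esub>)) \<oplus>\<^bsub>diag1 D\<^esub> (d \<odot>\<^bsub>diag1 D\<^esub> (\<zero>\<^bsub>\<rho>1\<^esub>, v2))"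
      using zeros by (simp add: cd d1')
    then show ?thesis
      using vm L.closed[OF vm(1)] L.closed[OF vm(2)] by (simp add: DD.V1.act_add DD.V1.act_smult L.add L.smult YY.V1.act_add YY.V1.act_smult
          dP swap assms(18,19))
  qed
  \<comment> \<open>The data concern the inverse of \<Pi>, while \<open>SE_cases\<close> writes
    elements with \<Pi> itself.\<close>
  have Pi: "\<psi> (act (diag1 D) \<Pi>0 v) = act (diag1 Y) \<Pi>0 (\<psi> v)" if v: "v \<in> carrier (diag1 D)" for v
  proof -
    have "act (diag1 D) (matrix_inv \<Pi>0) (act (diag1 D) \<Pi>0 v) = v"
      using DD.V1.act_mult[of "matrix_inv \<Pi>0" \<Pi>0 v] v by simp
    then have "act (diag1 Y) \<Pi>0 (\<psi> v) = act (diag1 Y) \<Pi>0 (act (diag1 Y) (matrix_inv \<Pi>0) (\<psi> (act (diag1 D) \<Pi>0 v)))"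
      using inv[of "act (diag1 D) \<Pi>0 v"] v by simp
    also have "\<dots> = \<psi> (act (diag1 D) \<Pi>0 v)"
      using YY.V1.act_mult[of \<Pi>0 "matrix_inv \<Pi>0" "\<psi> (act (diag1 D) \<Pi>0 v)"] v by simp
    finally show ?thesis ..
  qed
  have FI: "\<psi> (act (diag1 D) z v) = act (diag1 Y) z (\<psi> v)" if z: "z \<in> FI" and v: "v \<in> carrier (diag1 D)" for z v
  proof -
    have v0: "v \<in> carrier (diag0 D)"
      using v inv_sub unfolding d1' d0 by auto
    then have "\<psi> v \<in> carrier (diag0 Y)"
      using linear_mapsD(1)[OF rep_homD(1)[OF hom0]] by blast
    then show ?thesis
      using rep_homD(2)[OF hom0 FI_FK[OF z] v0] dI[OF z v] yI[OF z] by simp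
  qed
  have hom1: "\<psi> \<in> rep_hom SE (diag1 D) (diag1 Y)"
  proof -
    have "\<psi> (act (diag1 D) g v) = act (diag1 Y) g (\<psi> v)" if "g \<in> SE" "v \<in> carrier (diag1 D)" for g v
      using that(1)
    proof (cases rule: SE_cases)
      case 1
      then show ?thesis
        using FI that(2) by blast
    next
      case (2 z)
      note z = FI_SE[OF 2(1)]
      have "act (diag1 D) z v \<in> carrier (diag1 D)"
        using z that(2) by simp
      then show ?thesis
        using 2 z that(2) Pi[of "act (diag1 D) z v"] FI[OF 2(1) that(2)]
          DD.V1.act_mult[OF Pi_SE z that(2)] YY.V1.act_mult[OF Pi_SE z L.closed[OF that(2)]] by simp
    qed
    with linear show ?thesis
      by (simp add: rep_hom_def)
  qed
  interpret M: diagram_morphism F D Y \<psi>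
    by unfold_locales (use hom0 hom1 dr yr in auto)
  interpret HH: grep "carrier GL2" "H0 F \<I>"
    unfolding \<I>_def by unfold_locales (rule YY.representation_H0)
  have pi_sub: "subrep (carrier GL2) (H0 F \<I>) \<pi>"
    unfolding \<pi>_def \<I>_def \<V>_def by (rule M.image_subrep)
  \<comment> \<open>\<open>YY.fibre\<close> turns \<open>W\<close> into a
    \<open>K\<close>-subrepresentation of \<open>Y0\<close> that is stable under \<Pi>, to which
    \<open>contains_image_psi\<close> applies; \<open>M.image_subset\<close> then leads from the
    base vertex back to all of \<open>\<pi>\<close>.\<close>
  have min: "\<pi> \<subseteq> W" if W: "subrep (carrier GL2) (H0 F \<I>) W" "W \<noteq> {\<zero>\<^bsub>H0 F \<I>\<^esub>}" for W
  proof -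
    note fib = YY.fibre[OF W(1)[unfolded \<I>_def]]
    have sub: "subrep K Y0 (YY.fibre W)"
      using fib(1) K_FK unfolding y0[symmetric] subrep_def by blast
    have nz: "YY.fibre W \<noteq> {\<zero>\<^bsub>Y0\<^esub>}"
      using fib(3) W(2) unfolding y0[symmetric] \<I>_def by blast
    have "\<psi> ` carrier D0 \<subseteq> YY.fibre W"
      by (rule contains_image_psi[OF sub nz, of "act (diag1 Y) (matrix_inv \<Pi>0)"])
        (use fib(2) swap assms(18,19) in auto)
    then have "YY.cls (mat 1) (\<psi> y) \<in> W" if "y \<in> carrier (diag0 D)" for y
      using that unfolding d0 YY.fibre_def by blast
    then show ?thesis
      unfolding \<pi>_def \<I>_def \<V>_def using W(1) unfolding \<I>_def by (intro M.image_subset)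
  qed
  \<comment> \<open>The class of \<open>\<psi> (v1, \<zero>)\<close> at the base vertex is non-zero
    by \<open>cls_injective\<close>.\<close>
  have "\<pi> \<noteq> {\<zero>\<^bsub>H0 F \<I>\<^esub>}"
  proof
    assume "\<pi> = {\<zero>\<^bsub>H0 F \<I>\<^esub>}"
    moreover have "(v1, \<zero>\<^bsub>\<rho>2\<^esub>) \<in> carrier (diag0 D)"
      using zeros by (simp add: d0)
    then have "YY.cls (mat 1) (\<psi> (v1, \<zero>\<^bsub>\<rho>2\<^esub>)) \<in> \<pi>" "\<psi> (v1, \<zero>\<^bsub>\<rho>2\<^esub>) \<in> carrier (diag0 Y)"
      unfolding \<pi>_def \<I>_def \<V>_def using M.cls_mem_image[of "mat 1"] M.p0.closed by auto
    ultimately have "\<psi> (v1, \<zero>\<^bsub>\<rho>2\<^esub>) = \<zero>\<^bsub>diag0 Y\<^esub>"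
      using YY.cls_injective unfolding \<I>_def by blast
    then show False
      using psi_nonzero(1) by (simp add: y0)
  qed
  note soc = HH.socle_eq[OF pi_sub this min]
  have "smooth_rep F (carrier GL2) (H0 F \<I>)"
    unfolding \<I>_def
  proof (rule YY.smooth_H0)
    show "\<exists>m. \<forall>g\<in>K \<inter> congruence F m. act (diag0 Y) g y = y" if "y \<in> carrier (diag0 Y)" for y
      using dsum_smooth[OF smooth_E, of y] that by (simp add: y0)
  qed
  then show ?thesis
    \<comment> \<open>The socle is equal to \<open>\<pi>\<close>, so the isomorphism is the
      identity.\<close>
    using soc rep_isomorphic_refl by (simp add: essential_extension_def)
qed

end
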